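(* Assume that the damping vanishes, $a(x)\equiv 0$ in $\Omega$, that $$G(x)\frac{\partial}{\partial r}=\frac{\partial}{\partial r}\quad (x\in\mathbb{R}^n),$$ that there is a continuous nonnegative function $\alpha$ on $\mathbb{R}^n$ with $$\Big\langle\Big((1-\alpha(x))G(x)+\frac r2\frac{\partial G(x)}{\partial r}\Big)X,X\Big\rangle\ge 0\quad\text{for } X\in S(r)_x,\ x\in\Omega,$$ and that there are constants $c_0>0$ and $d\in\mathbb{R}$ with $\det(G(x))=c_0r^d$ for $x\in\Omega$. Assume moreover that $\frac{\partial r}{\partial\nu}\le 0$ for $x\in\Gamma$. Then there exists a positive constant $C$ such that for every solution $u$ of the system $$iu_t+\Delta_gu+ia(x)u-|u|^{p-1}u=0 \text{ in }\Omega\times(0,+\infty),\quad u|_\Gamma=0 \text{ for } t\in(0,+\infty),\quad u(x,0)=u_0(x) \text{ in }\Omega$$ and every $T>0$: (i) if $d=2(3-n)$, then $$\int_0^T\int_\Omega\frac{|u|^{p+1}}{r}\,dx_g\,dt+\int_0^T\int_\Omega\frac{\alpha(x)}{r}\big(|\nabla_gu|_g^2-|u_r|^2\big)\,dx_g\,dt\le C\,E(0);$$ (ii) if $d>2(3-n)$, then $$\int_0^T\int_\Omega\Big(\frac{|u|^2}{r^3}+\frac{|u|^{p+1}}{r}\Big)dx_g\,dt+\int_0^T\int_\Omega\frac{\alpha(x)}{r}\big(|\nabla_gu|_g^2-|u_r|^2\big)\,dx_g\,dt\le C\,E(0).$$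
   Context: Notation. $n\ge3$; $O$ is the origin of $\mathbb{R}^n$; $r=r(x)=|x|$ is the Euclidean distance to $O$; $\langle\cdot,\cdot\rangle$ is the Euclidean inner product; $\frac{\partial}{\partial r}=x/|x|$ is the radial unit vector ($x\neq O$). $(\mathbb{R}^n,g)$ is a smooth complete Riemannian manifold, $g=\sum_{i,j}g_{ij}(x)dx_idx_j$, $G(x)=(g_{ij}(x))_{n\times n}$, and $\frac{\partial G}{\partial r}$ is the entrywise radial derivative. $\mathbb{R}^n_x$ is the tangent space at $x$; $\langle X,Y\rangle_g=\langle G(x)X,Y\rangle$, $|X|_g^2=\langle X,X\rangle_g$. $S(r)$ is the Euclidean sphere of radius $r$ centred at $O$, and $S(r)_x$ its tangent space at $x$ (with $r=|x|$), i.e. the vectors $X$ with $\langle X,\frac{\partial}{\partial r}\rangle=0$. $\nabla_g,\Delta_g$ are the gradient and Laplace–Beltrami operator of $g$; $dx_g=\sqrt{\det G(x)}\,dx$. For complex-valued $u$, $|\nabla_gu|_g^2=\langle\nabla_gu,\nabla_g\bar u\rangle_g$ and $u_r=\partial u/\partial r$. Domain. $\Omega\subset\mathbb{R}^n$ is an exterior domain with smooth compact boundary $\Gamma$, $O\notin\overline\Omega$; $\nu$ is the unit normal on $\Gamma$ with respect to $g$ pointing outside $\Omega$. Equation. $1<p<\frac{n+2}{n-2}$; $a\in C^2(\overline\Omega)$ is a nonnegative real function with $\sup_{\overline\Omega}(a+|\nabla_ga|_g+|\Delta_ga|)<+\infty$. The energy is $$E(t)=\frac12\int_\Omega\big(|u|^2+|\nabla_gu|_g^2\big)dx_g+\frac1{p+1}\int_\Omega|u|^{p+1}dx_g.$$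 Function spaces: $L^2(\Omega),H^1(\Omega),H^2(\Omega)$ are the closures of the spaces of $w\in C^\infty(\overline\Omega)$ with finite norm, for the norms given by $\|w\|_{L^2}^2=\int_\Omega|w|^2dx_g$, $\|w\|_{H^1}^2=\int_\Omega(|w|^2+|\nabla_gw|_g^2)dx_g$, $\|w\|_{H^2}^2=\int_\Omega(|w|^2+|\nabla_gw|_g^2+|\Delta_gw|^2)dx_g$; $H^1_\Gamma(\Omega)=\{w\in H^1(\Omega):w|_\Gamma=0\}$. Standing assumption: the system is well-posed, with solution $u\in C([0,+\infty),H^1_\Gamma(\Omega)\cap H^2(\Omega))$. *)

theory Defs
  imports "HOL-Analysis.Analysis"
begin

section \<open>Classical differentiability\<close>

definition partial_deriv :: "'n \<Rightarrow> (real^'n \<Rightarrow> 'b) \<Rightarrow> real^'n \<Rightarrow> 'b::real_normed_vector" where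
  "partial_deriv i f x = frechet_derivative f (at x) (axis i 1)"

definition radial_deriv :: "(real^'n \<Rightarrow> 'b) \<Rightarrow> real^'n \<Rightarrow> 'b::real_normed_vector" where
  "radial_deriv f x = frechet_derivative f (at x) (x /\<^sub>R norm x)"

text \<open>\<open>Ck_on k S f\<close> is meant for open \<open>S\<close> only, since derivatives are taken in the full space.\<close>

primrec Ck_on :: "nat \<Rightarrow> (real^'n) set \<Rightarrow> (real^'n \<Rightarrow> 'b::real_normed_vector) \<Rightarrow> bool" where
  "Ck_on 0 S f = continuous_on S f"
| "Ck_on (Suc k) S f =
     ((\<forall>x\<in>S. f differentiable (at x)) \<and> (\<forall>i. Ck_on k S (partial_deriv i f)))"

definition smooth_on :: "(real^'n) set \<Rightarrow> (real^'n \<Rightarrow> 'b::real_normed_vector) \<Rightarrow> bool" where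
  "smooth_on S f \<longleftrightarrow> (\<forall>k. Ck_on k S f)"

text \<open>
  \<open>C\<^sup>k\<close> and \<open>C\<^sup>\<infinity>\<close> up to the boundary: regularity on some open neighbourhood of
  the closure.  Functions are total, so a function given only on the closure of \<open>\<Omega>\<close> is
  represented by any of its regular extensions.
\<close>

definition Ck_closure :: "nat \<Rightarrow> (real^'n) set \<Rightarrow> (real^'n \<Rightarrow> 'b::real_normed_vector) \<Rightarrow> bool" where
  "Ck_closure k \<Omega> f \<longleftrightarrow> (\<exists>U. open U \<and> closure \<Omega> \<subseteq> U \<and> Ck_on k U f)"

definition smooth_closure :: "(real^'n) set \<Rightarrow> (real^'n \<Rightarrow> 'b::real_normed_vector) \<Rightarrow> bool" where
  "smooth_closure \<Omega> f \<longleftrightarrow> (\<exists>U. open U \<and> closure \<Omega> \<subseteq> U \<and> smooth_on U f)"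


section \<open>The Riemannian metric\<close>

text \<open>
  For real vectors and symmetric \<open>A\<close> this is \<open>\<langle>A X, Y\<rangle>\<close>.  On \<^typ>\<open>complex\<close> the library
  inner product is \<open>z \<bullet> w = Re (z * cnj w)\<close>, so for a complex vector \<open>V\<close> the value
  \<open>g_inner A V V\<close> is the bilinear pairing of \<open>V\<close> with its complex conjugate.
\<close>

definition g_inner :: "real^'n^'n \<Rightarrow> 'b::real_inner^'n \<Rightarrow> 'b^'n \<Rightarrow> real" where
  "g_inner A X Y = (\<Sum>i\<in>UNIV. \<Sum>j\<in>UNIV. A $ i $ j * (X $ i \<bullet> Y $ j))"

definition g_normsq :: "real^'n^'n \<Rightarrow> 'b::real_inner^'n \<Rightarrow> real" where
  "g_normsq A X = g_inner A X X"

definition g_length :: "(real^'n \<Rightarrow> real^'n^'n) \<Rightarrow> (real \<Rightarrow> real^'n) \<Rightarrow> real" where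
  "g_length G \<gamma> = integral {0..1} (\<lambda>t. sqrt (g_normsq (G (\<gamma> t)) (vector_derivative \<gamma> (at t))))"

definition g_dist :: "(real^'n \<Rightarrow> real^'n^'n) \<Rightarrow> real^'n \<Rightarrow> real^'n \<Rightarrow> real" where
  "g_dist G x y = Inf {g_length G \<gamma> |\<gamma>.
     \<gamma> piecewise_C1_differentiable_on {0..1} \<and> \<gamma> 0 = x \<and> \<gamma> 1 = y}"

definition complete_riemannian_metric :: "(real^'n \<Rightarrow> real^'n^'n) \<Rightarrow> bool" where
  "complete_riemannian_metric G \<longleftrightarrow>
     (\<forall>i j. smooth_on UNIV (\<lambda>x. G x $ i $ j)) \<and>
     (\<forall>x. transpose (G x) = G x) \<and>
     (\<forall>x X. X \<noteq> 0 \<longrightarrow> (G x *v X) \<bullet> X > 0) \<and>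
     Metric_space.mcomplete UNIV (g_dist G)"

definition radial_deriv_matrix :: "(real^'n \<Rightarrow> real^'n^'n) \<Rightarrow> real^'n \<Rightarrow> real^'n^'n" where
  "radial_deriv_matrix G x = (\<chi> i j. radial_deriv (\<lambda>y. G y $ i $ j) x)"

definition sphere_tangent :: "real^'n \<Rightarrow> (real^'n) set" where
  "sphere_tangent x = {X. X \<bullet> (x /\<^sub>R norm x) = 0}"

definition g_grad :: "(real^'n \<Rightarrow> real^'n^'n) \<Rightarrow> (real^'n \<Rightarrow> 'b) \<Rightarrow> real^'n \<Rightarrow> 'b::real_normed_vector^'n" where
  "g_grad G f x = (\<chi> i. \<Sum>j\<in>UNIV. (matrix_inv (G x) $ i $ j) *\<^sub>R partial_deriv j f x)"

definition g_laplacian :: "(real^'n \<Rightarrow> real^'n^'n) \<Rightarrow> (real^'n \<Rightarrow> 'b) \<Rightarrow> real^'n \<Rightarrow> 'b::real_normed_vector" where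
  "g_laplacian G f x =
     (\<Sum>i\<in>UNIV. partial_deriv i (\<lambda>y. sqrt (det (G y)) *\<^sub>R (g_grad G f y $ i)) x)
       /\<^sub>R sqrt (det (G x))"

definition g_vol :: "(real^'n \<Rightarrow> real^'n^'n) \<Rightarrow> (real^'n) set \<Rightarrow> (real^'n) measure" where
  "g_vol G \<Omega> = density (lebesgue_on \<Omega>) (\<lambda>x. ennreal (sqrt (det (G x))))"


section \<open>Exterior domains\<close>

definition smooth_boundary :: "(real^'n) set \<Rightarrow> bool" where
  "smooth_boundary \<Omega> \<longleftrightarrow> (\<forall>x\<in>frontier \<Omega>. \<exists>U (\<rho> :: real^'n \<Rightarrow> real).
     open U \<and> x \<in> U \<and> smooth_on U \<rho> \<and> (\<forall>y\<in>U. \<exists>i. partial_deriv i \<rho> y \<noteq> 0) \<and>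
     \<Omega> \<inter> U = {y\<in>U. \<rho> y < 0})"

definition exterior_domain :: "(real^'n) set \<Rightarrow> bool" where
  "exterior_domain \<Omega> \<longleftrightarrow> open \<Omega> \<and> connected \<Omega> \<and> compact (- \<Omega>) \<and> smooth_boundary \<Omega>"

definition tangent_to :: "(real^'n) set \<Rightarrow> real^'n \<Rightarrow> real^'n \<Rightarrow> bool" where
  "tangent_to \<Gamma> x X \<longleftrightarrow> (\<exists>\<gamma>. \<gamma> 0 = x \<and> (\<gamma> has_vector_derivative X) (at 0) \<and>
     (\<forall>\<^sub>F s in at 0. \<gamma> s \<in> \<Gamma>))"

definition outer_unit_normal ::
  "(real^'n \<Rightarrow> real^'n^'n) \<Rightarrow> (real^'n) set \<Rightarrow> real^'n \<Rightarrow> real^'n \<Rightarrow> bool" where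
  "outer_unit_normal G \<Omega> x \<nu> \<longleftrightarrow>
     g_normsq (G x) \<nu> = 1 \<and>
     (\<forall>X. tangent_to (frontier \<Omega>) x X \<longrightarrow> g_inner (G x) \<nu> X = 0) \<and>
     (\<forall>\<^sub>F s in at_right 0. x + s *\<^sub>R \<nu> \<notin> closure \<Omega>)"


section \<open>Function spaces\<close>

text \<open>
  The spaces are closures of smooth functions.  Their elements are represented by measurable
  functions on \<open>\<Omega>\<close> (up to null sets), the gradient and the Laplacian of an element being
  the limits of those of the approximating smooth functions.  Squared norms take values in
  \<^typ>\<open>ennreal\<close>.
\<close>

definition L2_sq :: "(real^'n \<Rightarrow> real^'n^'n) \<Rightarrow> (real^'n) set \<Rightarrow> (real^'n \<Rightarrow> complex) \<Rightarrow> ennreal" where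
  "L2_sq G \<Omega> w = (\<integral>\<^sup>+x. ennreal ((cmod (w x))\<^sup>2) \<partial>g_vol G \<Omega>)"

definition L2_vec_sq ::
  "(real^'n \<Rightarrow> real^'n^'n) \<Rightarrow> (real^'n) set \<Rightarrow> (real^'n \<Rightarrow> complex^'n) \<Rightarrow> ennreal" where
  "L2_vec_sq G \<Omega> V = (\<integral>\<^sup>+x. ennreal (g_normsq (G x) (V x)) \<partial>g_vol G \<Omega>)"

definition L2_space :: "(real^'n \<Rightarrow> real^'n^'n) \<Rightarrow> (real^'n) set \<Rightarrow> (real^'n \<Rightarrow> complex) set" where
  "L2_space G \<Omega> = {w. w \<in> borel_measurable (g_vol G \<Omega>) \<and>
     (\<exists>\<phi>. (\<forall>k::nat. smooth_closure \<Omega> (\<phi> k) \<and> L2_sq G \<Omega> (\<phi> k) < \<infinity>) \<and>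
        (\<lambda>k. L2_sq G \<Omega> (\<lambda>x. \<phi> k x - w x)) \<longlonglongrightarrow> 0)}"

definition H1_smooth :: "(real^'n \<Rightarrow> real^'n^'n) \<Rightarrow> (real^'n) set \<Rightarrow> (real^'n \<Rightarrow> complex) set" where
  "H1_smooth G \<Omega> = {\<phi>. smooth_closure \<Omega> \<phi> \<and>
     L2_sq G \<Omega> \<phi> + L2_vec_sq G \<Omega> (g_grad G \<phi>) < \<infinity>}"

definition H2_smooth :: "(real^'n \<Rightarrow> real^'n^'n) \<Rightarrow> (real^'n) set \<Rightarrow> (real^'n \<Rightarrow> complex) set" where
  "H2_smooth G \<Omega> = {\<phi>. smooth_closure \<Omega> \<phi> \<and>
     L2_sq G \<Omega> \<phi> + L2_vec_sq G \<Omega> (g_grad G \<phi>) + L2_sq G \<Omega> (g_laplacian G \<phi>) < \<infinity>}"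

definition H1_limit ::
  "(real^'n \<Rightarrow> real^'n^'n) \<Rightarrow> (real^'n) set \<Rightarrow> (real^'n \<Rightarrow> complex) set \<Rightarrow>
   (real^'n \<Rightarrow> complex) \<Rightarrow> (real^'n \<Rightarrow> complex^'n) \<Rightarrow> bool" where
  "H1_limit G \<Omega> D w V \<longleftrightarrow>
     w \<in> borel_measurable (g_vol G \<Omega>) \<and> V \<in> borel_measurable (g_vol G \<Omega>) \<and>
     (\<exists>\<phi>. (\<forall>k::nat. \<phi> k \<in> D) \<and>
        (\<lambda>k. L2_sq G \<Omega> (\<lambda>x. \<phi> k x - w x)
           + L2_vec_sq G \<Omega> (\<lambda>x. g_grad G (\<phi> k) x - V x)) \<longlonglongrightarrow> 0)"

definition H2_limit ::
  "(real^'n \<Rightarrow> real^'n^'n) \<Rightarrow> (real^'n) set \<Rightarrow>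
   (real^'n \<Rightarrow> complex) \<Rightarrow> (real^'n \<Rightarrow> complex^'n) \<Rightarrow> (real^'n \<Rightarrow> complex) \<Rightarrow> bool" where
  "H2_limit G \<Omega> w V L \<longleftrightarrow>
     w \<in> borel_measurable (g_vol G \<Omega>) \<and> V \<in> borel_measurable (g_vol G \<Omega>) \<and>
     L \<in> borel_measurable (g_vol G \<Omega>) \<and>
     (\<exists>\<phi>. (\<forall>k::nat. \<phi> k \<in> H2_smooth G \<Omega>) \<and>
        (\<lambda>k. L2_sq G \<Omega> (\<lambda>x. \<phi> k x - w x)
           + L2_vec_sq G \<Omega> (\<lambda>x. g_grad G (\<phi> k) x - V x)
           + L2_sq G \<Omega> (\<lambda>x. g_laplacian G (\<phi> k) x - L x)) \<longlonglongrightarrow> 0)"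

definition H1_space :: "(real^'n \<Rightarrow> real^'n^'n) \<Rightarrow> (real^'n) set \<Rightarrow> (real^'n \<Rightarrow> complex) set" where
  "H1_space G \<Omega> = {w. \<exists>V. H1_limit G \<Omega> (H1_smooth G \<Omega>) w V}"

text \<open>
  Vanishing trace on \<open>\<Gamma>\<close> is expressed as approximability in \<open>H\<^sup>1\<close> by smooth
  functions that vanish on \<open>\<Gamma>\<close>.
\<close>

definition zero_trace :: "(real^'n \<Rightarrow> real^'n^'n) \<Rightarrow> (real^'n) set \<Rightarrow> (real^'n \<Rightarrow> complex) \<Rightarrow> bool" where
  "zero_trace G \<Omega> w \<longleftrightarrow>
     (\<exists>V. H1_limit G \<Omega> {\<phi> \<in> H1_smooth G \<Omega>. \<forall>x\<in>frontier \<Omega>. \<phi> x = 0} w V)"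

definition H1_Gamma_space :: "(real^'n \<Rightarrow> real^'n^'n) \<Rightarrow> (real^'n) set \<Rightarrow> (real^'n \<Rightarrow> complex) set" where
  "H1_Gamma_space G \<Omega> = {w \<in> H1_space G \<Omega>. zero_trace G \<Omega> w}"

definition H2_space :: "(real^'n \<Rightarrow> real^'n^'n) \<Rightarrow> (real^'n) set \<Rightarrow> (real^'n \<Rightarrow> complex) set" where
  "H2_space G \<Omega> = {w. \<exists>V L. H2_limit G \<Omega> w V L}"

text \<open>
  The limits below are weak derivatives, hence unique up to null sets; only their equivalence
  classes enter the integrals and almost-everywhere statements.
\<close>

definition sob_grad ::
  "(real^'n \<Rightarrow> real^'n^'n) \<Rightarrow> (real^'n) set \<Rightarrow> (real^'n \<Rightarrow> complex) \<Rightarrow> real^'n \<Rightarrow> complex^'n" where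
  "sob_grad G \<Omega> w = (SOME V. H1_limit G \<Omega> (H1_smooth G \<Omega>) w V)"

definition sob_laplacian ::
  "(real^'n \<Rightarrow> real^'n^'n) \<Rightarrow> (real^'n) set \<Rightarrow> (real^'n \<Rightarrow> complex) \<Rightarrow> real^'n \<Rightarrow> complex" where
  "sob_laplacian G \<Omega> w = (SOME L. \<exists>V. H2_limit G \<Omega> w V L)"

text \<open>The radial derivative as \<open>du(\<partial>/\<partial>r) = \<langle>\<nabla>\<^sub>g u, \<partial>/\<partial>r\<rangle>\<^sub>g\<close>.\<close>

definition sob_radial ::
  "(real^'n \<Rightarrow> real^'n^'n) \<Rightarrow> (real^'n) set \<Rightarrow> (real^'n \<Rightarrow> complex) \<Rightarrow> real^'n \<Rightarrow> complex" where
  "sob_radial G \<Omega> w x =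
     (\<Sum>i\<in>UNIV. \<Sum>j\<in>UNIV. (G x $ i $ j * (x $ j / norm x)) *\<^sub>R (sob_grad G \<Omega> w x $ i))"

definition H2_sq :: "(real^'n \<Rightarrow> real^'n^'n) \<Rightarrow> (real^'n) set \<Rightarrow> (real^'n \<Rightarrow> complex) \<Rightarrow> ennreal" where
  "H2_sq G \<Omega> w =
     L2_sq G \<Omega> w + L2_vec_sq G \<Omega> (sob_grad G \<Omega> w) + L2_sq G \<Omega> (sob_laplacian G \<Omega> w)"


section \<open>The Schroedinger equation\<close>

text \<open>
  Strong solutions: \<open>u\<close> is continuous from \<open>[0,\<infinity>)\<close> to \<open>H\<^sup>1\<^sub>\<Gamma> \<inter> H\<^sup>2\<close> and continuously
  differentiable as an \<open>L\<^sup>2\<close>-valued map; \<open>v\<close> is its time derivative \<open>u\<^sub>t\<close>, and the equation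
  holds almost everywhere in \<open>\<Omega>\<close> at each time.
\<close>

definition solution ::
  "(real^'n \<Rightarrow> real^'n^'n) \<Rightarrow> (real^'n) set \<Rightarrow> (real^'n \<Rightarrow> real) \<Rightarrow> real \<Rightarrow>
   (real^'n \<Rightarrow> complex) \<Rightarrow> (real \<Rightarrow> real^'n \<Rightarrow> complex) \<Rightarrow> bool" where
  "solution G \<Omega> a p u0 u \<longleftrightarrow>
     (\<forall>t\<ge>0. u t \<in> H1_Gamma_space G \<Omega> \<inter> H2_space G \<Omega>) \<and>
     (\<forall>t0\<ge>0. ((\<lambda>t. H2_sq G \<Omega> (\<lambda>x. u t x - u t0 x)) \<longlongrightarrow> 0) (at t0 within {0..})) \<and>
     (\<exists>v. (\<forall>t\<ge>0. v t \<in> L2_space G \<Omega>) \<and>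
        (\<forall>t0\<ge>0. ((\<lambda>t. L2_sq G \<Omega> (\<lambda>x. v t x - v t0 x)) \<longlongrightarrow> 0) (at t0 within {0..})) \<and>
        (\<forall>t0\<ge>0. ((\<lambda>t. L2_sq G \<Omega> (\<lambda>x. (u t x - u t0 x) /\<^sub>R (t - t0) - v t0 x)) \<longlongrightarrow> 0)
           (at t0 within {0..})) \<and>
        (\<forall>t>0. AE x in g_vol G \<Omega>.
           \<i> * v t x + sob_laplacian G \<Omega> (u t) x + \<i> * complex_of_real (a x) * u t x
             - complex_of_real (cmod (u t x) powr (p - 1)) * u t x = 0)) \<and>
     (AE x in g_vol G \<Omega>. u 0 x = u0 x)"

text \<open>Well-posedness in the sense of Hadamard: existence, uniqueness, continuous dependence.\<close>

definition well_posed ::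
  "(real^'n \<Rightarrow> real^'n^'n) \<Rightarrow> (real^'n) set \<Rightarrow> (real^'n \<Rightarrow> real) \<Rightarrow> real \<Rightarrow> bool" where
  "well_posed G \<Omega> a p \<longleftrightarrow>
     (\<forall>u0 \<in> H1_Gamma_space G \<Omega> \<inter> H2_space G \<Omega>. \<exists>u. solution G \<Omega> a p u0 u) \<and>
     (\<forall>u0 u v. solution G \<Omega> a p u0 u \<longrightarrow> solution G \<Omega> a p u0 v \<longrightarrow>
        (\<forall>t\<ge>0. AE x in g_vol G \<Omega>. u t x = v t x)) \<and>
     (\<forall>u0 u w0 w. solution G \<Omega> a p u0 u \<longrightarrow> (\<forall>k::nat. solution G \<Omega> a p (w0 k) (w k)) \<longrightarrow>
        (\<lambda>k. H2_sq G \<Omega> (\<lambda>x. w0 k x - u0 x)) \<longlonglongrightarrow> 0 \<longrightarrow>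
        (\<forall>T>0. (\<lambda>k. SUP t\<in>{0..T}. H2_sq G \<Omega> (\<lambda>x. w k t x - u t x)) \<longlonglongrightarrow> 0))"

definition energy ::
  "(real^'n \<Rightarrow> real^'n^'n) \<Rightarrow> (real^'n) set \<Rightarrow> real \<Rightarrow> (real \<Rightarrow> real^'n \<Rightarrow> complex) \<Rightarrow> real \<Rightarrow> ennreal" where
  "energy G \<Omega> p u t =
     ennreal (1/2) * (\<integral>\<^sup>+x. ennreal ((cmod (u t x))\<^sup>2 + g_normsq (G x) (sob_grad G \<Omega> (u t) x)) \<partial>g_vol G \<Omega>)
     + ennreal (1 / (p + 1)) * (\<integral>\<^sup>+x. ennreal (cmod (u t x) powr (p + 1)) \<partial>g_vol G \<Omega>)"

text \<open>
  As an \<^typ>\<open>ennreal\<close>-valued integral this is meant for nonnegative integrands.  Where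
  \<open>G \<partial>/\<partial>r = \<partial>/\<partial>r\<close>, the integrand built from
  \<open>|\<nabla>\<^sub>g u|\<^sub>g\<^sup>2 - |u\<^sub>r|\<^sup>2\<close> is nonnegative.
\<close>

definition spacetime_integral ::
  "(real^'n \<Rightarrow> real^'n^'n) \<Rightarrow> (real^'n) set \<Rightarrow> real \<Rightarrow> (real \<Rightarrow> real^'n \<Rightarrow> real) \<Rightarrow> ennreal" where
  "spacetime_integral G \<Omega> T f =
     (\<integral>\<^sup>+t\<in>{0..T}. (\<integral>\<^sup>+x. ennreal (f t x) \<partial>g_vol G \<Omega>) \<partial>lborel)"

end

theory Submission
  imports Defs
begin

text \<open>
 Write \<open>\<theta> = x/|x|\<close> and \<open>m = n - 1 + d/2\<close>.  Since \<open>G \<theta> = \<theta>\<close> and \<open>det G = c0 r\<^sup>d\<close>, the volume has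
 density proportional to \<open>r\<^sup>m\<close> along each ray.  The equation reads \<open>i u\<^sub>t = f\<close>, where
 \<open>f = |u|\<^bsup>p-1\<^esup>u - \<Delta>\<^sub>g u\<close> is the gradient of the convex functional
 \<open>J(u) = \<integral> (|\<nabla>u|\<^sup>2/2 + |u|\<^bsup>p+1\<^esup>/(p+1))\<close>.

 The classical Morawetz argument pairs the equation with \<open>P u = u\<^sub>r + (m/(2r)) u\<close> and integrates
 by parts twice, which leaves a boundary term of favourable sign.  Here \<open>u(t)\<close> is only known as a
 limit in \<open>H\<^sup>2\<close>, so traces of its gradient are avoided: \<open>-P\<close> generates the radial translations
 \<open>(S\<^sub>s u)(x) = ((r-s)/r)\<^bsup>m/2\<^esup> u(x - s\<theta>)\<close>, isometries of \<open>L\<^sup>2\<close>, and \<open>u\<close> is compared with \<open>S\<^sub>s u\<close>.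
 The sign of \<open>\<partial>r/\<partial>\<nu>\<close> means that rays going outward never leave \<open>\<Omega>\<close> (\<open>rays_stay\<close>), so \<open>S\<^sub>s u\<close> again
 vanishes on the boundary.  By convexity \<open>J(u) - J(S\<^sub>s u) \<le> \<langle>f, u - S\<^sub>s u\<rangle>\<close>, and both sides are
 divided by \<open>s\<close>:
 \<^item> the right-hand side tends to \<open>\<langle>f, P u\<rangle>\<close> (\<open>quotient_conv\<close>);
 \<^item> the potential part of \<open>J\<close> produces \<open>m(p-1)/(2(p+1)) \<integral> |u|\<^bsup>p+1\<^esup>/r\<close>, because \<open>\<integral> |S\<^sub>s u|\<^bsup>p+1\<^esup>\<close> has
   the additional weight \<open>(r/(r+s))\<^bsup>m(p-1)/2\<^esup>\<close> (\<open>power_of_translate\<close>);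
 \<^item> the tangential part of the gradient produces at least \<open>\<integral> (\<alpha>/r)(|\<nabla>u|\<^sup>2 - |u\<^sub>r|\<^sup>2)\<close>, because the
   hypothesis on \<open>(1-\<alpha>)G + (r/2) \<partial>G/\<partial>r\<close> bounds the growth of the metrics of the spheres from below
   (\<open>Tform_mono\<close>, \<open>Tform_liminf\<close>);
 \<^item> the radial part produces \<open>-(m/2) \<integral> u\<^sub>r u / r\<^sup>2\<close>, which is \<open>m(m-2)/4 \<integral> |u|\<^sup>2/r\<^sup>3\<close> by a divergence
   identity (\<open>hardy_identity\<close>).  Here \<open>m \<ge> 2\<close> is the same as \<open>d \<ge> 2(3-n)\<close>, and \<open>m > 2\<close> is case (ii).

 All three terms are nonnegative, so each is bounded by \<open>\<langle>f, P u\<rangle>\<close> (\<open>key_estimate\<close>).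

 Finally \<open>P\<close> is antisymmetric and commutes with \<open>i\<close>, so that \<open>M(t) = \<langle>i u, P u\<rangle>\<close> satisfies
 \<open>M' = 2\<langle>i u\<^sub>t, P u\<rangle> = 2\<langle>f, P u\<rangle>\<close>, while \<open>|M(t)| = |\<langle>i u, u\<^sub>r\<rangle>| \<le> E(t) \<le> E(0)\<close>.  Integrating in time
 bounds the space-time integrals by multiples of \<open>M(T) - M(0) \<le> 2 E(0)\<close> (\<open>spacetime_bound\<close>).
 The energy is constant for positive times; at \<open>t = 0\<close>, where the equation is not assumed,
 convexity still gives \<open>E(t) \<le> E(0)\<close> (\<open>en_le_initial\<close>).
\<close>


section \<open>Square-integrable fields for a pointwise semi-inner product\<close>

text \<open>
 Scalars, gradients and the tangential parts of gradients are all measured by integrals of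
 nonnegative quadratic forms that vary with the point.  The Hilbert space facts needed for the
 three of them are the same, so they are proved once for a measurable field of forms.
\<close>

locale form_field =
 fixes M :: "'a measure" and q :: "'a \<Rightarrow> 'v::euclidean_space \<Rightarrow> 'v \<Rightarrow> real"
 assumes q_add: "\<And>x u v w. q x (u + v) w = q x u w + q x v w"
  and q_scale: "\<And>x c u v. q x (c *\<^sub>R u) v = c * q x u v"
  and q_sym: "\<And>x u v. x \<in> space M \<Longrightarrow> q x u v = q x v u"
  and q_nonneg: "\<And>x u. x \<in> space M \<Longrightarrow> q x u u \<ge> 0"
  and q_meas: "\<And>f g. f \<in> borel_measurable M \<Longrightarrow> g \<in> borel_measurable M
          \<Longrightarrow> (\<lambda>x. q x (f x) (g x)) \<in> borel_measurable M"
begin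

definition sqi :: "('a \<Rightarrow> 'v) \<Rightarrow> bool" where
 "sqi f \<longleftrightarrow> f \<in> borel_measurable M \<and> integrable M (\<lambda>x. q x (f x) (f x))"

definition ip :: "('a \<Rightarrow> 'v) \<Rightarrow> ('a \<Rightarrow> 'v) \<Rightarrow> real" where
 "ip f g = (\<integral>x. q x (f x) (g x) \<partial>M)"

definition nrm :: "('a \<Rightarrow> 'v) \<Rightarrow> real" where
 "nrm f = sqrt (ip f f)"

lemma sqi_meas [measurable_dest]: "sqi f \<Longrightarrow> f \<in> borel_measurable M"
 by (simp add: sqi_def)

lemma q_minus: "q x (- u) v = - q x u v"
 using q_scale[of x "-1" u v] by simp

lemma q_diff: "q x (u - v) w = q x u w - q x v w"
 using q_add[of x u "-v" w] by (simp add: q_minus)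

lemma q_zero: "q x 0 v = 0"
 using q_scale[of x 0 0 v] by simp

lemma q_add2: "x \<in> space M \<Longrightarrow> q x w (u + v) = q x w u + q x w v"
 by (simp add: q_sym[of x w] q_add)

lemma q_scale2: "x \<in> space M \<Longrightarrow> q x w (c *\<^sub>R v) = c * q x w v"
 by (simp add: q_sym[of x w] q_scale)

lemma q_diff2: "x \<in> space M \<Longrightarrow> q x w (u - v) = q x w u - q x w v"
 by (simp add: q_sym[of x w] q_diff)


lemma q_abs_le:
 assumes "x \<in> space M"
 shows "\<bar>q x u v\<bar> \<le> (q x u u + q x v v) / 2"
proof -
 have "0 \<le> q x (u + v) (u + v)" "0 \<le> q x (u - v) (u - v)"
  using q_nonneg assms by auto
 then show ?thesis
  using assms by (simp add: q_add q_diff q_add2 q_diff2 q_sym[of x v u] abs_le_iff)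
qed

lemma q_sum_le:
 assumes "x \<in> space M"
 shows "q x (u + v) (u + v) \<le> 2 * q x u u + 2 * q x v v"
 using q_abs_le[OF assms, of u v] assms
 by (simp add: q_add q_add2 q_sym[of x v u])

lemma integrable_q:
 assumes "sqi f" "sqi g"
 shows "integrable M (\<lambda>x. q x (f x) (g x))"
proof (rule Bochner_Integration.integrable_bound)
 show "integrable M (\<lambda>x. (q x (f x) (f x) + q x (g x) (g x)) / 2)"
  using assms by (auto simp: sqi_def)
 show "(\<lambda>x. q x (f x) (g x)) \<in> borel_measurable M"
  using assms by (auto simp: sqi_def intro: q_meas)
 show "AE x in M. norm (q x (f x) (g x)) \<le> norm ((q x (f x) (f x) + q x (g x) (g x)) / 2)"
  by (rule AE_I2) (use q_abs_le q_nonneg in "force")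
qed

lemma sqi_add:
 assumes "sqi f" "sqi g"
 shows "sqi (\<lambda>x. f x + g x)"
proof -
 have m: "(\<lambda>x. f x + g x) \<in> borel_measurable M"
  using assms by (auto simp: sqi_def)
 moreover have "integrable M (\<lambda>x. q x (f x + g x) (f x + g x))"
 proof (rule Bochner_Integration.integrable_bound)
  show "integrable M (\<lambda>x. 2 * q x (f x) (f x) + 2 * q x (g x) (g x))"
   using assms by (auto simp: sqi_def)
  show "(\<lambda>x. q x (f x + g x) (f x + g x)) \<in> borel_measurable M"
   using m by (auto intro: q_meas)
  show "AE x in M. norm (q x (f x + g x) (f x + g x)) \<le> norm (2 * q x (f x) (f x) + 2 * q x (g x) (g x))"
   by (rule AE_I2) (use q_sum_le q_nonneg in "force")
 qed
 ultimately show ?thesis by (simp add: sqi_def)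
qed

lemma sqi_scale:
 assumes "sqi f"
 shows "sqi (\<lambda>x. c *\<^sub>R f x)"
proof -
 have "integrable M (\<lambda>x. c * (c * q x (f x) (f x)))"
  using assms by (auto simp: sqi_def)
 moreover have "integrable M (\<lambda>x. q x (c *\<^sub>R f x) (c *\<^sub>R f x)) \<longleftrightarrow> integrable M (\<lambda>x. c * (c * q x (f x) (f x)))"
  by (rule Bochner_Integration.integrable_cong) (auto simp: q_scale q_scale2)
 ultimately have "integrable M (\<lambda>x. q x (c *\<^sub>R f x) (c *\<^sub>R f x))"
  by blast
 then show ?thesis using assms by (auto simp: sqi_def)
qed

lemma sqi_diff:
 assumes "sqi f" "sqi g"
 shows "sqi (\<lambda>x. f x - g x)"
 using sqi_add[OF assms(1) sqi_scale[OF assms(2), of "-1"]] by simp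

lemma sqi_zero: "sqi (\<lambda>x. 0)"
 by (simp add: sqi_def q_zero)

lemma ip_sym: "ip f g = ip g f"
 unfolding ip_def by (rule Bochner_Integration.integral_cong) (auto simp: q_sym)

lemma ip_add:
 assumes "sqi f" "sqi g" "sqi h"
 shows "ip (\<lambda>x. f x + g x) h = ip f h + ip g h"
 unfolding ip_def using assms by (simp add: q_add integrable_q)

lemma ip_diff:
 assumes "sqi f" "sqi g" "sqi h"
 shows "ip (\<lambda>x. f x - g x) h = ip f h - ip g h"
 unfolding ip_def using assms by (simp add: q_diff integrable_q)

lemma ip_scale: "ip (\<lambda>x. c *\<^sub>R f x) h = c * ip f h"
 unfolding ip_def by (simp add: q_scale)


lemma ip_add2: "sqi f \<Longrightarrow> sqi g \<Longrightarrow> sqi h \<Longrightarrow> ip h (\<lambda>x. f x + g x) = ip h f + ip h g"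
 by (simp add: ip_sym[of h] ip_add)

lemma ip_diff2: "sqi f \<Longrightarrow> sqi g \<Longrightarrow> sqi h \<Longrightarrow> ip h (\<lambda>x. f x - g x) = ip h f - ip h g"
 by (simp add: ip_sym[of h] ip_diff)

lemma ip_scale2: "ip h (\<lambda>x. c *\<^sub>R f x) = c * ip h f"
 by (simp add: ip_sym[of h] ip_scale)

lemma ip_nonneg: "ip f f \<ge> 0"
 unfolding ip_def by (rule integral_nonneg_AE) (auto simp: q_nonneg)

lemma nrm_nonneg: "nrm f \<ge> 0"
 by (simp add: nrm_def ip_nonneg)

lemma nrm_sq: "(nrm f)\<^sup>2 = ip f f"
 by (simp add: nrm_def ip_nonneg)

lemma ip_cong_AE:
 assumes "AE x in M. f x = f' x" "AE x in M. g x = g' x"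
  and "f \<in> borel_measurable M" "f' \<in> borel_measurable M"
  and "g \<in> borel_measurable M" "g' \<in> borel_measurable M"
 shows "ip f g = ip f' g'"
 unfolding ip_def
 by (rule integral_cong_AE) (use assms in "auto intro: q_meas")

lemma sqi_cong_AE:
 assumes "AE x in M. f x = f' x"
  and "f \<in> borel_measurable M" "f' \<in> borel_measurable M"
 shows "sqi f \<longleftrightarrow> sqi f'"
proof -
 have "integrable M (\<lambda>x. q x (f x) (f x)) \<longleftrightarrow> integrable M (\<lambda>x. q x (f' x) (f' x))"
  by (rule integrable_cong_AE) (use assms in "auto intro: q_meas")
 then show ?thesis using assms by (simp add: sqi_def)
qed

lemma nrm_cong_AE:
 assumes "AE x in M. f x = f' x"
  and "f \<in> borel_measurable M" "f' \<in> borel_measurable M"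
 shows "nrm f = nrm f'"
 unfolding nrm_def using ip_cong_AE[OF assms(1) assms(1)] assms by simp

lemma ip_add_self:
 assumes "sqi f" "sqi g"
 shows "ip (\<lambda>x. f x + g x) (\<lambda>x. f x + g x) = ip f f + 2 * ip f g + ip g g"
 using assms by (simp add: ip_add ip_add2 sqi_add ip_sym[of g f])

lemma ip_diff_self:
 assumes "sqi f" "sqi g"
 shows "ip (\<lambda>x. f x - g x) (\<lambda>x. f x - g x) = ip f f - 2 * ip f g + ip g g"
 using assms by (simp add: ip_diff ip_diff2 sqi_diff ip_sym[of g f])

lemma ip_le_half:
 assumes "sqi f" "sqi g"
 shows "\<bar>ip f g\<bar> \<le> (ip f f + ip g g) / 2"
 using ip_add_self[OF assms] ip_diff_self[OF assms]
  ip_nonneg[of "\<lambda>x. f x + g x"] ip_nonneg[of "\<lambda>x. f x - g x"] by (simp add: abs_le_iff)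

lemma cauchy_schwarz:
 assumes "sqi f" "sqi g"
 shows "\<bar>ip f g\<bar> \<le> nrm f * nrm g"
proof -
 have main: "0 \<le> ip f f * t\<^sup>2 + 2 * ip f g * t + ip g g" for t
 proof -
  have "0 \<le> ip (\<lambda>x. t *\<^sub>R f x + g x) (\<lambda>x. t *\<^sub>R f x + g x)"
   by (rule ip_nonneg)
  also have "\<dots> = ip f f * t\<^sup>2 + 2 * ip f g * t + ip g g"
   using ip_add_self[OF sqi_scale[OF assms(1), of t] assms(2)]
   by (simp add: ip_scale ip_scale2 power2_eq_square algebra_simps)
  finally show ?thesis .
 qed
 have "(ip f g)\<^sup>2 \<le> ip f f * ip g g"
 proof (cases "ip f f = 0")
  case True
  have "ip f g = 0"
  proof (rule ccontr)
   assume n: "ip f g \<noteq> 0"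
   have "0 \<le> 2 * ip f g * (- (ip g g + 1) / (2 * ip f g)) + ip g g"
    using main[of "- (ip g g + 1) / (2 * ip f g)"] True by simp
   also have "\<dots> = -1" using n by (simp add: field_simps)
   finally show False by simp
  qed
  then show ?thesis using True by simp
 next
  case False
  then have pos: "ip f f > 0" using ip_nonneg[of f] by simp
  have "0 \<le> ip f f * (- ip f g / ip f f)\<^sup>2 + 2 * ip f g * (- ip f g / ip f f) + ip g g"
   by (rule main)
  also have "\<dots> = ip g g - (ip f g)\<^sup>2 / ip f f"
   using pos by (simp add: field_simps power2_eq_square)
  finally show ?thesis using pos by (simp add: field_simps)
 qed
 then have "sqrt ((ip f g)\<^sup>2) \<le> sqrt (ip f f * ip g g)"
  by (rule real_sqrt_le_mono)
 then show ?thesis by (simp add: nrm_def real_sqrt_mult)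
qed

lemma nrm_triangle:
 assumes "sqi f" "sqi g"
 shows "nrm (\<lambda>x. f x + g x) \<le> nrm f + nrm g"
proof -
 have "ip (\<lambda>x. f x + g x) (\<lambda>x. f x + g x) \<le> (nrm f + nrm g)\<^sup>2"
  using cauchy_schwarz[OF assms] ip_add_self[OF assms]
  by (simp add: power2_sum nrm_sq)
 then show ?thesis
  by (simp add: nrm_def[of "\<lambda>x. f x + g x"] real_le_lsqrt nrm_nonneg ip_nonneg)
qed

lemma nrm_scale: "nrm (\<lambda>x. c *\<^sub>R f x) = \<bar>c\<bar> * nrm f"
 by (simp add: nrm_def ip_scale ip_scale2 mult.assoc[symmetric] real_sqrt_mult)


lemma nrm_triangle_via:
 assumes "sqi f" "sqi g" "sqi h"
 shows "nrm (\<lambda>x. f x - h x) \<le> nrm (\<lambda>x. f x - g x) + nrm (\<lambda>x. g x - h x)"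
 using nrm_triangle[OF sqi_diff[OF assms(1,2)] sqi_diff[OF assms(2,3)]] by simp

lemma nrm_diff_sym: "nrm (\<lambda>x. f x - g x) = nrm (\<lambda>x. g x - f x)"
 using nrm_scale[of "-1" "\<lambda>x. g x - f x"] by simp

lemma nn_integral_eq_ip:
 assumes "sqi f"
 shows "(\<integral>\<^sup>+x. ennreal (q x (f x) (f x)) \<partial>M) = ennreal (ip f f)"
 unfolding ip_def using assms q_nonneg by (intro nn_integral_eq_integral) (auto simp: sqi_def)

lemma sqi_iff_finite:
 assumes "f \<in> borel_measurable M"
 shows "sqi f \<longleftrightarrow> (\<integral>\<^sup>+x. ennreal (q x (f x) (f x)) \<partial>M) < \<infinity>"
proof
 assume "sqi f"
 then show "(\<integral>\<^sup>+x. ennreal (q x (f x) (f x)) \<partial>M) < \<infinity>"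
  by (simp add: nn_integral_eq_ip)
next
 assume fin: "(\<integral>\<^sup>+x. ennreal (q x (f x) (f x)) \<partial>M) < \<infinity>"
 have "integrable M (\<lambda>x. q x (f x) (f x))"
  by (rule integrableI_nonneg) (use assms fin q_nonneg in "auto intro: q_meas")
 then show "sqi f" using assms by (simp add: sqi_def)
qed

lemma sqi_eventually_finite:
 assumes "f \<in> borel_measurable M" "sqi g"
  and "(\<integral>\<^sup>+x. ennreal (q x (g x - f x) (g x - f x)) \<partial>M) < \<infinity>"
 shows "sqi f"
proof -
 have m: "(\<lambda>x. g x - f x) \<in> borel_measurable M"
  using assms by (auto simp: sqi_def)
 have "sqi (\<lambda>x. g x - f x)"
  using sqi_iff_finite[OF m] assms(3) by blast
 from sqi_diff[OF assms(2) this] show ?thesis by simp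
qed

text \<open>
 Membership is required only eventually: in the application the filter is a neighbourhood of a
 time in the half-line, and nothing is known about negative times.
\<close>

definition conv :: "('i \<Rightarrow> 'a \<Rightarrow> 'v) \<Rightarrow> ('a \<Rightarrow> 'v) \<Rightarrow> 'i filter \<Rightarrow> bool" where
 "conv f f0 F \<longleftrightarrow> (\<forall>\<^sub>F k in F. sqi (f k)) \<and> sqi f0 \<and> ((\<lambda>k. nrm (\<lambda>x. f k x - f0 x)) \<longlongrightarrow> 0) F"

lemma conv_tendsto_ip:
 assumes "conv f f0 F" "conv g g0 F"
 shows "((\<lambda>k. ip (f k) (g k)) \<longlongrightarrow> ip f0 g0) F"
proof -
 have s: "sqi f0" "sqi g0" using assms by (auto simp: conv_def)
 have lim: "((\<lambda>k. nrm (\<lambda>x. f k x - f0 x) * nrm (\<lambda>x. g k x - g0 x)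
   + nrm (\<lambda>x. f k x - f0 x) * nrm g0 + nrm f0 * nrm (\<lambda>x. g k x - g0 x)) \<longlongrightarrow> 0 * 0 + 0 * nrm g0 + nrm f0 * 0) F"
  using assms unfolding conv_def by (intro tendsto_intros) auto
 have ev: "\<forall>\<^sub>F k in F. norm (ip (f k) (g k) - ip f0 g0) \<le> nrm (\<lambda>x. f k x - f0 x) * nrm (\<lambda>x. g k x - g0 x)
   + nrm (\<lambda>x. f k x - f0 x) * nrm g0 + nrm f0 * nrm (\<lambda>x. g k x - g0 x)"
 proof -
  have "\<forall>\<^sub>F k in F. sqi (f k) \<and> sqi (g k)"
   using assms unfolding conv_def by (auto intro: eventually_conj)
  then show ?thesis
  proof eventually_elim
   case (elim k)
   let ?a = "\<lambda>x. f k x - f0 x" and ?b = "\<lambda>x. g k x - g0 x"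
   have sa: "sqi ?a" "sqi ?b" using elim s sqi_diff by auto
   have "ip (f k) (g k) - ip f0 g0 = ip ?a ?b + ip ?a g0 + ip f0 ?b"
    using elim s sa by (simp add: ip_diff ip_diff2)
   moreover have "\<bar>ip ?a ?b\<bar> \<le> nrm ?a * nrm ?b" "\<bar>ip ?a g0\<bar> \<le> nrm ?a * nrm g0"
    "\<bar>ip f0 ?b\<bar> \<le> nrm f0 * nrm ?b"
    using cauchy_schwarz sa s by auto
   ultimately show ?case by simp
  qed
 qed
 have "((\<lambda>k. ip (f k) (g k) - ip f0 g0) \<longlongrightarrow> 0) F"
  by (rule Lim_null_comparison[OF ev]) (use lim in simp)
 then show ?thesis by (simp add: LIM_zero_iff)
qed

lemma conv_const: "sqi f \<Longrightarrow> conv (\<lambda>_. f) f F"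
 by (simp add: conv_def nrm_def ip_def q_zero)

lemma conv_tendsto_nrm:
 assumes "conv f f0 F"
 shows "((\<lambda>k. nrm (f k)) \<longlongrightarrow> nrm f0) F"
 unfolding nrm_def by (intro tendsto_real_sqrt conv_tendsto_ip assms)

lemma conv_add:
 assumes "conv f f0 F" "conv g g0 F"
 shows "conv (\<lambda>k x. f k x + g k x) (\<lambda>x. f0 x + g0 x) F"
proof -
 have s: "sqi f0" "sqi g0" using assms by (auto simp: conv_def)
 have ev: "\<forall>\<^sub>F k in F. sqi (f k) \<and> sqi (g k)"
  using assms unfolding conv_def by (auto intro: eventually_conj)
 have e2: "\<forall>\<^sub>F k in F. norm (nrm (\<lambda>x. f k x + g k x - (f0 x + g0 x))) \<le> nrm (\<lambda>x. f k x - f0 x) + nrm (\<lambda>x. g k x - g0 x)"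
  using ev
 proof eventually_elim
  case (elim k)
  have "(\<lambda>x. f k x + g k x - (f0 x + g0 x)) = (\<lambda>x. (f k x - f0 x) + (g k x - g0 x))" by auto
  then show ?case
   using nrm_triangle[of "\<lambda>x. f k x - f0 x" "\<lambda>x. g k x - g0 x"] elim s
   by (auto simp: sqi_diff nrm_nonneg)
 qed
 have lim: "((\<lambda>k. nrm (\<lambda>x. f k x - f0 x) + nrm (\<lambda>x. g k x - g0 x)) \<longlongrightarrow> 0) F"
  using assms unfolding conv_def by (auto intro!: tendsto_add_zero)
 have "\<forall>\<^sub>F k in F. sqi (\<lambda>x. f k x + g k x)"
  using ev by eventually_elim (auto intro: sqi_add)
 then show ?thesis
  unfolding conv_def using Lim_null_comparison[OF e2 lim] s by (auto intro: sqi_add)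
qed

lemma conv_scale:
 assumes "conv f f0 F"
 shows "conv (\<lambda>k x. c *\<^sub>R f k x) (\<lambda>x. c *\<^sub>R f0 x) F"
proof -
 have "((\<lambda>k. \<bar>c\<bar> * nrm (\<lambda>x. f k x - f0 x)) \<longlongrightarrow> \<bar>c\<bar> * 0) F"
  using assms unfolding conv_def by (intro tendsto_intros) auto
 moreover have "nrm (\<lambda>x. c *\<^sub>R f k x - c *\<^sub>R f0 x) = \<bar>c\<bar> * nrm (\<lambda>x. f k x - f0 x)" for k
  using nrm_scale[of c "\<lambda>x. f k x - f0 x"] by (simp add: scaleR_diff_right)
 ultimately show ?thesis
  using assms unfolding conv_def by (auto elim!: eventually_mono intro: sqi_scale)
qed

lemma conv_diff:
 assumes "conv f f0 F" "conv g g0 F"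
 shows "conv (\<lambda>k x. f k x - g k x) (\<lambda>x. f0 x - g0 x) F"
 using conv_add[OF assms(1) conv_scale[OF assms(2), of "-1"]] by simp

lemma conv_iff_ip:
 assumes "\<forall>\<^sub>F k in F. sqi (f k)" "sqi f0"
 shows "conv f f0 F \<longleftrightarrow> ((\<lambda>k. ip (\<lambda>x. f k x - f0 x) (\<lambda>x. f k x - f0 x)) \<longlongrightarrow> 0) F"
proof
 assume "conv f f0 F"
 then have "((\<lambda>k. (nrm (\<lambda>x. f k x - f0 x))\<^sup>2) \<longlongrightarrow> 0\<^sup>2) F"
  unfolding conv_def by (intro tendsto_intros) auto
 then show "((\<lambda>k. ip (\<lambda>x. f k x - f0 x) (\<lambda>x. f k x - f0 x)) \<longlongrightarrow> 0) F"
  by (simp add: nrm_sq)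
next
 assume "((\<lambda>k. ip (\<lambda>x. f k x - f0 x) (\<lambda>x. f k x - f0 x)) \<longlongrightarrow> 0) F"
 from tendsto_real_sqrt[OF this] show "conv f f0 F"
  using assms by (simp add: conv_def nrm_def)
qed

lemma conv_dominated:
 assumes "\<forall>\<^sub>F k in F. sqi (f k)" "sqi f0"
  and "\<And>k. nrm (\<lambda>x. f k x - f0 x) \<le> b k" "(b \<longlongrightarrow> 0) F"
 shows "conv f f0 F"
 unfolding conv_def
 using assms(1,2) by (auto intro!: Lim_null_comparison[OF _ assms(4)] always_eventually simp: nrm_nonneg assms(3))

lemma sqi_cong: "(\<And>x. x \<in> space M \<Longrightarrow> f x = g x) \<Longrightarrow> sqi f \<longleftrightarrow> sqi g"
 unfolding sqi_def by (intro conj_cong measurable_cong Bochner_Integration.integrable_cong) simp_all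

lemma conv_cong:
 assumes "conv f f0 F" "\<And>k x. x \<in> space M \<Longrightarrow> f k x = g k x" "\<And>x. x \<in> space M \<Longrightarrow> f0 x = g0 x"
 shows "conv g g0 F"
proof -
 have "sqi (f k) \<longleftrightarrow> sqi (g k)" "sqi f0 \<longleftrightarrow> sqi g0" for k using assms(2,3) by (intro sqi_cong; simp)+
 moreover have "nrm (\<lambda>x. f k x - f0 x) = nrm (\<lambda>x. g k x - g0 x)" for k
  unfolding nrm_def ip_def by (intro arg_cong[where f = sqrt] Bochner_Integration.integral_cong) (simp_all add: assms(2,3))
 ultimately show ?thesis using assms(1) by (simp add: conv_def)
qed

text \<open>Gradients of limits are determined only up to null sets.\<close>

lemma conv_limit_AE:
 assumes c: "conv f f0 F" and ae: "AE x in M. f0 x = g x" and g: "g \<in> borel_measurable M"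
 shows "conv f g F"
proof -
 have s: "\<forall>\<^sub>F k in F. sqi (f k)" "sqi f0" "((\<lambda>k. nrm (\<lambda>x. f k x - f0 x)) \<longlongrightarrow> 0) F" using c by (auto simp: conv_def)
 have "\<forall>\<^sub>F k in F. nrm (\<lambda>x. f k x - f0 x) = nrm (\<lambda>x. f k x - g x)"
  using s(1) by eventually_elim (rule nrm_cong_AE, use ae g s(2) in "auto simp: sqi_def")
 then show ?thesis using s sqi_cong_AE[OF ae] g by (simp add: conv_def sqi_meas tendsto_cong)
qed

lemma bounded_scale:
 assumes b: "b \<in> borel_measurable M" "\<And>x. x \<in> space M \<Longrightarrow> \<bar>b x\<bar> \<le> C" and f: "sqi f"
 shows "sqi (\<lambda>x. b x *\<^sub>R f x)" "nrm (\<lambda>x. b x *\<^sub>R f x) \<le> \<bar>C\<bar> * nrm f" (is ?th1)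
proof -
 have m: "(\<lambda>x. b x *\<^sub>R f x) \<in> borel_measurable M" using f b(1) by (intro borel_measurable_scaleR) (auto simp: sqi_def)
 have I: "integrable M (\<lambda>x. C\<^sup>2 * q x (f x) (f x))" using f by (simp add: sqi_def)
 have le: "q x (b x *\<^sub>R f x) (b x *\<^sub>R f x) \<le> C\<^sup>2 * q x (f x) (f x)" if x: "x \<in> space M" for x
 proof -
  have "\<bar>b x\<bar>\<^sup>2 \<le> C\<^sup>2" using b(2)[OF x] by (intro power_mono) auto
  then show ?thesis using q_nonneg[OF x, of "f x"]
   by (simp add: q_scale q_scale2[OF x] power2_eq_square mult.assoc[symmetric] mult_right_mono)
 qed
 have "integrable M (\<lambda>x. q x (b x *\<^sub>R f x) (b x *\<^sub>R f x))"
  by (rule Bochner_Integration.integrable_bound[OF I q_meas[OF m m]], rule AE_I2) (use le q_nonneg in force)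
 then show s: "sqi (\<lambda>x. b x *\<^sub>R f x)" using m by (simp add: sqi_def)
 have "ip (\<lambda>x. b x *\<^sub>R f x) (\<lambda>x. b x *\<^sub>R f x) \<le> (\<integral>x. C\<^sup>2 * q x (f x) (f x) \<partial>M)"
  unfolding ip_def by (rule integral_mono[OF _ I le]) (use s in "auto simp: sqi_def")
 from real_sqrt_le_mono[OF this] show ?th1
  by (simp add: nrm_def ip_def real_sqrt_mult)
qed

lemma bounded_scale_conv:
 assumes b: "b \<in> borel_measurable M" "\<And>x. x \<in> space M \<Longrightarrow> \<bar>b x\<bar> \<le> C" and u: "conv u u0 F"
 shows "conv (\<lambda>k x. b x *\<^sub>R u k x) (\<lambda>x. b x *\<^sub>R u0 x) F"
 unfolding conv_def
proof (intro conjI)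
 have s: "sqi u0" "\<forall>\<^sub>F k in F. sqi (u k)" using u by (auto simp: conv_def)
 show "sqi (\<lambda>x. b x *\<^sub>R u0 x)" by (rule bounded_scale(1)[OF b s(1)])
 show "\<forall>\<^sub>F k in F. sqi (\<lambda>x. b x *\<^sub>R u k x)" using s(2) by eventually_elim (rule bounded_scale(1)[OF b])
 have "((\<lambda>k. \<bar>C\<bar> * nrm (\<lambda>x. u k x - u0 x)) \<longlongrightarrow> 0) F"
  using u unfolding conv_def by (auto intro: tendsto_mult_right_zero)
 moreover have "\<forall>\<^sub>F k in F. norm (nrm (\<lambda>x. b x *\<^sub>R u k x - b x *\<^sub>R u0 x)) \<le> \<bar>C\<bar> * nrm (\<lambda>x. u k x - u0 x)"
  using s(2) by eventually_elim (use bounded_scale(2)[OF b sqi_diff[OF _ s(1)]] nrm_nonneg in "simp add: scaleR_diff_right")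
 ultimately show "((\<lambda>k. nrm (\<lambda>x. b x *\<^sub>R u k x - b x *\<^sub>R u0 x)) \<longlongrightarrow> 0) F" by (rule Lim_null_comparison[rotated])
qed

text \<open>
 Dominated convergence for a fixed field multiplied by scalars: it serves both the cut-off at
 infinity and the cut-off near the zero set of a function.
\<close>

lemma conv_scalar_dominated:
 fixes b :: "nat \<Rightarrow> 'a \<Rightarrow> real"
 assumes f: "sqi f" and b: "\<And>k. b k \<in> borel_measurable M" "\<And>k x. \<bar>b k x\<bar> \<le> C" and l: "\<And>x. (\<lambda>k. b k x) \<longlonglongrightarrow> b0 x"
 shows "conv (\<lambda>k x. b k x *\<^sub>R f x) (\<lambda>x. b0 x *\<^sub>R f x) sequentially"
proof (subst conv_iff_ip)
 have b0: "b0 \<in> borel_measurable M" by (rule borel_measurable_LIMSEQ_real[OF l b(1)])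
 have b0C: "\<bar>b0 x\<bar> \<le> C" for x by (rule LIMSEQ_le_const2[OF tendsto_rabs[OF l]]) (use b(2) in auto)
 show "\<forall>\<^sub>F k in sequentially. sqi (\<lambda>x. b k x *\<^sub>R f x)" by (simp add: bounded_scale(1)[OF b f])
 show s0: "sqi (\<lambda>x. b0 x *\<^sub>R f x)" by (rule bounded_scale(1)[OF b0 b0C f])
 let ?d = "\<lambda>k x. b k x *\<^sub>R f x - b0 x *\<^sub>R f x"
 have "(\<lambda>k. \<integral>x. q x (?d k x) (?d k x) \<partial>M) \<longlonglongrightarrow> (\<integral>x. 0 \<partial>M)"
 proof (rule integral_dominated_convergence[where w = "\<lambda>x. (2 * C)\<^sup>2 * q x (f x) (f x)"])
  have e: "q x (?d k x) (?d k x) = (b k x - b0 x)\<^sup>2 * q x (f x) (f x)" if "x \<in> space M" for k x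
   by (simp add: scaleR_diff_left[symmetric] q_scale q_scale2[OF that] power2_eq_square)
  show "integrable M (\<lambda>x. (2 * C)\<^sup>2 * q x (f x) (f x))" using f by (simp add: sqi_def)
  show "(\<lambda>x. q x (?d k x) (?d k x)) \<in> borel_measurable M" for k
   using f b(1)[of k] b0 by (intro q_meas) (auto simp: sqi_def)
  show "AE x in M. (\<lambda>k. q x (?d k x) (?d k x)) \<longlonglongrightarrow> 0"
  proof (rule AE_I2)
   fix x assume x: "x \<in> space M"
   have "(\<lambda>k. (b k x - b0 x)\<^sup>2 * q x (f x) (f x)) \<longlonglongrightarrow> (b0 x - b0 x)\<^sup>2 * q x (f x) (f x)" by (intro tendsto_intros l)
   then show "(\<lambda>k. q x (?d k x) (?d k x)) \<longlonglongrightarrow> 0" by (simp add: e[OF x])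
  qed
  show "AE x in M. norm (q x (?d k x) (?d k x)) \<le> (2 * C)\<^sup>2 * q x (f x) (f x)" for k
  proof (rule AE_I2)
   fix x assume x: "x \<in> space M"
   have "\<bar>b k x - b0 x\<bar> \<le> 2 * C" using b(2)[of k x] b0C[of x] by linarith
   then have "\<bar>b k x - b0 x\<bar>\<^sup>2 \<le> (2 * C)\<^sup>2" by (intro power_mono) auto
   then show "norm (q x (?d k x) (?d k x)) \<le> (2 * C)\<^sup>2 * q x (f x) (f x)"
    using q_nonneg[OF x, of "f x"] by (simp add: e[OF x] mult_right_mono)
  qed
 qed auto
 then show "(\<lambda>k. ip (?d k) (?d k)) \<longlonglongrightarrow> 0" by (simp add: ip_def)
qed

lemma conv_nn_iff:
 assumes f: "\<forall>\<^sub>F k in F. sqi (f k)" and f0: "sqi f0"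
 shows "conv f f0 F \<longleftrightarrow> ((\<lambda>k. \<integral>\<^sup>+x. ennreal (q x (f k x - f0 x) (f k x - f0 x)) \<partial>M) \<longlongrightarrow> 0) F"
proof -
 have "\<forall>\<^sub>F k in F. (\<integral>\<^sup>+x. ennreal (q x (f k x - f0 x) (f k x - f0 x)) \<partial>M) = ennreal (ip (\<lambda>x. f k x - f0 x) (\<lambda>x. f k x - f0 x))"
  using f by eventually_elim (rule nn_integral_eq_ip[OF sqi_diff[OF _ f0]])
 from tendsto_cong[OF this, of 0] show ?thesis
  using tendsto_ennreal_iff[of "\<lambda>k. ip (\<lambda>x. f k x - f0 x) (\<lambda>x. f k x - f0 x)" F 0]
  unfolding conv_iff_ip[OF f f0] by (simp add: ip_nonneg)
qed

lemmas conv_nn = conv_nn_iff[THEN iffD2]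

lemma conv_nnI:
 assumes f: "\<And>k. sqi (f k)" and f0: "f0 \<in> borel_measurable M"
  and l: "((\<lambda>k. \<integral>\<^sup>+x. ennreal (q x (f k x - f0 x) (f k x - f0 x)) \<partial>M) \<longlongrightarrow> 0) F" and F: "F \<noteq> bot"
 shows "conv f f0 F"
proof (rule conv_nn[OF always_eventually _ l])
 have "\<forall>\<^sub>F k in F. (\<integral>\<^sup>+x. ennreal (q x (f k x - f0 x) (f k x - f0 x)) \<partial>M) < \<infinity>"
  by (rule order_tendstoD(2)[OF l]) simp
 then obtain k where "(\<integral>\<^sup>+x. ennreal (q x (f k x - f0 x) (f k x - f0 x)) \<partial>M) < \<infinity>"
  using F eventually_happens by blast
 then show "sqi f0" by (rule sqi_eventually_finite[OF f0 f])
qed (use f in blast)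

end


section \<open>Continuously differentiable functions on open sets\<close>

definition C1_on :: "(real^'n) set \<Rightarrow> (real^'n \<Rightarrow> 'b::real_normed_vector) \<Rightarrow> bool" where
 "C1_on S f \<longleftrightarrow> (\<forall>x\<in>S. f differentiable (at x)) \<and> (\<forall>i. continuous_on S (partial_deriv i f))"

lemma Ck_on_imp_C1_on:
 fixes f :: "real^'n \<Rightarrow> 'b::real_normed_vector"
 assumes "Ck_on (Suc k) S f" "open S"
 shows "C1_on S f"
proof -
 have cont: "Ck_on k S g \<Longrightarrow> continuous_on S g" for k and g :: "real^'n \<Rightarrow> 'b"
  by (cases k) (auto intro!: differentiable_imp_continuous_on
    simp: differentiable_on_eq_differentiable_at assms(2))
 then show ?thesis using assms by (auto simp: C1_on_def)
qed

lemma partial_deriv_eq: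
 "(f has_derivative f') (at x) \<Longrightarrow> partial_deriv i f x = f' (axis i 1)"
 unfolding partial_deriv_def using frechet_derivative_at by metis

lemma C1_onI:
 assumes "\<And>x. x \<in> S \<Longrightarrow> (f has_derivative f' x) (at x)"
  and "\<And>i. continuous_on S (\<lambda>x. f' x (axis i 1))"
 shows "C1_on S f"
 unfolding C1_on_def
proof (intro conjI ballI allI)
 fix x assume "x \<in> S" then show "f differentiable (at x)"
  using assms(1) by (auto simp: differentiable_def)
next
 fix i show "continuous_on S (partial_deriv i f)"
  using assms(2)[of i] by (rule continuous_on_eq) (simp add: partial_deriv_eq[OF assms(1)])
qed

lemma linear_axis_expansion:
 fixes f' :: "real^'n \<Rightarrow> 'b::real_vector"
 assumes "linear f'"
 shows "f' v = (\<Sum>i\<in>UNIV. v $ i *\<^sub>R f' (axis i 1))"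
proof -
 have "f' v = f' (\<Sum>i\<in>UNIV. v $ i *\<^sub>R axis i 1)"
  by (subst basis_expansion[symmetric, of v]) (simp add: scalar_mult_eq_scaleR)
 then show ?thesis using assms by (simp add: linear_sum linear_scale)
qed

lemma has_derivative_partials:
 fixes f :: "real^'n \<Rightarrow> 'b::real_normed_vector"
 assumes "f differentiable (at x)"
 shows "(f has_derivative (\<lambda>v. \<Sum>i\<in>UNIV. v $ i *\<^sub>R partial_deriv i f x)) (at x)"
proof -
 have d: "(f has_derivative frechet_derivative f (at x)) (at x)"
  using assms by (simp add: frechet_derivative_works)
 have "frechet_derivative f (at x) = (\<lambda>v. \<Sum>i\<in>UNIV. v $ i *\<^sub>R partial_deriv i f x)"
  unfolding partial_deriv_def
  by (rule ext) (rule linear_axis_expansion, rule has_derivative_linear[OF d])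
 then show ?thesis using d by simp
qed

lemma C1_on_differentiable: "C1_on S f \<Longrightarrow> x \<in> S \<Longrightarrow> f differentiable (at x)"
 by (simp add: C1_on_def)

lemma C1_on_partial: "C1_on S f \<Longrightarrow> continuous_on S (partial_deriv i f)"
 by (simp add: C1_on_def)

lemma C1_on_deriv:
 "C1_on S f \<Longrightarrow> x \<in> S \<Longrightarrow> (f has_derivative (\<lambda>v. \<Sum>i\<in>UNIV. v $ i *\<^sub>R partial_deriv i f x)) (at x)"
 by (simp add: C1_on_def has_derivative_partials)

lemma C1_on_line:
 assumes "C1_on S f" "x + s *\<^sub>R v \<in> S"
 shows "((\<lambda>s. f (x + s *\<^sub>R v)) has_vector_derivative (\<Sum>i\<in>UNIV. v $ i *\<^sub>R partial_deriv i f (x + s *\<^sub>R v))) (at s within T)"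
proof -
 have d: "((\<lambda>s. x + s *\<^sub>R v) has_derivative (\<lambda>s. s *\<^sub>R v)) (at s within T)"
  by (auto intro!: derivative_eq_intros)
 from has_derivative_compose[OF d C1_on_deriv[OF assms]] show ?thesis
  by (simp add: has_vector_derivative_def scaleR_sum_right)
qed

lemma C1_on_continuous: "C1_on S f \<Longrightarrow> continuous_on S f"
 by (meson C1_on_differentiable continuous_at_imp_continuous_on differentiable_imp_continuous_within)

lemma C1_on_subset: "C1_on S f \<Longrightarrow> T \<subseteq> S \<Longrightarrow> C1_on T f"
 unfolding C1_on_def by (blast intro: continuous_on_subset)

lemma C1_on_cong_open:
 assumes "C1_on S f" "open S" "\<And>x. x \<in> S \<Longrightarrow> f x = g x"
 shows "C1_on S g"
proof (rule C1_onI)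
 fix x assume x: "x \<in> S"
 show "(g has_derivative (\<lambda>v. \<Sum>i\<in>UNIV. v $ i *\<^sub>R partial_deriv i f x)) (at x)"
  by (rule has_derivative_transform_within_open[OF C1_on_deriv[OF assms(1) x] assms(2) x assms(3)])
next
 fix i
 have "continuous_on S (partial_deriv i f)" using assms by (simp add: C1_on_def)
 then show "continuous_on S (\<lambda>x. \<Sum>ia\<in>UNIV. axis i 1 $ ia *\<^sub>R partial_deriv ia f x)"
  by (simp add: axis_def if_distrib[of "\<lambda>c. c *\<^sub>R _"] cong: if_cong)
qed

lemma partial_deriv_cong_open:
 assumes "open S" "x \<in> S" "\<And>x. x \<in> S \<Longrightarrow> f x = g x"
 shows "partial_deriv i f x = partial_deriv i g x"
proof -
 have "(f has_derivative F) (at x) \<longleftrightarrow> (g has_derivative F) (at x)" for F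
  using has_derivative_transform_within_open[OF _ assms(1,2), of f F UNIV g]
   has_derivative_transform_within_open[OF _ assms(1,2), of g F UNIV f] assms(3) by auto
 then show ?thesis by (simp add: partial_deriv_def frechet_derivative_def)
qed

lemma C1_on_Un:
 assumes "C1_on S f" "C1_on T f" "open S" "open T"
 shows "C1_on (S \<union> T) f"
 using assms unfolding C1_on_def by (auto intro: continuous_on_open_Un)

lemma C1_on_const: "C1_on S (\<lambda>x. c)"
 by (rule C1_onI[where f' = "\<lambda>_ _. 0"]) auto

lemma C1_on_nth: "C1_on S (\<lambda>x. x $ i)"
 by (rule C1_onI[where f' = "\<lambda>_ v. v $ i"])
  (auto intro: bounded_linear_imp_has_derivative bounded_linear_vec_nth)

lemma C1_on_bilinear:
 assumes "bounded_bilinear b" and f: "C1_on S f" and g: "C1_on S g"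
 shows "C1_on S (\<lambda>x. b (f x) (g x))"
proof -
 interpret bounded_bilinear b by fact
 show ?thesis
 proof (rule C1_onI)
  fix x assume x: "x \<in> S"
  show "((\<lambda>x. b (f x) (g x)) has_derivative
   (\<lambda>v. b (f x) (\<Sum>i\<in>UNIV. v $ i *\<^sub>R partial_deriv i g x) + b (\<Sum>i\<in>UNIV. v $ i *\<^sub>R partial_deriv i f x) (g x))) (at x)"
   using FDERIV[OF C1_on_deriv[OF f x] C1_on_deriv[OF g x]] .
 next
  fix i
  show "continuous_on S (\<lambda>x. b (f x) (\<Sum>ia\<in>UNIV. axis i 1 $ ia *\<^sub>R partial_deriv ia g x) +
        b (\<Sum>ia\<in>UNIV. axis i 1 $ ia *\<^sub>R partial_deriv ia f x) (g x))"
   by (intro continuous_intros continuous_on C1_on_continuous[OF f] C1_on_continuous[OF g] C1_on_partial[OF f] C1_on_partial[OF g])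
 qed
qed

lemma partial_deriv_bilinear:
 assumes "bounded_bilinear b" and "f differentiable (at x)" "g differentiable (at x)"
 shows "partial_deriv i (\<lambda>x. b (f x) (g x)) x = b (f x) (partial_deriv i g x) + b (partial_deriv i f x) (g x)"
proof -
 interpret bounded_bilinear b by fact
 show ?thesis unfolding partial_deriv_def
  by (subst frechet_derivative_at[OF FDERIV[OF assms(2,3)[THEN frechet_derivative_works[THEN iffD1]]], symmetric]) simp
qed

lemmas C1_on_scaleR = C1_on_bilinear[OF bounded_bilinear_scaleR]
lemmas C1_on_mult = C1_on_bilinear[OF bounded_bilinear_mult]
lemmas C1_on_inner = C1_on_bilinear[OF bounded_bilinear_inner]
lemmas partial_deriv_scaleR = partial_deriv_bilinear[OF bounded_bilinear_scaleR]
lemmas partial_deriv_inner = partial_deriv_bilinear[OF bounded_bilinear_inner]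

lemma C1_on_add:
 assumes f: "C1_on S f" and g: "C1_on S g"
 shows "C1_on S (\<lambda>x. f x + g x)"
 by (rule C1_onI[OF has_derivative_add[OF C1_on_deriv[OF f] C1_on_deriv[OF g]]])
  (auto intro!: continuous_intros C1_on_partial[OF f] C1_on_partial[OF g])

lemma partial_deriv_add:
 "f differentiable (at x) \<Longrightarrow> g differentiable (at x) \<Longrightarrow>
  partial_deriv i (\<lambda>x. f x + g x) x = partial_deriv i f x + partial_deriv i g x"
 by (subst partial_deriv_eq[OF has_derivative_add[OF has_derivative_partials has_derivative_partials]])
   (auto simp: axis_def if_distrib[of "\<lambda>c. c *\<^sub>R _"] cong: if_cong)

lemma partial_deriv_cmult:
 assumes "f differentiable (at x)"
 shows "partial_deriv i (\<lambda>x. c *\<^sub>R f x) x = c *\<^sub>R partial_deriv i f x"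
 by (subst partial_deriv_eq[OF has_derivative_scaleR_right[OF has_derivative_partials[OF assms]]])
   (auto simp: axis_def if_distrib[of "\<lambda>c. c *\<^sub>R _"] cong: if_cong)

lemma partial_deriv_linear:
 assumes "bounded_linear h" "f differentiable (at x)"
 shows "partial_deriv i (\<lambda>x. h (f x)) x = h (partial_deriv i f x)"
 by (subst partial_deriv_eq[OF bounded_linear.has_derivative[OF assms(1) has_derivative_partials[OF assms(2)]]])
   (auto simp: axis_def if_distrib[of "\<lambda>c. c *\<^sub>R _"] cong: if_cong)

lemma C1_on_linear:
 assumes "bounded_linear h" and f: "C1_on S f"
 shows "C1_on S (\<lambda>x. h (f x))"
proof (rule C1_onI[OF bounded_linear.has_derivative[OF assms(1) C1_on_deriv[OF f]]])
 fix i
 show "continuous_on S (\<lambda>x. h (\<Sum>ia\<in>UNIV. axis i 1 $ ia *\<^sub>R partial_deriv ia f x))"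
  by (intro bounded_linear.continuous_on[OF assms(1)] continuous_intros C1_on_partial[OF f])
qed auto

lemma C1_on_minus: "C1_on S f \<Longrightarrow> C1_on S (\<lambda>x. - f x)"
 by (rule C1_on_linear) (auto intro: bounded_linear_minus bounded_linear_ident)

lemma C1_on_diff: "C1_on S f \<Longrightarrow> C1_on S g \<Longrightarrow> C1_on S (\<lambda>x. f x - g x)"
 using C1_on_add[OF _ C1_on_minus, of S f g] by simp

lemma C1_on_sum:
 "(\<And>k. k \<in> K \<Longrightarrow> C1_on S (f k)) \<Longrightarrow> C1_on S (\<lambda>x. \<Sum>k\<in>K. f k x)"
 by (induction K rule: infinite_finite_induct) (auto intro: C1_on_const C1_on_add)

lemma C1_on_prod:
 fixes f :: "'k \<Rightarrow> real^'n \<Rightarrow> real"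
 shows "(\<And>k. k \<in> K \<Longrightarrow> C1_on S (f k)) \<Longrightarrow> C1_on S (\<lambda>x. \<Prod>k\<in>K. f k x)"
 by (induction K rule: infinite_finite_induct) (auto intro: C1_on_const C1_on_mult)

lemma C1_on_compose_real:
 fixes f :: "real^'n \<Rightarrow> real" and g :: "real \<Rightarrow> 'b::real_normed_vector"
 assumes f: "C1_on S f" and g: "\<And>x. x \<in> S \<Longrightarrow> (g has_vector_derivative g' (f x)) (at (f x))"
  and c: "continuous_on (f ` S) g'"
 shows "C1_on S (\<lambda>x. g (f x))"
proof (rule C1_onI)
 fix x assume x: "x \<in> S"
 show "((\<lambda>x. g (f x)) has_derivative (\<lambda>v. (\<Sum>i\<in>UNIV. v $ i *\<^sub>R partial_deriv i f x) *\<^sub>R g' (f x))) (at x)"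
  using has_derivative_compose[OF C1_on_deriv[OF f x] g[OF x, unfolded has_vector_derivative_def]] .
next
 fix i
 show "continuous_on S (\<lambda>x. (\<Sum>ia\<in>UNIV. axis i 1 $ ia *\<^sub>R partial_deriv ia f x) *\<^sub>R g' (f x))"
  by (intro continuous_intros C1_on_partial[OF f] continuous_on_compose2[OF c C1_on_continuous[OF f]]) auto
qed

lemma C1_on_compose_map:
 fixes f :: "real^'m \<Rightarrow> 'b::real_normed_vector" and h :: "real^'n \<Rightarrow> real^'m"
 assumes f: "C1_on T f" and h: "\<And>j. C1_on S (\<lambda>x. h x $ j)" and im: "h ` S \<subseteq> T"
 shows "C1_on S (\<lambda>x. f (h x))" (is ?th1)
  and "x \<in> S \<Longrightarrow> partial_deriv i (\<lambda>x. f (h x)) x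
   = (\<Sum>j\<in>UNIV. partial_deriv i (\<lambda>x. h x $ j) x *\<^sub>R partial_deriv j f (h x))"
proof -
 have dh: "(h has_derivative (\<lambda>v. \<chi> j. \<Sum>i\<in>UNIV. v $ i *\<^sub>R partial_deriv i (\<lambda>x. h x $ j) x)) (at x)" if "x \<in> S" for x
  using C1_on_deriv[OF h that]
  by (subst has_derivative_componentwise_within) (auto simp: Basis_vec_def inner_axis)
 have d: "((\<lambda>x. f (h x)) has_derivative
   (\<lambda>v. \<Sum>j\<in>UNIV. (\<Sum>i\<in>UNIV. v $ i *\<^sub>R partial_deriv i (\<lambda>x. h x $ j) x) *\<^sub>R partial_deriv j f (h x))) (at x)" if "x \<in> S" for x
  using has_derivative_compose[OF dh[OF that] C1_on_deriv[OF f]] im that by auto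
 have ax: "(\<Sum>j\<in>UNIV. (\<Sum>ia\<in>UNIV. axis i 1 $ ia *\<^sub>R partial_deriv ia (\<lambda>x. h x $ j) x) *\<^sub>R partial_deriv j f (h x))
   = (\<Sum>j\<in>UNIV. partial_deriv i (\<lambda>x. h x $ j) x *\<^sub>R partial_deriv j f (h x))" for i x
  by (auto simp: axis_def if_distrib[of "\<lambda>c. c * _"] cong: if_cong)
 have ch: "continuous_on S h"
  using dh by (meson continuous_at_imp_continuous_on has_derivative_continuous)
 show ?th1
  by (rule C1_onI[OF d], simp, unfold ax)
   (intro continuous_intros C1_on_partial[OF h] continuous_on_compose2[OF C1_on_partial[OF f] ch im])
 show "x \<in> S \<Longrightarrow> partial_deriv i (\<lambda>x. f (h x)) x
   = (\<Sum>j\<in>UNIV. partial_deriv i (\<lambda>x. h x $ j) x *\<^sub>R partial_deriv j f (h x))"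
  using partial_deriv_eq[OF d] ax by simp
qed

lemma C1_on_inverse:
 fixes f :: "real^'n \<Rightarrow> real"
 assumes "C1_on S f" "\<And>x. x \<in> S \<Longrightarrow> f x \<noteq> 0"
 shows "C1_on S (\<lambda>x. inverse (f x))"
 by (rule C1_on_compose_real[OF assms(1), where g' = "\<lambda>y. - (inverse y * inverse y)"])
   (use assms(2) in "auto intro!: DERIV_inverse' continuous_intros derivative_eq_intros simp: has_real_derivative_iff_has_vector_derivative[symmetric]")

lemma C1_on_divide:
 fixes f g :: "real^'n \<Rightarrow> real"
 assumes "C1_on S f" "C1_on S g" "\<And>x. x \<in> S \<Longrightarrow> g x \<noteq> 0"
 shows "C1_on S (\<lambda>x. f x / g x)"
 unfolding divide_inverse by (intro C1_on_mult C1_on_inverse assms)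

lemma C1_on_powr:
 fixes f :: "real^'n \<Rightarrow> real"
 assumes "C1_on S f" "\<And>x. x \<in> S \<Longrightarrow> f x > 0"
 shows "C1_on S (\<lambda>x. f x powr a)"
 by (rule C1_on_compose_real[OF assms(1), where g' = "\<lambda>y. a * y powr (a - 1)"])
   (use assms(2) in "force intro!: continuous_intros derivative_eq_intros simp: has_real_derivative_iff_has_vector_derivative[symmetric]")+

lemma C1_on_sqrt:
 fixes f :: "real^'n \<Rightarrow> real"
 assumes "C1_on S f" "\<And>x. x \<in> S \<Longrightarrow> f x > 0"
 shows "C1_on S (\<lambda>x. sqrt (f x))"
 by (rule C1_on_compose_real[OF assms(1), where g' = "\<lambda>y. inverse (sqrt y) / 2"])
   (use assms(2) in "force intro!: continuous_intros DERIV_real_sqrt simp: has_real_derivative_iff_has_vector_derivative[symmetric]")+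

lemma has_derivative_norm_vec:
 fixes x :: "real^'n"
 assumes "x \<noteq> 0"
 shows "(norm has_derivative (\<lambda>v. v \<bullet> x / norm x)) (at x)"
 using has_derivative_norm[OF assms] by (simp add: sgn_div_norm divide_inverse mult.commute inner_commute)


lemma C1_on_norm: "C1_on (- {0 :: real^'n}) norm"
 by (rule C1_onI[OF has_derivative_norm_vec]) (auto intro!: continuous_intros)

lemma C1_on_det:
 fixes A :: "real^'n \<Rightarrow> real^'m^'m"
 assumes "\<And>i j. C1_on S (\<lambda>x. A x $ i $ j)"
 shows "C1_on S (\<lambda>x. det (A x))"
 unfolding det_def by (intro C1_on_sum C1_on_mult C1_on_const C1_on_prod assms)

subsection \<open>Inverse matrices\<close>

lemma matrix_inv_works:
 fixes A :: "real^'n^'n"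
 assumes "det A \<noteq> 0"
 shows "A ** matrix_inv A = mat 1" "matrix_inv A ** A = mat 1"
proof -
 have "\<exists>B. A ** B = mat 1 \<and> B ** A = mat 1"
  using assms by (simp add: invertible_det_nz[symmetric] invertible_def)
 then have "A ** matrix_inv A = mat 1 \<and> matrix_inv A ** A = mat 1"
  unfolding matrix_inv_def by (rule someI_ex)
 then show "A ** matrix_inv A = mat 1" "matrix_inv A ** A = mat 1" by auto
qed

text \<open>Cramer's rule shows that the entries of the inverse are as regular as those of the matrix.\<close>

lemma matrix_inv_cramer:
 fixes A :: "real^'n^'n"
 assumes "det A \<noteq> 0"
 shows "matrix_inv A $ k $ l = det (\<chi> i j. if j = k then axis l 1 $ i else A $ i $ j) / det A"
proof -
 have "A *v (matrix_inv A *v axis l 1) = axis l 1"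
  by (simp add: matrix_vector_mul_assoc matrix_inv_works[OF assms])
 then have "matrix_inv A *v axis l 1 = (\<chi> k. det (\<chi> i j. if j = k then axis l 1 $ i else A $ i $ j) / det A)"
  using cramer[OF assms] by blast
 then have "(matrix_inv A *v axis l 1) $ k = det (\<chi> i j. if j = k then axis l 1 $ i else A $ i $ j) / det A"
  by simp
 then show ?thesis
  by (simp add: matrix_vector_mult_def axis_def if_distrib[of "\<lambda>c. _ * c"] cong: if_cong)
qed

lemma C1_on_matrix_inv:
 fixes A :: "real^'n \<Rightarrow> real^'m^'m"
 assumes "\<And>i j. C1_on S (\<lambda>x. A x $ i $ j)" and "\<And>x. det (A x) \<noteq> 0"
 shows "C1_on S (\<lambda>x. matrix_inv (A x) $ k $ l)"
proof -
 have "C1_on S (\<lambda>x. if j = k then axis l 1 $ i else A x $ i $ j)" for i j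
  by (cases "j = k") (auto intro: C1_on_const assms)
 then show ?thesis
  unfolding matrix_inv_cramer[OF assms(2)]
  by (intro C1_on_divide C1_on_det) (auto simp: assms)
qed


section \<open>Compactly supported test functions\<close>

definition C1c :: "(real^'n) set \<Rightarrow> (real^'n \<Rightarrow> 'b::real_normed_vector) \<Rightarrow> bool" where
 "C1c \<Omega> f \<longleftrightarrow> C1_on UNIV f \<and> (\<exists>K. compact K \<and> K \<subseteq> \<Omega> \<and> (\<forall>x. x \<notin> K \<longrightarrow> f x = 0))"

lemma C1cE:
 assumes "C1c \<Omega> f"
 obtains K where "compact K" "K \<subseteq> \<Omega>" "\<And>x. x \<notin> K \<Longrightarrow> f x = 0" "\<And>i x. x \<notin> K \<Longrightarrow> partial_deriv i f x = 0"
proof -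
 obtain K where K: "compact K" "K \<subseteq> \<Omega>" "\<And>x. x \<notin> K \<Longrightarrow> f x = 0"
  using assms by (auto simp: C1c_def)
 have "partial_deriv i f x = 0" if "x \<notin> K" for i x
 proof -
  have "partial_deriv i f x = partial_deriv i (\<lambda>_. 0) x"
   by (rule partial_deriv_cong_open[of "- K"]) (use K that in "auto simp: compact_imp_closed open_Compl")
  also have "\<dots> = 0" by (rule partial_deriv_eq) simp
  finally show ?thesis .
 qed
 with K show ?thesis using that by blast
qed

lemma C1c_C1: "C1c \<Omega> f \<Longrightarrow> C1_on S f"
 by (auto simp: C1c_def intro: C1_on_subset)

lemma C1c_differentiable: "C1c \<Omega> f \<Longrightarrow> f differentiable (at x)"
 by (auto simp: C1c_def C1_on_def)

lemma C1c_continuous: "C1c \<Omega> f \<Longrightarrow> continuous_on S f"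
 by (auto intro: C1_on_continuous C1c_C1)

lemma C1c_continuous_partial: "C1c \<Omega> f \<Longrightarrow> continuous_on S (partial_deriv i f)"
 by (auto intro: C1_on_partial C1c_C1)

lemma C1cI:
 assumes "open \<Omega>" "C1_on \<Omega> f" "compact K" "K \<subseteq> \<Omega>" "\<And>x. x \<notin> K \<Longrightarrow> f x = 0"
 shows "C1c \<Omega> f"
proof -
 have "C1_on (- K) f"
  by (rule C1_on_cong_open[OF C1_on_const[of _ 0]]) (use assms in "auto simp: compact_imp_closed open_Compl")
 then have "C1_on (\<Omega> \<union> - K) f"
  by (intro C1_on_Un) (use assms in "auto simp: compact_imp_closed open_Compl")
 moreover have "\<Omega> \<union> - K = UNIV" using assms by auto
 ultimately show ?thesis using assms by (auto simp: C1c_def)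
qed

lemma C1c_bilinear:
 assumes b: "bounded_bilinear b" and \<Omega>: "open \<Omega>" and f: "C1_on \<Omega> f" and g: "C1c \<Omega> g"
 shows "C1c \<Omega> (\<lambda>x. b (f x) (g x))"
proof -
 obtain K where K: "compact K" "K \<subseteq> \<Omega>" "\<And>x. x \<notin> K \<Longrightarrow> g x = 0"
  using C1cE[OF g] by metis
 show ?thesis
  by (rule C1cI[OF \<Omega> C1_on_bilinear[OF b f C1c_C1[OF g]] K(1,2)])
   (use K in "auto simp: bounded_bilinear.zero_right[OF b]")
qed

lemmas C1c_scaleR = C1c_bilinear[OF bounded_bilinear_scaleR]
lemmas C1c_inner = C1c_bilinear[OF bounded_bilinear_inner]

lemma C1c_add:
 assumes "C1c \<Omega> f" "C1c \<Omega> g"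
 shows "C1c \<Omega> (\<lambda>x. f x + g x)"
proof -
 obtain K where K: "compact K" "K \<subseteq> \<Omega>" "\<And>x. x \<notin> K \<Longrightarrow> f x = 0" using C1cE[OF assms(1)] by metis
 obtain L where L: "compact L" "L \<subseteq> \<Omega>" "\<And>x. x \<notin> L \<Longrightarrow> g x = 0" using C1cE[OF assms(2)] by metis
 have "C1_on UNIV (\<lambda>x. f x + g x)" using assms by (auto simp: C1c_def intro: C1_on_add)
 moreover have "compact (K \<union> L)" "K \<union> L \<subseteq> \<Omega>" "\<forall>x. x \<notin> K \<union> L \<longrightarrow> f x + g x = 0"
  using K L by (auto intro: compact_Un)
 ultimately show ?thesis unfolding C1c_def by blast
qed

lemma C1c_linear:
 assumes "bounded_linear h" "C1c \<Omega> f"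
 shows "C1c \<Omega> (\<lambda>x. h (f x))"
proof -
 have "h 0 = 0" using assms(1) by (simp add: linear_simps)
 then show ?thesis using assms unfolding C1c_def by (metis C1_on_linear)
qed


lemma compact_support_bounds:
 fixes f :: "real^'n \<Rightarrow> 'b::real_normed_vector"
 assumes "continuous_on UNIV f" "compact K" "\<And>x. x \<notin> K \<Longrightarrow> f x = 0"
 obtains B where "B \<ge> 0" "\<And>x. norm (f x) \<le> B"
proof -
 have "compact (f ` K)" by (rule compact_continuous_image[OF continuous_on_subset[OF assms(1)] assms(2)]) auto
 then obtain B where B: "\<And>x. x \<in> K \<Longrightarrow> norm (f x) \<le> B"
  using compact_imp_bounded bounded_iff by (metis image_eqI)
 have "norm (f x) \<le> max B 0" for x
  by (cases "x \<in> K") (use B assms(3) in "auto simp: le_max_iff_disj")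
 then show ?thesis using that[of "max B 0"] by auto
qed

lemma compact_support_integrable:
 fixes f :: "real^'n \<Rightarrow> 'b::euclidean_space"
 assumes "continuous_on UNIV f" "compact K" "\<And>x. x \<notin> K \<Longrightarrow> f x = 0"
 shows "integrable lborel f"
proof -
 obtain B where B: "B \<ge> 0" "\<And>x. norm (f x) \<le> B"
  using compact_support_bounds[OF assms] by blast
 show ?thesis
 proof (rule Bochner_Integration.integrable_bound)
  show "integrable lborel (\<lambda>x. B * indicator K x :: real)"
   by (intro integrable_mult_right integrable_real_indicator) (use assms(2) in "simp_all add: borel_compact emeasure_compact_finite[simplified]")
  show "f \<in> borel_measurable lborel" using assms(1) by (simp add: borel_measurable_continuous_onI)
  show "AE x in lborel. norm (f x) \<le> norm (B * indicator K x)"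
   by (rule AE_I2) (use B assms(3) in "auto simp: indicator_def")
 qed
qed

lemma vector_derivative_norm_bound:
 fixes f :: "real \<Rightarrow> 'b::real_normed_vector"
 assumes "\<And>s. s \<in> S \<Longrightarrow> (f has_vector_derivative f' s) (at s within S)"
  and "\<And>s. s \<in> S \<Longrightarrow> norm (f' s) \<le> B" and "convex S" "a \<in> S" "b \<in> S"
 shows "norm (f a - f b) \<le> B * norm (a - b)"
 using assms(1) unfolding has_vector_derivative_def
 by (rule differentiable_bound[OF assms(3) _ _ assms(4,5)])
  (auto intro!: onorm_le, metis assms(2) mult.commute mult_right_mono abs_ge_zero)

lemma has_vector_derivative_quotient:
 assumes "(f has_vector_derivative D) (at s)"
 shows "((\<lambda>h. (f (s + h) - f s) /\<^sub>R h) \<longlongrightarrow> D) (at 0)"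
proof -
 have "((\<lambda>h. norm (f (s + h) - f s - h *\<^sub>R D) / norm h) \<longlongrightarrow> 0) (at 0)"
  using assms by (simp add: has_vector_derivative_def has_derivative_at)
 moreover have "\<forall>\<^sub>F h in at 0. norm (f (s + h) - f s - h *\<^sub>R D) / norm h = norm ((f (s + h) - f s) /\<^sub>R h - D)"
  unfolding eventually_at_filter
 proof (rule always_eventually, intro allI impI)
  fix h :: real assume h: "h \<noteq> 0"
  have "(f (s + h) - f s) /\<^sub>R h - D = (f (s + h) - f s - h *\<^sub>R D) /\<^sub>R h"
   using h by (simp add: scaleR_diff_right)
  then show "norm (f (s + h) - f s - h *\<^sub>R D) / norm h = norm ((f (s + h) - f s) /\<^sub>R h - D)"
   by (simp add: divide_inverse mult.commute)
 qed
 ultimately have "((\<lambda>h. norm ((f (s + h) - f s) /\<^sub>R h - D)) \<longlongrightarrow> 0) (at 0)"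
  by (simp add: tendsto_cong)
 then show ?thesis by (simp add: tendsto_norm_zero_iff LIM_zero_iff)
qed

text \<open>
 The integral of a difference quotient vanishes by translation invariance, and the difference
 quotients converge boundedly on a fixed bounded set.
\<close>

lemma integral_partial_deriv_C1c:
 fixes f :: "real^'n \<Rightarrow> 'b::euclidean_space"
 assumes "C1c \<Omega> f"
 shows "(\<integral>x. partial_deriv i f x \<partial>lborel) = 0"
proof -
 obtain K where K: "compact K" "\<And>x. x \<notin> K \<Longrightarrow> f x = 0" "\<And>i x. x \<notin> K \<Longrightarrow> partial_deriv i f x = 0"
  using C1cE[OF assms] by metis
 obtain B where B: "B \<ge> 0" "\<And>x. norm (partial_deriv i f x) \<le> B"
  using compact_support_bounds[OF C1c_continuous_partial[OF assms] K(1)] K(3) by blast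
 obtain R where R: "\<And>x. x \<in> K \<Longrightarrow> norm x \<le> R"
  using compact_imp_bounded[OF K(1)] by (auto simp: bounded_iff)
 define e :: "real^'n" where "e = axis i 1"
 have ne: "norm e = 1" by (simp add: e_def)
 define t :: "nat \<Rightarrow> real" where "t k = 1 / (real k + 1)" for k
 have t: "t k > 0" "t k \<le> 1" for k by (auto simp: t_def)
 have tlim: "t \<longlonglongrightarrow> 0" unfolding t_def by (rule LIMSEQ_Suc[of "\<lambda>n. 1 / real n" 0, unfolded of_nat_Suc, simplified add.commute[of 1]]) (rule lim_1_over_n)
 have tat: "filterlim t (at 0) sequentially"
  using tlim t(1) by (simp add: filterlim_at less_imp_neq[THEN not_sym])
 have line: "((\<lambda>s. f (x + s *\<^sub>R e)) has_vector_derivative partial_deriv i f (x + s *\<^sub>R e)) (at s within S)" for x s S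
  using C1_on_line[OF C1c_C1[OF assms, of UNIV], of x s e S]
  by (simp add: e_def axis_def if_distrib[of "\<lambda>c. c *\<^sub>R _"] cong: if_cong)
 have fint: "integrable lborel f"
  by (rule compact_support_integrable[OF C1c_continuous[OF assms] K(1,2)])
 define F where "F k x = (f (x + t k *\<^sub>R e) - f x) /\<^sub>R t k" for k x
 have tr: "integrable lborel (\<lambda>x. f (x + a))" "(\<integral>x. f (x + a) \<partial>lborel) = (\<integral>x. f x \<partial>lborel)" for a
 proof -
  have m: "f \<in> borel_measurable borel" using fint by simp
  have e: "lborel = distr lborel borel (\<lambda>x. x + a)" using lborel_distr_plus[of a] by (simp add: add.commute[of _ a])
  show "integrable lborel (\<lambda>x. f (x + a))"
   using fint by (subst (asm) e) (subst (asm) integrable_distr_eq, auto simp: m)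
  show "(\<integral>x. f (x + a) \<partial>lborel) = (\<integral>x. f x \<partial>lborel)"
   by (subst (2) e) (subst integral_distr, auto simp: m)
 qed
 have Fint0: "(\<integral>x. F k x \<partial>lborel) = 0" for k
  unfolding F_def using fint tr by simp
 have lim: "(\<lambda>k. \<integral>x. F k x \<partial>lborel) \<longlonglongrightarrow> (\<integral>x. partial_deriv i f x \<partial>lborel)"
 proof (rule integral_dominated_convergence[where w = "\<lambda>x. B * indicator (cball 0 (R + 1)) x"])
  show "partial_deriv i f \<in> borel_measurable lborel"
   using C1c_continuous_partial[OF assms, of UNIV] by (simp add: borel_measurable_continuous_onI)
  show "F k \<in> borel_measurable lborel" for k
   unfolding F_def using fint tr(1)[of "t k *\<^sub>R e"] by (intro borel_measurable_scaleR borel_measurable_diff) auto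
  show "integrable lborel (\<lambda>x. B * indicator (cball 0 (R + 1)) (x :: real^'n))"
   by (intro integrable_mult_right integrable_real_indicator) (auto simp: emeasure_compact_finite[simplified])
  show "AE x in lborel. (\<lambda>k. F k x) \<longlonglongrightarrow> partial_deriv i f x"
  proof (rule AE_I2)
   fix x
   have "((\<lambda>s. (f (x + s *\<^sub>R e) - f x) /\<^sub>R s) \<longlongrightarrow> partial_deriv i f x) (at 0)"
    using has_vector_derivative_quotient[OF line[of x 0 UNIV]] by simp
   then show "(\<lambda>k. F k x) \<longlonglongrightarrow> partial_deriv i f x"
    unfolding F_def by (rule filterlim_compose[OF _ tat])
  qed
  show "AE x in lborel. norm (F k x) \<le> B * indicator (cball 0 (R + 1)) x" for k
  proof (rule AE_I2)
   fix x
   show "norm (F k x) \<le> B * indicator (cball 0 (R + 1)) x"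
   proof (cases "x \<in> cball 0 (R + 1)")
    case True
    have "norm (f (x + t k *\<^sub>R e) - f (x + 0 *\<^sub>R e)) \<le> B * norm (t k - 0)"
     by (rule vector_derivative_norm_bound[OF line, where S = UNIV]) (use B(2) in auto)
    moreover have "norm (F k x) = norm (f (x + t k *\<^sub>R e) - f x) / t k"
     using t[of k] by (simp add: F_def divide_inverse mult.commute)
    ultimately show ?thesis using True t[of k] by (simp add: pos_divide_le_eq)
   next
    case False
    have "norm (x + t k *\<^sub>R e) \<ge> norm x - t k"
     using norm_diff_ineq[of x "t k *\<^sub>R e"] ne t[of k] by simp
    then have "x + t k *\<^sub>R e \<notin> K" "x \<notin> K" using False R[of x] R[of "x + t k *\<^sub>R e"] t[of k] by auto
    then show ?thesis using False K(2) by (simp add: F_def)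
   qed
  qed
 qed
 then show ?thesis using Fint0 by (simp add: LIMSEQ_const_iff)
qed

subsection \<open>Bump functions on boxes\<close>

lemma has_derivative_pos_part_sq:
 "((\<lambda>y::real. (max 0 y)\<^sup>2) has_real_derivative 2 * max 0 y) (at y)"
proof -
 consider "y > 0" | "y < 0" | "y = 0" by linarith
 then show ?thesis
 proof cases
  case 1
  have "((\<lambda>y. y\<^sup>2) has_real_derivative 2 * y) (at y)" by (auto intro!: derivative_eq_intros)
  then have "((\<lambda>y. (max 0 y)\<^sup>2) has_real_derivative 2 * y) (at y)"
   by (rule has_field_derivative_transform_within_open[of _ _ _ "{0<..}"]) (use 1 in auto)
  then show ?thesis using 1 by simp
 next
  case 2
  have "((\<lambda>y. 0) has_real_derivative 0) (at y)" by simp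
  then have "((\<lambda>y. (max 0 y)\<^sup>2) has_real_derivative 0) (at y)"
   by (rule has_field_derivative_transform_within_open[of _ _ _ "{..<0}"]) (use 2 in auto)
  then show ?thesis using 2 by simp
 next
  case 3
  have "((\<lambda>h. ((max 0 (0 + h))\<^sup>2 - (max 0 0)\<^sup>2) / h) \<longlongrightarrow> 0) (at (0::real))"
  proof (rule Lim_null_comparison)
   show "\<forall>\<^sub>F h in at 0. norm (((max 0 (0 + h))\<^sup>2 - (max 0 0)\<^sup>2) / h) \<le> \<bar>h::real\<bar>"
    by (rule always_eventually) (auto simp: max_def power2_eq_square)
   show "((\<lambda>h::real. \<bar>h\<bar>) \<longlongrightarrow> 0) (at 0)" by (auto intro!: tendsto_eq_intros)
  qed
  then show ?thesis using 3 by (simp add: DERIV_def)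
 qed
qed

lemma C1_on_pos_part_sq:
 fixes f :: "real^'n \<Rightarrow> real"
 assumes "C1_on S f"
 shows "C1_on S (\<lambda>x. (max 0 (f x))\<^sup>2)"
 by (rule C1_on_compose_real[OF assms, where g' = "\<lambda>y. 2 * max 0 y"])
   (auto intro!: continuous_intros has_derivative_pos_part_sq simp: has_real_derivative_iff_has_vector_derivative[symmetric])

definition box_bump :: "real^'n \<Rightarrow> real^'n \<Rightarrow> real^'n \<Rightarrow> real" where
 "box_bump a b x = (\<Prod>i\<in>UNIV. (max 0 (x $ i - a $ i))\<^sup>2 * (max 0 (b $ i - x $ i))\<^sup>2)"

lemma box_bump_nonneg: "box_bump a b x \<ge> 0"
 unfolding box_bump_def by (rule prod_nonneg) auto

lemma box_bump_pos_iff: "box_bump a b x > 0 \<longleftrightarrow> x \<in> box a b"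
proof -
 have m: "max 0 t = 0 \<longleftrightarrow> t \<le> 0" for t :: real by (auto simp: max_def)
 have "box_bump a b x \<noteq> 0 \<longleftrightarrow> x \<in> box a b"
  unfolding box_bump_def mem_box_cart by (simp add: m not_le)
 then show ?thesis using box_bump_nonneg[of a b x] by auto
qed

lemma C1_on_box_bump: "C1_on S (box_bump a b)"
 unfolding box_bump_def
 by (intro C1_on_prod C1_on_mult C1_on_pos_part_sq C1_on_diff C1_on_nth C1_on_const)

text \<open>
 For a nonnegative bump \<open>b\<close>, the functions \<open>k b/(1 + k b)\<close> increase to the indicator of \<open>{b > 0}\<close>
 without losing smoothness.
\<close>

definition box_plateau :: "real^'n \<Rightarrow> real^'n \<Rightarrow> nat \<Rightarrow> real^'n \<Rightarrow> real" where
 "box_plateau a b k x = real k * box_bump a b x / (1 + real k * box_bump a b x)"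

lemma one_add_pos: "1 + real k * box_bump a b x > 0"
 using box_bump_nonneg[of a b x] by (simp add: add_pos_nonneg)

lemma box_plateau_C1c:
 assumes "open \<Omega>" "cbox a b \<subseteq> \<Omega>"
 shows "C1c \<Omega> (box_plateau a b k)"
proof (rule C1cI[OF assms(1) _ compact_cbox assms(2)])
 show "C1_on \<Omega> (box_plateau a b k)"
  unfolding box_plateau_def
  by (intro C1_on_divide C1_on_add C1_on_mult C1_on_const C1_on_box_bump) (use one_add_pos in "metis less_irrefl")
 fix x assume "x \<notin> cbox a b"
 then have "x \<notin> box a b" using box_subset_cbox by blast
 then have "box_bump a b x = 0" using box_bump_pos_iff[of a b x] box_bump_nonneg[of a b x] by auto
 then show "box_plateau a b k x = 0" by (simp add: box_plateau_def)
qed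

lemma box_plateau_range: "0 \<le> box_plateau a b k x" "box_plateau a b k x \<le> 1"
 using one_add_pos[of k a b x] box_bump_nonneg[of a b x] by (auto simp: box_plateau_def)


lemma box_plateau_mono: "k \<le> l \<Longrightarrow> box_plateau a b k x \<le> box_plateau a b l x"
 using one_add_pos[of k a b x] one_add_pos[of l a b x] box_bump_nonneg[of a b x]
 unfolding box_plateau_def by (simp add: field_simps mult_right_mono)

lemma box_plateau_tendsto: "(\<lambda>k. box_plateau a b k x) \<longlonglongrightarrow> indicator (box a b) x"
proof (cases "x \<in> box a b")
 case False
 then have "box_bump a b x = 0" using box_bump_pos_iff[of a b x] box_bump_nonneg[of a b x] by auto
 then show ?thesis using False by (simp add: box_plateau_def)
next
 case True
 then have p: "box_bump a b x > 0" using box_bump_pos_iff by blast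
 have "(\<lambda>k. 1 - inverse (1 + real k * box_bump a b x)) \<longlonglongrightarrow> 1 - 0"
 proof (intro tendsto_intros tendsto_inverse_0_at_top)
  show "filterlim (\<lambda>k. 1 + real k * box_bump a b x) at_top sequentially"
   by (intro filterlim_tendsto_add_at_top[OF tendsto_const]
     filterlim_at_top_mult_tendsto_pos[OF tendsto_const p filterlim_real_sequentially])
 qed
 moreover have "1 - inverse (1 + real k * box_bump a b x) = box_plateau a b k x" for k
  using one_add_pos[of k a b x] by (simp add: box_plateau_def field_simps)
 ultimately show ?thesis using True by simp
qed

text \<open>
 Test functions determine a measure on an open set: they increase to indicators of boxes, and
 the boxes form an intersection-stable generator.
\<close>

lemma measure_eq_on_Borel_by_test_functions:
 fixes A B :: "(real^'n) measure"
 assumes \<Omega>: "open \<Omega>" and sA: "sets A = sets borel" and sB: "sets B = sets borel"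
  and cA: "emeasure A (- \<Omega>) = 0" and cB: "emeasure B (- \<Omega>) = 0"
  and fin: "\<And>a b. cbox a b \<subseteq> \<Omega> \<Longrightarrow> emeasure A (cbox a b) < \<infinity>"
  and eq: "\<And>\<psi> :: real^'n \<Rightarrow> real. C1c \<Omega> \<psi> \<Longrightarrow> (\<And>x. 0 \<le> \<psi> x) \<Longrightarrow> (\<And>x. \<psi> x \<le> 1) \<Longrightarrow>
    (\<integral>\<^sup>+x. ennreal (\<psi> x) \<partial>A) = (\<integral>\<^sup>+x. ennreal (\<psi> x) \<partial>B)"
 shows "A = B"
proof -
 have box: "emeasure A (box a b) = emeasure B (box a b)" if "cbox a b \<subseteq> \<Omega>" for a b
 proof -
  have lim: "(\<integral>\<^sup>+x. (SUP k. ennreal (box_plateau a b k x)) \<partial>M) = emeasure M (box a b)"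
   if "sets M = sets borel" for M :: "(real^'n) measure"
  proof -
   have "(SUP k. ennreal (box_plateau a b k x)) = indicator (box a b) x" for x
   proof (rule SUP_Lim)
    show "incseq (\<lambda>k. ennreal (box_plateau a b k x))"
     by (auto simp: incseq_def intro!: ennreal_leI box_plateau_mono)
    show "(\<lambda>k. ennreal (box_plateau a b k x)) \<longlonglongrightarrow> indicator (box a b) x"
     using tendsto_ennrealI[OF box_plateau_tendsto[of a b x]] by (simp add: ennreal_indicator)
   qed
   then show ?thesis using that by simp
  qed
  have mono: "(\<integral>\<^sup>+x. (SUP k. ennreal (box_plateau a b k x)) \<partial>M) = (SUP k. \<integral>\<^sup>+x. ennreal (box_plateau a b k x) \<partial>M)"
   if "sets M = sets borel" for M :: "(real^'n) measure"
  proof (rule nn_integral_monotone_convergence_SUP)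
   show "incseq (\<lambda>k x. ennreal (box_plateau a b k x))"
    by (auto simp: incseq_def le_fun_def intro!: ennreal_leI box_plateau_mono)
   have "box_plateau a b k \<in> borel_measurable borel" for k
    by (intro borel_measurable_continuous_onI C1c_continuous[OF box_plateau_C1c[of UNIV]]) auto
   then show "(\<lambda>x. ennreal (box_plateau a b k x)) \<in> borel_measurable M" for k
    using measurable_cong_sets[OF that refl] by (metis measurable_compose measurable_ennreal)
  qed
  have "(\<integral>\<^sup>+x. ennreal (box_plateau a b k x) \<partial>A) = (\<integral>\<^sup>+x. ennreal (box_plateau a b k x) \<partial>B)" for k
   by (intro eq box_plateau_C1c \<Omega> that box_plateau_range)
  then show ?thesis using lim[OF sA] lim[OF sB] mono[OF sA] mono[OF sB] by simp
 qed
 let ?E = "{box a b |a b. cbox a b \<subseteq> \<Omega>}"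
 have "\<not> (1 < t \<and> t < 0)" "\<not> (1 \<le> t \<and> t \<le> 0)" for t :: real by linarith+
 then have "{} = box (1::real^'n) 0" "cbox (1::real^'n) 0 = {}"
  by (auto simp only: set_eq_iff mem_box_cart one_index zero_index)
 then have empty: "{} \<in> ?E" by blast
 have cover: "\<exists>D. countable D \<and> D \<subseteq> ?E \<and> \<Union>D = U" if U: "open U" "U \<subseteq> \<Omega>" for U
 proof -
  obtain D where D: "D \<subseteq> {X \<in> ?E. X \<subseteq> U}" "countable D" "\<Union>D = \<Union>{X \<in> ?E. X \<subseteq> U}"
   using Lindelof[of "{X \<in> ?E. X \<subseteq> U}"] open_box by blast
  have "U \<subseteq> \<Union>{X \<in> ?E. X \<subseteq> U}"
  proof
   fix x assume "x \<in> U"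
   then obtain a b where "cbox a b \<subseteq> U" "x \<in> box a b" using open_contains_cbox[OF U(1)] by metis
   then show "x \<in> \<Union>{X \<in> ?E. X \<subseteq> U}" using box_subset_cbox[of a b] U(2) by blast
  qed
  then have "\<Union>D = U" unfolding D(3) by (intro equalityI) auto
  moreover have "D \<subseteq> ?E" using D(1) by auto
  ultimately show ?thesis using D(2) by (intro exI[of _ D]) simp
 qed
 obtain D where D: "countable D" "D \<subseteq> ?E" "\<Union>D = \<Omega>" using cover[OF \<Omega> subset_refl] by (elim exE conjE)
 have gen: "sets (restrict_space M \<Omega>) = sigma_sets \<Omega> ?E" if "sets M = sets borel" for M :: "(real^'n) measure"
 proof -
  have "sets (restrict_space M \<Omega>) = (\<inter>) \<Omega> ` sigma_sets UNIV {S. open S}"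
   by (simp add: sets_restrict_space that borel_def)
  also have "\<dots> = sigma_sets \<Omega> ((\<inter>) \<Omega> ` {S. open S})"
   by (rule sigma_sets_Int) (use \<Omega> in auto)
  also have "\<dots> = sigma_sets \<Omega> ?E"
  proof (rule sigma_sets_eqI)
   show "X \<in> sigma_sets \<Omega> ?E" if "X \<in> (\<inter>) \<Omega> ` {S. open S}" for X
   proof -
    have "open X" "X \<subseteq> \<Omega>" using that \<Omega> by auto
    from cover[OF this] obtain C where C: "countable C" "C \<subseteq> ?E" "\<Union>C = X" by (elim exE conjE)
    show ?thesis unfolding C(3)[symmetric]
     by (rule sigma_sets_UNION[OF C(1)]) (use C(2) in "auto intro: sigma_sets.Basic")
   qed
   show "X \<in> sigma_sets \<Omega> ((\<inter>) \<Omega> ` {S. open S})" if X: "X \<in> ?E" for X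
   proof -
    have "open X" "X = \<Omega> \<inter> X" using X box_subset_cbox by blast+
    then show ?thesis by (intro sigma_sets.Basic) blast
   qed
  qed
  finally show ?thesis .
 qed
 show ?thesis
 proof (rule measure_eqI_restrict_generator[where E = ?E and \<Omega> = \<Omega> and A = "insert {} D"])
  show "Int_stable ?E"
  proof (rule Int_stableI)
   fix X Y assume X: "X \<in> ?E" and "Y \<in> ?E"
   then obtain a b c d where ab: "X = box a b" "cbox a b \<subseteq> \<Omega>" "Y = box c d" by blast
   obtain e f where ef: "X \<inter> Y = box e f" unfolding ab box_Int_box by blast
   show "X \<inter> Y \<in> ?E"
   proof (cases "box e f = {}")
    case False
    have "closure (box e f) \<subseteq> cbox a b"
     by (rule closure_minimal) (use ef ab box_subset_cbox[of a b] in auto)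
    then show ?thesis unfolding ef using ab(2) by (auto simp: closure_box[OF False])
   qed (use ef empty in simp)
  qed
  show "emeasure A X = emeasure B X" if "X \<in> ?E" for X using that box by blast
  show "?E \<subseteq> Pow \<Omega>" using box_subset_cbox by blast
  show "\<Omega> \<in> sets A" using \<Omega> sA by simp
  have "- \<Omega> \<in> null_sets A" "- \<Omega> \<in> null_sets B" using cA cB sA sB \<Omega> by (auto simp: null_sets_def)
  then show "AE x in A. x \<in> \<Omega>" "AE x in B. x \<in> \<Omega>" by (auto dest!: AE_not_in)
  show "emeasure A X \<noteq> \<infinity>" if X: "X \<in> insert {} D" for X
  proof -
   have "X \<in> ?E" using X D(2) empty by (elim insertE) auto
   then obtain a b where "X = box a b" "cbox a b \<subseteq> \<Omega>" by blast
   moreover from this have "emeasure A X \<le> emeasure A (cbox a b)" by (intro emeasure_mono) (auto simp: sA box_subset_cbox)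
   ultimately show ?thesis using fin[of a b] by (auto simp: top_unique)
  qed
 qed (use D empty gen sA sB in auto)
qed


section \<open>Matrices acting on complex vectors\<close>

text \<open>
 Gradients of complex functions are complex vectors, while the metric is real; the same definition
 applied to real vectors is matrix-vector multiplication.
\<close>

definition matrix_act :: "real^'n^'m \<Rightarrow> 'b::real_vector^'n \<Rightarrow> 'b^'m" where
 "matrix_act A X = (\<chi> i. \<Sum>j\<in>UNIV. A $ i $ j *\<^sub>R X $ j)"

lemma matrix_act_nth: "matrix_act A X $ i = (\<Sum>j\<in>UNIV. A $ i $ j *\<^sub>R X $ j)"
 by (simp add: matrix_act_def)

lemma matrix_act_add: "matrix_act A (X + Y) = matrix_act A X + matrix_act A Y"
 by (simp add: vec_eq_iff matrix_act_nth scaleR_add_right sum.distrib)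

lemma matrix_act_diff: "matrix_act A (X - Y) = matrix_act A X - matrix_act A Y"
 by (simp add: vec_eq_iff matrix_act_nth scaleR_diff_right sum_subtractf)

lemma matrix_act_scaleR: "matrix_act A (c *\<^sub>R X) = c *\<^sub>R matrix_act A X"
 by (simp add: vec_eq_iff matrix_act_nth scaleR_sum_right mult.commute)

lemma matrix_act_mult: "matrix_act A (matrix_act B X) = matrix_act (A ** B) X"
proof -
 have "(\<Sum>j\<in>UNIV. A $ i $ j *\<^sub>R (\<Sum>k\<in>UNIV. B $ j $ k *\<^sub>R X $ k))
   = (\<Sum>k\<in>UNIV. (\<Sum>j\<in>UNIV. A $ i $ j * B $ j $ k) *\<^sub>R X $ k)" for i
  unfolding scaleR_sum_right scaleR_sum_left scaleR_scaleR by (rule sum.swap)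
 then show ?thesis by (simp add: vec_eq_iff matrix_act_nth matrix_matrix_mult_def)
qed

lemma matrix_act_mat1 [simp]: "matrix_act (mat 1) X = X"
 by (simp add: vec_eq_iff matrix_act_nth mat_def if_distrib[of "\<lambda>c. c *\<^sub>R _"] cong: if_cong)

lemma g_inner_eq: "g_inner A X Y = X \<bullet> matrix_act A Y"
 by (simp add: g_inner_def inner_vec_def matrix_act_nth inner_sum_right)

lemma g_inner_transpose: "g_inner A X Y = matrix_act (transpose A) X \<bullet> Y"
 unfolding g_inner_def inner_vec_def matrix_act_nth transpose_def
 by (simp add: inner_sum_left) (rule sum.swap)

lemma matrix_act_real: "matrix_act A X = A *v X"
 by (simp add: vec_eq_iff matrix_act_nth matrix_vector_mult_def)

definition Re_vec :: "complex^'n \<Rightarrow> real^'n" where "Re_vec X = (\<chi> i. Re (X $ i))"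
definition Im_vec :: "complex^'n \<Rightarrow> real^'n" where "Im_vec X = (\<chi> i. Im (X $ i))"

lemma Re_Im_vec_nth [simp]: "Re_vec X $ i = Re (X $ i)" "Im_vec X $ i = Im (X $ i)"
 by (simp_all add: Re_vec_def Im_vec_def)

lemma g_inner_Re_Im:
 "g_inner A X Y = g_inner A (Re_vec X) (Re_vec Y) + g_inner A (Im_vec X) (Im_vec Y)"
 unfolding g_inner_def by (simp add: inner_complex_def distrib_left sum.distrib)


definition grad_vec :: "(real^'n \<Rightarrow> 'b) \<Rightarrow> real^'n \<Rightarrow> 'b::real_normed_vector^'n" where
 "grad_vec f x = (\<chi> i. partial_deriv i f x)"

lemma grad_vec_nth [simp]: "grad_vec f x $ i = partial_deriv i f x"
 by (simp add: grad_vec_def)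

lemma g_grad_eq: "g_grad G f x = matrix_act (matrix_inv (G x)) (grad_vec f x)"
 by (simp add: g_grad_def matrix_act_def)

lemma borel_measurable_vec_iff:
 fixes f :: "'a \<Rightarrow> 'b::euclidean_space^'n"
 shows "f \<in> borel_measurable M \<longleftrightarrow> (\<forall>i. (\<lambda>x. f x $ i) \<in> borel_measurable M)"
proof
 assume f: "f \<in> borel_measurable M"
 show "\<forall>i. (\<lambda>x. f x $ i) \<in> borel_measurable M"
  by (intro allI measurable_compose[OF f] borel_measurable_continuous_onI continuous_intros)
next
 assume f: "\<forall>i. (\<lambda>x. f x $ i) \<in> borel_measurable M"
 have "(\<lambda>x. f x $ i \<bullet> b) \<in> borel_measurable M" for i b
  by (intro borel_measurable_inner) (use f in auto)
 then show "f \<in> borel_measurable M"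
  by (subst borel_measurable_euclidean_space) (auto simp: Basis_vec_def inner_axis)
qed

section \<open>Integration on an open set with a Riemannian metric\<close>

locale riemannian_domain =
 fixes G :: "real^'n \<Rightarrow> real^'n^'n" and \<Omega> :: "(real^'n) set"
 assumes G_C1: "\<And>i j. C1_on UNIV (\<lambda>x. G x $ i $ j)"
  and G_sym: "\<And>x. transpose (G x) = G x"
  and G_pos: "\<And>x X. X \<noteq> 0 \<Longrightarrow> (G x *v X) \<bullet> X > 0"
  and open_\<Omega>: "open \<Omega>"
  and det_G_pos: "\<And>x. x \<in> \<Omega> \<Longrightarrow> det (G x) > 0"
begin

definition w :: "real^'n \<Rightarrow> real" where "w x = sqrt (det (G x))"

abbreviation "\<mu> \<equiv> g_vol G \<Omega>"

lemma det_G_nonzero: "det (G x) \<noteq> 0"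
proof -
 have "inj ((*v) (G x))"
 proof (rule injI)
  fix X Y assume "G x *v X = G x *v Y"
  then have "G x *v (X - Y) = 0" by (simp add: matrix_vector_mult_diff_distrib)
  then show "X = Y" using G_pos[of "X - Y" x] by auto
 qed
 then show ?thesis
  by (metis invertible_det_nz invertible_left_inverse matrix_left_invertible_injective)
qed

lemma G_inv: "G x ** matrix_inv (G x) = mat 1" "matrix_inv (G x) ** G x = mat 1"
 by (rule matrix_inv_works[OF det_G_nonzero])+

lemma act_G_inv [simp]: "matrix_act (G x) (matrix_act (matrix_inv (G x)) X) = X"
 "matrix_act (matrix_inv (G x)) (matrix_act (G x) X) = X"
 by (simp_all add: matrix_act_mult G_inv)


lemma Gi_sym: "transpose (matrix_inv (G x)) = matrix_inv (G x)"
proof -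
 have "transpose (matrix_inv (G x)) = transpose (matrix_inv (G x)) ** (G x ** matrix_inv (G x))"
  by (simp add: G_inv)
 also have "\<dots> = (transpose (matrix_inv (G x)) ** transpose (G x)) ** matrix_inv (G x)"
  by (simp add: G_sym matrix_mul_assoc)
 also have "\<dots> = matrix_inv (G x)"
  by (simp add: matrix_transpose_mul[symmetric] G_inv)
 finally show ?thesis .
qed

lemma g_inner_act: "g_inner (G x) X Y = matrix_act (G x) X \<bullet> Y"
 by (simp add: g_inner_transpose G_sym)

lemma g_inner_sym: "g_inner (G x) X Y = g_inner (G x) Y X"
 by (metis g_inner_act g_inner_eq inner_commute)

lemma g_inner_nonneg: "g_inner (G x) X X \<ge> 0" for X :: "complex^'n"
proof -
 have "g_inner (G x) Y Y \<ge> 0" for Y :: "real^'n"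
  using G_pos[of Y x] by (cases "Y = 0") (auto simp: g_inner_act matrix_act_real)
 then show ?thesis by (simp add: g_inner_Re_Im[of _ X])
qed

lemma Gi_inner_nonneg: "g_inner (matrix_inv (G x)) X X \<ge> 0" for X :: "complex^'n"
proof -
 have "g_inner (G x) (matrix_act (matrix_inv (G x)) X) (matrix_act (matrix_inv (G x)) X)
   = g_inner (matrix_inv (G x)) X X"
  by (simp add: g_inner_act g_inner_eq inner_commute)
 then show ?thesis using g_inner_nonneg by metis
qed

lemma g_inner_grad: "g_inner (G x) (g_grad G f x) Y = grad_vec f x \<bullet> Y"
 by (simp add: g_grad_eq g_inner_act)

lemma Gi_C1: "C1_on S (\<lambda>x. matrix_inv (G x) $ k $ l)"
 by (rule C1_on_matrix_inv) (auto intro: C1_on_subset[OF G_C1] simp: det_G_nonzero)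

lemma det_G_C1: "C1_on UNIV (\<lambda>x. det (G x))"
 by (rule C1_on_det) (rule G_C1)

lemma w_C1: "C1_on \<Omega> w"
 unfolding w_def by (rule C1_on_sqrt) (auto intro: C1_on_subset[OF det_G_C1] dest: det_G_pos)

lemma w_pos: "x \<in> \<Omega> \<Longrightarrow> w x > 0"
 by (simp add: w_def det_G_pos)

lemma w_cont: "continuous_on UNIV w"
 unfolding w_def by (intro continuous_intros C1_on_continuous[OF det_G_C1])

lemma w_borel [measurable]: "w \<in> borel_measurable borel"
 by (rule borel_measurable_continuous_onI[OF w_cont])

lemma w_nonneg: "x \<in> \<Omega> \<Longrightarrow> w x \<ge> 0" using w_pos by force

lemma \<Omega>_sets [measurable]: "\<Omega> \<in> sets borel" using open_\<Omega> by simp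

lemma w_lebesgue: "w \<in> borel_measurable (lebesgue_on \<Omega>)"
 by (intro measurable_restrict_space1 measurable_completion) simp

lemma \<mu>_def': "\<mu> = density (lebesgue_on \<Omega>) (\<lambda>x. ennreal (w x))"
 by (simp add: g_vol_def w_def)

lemma space_\<mu> [simp]: "space \<mu> = \<Omega>"
 by (simp add: g_vol_def)

lemma measurable_\<mu>: "f \<in> borel_measurable \<mu> \<longleftrightarrow> f \<in> borel_measurable (lebesgue_on \<Omega>)"
 by (simp add: g_vol_def cong: measurable_cong_sets)

lemma measurable_\<mu>_cont: "continuous_on \<Omega> f \<Longrightarrow> f \<in> borel_measurable \<mu>"
 unfolding measurable_\<mu> by (rule continuous_imp_measurable_on_sets_lebesgue) (use open_\<Omega> in auto)

lemma measurable_\<mu>_borel: "f \<in> borel_measurable borel \<Longrightarrow> f \<in> borel_measurable \<mu>"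
 unfolding measurable_\<mu> by (intro measurable_restrict_space1 measurable_completion) simp

lemma nn_integral_\<mu>:
 assumes "f \<in> borel_measurable borel"
 shows "(\<integral>\<^sup>+x. f x \<partial>\<mu>) = (\<integral>\<^sup>+x. indicator \<Omega> x * (ennreal (w x) * f x) \<partial>lborel)"
proof -
 have f: "f \<in> borel_measurable (lebesgue_on \<Omega>)"
  using measurable_\<mu>_borel[OF assms] measurable_\<mu> by (simp add: g_vol_def)
 have "(\<integral>\<^sup>+x. f x \<partial>\<mu>) = (\<integral>\<^sup>+x. ennreal (w x) * f x \<partial>lebesgue_on \<Omega>)"
  unfolding \<mu>_def' by (rule nn_integral_density) (use f w_lebesgue in auto)
 also have "\<dots> = (\<integral>\<^sup>+x. ennreal (w x) * f x * indicator \<Omega> x \<partial>lebesgue)"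
  by (rule nn_integral_restrict_space) (use open_\<Omega> in auto)
 finally show ?thesis by (simp add: nn_integral_completion mult.commute)
qed

lemma integral_\<mu>:
 fixes f :: "real^'n \<Rightarrow> 'b::euclidean_space"
 assumes "f \<in> borel_measurable borel"
 shows "(\<integral>x. f x \<partial>\<mu>) = (\<integral>x. indicator \<Omega> x *\<^sub>R (w x *\<^sub>R f x) \<partial>lborel)" (is ?th1)
  and "integrable \<mu> f \<longleftrightarrow> integrable lborel (\<lambda>x. indicator \<Omega> x *\<^sub>R (w x *\<^sub>R f x))" (is ?th2)
proof -
 have f: "f \<in> borel_measurable (lebesgue_on \<Omega>)"
  using measurable_\<mu>_borel[OF assms] measurable_\<mu> by (simp add: g_vol_def)
 have nn: "AE x in lebesgue_on \<Omega>. 0 \<le> w x"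
  by (rule AE_I2) (simp add: w_nonneg)
 have b: "(\<lambda>x. indicator \<Omega> x *\<^sub>R (w x *\<^sub>R f x)) \<in> borel_measurable lborel" using assms by simp
 show ?th1
  unfolding \<mu>_def' integral_density[OF f w_lebesgue nn]
  by (subst integral_restrict_space) (use open_\<Omega> b in "auto simp: integral_completion")
 show ?th2
  unfolding \<mu>_def' integrable_density[OF f w_lebesgue nn]
  by (subst integrable_restrict_space) (use open_\<Omega> b in "auto simp: integrable_completion")
qed

lemma AE_\<mu>_iff: "(AE x in \<mu>. P x) \<longleftrightarrow> (AE x in lborel. x \<in> \<Omega> \<longrightarrow> P x)"
proof -
 have "(AE x in \<mu>. P x) \<longleftrightarrow> (AE x in lebesgue_on \<Omega>. 0 < ennreal (w x) \<longrightarrow> P x)"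
  unfolding \<mu>_def' by (rule AE_density) (use w_lebesgue in auto)
 also have "\<dots> \<longleftrightarrow> (AE x in lebesgue. x \<in> \<Omega> \<longrightarrow> 0 < ennreal (w x) \<longrightarrow> P x)"
  by (rule AE_restrict_space_iff) (use open_\<Omega> in auto)
 also have "\<dots> \<longleftrightarrow> (AE x in lebesgue. x \<in> \<Omega> \<longrightarrow> P x)"
  by (rule AE_cong) (auto simp: w_pos)
 finally show ?thesis by (simp add: AE_completion_iff)
qed

text \<open>
 The measure lives on Lebesgue sets, whereas composition with the flow and densities of measures
 require Borel functions.
\<close>

lemma borel_representative:
 fixes f :: "real^'n \<Rightarrow> 'b::euclidean_space"
 assumes "f \<in> borel_measurable \<mu>"
 obtains g where "g \<in> borel_measurable borel" "\<And>x. x \<notin> \<Omega> \<Longrightarrow> g x = 0" "AE x in \<mu>. f x = g x"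
proof -
 have f: "(\<lambda>x. indicator \<Omega> x *\<^sub>R f x) \<in> borel_measurable lebesgue"
  using assms unfolding measurable_\<mu> by (subst (asm) borel_measurable_restrict_space_iff) (use open_\<Omega> in auto)
 have "\<exists>g\<in>borel_measurable lborel. AE x in lborel. (indicator \<Omega> x *\<^sub>R f x) \<bullet> b = g x" for b
  by (rule completion_ex_borel_measurable_real) (intro borel_measurable_inner f, simp)
 then obtain g where g: "\<And>b. g b \<in> borel_measurable lborel" "\<And>b. AE x in lborel. (indicator \<Omega> x *\<^sub>R f x) \<bullet> b = g b x"
  by metis
 have ae: "AE x in lborel. \<forall>b\<in>Basis. (indicator \<Omega> x *\<^sub>R f x) \<bullet> b = g b x"
  using g(2) by (subst AE_finite_all) auto
 define h where "h x = indicator \<Omega> x *\<^sub>R (\<Sum>b\<in>Basis. g b x *\<^sub>R b)" for x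
 have "h \<in> borel_measurable borel" unfolding h_def using g(1) by simp
 moreover have "h x = 0" if "x \<notin> \<Omega>" for x using that by (simp add: h_def)
 moreover have "AE x in \<mu>. f x = h x"
  unfolding AE_\<mu>_iff using ae
 proof eventually_elim
  case (elim x)
  show ?case
  proof
   assume x: "x \<in> \<Omega>"
   have "(\<Sum>b\<in>Basis. g b x *\<^sub>R b) = (\<Sum>b\<in>Basis. (f x \<bullet> b) *\<^sub>R b)"
    by (rule sum.cong) (use elim x in auto)
   then show "f x = h x" using x by (simp add: h_def euclidean_representation)
  qed
 qed
 ultimately show ?thesis using that by blast
qed

lemma measurable_act_G:
 assumes "V \<in> borel_measurable \<mu>"
 shows "(\<lambda>x. matrix_act (G x) (V x) :: complex^'n) \<in> borel_measurable \<mu>" (is ?th1)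
  and "(\<lambda>x. matrix_act (matrix_inv (G x)) (V x) :: complex^'n) \<in> borel_measurable \<mu>" (is ?th2)
proof -
 have V: "(\<lambda>x. V x $ j) \<in> borel_measurable \<mu>" for j
  using assms borel_measurable_vec_iff by blast
 have m: "(\<lambda>x. matrix_act (A x) (V x)) \<in> borel_measurable \<mu>"
  if "\<And>i j. continuous_on UNIV (\<lambda>x. A x $ i $ j)" for A :: "real^'n \<Rightarrow> real^'n^'n"
  unfolding borel_measurable_vec_iff matrix_act_nth
  by (intro allI borel_measurable_sum borel_measurable_scaleR V measurable_\<mu>_cont continuous_on_subset[OF that]) auto
 show ?th1
  by (rule m) (rule C1_on_continuous[OF G_C1])
 show ?th2
  by (rule m) (rule C1_on_continuous[OF Gi_C1])
qed

end

sublocale riemannian_domain \<subseteq> sc: form_field "g_vol G \<Omega>" "\<lambda>_. (\<bullet>) :: complex \<Rightarrow> complex \<Rightarrow> real"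
 by unfold_locales (auto simp: inner_add_left intro: inner_commute)

sublocale riemannian_domain \<subseteq> vf: form_field "g_vol G \<Omega>" "\<lambda>x. g_inner (G x) :: complex^'n \<Rightarrow> complex^'n \<Rightarrow> real"
proof
 show "(\<lambda>x. g_inner (G x) (f x) (g x)) \<in> borel_measurable \<mu>"
  if "f \<in> borel_measurable \<mu>" "g \<in> borel_measurable \<mu>" for f g :: "real^'n \<Rightarrow> complex^'n"
  unfolding g_inner_eq by (intro borel_measurable_inner measurable_act_G that)
qed (auto simp: g_inner_eq inner_add_left g_inner_nonneg[unfolded g_inner_eq], metis g_inner_eq g_inner_sym)

context riemannian_domain begin

lemma sc_sqi_iff: "sc.sqi f \<longleftrightarrow> f \<in> borel_measurable \<mu> \<and> L2_sq G \<Omega> f < \<infinity>"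
 using sc.sqi_iff_finite[of f] sc.sqi_def[of f] by (auto simp: L2_sq_def power2_norm_eq_inner)

lemma vf_sqi_iff: "vf.sqi V \<longleftrightarrow> V \<in> borel_measurable \<mu> \<and> L2_vec_sq G \<Omega> V < \<infinity>"
 using vf.sqi_iff_finite[of V] vf.sqi_def[of V] by (auto simp: L2_vec_sq_def g_normsq_def)

lemma L2_sq_nn: "L2_sq G \<Omega> f = (\<integral>\<^sup>+x. ennreal (f x \<bullet> f x) \<partial>\<mu>)"
 by (simp add: L2_sq_def power2_norm_eq_inner)

lemma L2_vec_sq_nn: "L2_vec_sq G \<Omega> V = (\<integral>\<^sup>+x. ennreal (g_inner (G x) (V x) (V x)) \<partial>\<mu>)"
 by (simp add: L2_vec_sq_def g_normsq_def)

lemmas sc_conv = sc.conv_nn[folded L2_sq_nn] and vf_conv = vf.conv_nn[folded L2_vec_sq_nn]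
lemmas sc_conv_L2 = sc.conv_nn_iff[THEN iffD1, folded L2_sq_nn] and vf_conv_L2 = vf.conv_nn_iff[THEN iffD1, folded L2_vec_sq_nn]
lemmas sc_convI = sc.conv_nnI[folded L2_sq_nn] and vf_convI = vf.conv_nnI[folded L2_vec_sq_nn]

end


section \<open>Weak gradients and weak Laplacians\<close>

context riemannian_domain begin

lemma continuous_compact_support_UNIV:
 fixes h :: "real^'n \<Rightarrow> 'b::real_normed_vector"
 assumes "continuous_on \<Omega> h" "compact K" "K \<subseteq> \<Omega>" "\<And>x. x \<notin> K \<Longrightarrow> h x = 0"
 shows "continuous_on UNIV h"
proof -
 have "continuous_on (- K) h"
  by (rule continuous_on_eq[of _ "\<lambda>_. 0"]) (use assms in auto)
 then have "continuous_on (\<Omega> \<union> - K) h"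
  by (intro continuous_on_open_Un assms open_\<Omega>) (use assms(2) in "auto simp: compact_imp_closed open_Compl")
 moreover have "\<Omega> \<union> - K = UNIV" using assms by auto
 ultimately show ?thesis by simp
qed

lemma integral_compact_support:
 fixes h :: "real^'n \<Rightarrow> 'b::euclidean_space"
 assumes "continuous_on \<Omega> h" "compact K" "K \<subseteq> \<Omega>" "\<And>x. x \<notin> K \<Longrightarrow> h x = 0"
 shows "integrable \<mu> h" "(\<integral>x. h x \<partial>\<mu>) = (\<integral>x. w x *\<^sub>R h x \<partial>lborel)" "integrable lborel (\<lambda>x. w x *\<^sub>R h x)"
  and "h \<in> borel_measurable borel"
proof -
 have c: "continuous_on UNIV h" by (rule continuous_compact_support_UNIV[OF assms])
 show b: "h \<in> borel_measurable borel" by (rule borel_measurable_continuous_onI[OF c])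
 have e: "(\<lambda>x. indicator \<Omega> x *\<^sub>R (w x *\<^sub>R h x)) = (\<lambda>x. w x *\<^sub>R h x)"
  using assms by (auto simp: indicator_def fun_eq_iff)
 have "continuous_on UNIV (\<lambda>x. w x *\<^sub>R h x)"
  by (intro continuous_intros c w_cont)
 then show i: "integrable lborel (\<lambda>x. w x *\<^sub>R h x)"
  by (rule compact_support_integrable[OF _ assms(2)]) (use assms in auto)
 show "integrable \<mu> h" "(\<integral>x. h x \<partial>\<mu>) = (\<integral>x. w x *\<^sub>R h x \<partial>lborel)"
  using integral_\<mu>[OF b] e i by auto
qed

lemma test_integrable:
 fixes f :: "real^'n \<Rightarrow> 'b::euclidean_space"
 assumes "C1c \<Omega> f"
 shows "integrable \<mu> f"
 using C1cE[OF assms] integral_compact_support(1)[OF C1c_continuous[OF assms]] by metis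

lemma sc_sqi_compact_support:
 assumes "continuous_on \<Omega> h" "compact K" "K \<subseteq> \<Omega>" "\<And>x. x \<notin> K \<Longrightarrow> h x = 0"
 shows "sc.sqi h"
 unfolding sc.sqi_def using assms
 by (auto intro!: measurable_\<mu>_cont integral_compact_support(1)[where K = K] continuous_intros)

lemma continuous_on_act_G:
 fixes V :: "real^'n \<Rightarrow> 'b::real_normed_vector^'n"
 assumes "continuous_on \<Omega> V"
 shows "continuous_on \<Omega> (\<lambda>x. matrix_act (G x) (V x))" (is ?th1) "continuous_on \<Omega> (\<lambda>x. matrix_act (matrix_inv (G x)) (V x))"
proof -
 have g: "continuous_on \<Omega> (\<lambda>x. G x $ i $ j)" "continuous_on \<Omega> (\<lambda>x. matrix_inv (G x) $ i $ j)" for i j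
  by (rule C1_on_continuous[OF C1_on_subset[OF G_C1]], simp, rule C1_on_continuous[OF Gi_C1])
 show ?th1 "continuous_on \<Omega> (\<lambda>x. matrix_act (matrix_inv (G x)) (V x))"
  unfolding matrix_act_def
  by (intro continuous_on_vec_lambda continuous_on_sum continuous_on_scaleR g continuous_on_component assms)+
qed

lemma vf_sqi_compact_support:
 assumes "continuous_on \<Omega> V" "compact K" "K \<subseteq> \<Omega>" "\<And>x. x \<notin> K \<Longrightarrow> V x = 0"
 shows "vf.sqi V"
 unfolding vf.sqi_def g_inner_eq using assms
 by (auto intro!: measurable_\<mu>_cont integral_compact_support(1)[where K = K] continuous_intros continuous_on_act_G)

lemma continuous_on_grad_vec: "C1_on S f \<Longrightarrow> continuous_on S (grad_vec f)"
 unfolding grad_vec_def by (intro continuous_on_vec_lambda C1_on_partial)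

lemma continuous_on_g_grad: "C1_on \<Omega> f \<Longrightarrow> continuous_on \<Omega> (g_grad G f)"
 unfolding g_grad_eq[abs_def] by (intro continuous_on_act_G continuous_on_grad_vec)

lemma g_grad_zero_off_support:
 assumes "\<And>i. partial_deriv i f x = 0"
 shows "g_grad G f x = 0"
 using assms by (simp add: g_grad_def vec_eq_iff)

text \<open>The negative adjoint of \<open>\<partial>\<^sub>j\<close> in the weighted space \<open>L\<^sup>2(w dx)\<close>.\<close>

definition dual_partial :: "'n \<Rightarrow> (real^'n \<Rightarrow> complex) \<Rightarrow> real^'n \<Rightarrow> complex" where
 "dual_partial j \<psi> x = partial_deriv j (\<lambda>y. w y *\<^sub>R \<psi> y) x /\<^sub>R w x"

lemma C1c_w_scale: "C1c \<Omega> \<psi> \<Longrightarrow> C1c \<Omega> (\<lambda>y. w y *\<^sub>R \<psi> y)"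
 by (rule C1c_scaleR[OF open_\<Omega> w_C1])

lemma test_sqi:
 fixes \<psi> :: "real^'n \<Rightarrow> complex"
 assumes "C1c \<Omega> \<psi>"
 shows "sc.sqi \<psi>" "vf.sqi (\<lambda>x. axis j (\<psi> x))" (is ?th1) "vf.sqi (g_grad G \<psi>)" "sc.sqi (dual_partial j \<psi>)" (is ?th2)
proof -
 obtain K where K: "compact K" "K \<subseteq> \<Omega>" "\<And>x. x \<notin> K \<Longrightarrow> \<psi> x = 0" "\<And>i x. x \<notin> K \<Longrightarrow> partial_deriv i \<psi> x = 0"
  using C1cE[OF assms] by metis
 obtain L where L: "compact L" "L \<subseteq> \<Omega>" "\<And>i x. x \<notin> L \<Longrightarrow> partial_deriv i (\<lambda>y. w y *\<^sub>R \<psi> y) x = 0"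
  using C1cE[OF C1c_w_scale[OF assms]] by metis
 show "sc.sqi \<psi>" by (rule sc_sqi_compact_support[OF C1c_continuous[OF assms] K(1-3)])
 have "continuous_on \<Omega> (\<lambda>x. if i = j then \<psi> x else 0)" for i
  by (cases "i = j") (simp_all add: C1c_continuous[OF assms])
 then have "continuous_on \<Omega> (\<lambda>x. axis j (\<psi> x))"
  unfolding axis_def by (intro continuous_on_vec_lambda)
 then show ?th1
  by (rule vf_sqi_compact_support[OF _ K(1,2)]) (use K in "auto simp: axis_def vec_eq_iff")
 show "vf.sqi (g_grad G \<psi>)"
  by (rule vf_sqi_compact_support[OF continuous_on_g_grad[OF C1c_C1[OF assms]] K(1,2)])
   (use K g_grad_zero_off_support in blast)
 have "continuous_on \<Omega> (dual_partial j \<psi>)"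
  unfolding dual_partial_def
  by (intro continuous_intros C1c_continuous_partial[OF C1c_w_scale[OF assms]] continuous_on_subset[OF w_cont])
   (use w_pos in force)+
 then show ?th2
  by (rule sc_sqi_compact_support[OF _ L(1,2)]) (simp add: dual_partial_def L)
qed

text \<open>
 The divergence theorem for compact supports, relative to the density \<open>w\<close>.  It yields all
 integrations by parts below; the index set is a singleton for a single partial derivative.
\<close>

lemma test_divergence:
 fixes F :: "'n \<Rightarrow> real^'n \<Rightarrow> real"
 assumes F: "\<And>i. C1c \<Omega> (F i)" and h: "\<And>x. x \<in> \<Omega> \<Longrightarrow> w x * h x = (\<Sum>i\<in>I. partial_deriv i (F i) x)"
 shows "integrable \<mu> h" "(\<integral>x. h x \<partial>\<mu>) = 0"
proof -
 let ?D = "\<lambda>x. \<Sum>i\<in>I. partial_deriv i (F i) x"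
 have i: "integrable lborel (partial_deriv i (F i))" for i
  using C1cE[OF F[of i]] compact_support_integrable[OF C1c_continuous_partial[OF F]] by metis
 have b: "(\<lambda>x. ?D x / w x) \<in> borel_measurable borel"
  using borel_measurable_continuous_onI[OF C1c_continuous_partial[OF F]] by measurable
 have "partial_deriv i (F i) x = 0" if "x \<notin> \<Omega>" for i x
  using C1cE[OF F[of i]] that by (metis subsetD)
 then have "indicator \<Omega> x *\<^sub>R (w x *\<^sub>R (?D x / w x)) = ?D x" for x
  using w_pos[of x] by (cases "x \<in> \<Omega>") simp_all
 then have "integrable \<mu> (\<lambda>x. ?D x / w x)" "(\<integral>x. ?D x / w x \<partial>\<mu>) = 0"
  using integral_\<mu>[OF b] i integral_partial_deriv_C1c[OF F] by simp_all
 moreover have e: "?D x / w x = h x" if "x \<in> space \<mu>" for x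
  using that w_pos[of x] h[of x] by (simp add: field_simps)
 have "integrable \<mu> (\<lambda>x. ?D x / w x) \<longleftrightarrow> integrable \<mu> h" "(\<integral>x. ?D x / w x \<partial>\<mu>) = (\<integral>x. h x \<partial>\<mu>)"
  by (rule Bochner_Integration.integrable_cong Bochner_Integration.integral_cong, rule refl, erule e)+
 ultimately show "integrable \<mu> h" "(\<integral>x. h x \<partial>\<mu>) = 0" by simp_all
qed

lemma smooth_weak_gradient:
 fixes \<phi> \<psi> :: "real^'n \<Rightarrow> complex"
 assumes \<phi>: "C1_on \<Omega> \<phi>" and \<psi>: "C1c \<Omega> \<psi>"
 shows "vf.ip (g_grad G \<phi>) (\<lambda>x. axis j (\<psi> x)) = - sc.ip \<phi> (dual_partial j \<psi>)"
proof -
 let ?P = "\<lambda>y. w y *\<^sub>R \<psi> y"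
 let ?h1 = "\<lambda>x. partial_deriv j \<phi> x \<bullet> \<psi> x" and ?h2 = "\<lambda>x. \<phi> x \<bullet> dual_partial j \<psi> x"
 have P: "C1c \<Omega> ?P" by (rule C1c_w_scale[OF \<psi>])
 obtain K where K: "compact K" "K \<subseteq> \<Omega>" "\<And>x. x \<notin> K \<Longrightarrow> \<psi> x = 0" using C1cE[OF \<psi>] by metis
 have i1: "integrable \<mu> ?h1"
  by (rule integral_compact_support(1)[OF _ K(1,2)])
   (auto intro!: continuous_intros C1_on_partial[OF \<phi>] C1c_continuous[OF \<psi>] simp: K(3))
 have "w x * (?h1 x + ?h2 x) = (\<Sum>i\<in>{j}. partial_deriv i (\<lambda>x. \<phi> x \<bullet> ?P x) x)" if "x \<in> \<Omega>" for x
 proof -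
  have "partial_deriv j (\<lambda>x. \<phi> x \<bullet> ?P x) x = \<phi> x \<bullet> partial_deriv j ?P x + partial_deriv j \<phi> x \<bullet> ?P x"
   by (rule partial_deriv_inner) (use \<phi> that P in "auto intro: C1_on_differentiable C1c_differentiable")
  then show ?thesis using w_pos[OF that] by (simp add: dual_partial_def distrib_left)
 qed
 note d = test_divergence[OF C1c_inner[OF open_\<Omega> \<phi> P] this]
 have "(\<integral>x. ?h2 x \<partial>\<mu>) = (\<integral>x. ?h1 x + ?h2 x \<partial>\<mu>) - (\<integral>x. ?h1 x \<partial>\<mu>)"
  using Bochner_Integration.integral_diff[OF d(1) i1] by simp
 then show ?thesis by (simp add: d(2) vf.ip_def sc.ip_def g_inner_grad inner_axis)
qed

lemma smooth_weak_laplacian: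
 fixes \<phi> \<psi> :: "real^'n \<Rightarrow> complex"
 assumes \<phi>: "\<And>i. C1_on \<Omega> (\<lambda>x. g_grad G \<phi> x $ i)" and \<psi>: "C1c \<Omega> \<psi>"
 shows "sc.ip (g_laplacian G \<phi>) \<psi> = - vf.ip (g_grad G \<phi>) (g_grad G \<psi>)"
proof -
 obtain K where K: "compact K" "K \<subseteq> \<Omega>" "\<And>x. x \<notin> K \<Longrightarrow> \<psi> x = 0" using C1cE[OF \<psi>] by metis
 let ?W = "\<lambda>i x. w x *\<^sub>R g_grad G \<phi> x $ i"
 let ?h1 = "\<lambda>x. g_laplacian G \<phi> x \<bullet> \<psi> x" and ?h2 = "\<lambda>x. g_inner (G x) (g_grad G \<phi> x) (g_grad G \<psi> x)"
 have W: "C1_on \<Omega> (?W i)" for i by (intro C1_on_scaleR w_C1 \<phi>)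
 have F: "C1c \<Omega> (\<lambda>x. ?W i x \<bullet> \<psi> x)" for i by (rule C1c_inner[OF open_\<Omega> W \<psi>])
 have lap: "g_laplacian G \<phi> x = (\<Sum>i\<in>UNIV. partial_deriv i (?W i) x) /\<^sub>R w x" for x
  unfolding g_laplacian_def w_def ..
 have "continuous_on \<Omega> ?h1"
  unfolding lap by (intro continuous_intros C1_on_partial[OF W] C1c_continuous[OF \<psi>] continuous_on_subset[OF w_cont])
   (use w_pos in force)+
 then have i1: "integrable \<mu> ?h1" by (rule integral_compact_support(1)[OF _ K(1,2)]) (simp add: K(3))
 have "w x * (?h1 x + ?h2 x) = (\<Sum>i\<in>UNIV. partial_deriv i (\<lambda>x. ?W i x \<bullet> \<psi> x) x)" if x: "x \<in> \<Omega>" for x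
 proof -
  have "partial_deriv i (\<lambda>x. ?W i x \<bullet> \<psi> x) x = ?W i x \<bullet> partial_deriv i \<psi> x + partial_deriv i (?W i) x \<bullet> \<psi> x" for i
   by (rule partial_deriv_inner) (use W x \<psi> in "auto intro: C1_on_differentiable C1c_differentiable")
  moreover have "?h2 x = g_grad G \<phi> x \<bullet> grad_vec \<psi> x"
   by (subst g_inner_sym) (simp add: g_inner_grad inner_commute)
  ultimately show ?thesis
   using w_pos[OF x] unfolding lap inner_vec_def
   by (simp add: sum.distrib inner_sum_left sum_distrib_left mult.assoc[symmetric] distrib_left)
 qed
 note d = test_divergence[OF F this]
 have "(\<integral>x. ?h2 x \<partial>\<mu>) = (\<integral>x. ?h1 x + ?h2 x \<partial>\<mu>) - (\<integral>x. ?h1 x \<partial>\<mu>)"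
  using Bochner_Integration.integral_diff[OF d(1) i1] by simp
 then show ?thesis by (simp add: d(2) vf.ip_def sc.ip_def)
qed

subsection \<open>Uniqueness\<close>

text \<open>
 Choose a Borel representative \<open>g\<close>.  The measures with densities \<open>g\<^sup>+\<close> and \<open>g\<^sup>-\<close> agree on test functions,
 hence coincide, and so do their densities.
\<close>

lemma fundamental_lemma:
 fixes f :: "real^'n \<Rightarrow> real"
 assumes f: "f \<in> borel_measurable \<mu>"
  and loc: "\<And>K. compact K \<Longrightarrow> K \<subseteq> \<Omega> \<Longrightarrow> integrable \<mu> (\<lambda>x. indicator K x * f x)"
  and zero: "\<And>\<psi>. C1c \<Omega> \<psi> \<Longrightarrow> (\<integral>x. \<psi> x * f x \<partial>\<mu>) = 0"
 shows "AE x in \<mu>. f x = 0"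
proof -
 obtain g where g: "g \<in> borel_measurable borel" "\<And>x. x \<notin> \<Omega> \<Longrightarrow> g x = 0" "AE x in \<mu>. f x = g x"
  by (rule borel_representative[OF f]) blast
 \<comment> \<open>The densities are truncated at 0 by \<open>ennreal\<close>, so \<open>D g\<close> and \<open>D (-g)\<close> are the positive and negative parts.\<close>
 define D where "D h = density lborel (\<lambda>x. indicator \<Omega> x * (ennreal (w x) * ennreal (h x)))" for h :: "real^'n \<Rightarrow> real"
 have Dint: "(\<integral>\<^sup>+x. ennreal (\<psi> x) \<partial>D h) = (\<integral>\<^sup>+x. ennreal (\<psi> x * h x) \<partial>\<mu>)"
  if "\<psi> \<in> borel_measurable borel" "h \<in> borel_measurable borel" "\<And>x. \<psi> x \<ge> 0" for \<psi> h
 proof -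
  have "(\<integral>\<^sup>+x. ennreal (\<psi> x) \<partial>D h) = (\<integral>\<^sup>+x. indicator \<Omega> x * (ennreal (w x) * ennreal (h x)) * ennreal (\<psi> x) \<partial>lborel)"
   unfolding D_def by (rule nn_integral_density) (use that in auto)
  also have "\<dots> = (\<integral>\<^sup>+x. indicator \<Omega> x * (ennreal (w x) * ennreal (\<psi> x * h x)) \<partial>lborel)"
   by (rule nn_integral_cong) (use that(3) in "auto simp: ennreal_mult' mult_ac")
  also have "\<dots> = (\<integral>\<^sup>+x. ennreal (\<psi> x * h x) \<partial>\<mu>)"
   by (rule nn_integral_\<mu>[symmetric]) (use that in auto)
  finally show ?thesis .
 qed
 have locg: "integrable \<mu> (\<lambda>x. indicator K x * g x)" if "compact K" "K \<subseteq> \<Omega>" for K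
  by (rule integrable_cong_AE_imp[OF loc[OF that]])
   (use g that in "auto intro!: measurable_\<mu>_borel borel_measurable_times borel_measurable_indicator borel_compact elim!: eventually_mono")
 have "D g = D (\<lambda>x. - g x)"
 proof (rule measure_eq_on_Borel_by_test_functions[OF open_\<Omega>])
  show "sets (D g) = sets borel" "sets (D (\<lambda>x. - g x)) = sets borel" by (simp_all add: D_def)
  have "emeasure (D h) (- \<Omega>) = 0" if "h \<in> borel_measurable borel" for h
   unfolding D_def
   by (subst emeasure_density) (use that in "auto simp: nn_integral_0_iff_AE indicator_def")
  then show "emeasure (D g) (- \<Omega>) = 0" "emeasure (D (\<lambda>x. - g x)) (- \<Omega>) = 0"
   using g(1) by auto
  show "emeasure (D g) (cbox a b) < \<infinity>" if "cbox a b \<subseteq> \<Omega>" for a b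
  proof -
   have "emeasure (D g) (cbox a b) = (\<integral>\<^sup>+x. ennreal (indicator (cbox a b) x) \<partial>D g)"
    by (simp add: D_def ennreal_indicator)
   also have "\<dots> = (\<integral>\<^sup>+x. ennreal (indicator (cbox a b) x * g x) \<partial>\<mu>)"
    by (rule Dint) (use g in auto)
   also have "\<dots> < \<infinity>"
    using integrableD(2)[OF locg[OF compact_cbox that]] by (auto simp: less_top)
   finally show ?thesis .
  qed
 next
  fix \<psi> :: "real^'n \<Rightarrow> real"
  assume \<psi>: "C1c \<Omega> \<psi>" "\<And>x. 0 \<le> \<psi> x" "\<And>x. \<psi> x \<le> 1"
  obtain K where K: "compact K" "K \<subseteq> \<Omega>" "\<And>x. x \<notin> K \<Longrightarrow> \<psi> x = 0" using C1cE[OF \<psi>(1)] by metis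
  have b: "\<psi> \<in> borel_measurable borel" by (rule borel_measurable_continuous_onI[OF C1c_continuous[OF \<psi>(1)]])
  have i: "integrable \<mu> (\<lambda>x. \<psi> x * g x)"
  proof (rule Bochner_Integration.integrable_bound[OF locg[OF K(1,2)]])
   show "(\<lambda>x. \<psi> x * g x) \<in> borel_measurable \<mu>" by (rule measurable_\<mu>_borel) (use b g in auto)
   show "AE x in \<mu>. norm (\<psi> x * g x) \<le> norm (indicator K x * g x)"
   proof (rule AE_I2)
    fix x show "norm (\<psi> x * g x) \<le> norm (indicator K x * g x)"
     using K(3)[of x] \<psi>(2,3)[of x] by (cases "x \<in> K") (auto simp: abs_mult mult_left_le_one_le)
   qed
  qed
  have "(\<integral>x. \<psi> x * g x \<partial>\<mu>) = (\<integral>x. \<psi> x * f x \<partial>\<mu>)"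
   by (rule integral_cong_AE[OF borel_measurable_times[OF measurable_\<mu>_borel[OF b] measurable_\<mu>_borel[OF g(1)]]
      borel_measurable_times[OF measurable_\<mu>_borel[OF b] f]])
    (use g(3) in "auto elim!: eventually_mono")
  then have "(\<integral>x. \<psi> x * g x \<partial>\<mu>) = 0" using zero[OF \<psi>(1)] by simp
  then have eq: "enn2real (\<integral>\<^sup>+x. ennreal (\<psi> x * g x) \<partial>\<mu>) = enn2real (\<integral>\<^sup>+x. ennreal (- (\<psi> x * g x)) \<partial>\<mu>)"
   using real_lebesgue_integral_def[OF i] by simp
  have fin: "(\<integral>\<^sup>+x. ennreal (\<psi> x * g x) \<partial>\<mu>) < top" "(\<integral>\<^sup>+x. ennreal (- (\<psi> x * g x)) \<partial>\<mu>) < top"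
   using integrableD(2,3)[OF i] by (simp_all add: less_top)
  have "(\<integral>\<^sup>+x. ennreal (\<psi> x * g x) \<partial>\<mu>) = ennreal (enn2real (\<integral>\<^sup>+x. ennreal (\<psi> x * g x) \<partial>\<mu>))"
   by (simp only: ennreal_enn2real[OF fin(1)])
  also have "\<dots> = (\<integral>\<^sup>+x. ennreal (\<psi> x * - g x) \<partial>\<mu>)"
   unfolding eq mult_minus_right by (simp only: ennreal_enn2real[OF fin(2)])
  finally have "(\<integral>\<^sup>+x. ennreal (\<psi> x * g x) \<partial>\<mu>) = (\<integral>\<^sup>+x. ennreal (\<psi> x * - g x) \<partial>\<mu>)" .
  then show "(\<integral>\<^sup>+x. ennreal (\<psi> x) \<partial>D g) = (\<integral>\<^sup>+x. ennreal (\<psi> x) \<partial>D (\<lambda>x. - g x))"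
   by (simp only: Dint[OF b g(1) \<psi>(2)] Dint[OF b borel_measurable_uminus[OF g(1)] \<psi>(2)])
 qed
 then have "AE x in lborel. indicator \<Omega> x * (ennreal (w x) * ennreal (g x)) = indicator \<Omega> x * (ennreal (w x) * ennreal (- g x))"
  unfolding D_def by (subst (asm) sigma_finite_measure.density_unique_iff[OF sigma_finite_lborel]) (use g in auto)
 then have "AE x in \<mu>. g x = 0"
  unfolding AE_\<mu>_iff
 proof eventually_elim
  case (elim x)
  show ?case
  proof
   assume x: "x \<in> \<Omega>"
   then have "ennreal (w x) * ennreal (g x) = ennreal (w x) * ennreal (- g x)" using elim by simp
   then have "ennreal (g x) = ennreal (- g x)"
    using w_pos[OF x] by (simp add: ennreal_mult_cancel_left)
   then show "g x = 0" by (metis ennreal_eq_0_iff ennreal_inj le_cases neg_0_le_iff_le neg_le_0_iff_le order_antisym)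
  qed
 qed
 then show ?thesis using g(3) by eventually_elim simp
qed

lemma AE_zero_by_complex_tests:
 fixes f :: "real^'n \<Rightarrow> complex"
 assumes f: "f \<in> borel_measurable \<mu>"
  and loc: "\<And>K c. compact K \<Longrightarrow> K \<subseteq> \<Omega> \<Longrightarrow> integrable \<mu> (\<lambda>x. f x \<bullet> (indicator K x *\<^sub>R c))"
  and zero: "\<And>\<psi> :: real^'n \<Rightarrow> complex. C1c \<Omega> \<psi> \<Longrightarrow> (\<integral>x. f x \<bullet> \<psi> x \<partial>\<mu>) = 0"
 shows "AE x in \<mu>. f x = 0"
proof -
 have c: "AE x in \<mu>. f x \<bullet> c = 0" for c
 proof (rule fundamental_lemma)
  show "(\<lambda>x. f x \<bullet> c) \<in> borel_measurable \<mu>" using f by simp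
  show "integrable \<mu> (\<lambda>x. indicator K x * (f x \<bullet> c))" if "compact K" "K \<subseteq> \<Omega>" for K
   using loc[OF that, of c] by (simp add: mult.commute)
  show "(\<integral>x. \<psi> x * (f x \<bullet> c) \<partial>\<mu>) = 0" if "C1c \<Omega> \<psi>" for \<psi>
   using zero[OF C1c_linear[OF bounded_linear_scaleR_left[of c] that]] by simp
 qed
 have "AE x in \<mu>. f x \<bullet> 1 = 0 \<and> f x \<bullet> \<i> = 0" using c[of 1] c[of \<i>] by eventually_elim simp
 then show ?thesis by eventually_elim (simp add: inner_complex_def complex_eq_iff)
qed

text \<open>Testing by fields with one component reduces the notion to scalar integrals.\<close>

definition wk_grad :: "(real^'n \<Rightarrow> complex) \<Rightarrow> (real^'n \<Rightarrow> complex^'n) \<Rightarrow> bool" where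
 "wk_grad u V \<longleftrightarrow> sc.sqi u \<and> vf.sqi V \<and>
  (\<forall>\<psi> j. C1c \<Omega> \<psi> \<longrightarrow> vf.ip V (\<lambda>x. axis j (\<psi> x)) = - sc.ip u (dual_partial j \<psi>))"

definition wk_lap :: "(real^'n \<Rightarrow> complex^'n) \<Rightarrow> (real^'n \<Rightarrow> complex) \<Rightarrow> bool" where
 "wk_lap V L \<longleftrightarrow> vf.sqi V \<and> sc.sqi L \<and> (\<forall>\<psi>. C1c \<Omega> \<psi> \<longrightarrow> sc.ip L \<psi> = - vf.ip V (g_grad G \<psi>))"

text \<open>Testing by fields with one component gives the components of \<open>G V\<close>, and \<open>G\<close> is invertible.\<close>

lemma AE_zero_field:
 assumes V: "vf.sqi V" and z: "\<And>\<psi> j. C1c \<Omega> \<psi> \<Longrightarrow> vf.ip V (\<lambda>x. axis j (\<psi> x)) = 0"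
 shows "AE x in \<mu>. V x = 0"
proof -
 have e: "g_inner (G x) (V x) (axis j c) = matrix_act (G x) (V x) $ j \<bullet> c" for x j c
  by (simp add: g_inner_act inner_axis)
 have m: "(\<lambda>x. matrix_act (G x) (V x)) \<in> borel_measurable \<mu>"
  by (rule measurable_act_G) (use V vf.sqi_meas in auto)
 have "AE x in \<mu>. matrix_act (G x) (V x) $ j = 0" for j
 proof (rule AE_zero_by_complex_tests)
  show "(\<lambda>x. matrix_act (G x) (V x) $ j) \<in> borel_measurable \<mu>"
   using borel_measurable_vec_iff[THEN iffD1, OF m] by blast
  show "(\<integral>x. matrix_act (G x) (V x) $ j \<bullet> \<psi> x \<partial>\<mu>) = 0" if "C1c \<Omega> \<psi>" for \<psi>
   using z[OF that, of j] by (simp add: vf.ip_def e)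
  show "integrable \<mu> (\<lambda>x. matrix_act (G x) (V x) $ j \<bullet> (indicator K x *\<^sub>R c))" if K: "compact K" "K \<subseteq> \<Omega>" for K c
  proof -
   have "vf.sqi (\<lambda>x. axis j (indicator K x *\<^sub>R c))"
   proof -
    have b: "(\<lambda>x. axis j (indicator K x *\<^sub>R c) :: complex^'n) \<in> borel_measurable borel"
     unfolding borel_measurable_vec_iff
    proof
     fix i show "(\<lambda>x. (axis j (indicator K x *\<^sub>R c) :: complex^'n) $ i) \<in> borel_measurable borel"
      by (cases "i = j") (use borel_compact[OF K(1)] in "auto simp: axis_def")
    qed
    have eq: "g_inner (G x) (axis j (indicator K x *\<^sub>R c)) (axis j (indicator K x *\<^sub>R c))
      = indicator K x *\<^sub>R (G x $ j $ j * (c \<bullet> c))" for x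
    proof (cases "x \<in> K")
     case True
     have "matrix_act (G x) (axis j c) $ j = G x $ j $ j *\<^sub>R c"
      by (simp add: matrix_act_nth axis_def if_distrib[of "\<lambda>c. _ *\<^sub>R c"] cong: if_cong)
     then show ?thesis using True by (simp add: g_inner_act inner_axis)
    next
     case False
     then show ?thesis by (simp add: g_inner_act inner_axis)
    qed
    have "continuous_on K (\<lambda>x. w x * (G x $ j $ j * (c \<bullet> c)))"
     by (intro continuous_intros continuous_on_subset[OF w_cont] continuous_on_subset[OF C1_on_continuous[OF G_C1]]) auto
    then have "integrable lborel (\<lambda>x. indicator K x *\<^sub>R (w x * (G x $ j $ j * (c \<bullet> c))))"
     by (rule borel_integrable_compact[OF K(1)])
    moreover have "(\<lambda>x. indicator K x *\<^sub>R (w x * (G x $ j $ j * (c \<bullet> c))))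
      = (\<lambda>x. indicator \<Omega> x *\<^sub>R (w x *\<^sub>R (indicator K x *\<^sub>R (G x $ j $ j * (c \<bullet> c)))))"
     using K(2) by (auto simp: fun_eq_iff indicator_def)
    moreover have "(\<lambda>x. indicator K x *\<^sub>R (G x $ j $ j * (c \<bullet> c))) \<in> borel_measurable borel"
     using borel_compact[OF K(1)] borel_measurable_continuous_onI[OF C1_on_continuous[OF G_C1]] by simp
    ultimately have "integrable \<mu> (\<lambda>x. indicator K x *\<^sub>R (G x $ j $ j * (c \<bullet> c)))"
     using integral_\<mu>(2)[of "\<lambda>x. indicator K x *\<^sub>R (G x $ j $ j * (c \<bullet> c))"] by (simp add: mult.assoc)
    then show ?thesis unfolding vf.sqi_def eq using measurable_\<mu>_borel[OF b] by simp
   qed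
   from vf.integrable_q[OF V this] show ?thesis by (simp add: e)
  qed
 qed
 then have "AE x in \<mu>. \<forall>j. matrix_act (G x) (V x) $ j = 0"
  by (subst AE_all_countable) auto
 then show ?thesis
 proof eventually_elim
  case (elim x)
  then have "matrix_act (G x) (V x) = 0" by (simp add: vec_eq_iff)
  then have "matrix_act (matrix_inv (G x)) (matrix_act (G x) (V x)) = matrix_act (matrix_inv (G x)) 0" by simp
  then show ?case by (simp only: act_G_inv) (simp add: matrix_act_def vec_eq_iff)
 qed
qed

lemma wk_grad_unique:
 assumes "wk_grad u V" "wk_grad u V'"
 shows "AE x in \<mu>. V x = V' x"
proof -
 have "AE x in \<mu>. V x - V' x = 0"
 proof (rule AE_zero_field)
  show "vf.sqi (\<lambda>x. V x - V' x)" using assms by (auto simp: wk_grad_def intro: vf.sqi_diff)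
  show "vf.ip (\<lambda>x. V x - V' x) (\<lambda>x. axis j (\<psi> x)) = 0" if "C1c \<Omega> \<psi>" for \<psi> j
   using assms that by (simp add: wk_grad_def vf.ip_diff test_sqi(2)[OF that])
 qed
 then show ?thesis by eventually_elim simp
qed

lemma wk_lap_unique:
 assumes "wk_lap V L" "wk_lap V' L'" "AE x in \<mu>. V x = V' x"
 shows "AE x in \<mu>. L x = L' x"
proof -
 have s: "sc.sqi (\<lambda>x. L x - L' x)" using assms by (auto simp: wk_lap_def intro: sc.sqi_diff)
 have "AE x in \<mu>. L x - L' x = 0"
 proof (rule AE_zero_by_complex_tests)
  show "(\<lambda>x. L x - L' x) \<in> borel_measurable \<mu>" by (rule sc.sqi_meas[OF s])
  show "(\<integral>x. (L x - L' x) \<bullet> \<psi> x \<partial>\<mu>) = 0" if "C1c \<Omega> \<psi>" for \<psi>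
  proof -
   have "vf.ip V (g_grad G \<psi>) = vf.ip V' (g_grad G \<psi>)"
    by (rule vf.ip_cong_AE) (use assms vf.sqi_meas[OF test_sqi(3)[OF that]] in "auto simp: wk_lap_def vf.sqi_def")
   then show ?thesis
    using assms that sc.ip_diff[of L L' \<psi>] test_sqi(1)[OF that] by (simp add: wk_lap_def sc.ip_def)
  qed
  show "integrable \<mu> (\<lambda>x. (L x - L' x) \<bullet> (indicator K x *\<^sub>R c))" if K: "compact K" "K \<subseteq> \<Omega>" for K c
  proof -
   have b: "(\<lambda>x. indicator K x *\<^sub>R c) \<in> borel_measurable borel" using borel_compact[OF K(1)] by simp
   have "continuous_on K (\<lambda>x. w x * (c \<bullet> c))"
    by (intro continuous_intros continuous_on_subset[OF w_cont]) auto
   then have "integrable lborel (\<lambda>x. indicator K x *\<^sub>R (w x * (c \<bullet> c)))"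
    by (rule borel_integrable_compact[OF K(1)])
   moreover have "(\<lambda>x. indicator K x *\<^sub>R (w x * (c \<bullet> c)))
     = (\<lambda>x. indicator \<Omega> x *\<^sub>R (w x *\<^sub>R ((indicator K x *\<^sub>R c) \<bullet> (indicator K x *\<^sub>R c))))"
    using K(2) by (auto simp: fun_eq_iff indicator_def)
   ultimately have "sc.sqi (\<lambda>x. indicator K x *\<^sub>R c)"
    unfolding sc.sqi_def using integral_\<mu>(2)[OF borel_measurable_inner[OF b b]] measurable_\<mu>_borel[OF b] by simp
   from sc.integrable_q[OF s this] show ?thesis .
  qed
 qed
 then show ?thesis by eventually_elim simp
qed

end


section \<open>The Sobolev spaces\<close>

lemma Ck_on_cong_open:
 fixes f g :: "real^'n \<Rightarrow> 'b::real_normed_vector"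
 assumes "open S" "\<And>x. x \<in> S \<Longrightarrow> f x = g x" "Ck_on k S f"
 shows "Ck_on k S g"
 using assms(2,3)
proof (induction k arbitrary: f g)
 case 0
 then show ?case by (metis Ck_on.simps(1) continuous_on_eq)
next
 case (Suc k)
 have "g differentiable (at x)" if "x \<in> S" for x
 proof -
  have "f differentiable (at x)" using Suc.prems that by simp
  then show ?thesis
   using has_derivative_transform_within_open[OF _ assms(1) that, of f _ UNIV g] Suc.prems(1)
   unfolding differentiable_def by blast
 qed
 moreover have "Ck_on k S (partial_deriv i g)" for i
  using Suc.IH[of "partial_deriv i f" "partial_deriv i g"] partial_deriv_cong_open[OF assms(1) _ Suc.prems(1)] Suc.prems(2)
  by auto
 ultimately show ?case by simp
qed

lemma Ck_on_subset:
 fixes f :: "real^'n \<Rightarrow> 'b::real_normed_vector"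
 shows "Ck_on k S f \<Longrightarrow> T \<subseteq> S \<Longrightarrow> Ck_on k T f"
 by (induction k arbitrary: f) (auto intro: continuous_on_subset)

lemma Ck_on_diff:
 fixes f g :: "real^'n \<Rightarrow> 'b::real_normed_vector"
 assumes "open S" "Ck_on k S f" "Ck_on k S g"
 shows "Ck_on k S (\<lambda>x. f x - g x)"
 using assms(2,3)
proof (induction k arbitrary: f g)
 case 0
 then show ?case by (auto intro: continuous_on_diff)
next
 case (Suc k)
 have d: "f differentiable (at x)" "g differentiable (at x)" if "x \<in> S" for x using Suc.prems that by auto
 have "Ck_on k S (partial_deriv i (\<lambda>x. f x - g x))" for i
 proof (rule Ck_on_cong_open[OF assms(1)])
  show "Ck_on k S (\<lambda>x. partial_deriv i f x - partial_deriv i g x)"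
   using Suc by simp
  show "partial_deriv i f x - partial_deriv i g x = partial_deriv i (\<lambda>x. f x - g x) x" if "x \<in> S" for x
   using partial_deriv_add[of f x "\<lambda>x. - g x" i] d[OF that] partial_deriv_cmult[of g x i "-1"]
   by (simp add: differentiable_minus)
 qed
 then show ?case using d by (simp add: differentiable_diff)
qed

lemma partial_deriv_diff:
 "f differentiable (at x) \<Longrightarrow> g differentiable (at x) \<Longrightarrow>
  partial_deriv i (\<lambda>x. f x - g x) x = partial_deriv i f x - partial_deriv i g x"
 using partial_deriv_add[of f x "\<lambda>x. - g x" i] partial_deriv_cmult[of g x i "-1"]
 by (simp add: differentiable_minus)

lemma smooth_closure_diff:
 fixes f g :: "real^'n \<Rightarrow> 'b::real_normed_vector"
 assumes "smooth_closure \<Omega> f" "smooth_closure \<Omega> g"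
 shows "smooth_closure \<Omega> (\<lambda>x. f x - g x)"
proof -
 obtain U where U: "open U" "closure \<Omega> \<subseteq> U" "smooth_on U f" using assms by (auto simp: smooth_closure_def)
 obtain T where T: "open T" "closure \<Omega> \<subseteq> T" "smooth_on T g" using assms by (auto simp: smooth_closure_def)
 have "smooth_on (U \<inter> T) (\<lambda>x. f x - g x)"
  unfolding smooth_on_def using U T
  by (auto intro!: Ck_on_diff open_Int simp: smooth_on_def intro: Ck_on_subset)
 then show ?thesis using U T unfolding smooth_closure_def by (intro exI[of _ "U \<inter> T"]) auto
qed

lemma smooth_closure_Ck_on:
 fixes f :: "real^'n \<Rightarrow> 'b::real_normed_vector"
 shows "smooth_closure \<Omega> f \<Longrightarrow> Ck_on k \<Omega> f"
 unfolding smooth_closure_def smooth_on_def using Ck_on_subset closure_subset by (metis subset_trans)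

context riemannian_domain begin

lemma smooth_closure_C1:
 fixes f :: "real^'n \<Rightarrow> 'b::real_normed_vector"
 assumes "smooth_closure \<Omega> f"
 shows "C1_on \<Omega> f" "C1_on \<Omega> (partial_deriv i f)"
proof -
 have "Ck_on (Suc (Suc 0)) \<Omega> f" using smooth_closure_Ck_on[OF assms] .
 then show "C1_on \<Omega> f" "C1_on \<Omega> (partial_deriv i f)"
  using Ck_on_imp_C1_on[OF _ open_\<Omega>, of 1 f] Ck_on_imp_C1_on[OF _ open_\<Omega>, of 0 "partial_deriv i f"] by auto
qed

lemma g_grad_C1:
 fixes f :: "real^'n \<Rightarrow> complex"
 assumes "smooth_closure \<Omega> f"
 shows "C1_on \<Omega> (\<lambda>x. g_grad G f x $ i)"
 unfolding g_grad_def using smooth_closure_C1(2)[OF assms]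
 by (simp) (intro C1_on_sum C1_on_scaleR Gi_C1)

lemma g_grad_linear:
 fixes f g :: "real^'n \<Rightarrow> complex"
 assumes "f differentiable (at x)" "g differentiable (at x)"
 shows "g_grad G (\<lambda>x. f x - g x) x = g_grad G f x - g_grad G g x"
proof -
 have "grad_vec (\<lambda>x. f x - g x) x = grad_vec f x - grad_vec g x"
  using assms by (simp add: vec_eq_iff partial_deriv_diff)
 then show ?thesis by (simp add: g_grad_eq matrix_act_diff)
qed

lemma continuous_on_laplacian:
 fixes f :: "real^'n \<Rightarrow> complex"
 assumes "smooth_closure \<Omega> f"
 shows "continuous_on \<Omega> (g_laplacian G f)"
proof -
 have "C1_on \<Omega> (\<lambda>x. w x *\<^sub>R g_grad G f x $ i)" for i by (intro C1_on_scaleR w_C1 g_grad_C1 assms)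
 from C1_on_partial[OF this] show ?thesis
  unfolding g_laplacian_def w_def[symmetric]
  by (intro continuous_intros continuous_on_subset[OF w_cont]) (use w_pos in force)+
qed

lemma g_laplacian_linear:
 fixes f g :: "real^'n \<Rightarrow> complex"
 assumes f: "smooth_closure \<Omega> f" and g: "smooth_closure \<Omega> g" and x: "x \<in> \<Omega>"
 shows "g_laplacian G (\<lambda>x. f x - g x) x = g_laplacian G f x - g_laplacian G g x"
proof -
 have C: "C1_on \<Omega> (\<lambda>x. w x *\<^sub>R g_grad G f x $ i)" "C1_on \<Omega> (\<lambda>x. w x *\<^sub>R g_grad G g x $ i)" for i
  by (intro C1_on_scaleR w_C1 g_grad_C1 f g)+
 have "partial_deriv i (\<lambda>y. w y *\<^sub>R g_grad G (\<lambda>x. f x - g x) y $ i) x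
   = partial_deriv i (\<lambda>x. w x *\<^sub>R g_grad G f x $ i) x - partial_deriv i (\<lambda>x. w x *\<^sub>R g_grad G g x $ i) x" for i
 proof -
  have "partial_deriv i (\<lambda>y. w y *\<^sub>R g_grad G (\<lambda>x. f x - g x) y $ i) x
    = partial_deriv i (\<lambda>y. w y *\<^sub>R g_grad G f y $ i - w y *\<^sub>R g_grad G g y $ i) x"
   by (rule partial_deriv_cong_open[OF open_\<Omega> x])
    (simp add: scaleR_diff_right g_grad_linear[OF C1_on_differentiable[OF smooth_closure_C1(1)[OF f]]
      C1_on_differentiable[OF smooth_closure_C1(1)[OF g]]])
  also have "\<dots> = partial_deriv i (\<lambda>x. w x *\<^sub>R g_grad G f x $ i) x - partial_deriv i (\<lambda>x. w x *\<^sub>R g_grad G g x $ i) x"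
   by (rule partial_deriv_diff) (use C C1_on_differentiable x in blast)+
  finally show ?thesis .
 qed
 then show ?thesis
  unfolding g_laplacian_def w_def[symmetric] by (simp add: sum_subtractf scaleR_diff_right)
qed

lemma H1_smoothD:
 assumes "\<phi> \<in> H1_smooth G \<Omega>"
 shows "C1_on \<Omega> \<phi>" "sc.sqi \<phi>" "vf.sqi (g_grad G \<phi>)"
proof -
 have s: "smooth_closure \<Omega> \<phi>" and f: "L2_sq G \<Omega> \<phi> + L2_vec_sq G \<Omega> (g_grad G \<phi>) < \<infinity>"
  using assms by (auto simp: H1_smooth_def)
 show C: "C1_on \<Omega> \<phi>" by (rule smooth_closure_C1[OF s])
 show "sc.sqi \<phi>" "vf.sqi (g_grad G \<phi>)"
  unfolding sc_sqi_iff vf_sqi_iff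
  using f measurable_\<mu>_cont[OF C1_on_continuous[OF C]] measurable_\<mu>_cont[OF continuous_on_g_grad[OF C]] by auto
qed

lemma H2_smooth_H1: "\<phi> \<in> H2_smooth G \<Omega> \<Longrightarrow> \<phi> \<in> H1_smooth G \<Omega>"
 unfolding H2_smooth_def H1_smooth_def by auto

lemma H2_smooth_smooth: "\<phi> \<in> H2_smooth G \<Omega> \<Longrightarrow> smooth_closure \<Omega> \<phi>"
 unfolding H2_smooth_def by auto

lemma H2_smooth_laplacian:
 assumes "\<phi> \<in> H2_smooth G \<Omega>"
 shows "sc.sqi (g_laplacian G \<phi>)"
 unfolding sc_sqi_iff
 using measurable_\<mu>_cont[OF continuous_on_laplacian[OF H2_smooth_smooth[OF assms]]] assms
 by (auto simp: H2_smooth_def)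

lemma ennreal_tendsto_zero_mono:
 fixes f g :: "'i \<Rightarrow> ennreal"
 assumes "(g \<longlongrightarrow> 0) F" "\<And>k. f k \<le> g k"
 shows "(f \<longlongrightarrow> 0) F"
 by (rule tendsto_sandwich[OF _ _ tendsto_const assms(1)]) (auto simp: assms(2))

lemma H1_limitD:
 assumes "H1_limit G \<Omega> D u V" "D \<subseteq> H1_smooth G \<Omega>"
 obtains \<phi> where "\<And>k. \<phi> k \<in> D" "sc.conv \<phi> u sequentially" "vf.conv (\<lambda>k. g_grad G (\<phi> k)) V sequentially"
proof -
 obtain \<phi> where \<phi>: "\<And>k. \<phi> k \<in> D"
   "(\<lambda>k. L2_sq G \<Omega> (\<lambda>x. \<phi> k x - u x) + L2_vec_sq G \<Omega> (\<lambda>x. g_grad G (\<phi> k) x - V x)) \<longlonglongrightarrow> 0"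
  and m: "u \<in> borel_measurable \<mu>" "V \<in> borel_measurable \<mu>"
  using assms(1) unfolding H1_limit_def by auto
 have "sc.conv \<phi> u sequentially"
  by (rule sc_convI[OF H1_smoothD(2) m(1)]) (use \<phi> assms(2) in "auto intro: ennreal_tendsto_zero_mono")
 moreover have "vf.conv (\<lambda>k. g_grad G (\<phi> k)) V sequentially"
  by (rule vf_convI[OF H1_smoothD(3) m(2)]) (use \<phi> assms(2) in "auto intro: ennreal_tendsto_zero_mono")
 ultimately show ?thesis using \<phi>(1) that by blast
qed

lemma wk_grad_limit:
 assumes \<phi>: "\<And>k. C1_on \<Omega> (\<phi> k)" "sc.conv \<phi> u sequentially" "vf.conv (\<lambda>k. g_grad G (\<phi> k)) V sequentially"
 shows "wk_grad u V"
proof -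
 have "vf.ip V (\<lambda>x. axis j (\<psi> x)) = - sc.ip u (dual_partial j \<psi>)" if \<psi>: "C1c \<Omega> \<psi>" for \<psi> j
 proof (rule LIMSEQ_unique)
  show "(\<lambda>k. vf.ip (g_grad G (\<phi> k)) (\<lambda>x. axis j (\<psi> x))) \<longlonglongrightarrow> vf.ip V (\<lambda>x. axis j (\<psi> x))"
   by (rule vf.conv_tendsto_ip[OF \<phi>(3) vf.conv_const[OF test_sqi(2)[OF \<psi>]]])
  show "(\<lambda>k. vf.ip (g_grad G (\<phi> k)) (\<lambda>x. axis j (\<psi> x))) \<longlonglongrightarrow> - sc.ip u (dual_partial j \<psi>)"
   using tendsto_minus[OF sc.conv_tendsto_ip[OF \<phi>(2) sc.conv_const[OF test_sqi(4)[OF \<psi>]]]]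
   by (simp add: smooth_weak_gradient[OF \<phi>(1) \<psi>])
 qed
 then show ?thesis using \<phi>(2,3) unfolding wk_grad_def sc.conv_def vf.conv_def by blast
qed

lemma H1_limit_wk_grad:
 assumes "H1_limit G \<Omega> D u V" "D \<subseteq> H1_smooth G \<Omega>"
 shows "wk_grad u V"
proof -
 obtain \<phi> where \<phi>: "\<And>k. \<phi> k \<in> D" "sc.conv \<phi> u sequentially" "vf.conv (\<lambda>k. g_grad G (\<phi> k)) V sequentially"
  using H1_limitD[OF assms] by metis
 show ?thesis by (rule wk_grad_limit[OF H1_smoothD(1) \<phi>(2,3)]) (use \<phi>(1) assms(2) in auto)
qed

lemma H2_limitD:
 assumes "H2_limit G \<Omega> u V L"
 obtains \<phi> where "\<And>k. \<phi> k \<in> H2_smooth G \<Omega>" "sc.conv \<phi> u sequentially"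
  "vf.conv (\<lambda>k. g_grad G (\<phi> k)) V sequentially" "sc.conv (\<lambda>k. g_laplacian G (\<phi> k)) L sequentially"
  "H1_limit G \<Omega> (H1_smooth G \<Omega>) u V"
proof -
 obtain \<phi> where \<phi>: "\<And>k. \<phi> k \<in> H2_smooth G \<Omega>"
   "(\<lambda>k. L2_sq G \<Omega> (\<lambda>x. \<phi> k x - u x) + L2_vec_sq G \<Omega> (\<lambda>x. g_grad G (\<phi> k) x - V x)
     + L2_sq G \<Omega> (\<lambda>x. g_laplacian G (\<phi> k) x - L x)) \<longlonglongrightarrow> 0"
  and m: "u \<in> borel_measurable \<mu>" "V \<in> borel_measurable \<mu>" "L \<in> borel_measurable \<mu>"
  using assms(1) unfolding H2_limit_def by auto
 have h1: "\<phi> k \<in> H1_smooth G \<Omega>" for k using \<phi>(1) H2_smooth_H1 by blast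
 have "H1_limit G \<Omega> (H1_smooth G \<Omega>) u V"
  unfolding H1_limit_def using m h1
  by (auto intro!: exI[of _ \<phi>] ennreal_tendsto_zero_mono[OF \<phi>(2)])
 moreover have "sc.conv \<phi> u sequentially"
  by (rule sc_convI[OF H1_smoothD(2)[OF h1] m(1) ennreal_tendsto_zero_mono[OF \<phi>(2)]]) (auto simp: add_increasing2 intro: add_increasing2)
 moreover have "vf.conv (\<lambda>k. g_grad G (\<phi> k)) V sequentially"
  by (rule vf_convI[OF H1_smoothD(3)[OF h1] m(2) ennreal_tendsto_zero_mono[OF \<phi>(2)]]) (auto intro: add_increasing2 add_increasing)
 moreover have "sc.conv (\<lambda>k. g_laplacian G (\<phi> k)) L sequentially"
  by (rule sc_convI[OF H2_smooth_laplacian[OF \<phi>(1)] m(3) ennreal_tendsto_zero_mono[OF \<phi>(2)]]) (auto intro: add_increasing)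
 ultimately show ?thesis using \<phi>(1) that by blast
qed

lemma H2_limit_wk:
 assumes "H2_limit G \<Omega> u V L"
 shows "wk_grad u V" "wk_lap V L"
proof -
 obtain \<phi> where \<phi>: "\<And>k. \<phi> k \<in> H2_smooth G \<Omega>" "sc.conv \<phi> u sequentially"
  "vf.conv (\<lambda>k. g_grad G (\<phi> k)) V sequentially" "sc.conv (\<lambda>k. g_laplacian G (\<phi> k)) L sequentially"
  "H1_limit G \<Omega> (H1_smooth G \<Omega>) u V"
  using H2_limitD[OF assms] by metis
 show "wk_grad u V" by (rule H1_limit_wk_grad[OF \<phi>(5)]) simp
 have "sc.ip L \<psi> = - vf.ip V (g_grad G \<psi>)" if \<psi>: "C1c \<Omega> \<psi>" for \<psi>
 proof (rule LIMSEQ_unique)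
  show "(\<lambda>k. sc.ip (g_laplacian G (\<phi> k)) \<psi>) \<longlonglongrightarrow> sc.ip L \<psi>"
   by (rule sc.conv_tendsto_ip[OF \<phi>(4) sc.conv_const[OF test_sqi(1)[OF \<psi>]]])
  have "sc.ip (g_laplacian G (\<phi> k)) \<psi> = - vf.ip (g_grad G (\<phi> k)) (g_grad G \<psi>)" for k
   by (rule smooth_weak_laplacian[OF g_grad_C1[OF H2_smooth_smooth[OF \<phi>(1)]] \<psi>])
  then show "(\<lambda>k. sc.ip (g_laplacian G (\<phi> k)) \<psi>) \<longlonglongrightarrow> - vf.ip V (g_grad G \<psi>)"
   using tendsto_minus[OF vf.conv_tendsto_ip[OF \<phi>(3) vf.conv_const[OF test_sqi(3)[OF \<psi>]]]] by simp
 qed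
 then show "wk_lap V L" using \<phi> unfolding wk_lap_def sc.conv_def vf.conv_def by blast
qed

text \<open>
 The gradient of a Sobolev function is an arbitrary choice among the limits of gradients of
 approximating sequences.  Every such limit is a weak gradient, hence the choice does not matter.
\<close>

lemma sob_grad_H1:
 assumes "u \<in> H1_space G \<Omega>"
 shows "wk_grad u (sob_grad G \<Omega> u)"
proof -
 have "H1_limit G \<Omega> (H1_smooth G \<Omega>) u (sob_grad G \<Omega> u)"
 proof -
  obtain V where "H1_limit G \<Omega> (H1_smooth G \<Omega>) u V" using assms unfolding H1_space_def by auto
  then show ?thesis unfolding sob_grad_def by (rule someI[where P = "H1_limit G \<Omega> (H1_smooth G \<Omega>) u"])
 qed
 then show ?thesis by (rule H1_limit_wk_grad) simp
qed

lemma sob_laplacian_H2: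
 assumes "u \<in> H2_space G \<Omega>"
 shows "u \<in> H1_space G \<Omega>" "wk_lap (sob_grad G \<Omega> u) (sob_laplacian G \<Omega> u)" (is ?th1)
proof -
 have "\<exists>V. H2_limit G \<Omega> u V (sob_laplacian G \<Omega> u)"
 proof -
  obtain V L where "H2_limit G \<Omega> u V L" using assms unfolding H2_space_def by auto
  then have "\<exists>L. \<exists>V. H2_limit G \<Omega> u V L" by blast
  then show ?thesis unfolding sob_laplacian_def by (rule someI_ex)
 qed
 then obtain V where V: "H2_limit G \<Omega> u V (sob_laplacian G \<Omega> u)" by blast
 show h: "u \<in> H1_space G \<Omega>" using H2_limitD[OF V] unfolding H1_space_def by blast
 have s: "wk_grad u (sob_grad G \<Omega> u)" by (rule sob_grad_H1[OF h])
 have ae: "AE x in \<mu>. V x = sob_grad G \<Omega> u x"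
  by (rule wk_grad_unique[OF H2_limit_wk(1)[OF V] s])
 have wl: "wk_lap V (sob_laplacian G \<Omega> u)" by (rule H2_limit_wk(2)[OF V])
 have "vf.ip V (g_grad G \<psi>) = vf.ip (sob_grad G \<Omega> u) (g_grad G \<psi>)" if "C1c \<Omega> \<psi>" for \<psi>
  by (rule vf.ip_cong_AE[OF ae])
   (use wl s vf.sqi_meas[OF test_sqi(3)[OF that]] in "auto simp: wk_lap_def wk_grad_def vf.sqi_def")
 then show ?th1
  using wl s by (simp add: wk_lap_def wk_grad_def)
qed

lemma H2_space_diff:
 assumes "u \<in> H2_space G \<Omega>" "u' \<in> H2_space G \<Omega>"
 shows "(\<lambda>x. u x - u' x) \<in> H2_space G \<Omega>"
proof -
 obtain V L V' L' where H: "H2_limit G \<Omega> u V L" "H2_limit G \<Omega> u' V' L'"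
  using assms unfolding H2_space_def by auto
 obtain \<phi> where \<phi>: "\<And>k. \<phi> k \<in> H2_smooth G \<Omega>" "sc.conv \<phi> u sequentially"
  "vf.conv (\<lambda>k. g_grad G (\<phi> k)) V sequentially" "sc.conv (\<lambda>k. g_laplacian G (\<phi> k)) L sequentially"
  using H2_limitD[OF H(1)] by metis
 obtain \<phi>' where \<phi>': "\<And>k. \<phi>' k \<in> H2_smooth G \<Omega>" "sc.conv \<phi>' u' sequentially"
  "vf.conv (\<lambda>k. g_grad G (\<phi>' k)) V' sequentially" "sc.conv (\<lambda>k. g_laplacian G (\<phi>' k)) L' sequentially"
  using H2_limitD[OF H(2)] by metis
 let ?d = "\<lambda>k x. \<phi> k x - \<phi>' k x"
 note sm = H2_smooth_smooth[OF \<phi>(1)] H2_smooth_smooth[OF \<phi>'(1)]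
 have sd: "smooth_closure \<Omega> (?d k)" for k by (rule smooth_closure_diff[OF sm])
 have gd: "g_grad G (?d k) x = g_grad G (\<phi> k) x - g_grad G (\<phi>' k) x" if "x \<in> \<Omega>" for k x
  by (rule g_grad_linear) (use sm smooth_closure_C1(1) C1_on_differentiable that in blast)+
 have ld: "g_laplacian G (?d k) x = g_laplacian G (\<phi> k) x - g_laplacian G (\<phi>' k) x" if "x \<in> \<Omega>" for k x
  by (rule g_laplacian_linear[OF sm that])
 have c: "sc.conv ?d (\<lambda>x. u x - u' x) sequentially"
  "vf.conv (\<lambda>k x. g_grad G (\<phi> k) x - g_grad G (\<phi>' k) x) (\<lambda>x. V x - V' x) sequentially"
  "sc.conv (\<lambda>k x. g_laplacian G (\<phi> k) x - g_laplacian G (\<phi>' k) x) (\<lambda>x. L x - L' x) sequentially"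
  by (intro sc.conv_diff vf.conv_diff \<phi> \<phi>')+
 have s1: "sc.sqi (?d k)" for k by (intro sc.sqi_diff H1_smoothD(2) H2_smooth_H1 \<phi> \<phi>')
 have s2: "vf.sqi (\<lambda>x. g_grad G (\<phi> k) x - g_grad G (\<phi>' k) x)" for k
  by (intro vf.sqi_diff H1_smoothD(3) H2_smooth_H1 \<phi> \<phi>')
 have s3: "sc.sqi (\<lambda>x. g_laplacian G (\<phi> k) x - g_laplacian G (\<phi>' k) x)" for k
  by (intro sc.sqi_diff H2_smooth_laplacian \<phi> \<phi>')
 have e2: "L2_vec_sq G \<Omega> (\<lambda>x. g_grad G (?d k) x - W x) = L2_vec_sq G \<Omega> (\<lambda>x. (g_grad G (\<phi> k) x - g_grad G (\<phi>' k) x) - W x)" for k W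
  unfolding L2_vec_sq_def by (rule nn_integral_cong) (simp add: gd)
 have e3: "L2_sq G \<Omega> (\<lambda>x. g_laplacian G (?d k) x - W x) = L2_sq G \<Omega> (\<lambda>x. (g_laplacian G (\<phi> k) x - g_laplacian G (\<phi>' k) x) - W x)" for k W
  unfolding L2_sq_def by (rule nn_integral_cong) (simp add: ld)
 have d: "?d k \<in> H2_smooth G \<Omega>" for k
  using e2[of k "\<lambda>_. 0"] e3[of k "\<lambda>_. 0"] s1[of k] s2[of k] s3[of k] sd[of k]
  by (simp add: H2_smooth_def sc_sqi_iff vf_sqi_iff)
 have z: "sc.sqi (\<lambda>x. u x - u' x)" "vf.sqi (\<lambda>x. V x - V' x)" "sc.sqi (\<lambda>x. L x - L' x)"
  using c by (auto simp: sc.conv_def vf.conv_def)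
 have "H2_limit G \<Omega> (\<lambda>x. u x - u' x) (\<lambda>x. V x - V' x) (\<lambda>x. L x - L' x)"
  unfolding H2_limit_def
 proof (intro conjI exI[of _ ?d] allI)
  show "(\<lambda>x. u x - u' x) \<in> borel_measurable \<mu>" "(\<lambda>x. V x - V' x) \<in> borel_measurable \<mu>" "(\<lambda>x. L x - L' x) \<in> borel_measurable \<mu>"
   using z by (auto simp: sc.sqi_def vf.sqi_def)
  show "?d k \<in> H2_smooth G \<Omega>" for k by (rule d)
  show "(\<lambda>k. L2_sq G \<Omega> (\<lambda>x. ?d k x - (u x - u' x)) + L2_vec_sq G \<Omega> (\<lambda>x. g_grad G (?d k) x - (V x - V' x))
    + L2_sq G \<Omega> (\<lambda>x. g_laplacian G (?d k) x - (L x - L' x))) \<longlonglongrightarrow> 0"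
   unfolding e2 e3
   using tendsto_add[OF tendsto_add[OF sc_conv_L2[OF _ z(1) c(1)] vf_conv_L2[OF _ z(2) c(2)]] sc_conv_L2[OF _ z(3) c(3)]] by (simp add: s1 s2 s3)
 qed
 then show ?thesis unfolding H2_space_def by blast
qed

text \<open>
 Linearity up to null sets: a choice of representatives need not be linear, but differences of
 weak derivatives are weak derivatives of differences.
\<close>

lemma sob_diff_AE:
 assumes u: "u \<in> H2_space G \<Omega>" and u': "u' \<in> H2_space G \<Omega>"
 shows "AE x in \<mu>. sob_grad G \<Omega> (\<lambda>x. u x - u' x) x = sob_grad G \<Omega> u x - sob_grad G \<Omega> u' x"
  and "AE x in \<mu>. sob_laplacian G \<Omega> (\<lambda>x. u x - u' x) x = sob_laplacian G \<Omega> u x - sob_laplacian G \<Omega> u' x"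
proof -
 let ?V = "sob_grad G \<Omega>" and ?L = "sob_laplacian G \<Omega>" and ?d = "\<lambda>x. u x - u' x"
 note d = H2_space_diff[OF u u']
 note g = sob_grad_H1[OF sob_laplacian_H2(1)] and l = sob_laplacian_H2(2)
 have wd: "wk_grad ?d (\<lambda>x. ?V u x - ?V u' x)"
  using g[OF u] g[OF u'] unfolding wk_grad_def
  by (auto simp: sc.sqi_diff vf.sqi_diff vf.ip_diff sc.ip_diff test_sqi)
 show ae: "AE x in \<mu>. ?V ?d x = ?V u x - ?V u' x"
  by (rule wk_grad_unique[OF g[OF d] wd])
 have "wk_lap (\<lambda>x. ?V u x - ?V u' x) (\<lambda>x. ?L u x - ?L u' x)"
  using l[OF u] l[OF u'] unfolding wk_lap_def
  by (auto simp: sc.sqi_diff vf.sqi_diff vf.ip_diff sc.ip_diff test_sqi)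
 then show "AE x in \<mu>. ?L ?d x = ?L u x - ?L u' x"
  by (rule wk_lap_unique[OF l[OF d] _ ae])
qed

end


section \<open>Functions vanishing on the boundary\<close>

text \<open>
 The ratio \<open>q = (y\<^sup>2 - \<epsilon>\<^sup>2)\<^sup>+ / (y\<^sup>2 + \<epsilon>\<^sup>2)\<close> lies between 0 and 1, vanishes for
 \<open>\<bar>y\<bar> \<le> \<epsilon>\<close> and tends to 1 as \<open>\<epsilon> \<rightarrow> 0\<close> for \<open>y \<noteq> 0\<close>.  Its square is continuously
 differentiable, so \<open>soft \<epsilon> y = y q\<^sup>2\<close> removes the part of a function near its zero set by a
 \<open>C\<^sup>1\<close> modification, at the price of a bounded factor in the derivative.
\<close>

definition qratio :: "real \<Rightarrow> real \<Rightarrow> real" where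
 "qratio \<epsilon> y = max 0 (y\<^sup>2 - \<epsilon>\<^sup>2) / (y\<^sup>2 + \<epsilon>\<^sup>2)"

definition soft :: "real \<Rightarrow> real \<Rightarrow> real" where
 "soft \<epsilon> y = y * (qratio \<epsilon> y)\<^sup>2"

definition soft' :: "real \<Rightarrow> real \<Rightarrow> real" where
 "soft' \<epsilon> y = (qratio \<epsilon> y)\<^sup>2 + 4 * (y\<^sup>2 / (y\<^sup>2 + \<epsilon>\<^sup>2)) * (qratio \<epsilon> y * (1 - qratio \<epsilon> y))"

lemma qratio_range:
 assumes "\<epsilon> > 0" shows "0 \<le> qratio \<epsilon> y" "qratio \<epsilon> y \<le> 1"
proof -
 have "y\<^sup>2 + \<epsilon>\<^sup>2 > 0" "max 0 (y\<^sup>2 - \<epsilon>\<^sup>2) \<le> y\<^sup>2 + \<epsilon>\<^sup>2" using assms by (simp_all add: add_nonneg_pos)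
 then show "0 \<le> qratio \<epsilon> y" "qratio \<epsilon> y \<le> 1" by (auto simp: qratio_def)
qed

lemma soft_small: "\<epsilon> > 0 \<Longrightarrow> \<bar>y\<bar> \<le> \<epsilon> \<Longrightarrow> soft \<epsilon> y = 0"
 using abs_le_square_iff[of y \<epsilon>] by (simp add: soft_def qratio_def)


lemma soft'_range:
 assumes "\<epsilon> > 0" shows "\<bar>soft' \<epsilon> y - 1\<bar> \<le> 4"
proof -
 note q = qratio_range[OF assms, of y]
 have B: "y\<^sup>2 + \<epsilon>\<^sup>2 > 0" using assms by (simp add: add_nonneg_pos)
 have r: "0 \<le> y\<^sup>2 / (y\<^sup>2 + \<epsilon>\<^sup>2)" "y\<^sup>2 / (y\<^sup>2 + \<epsilon>\<^sup>2) \<le> 1" using B by auto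
 have "0 \<le> y\<^sup>2 / (y\<^sup>2 + \<epsilon>\<^sup>2) * (qratio \<epsilon> y * (1 - qratio \<epsilon> y))" "y\<^sup>2 / (y\<^sup>2 + \<epsilon>\<^sup>2) * (qratio \<epsilon> y * (1 - qratio \<epsilon> y)) \<le> 1 * (1 * 1)"
  using q r by (intro mult_nonneg_nonneg mult_mono; simp)+
 moreover have "0 \<le> (qratio \<epsilon> y)\<^sup>2" "(qratio \<epsilon> y)\<^sup>2 \<le> 1" using q by (auto simp: power_le_one)
 ultimately show ?thesis unfolding soft'_def mult.assoc[of 4] by linarith
qed

lemma soft_derivative:
 assumes e: "\<epsilon> > 0"
 shows "(soft \<epsilon> has_real_derivative soft' \<epsilon> y) (at y)"
proof -
 let ?A = "max 0 (y\<^sup>2 - \<epsilon>\<^sup>2)" and ?B = "y\<^sup>2 + \<epsilon>\<^sup>2"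
 have B: "?B > 0" using e by (simp add: add_nonneg_pos)
 have "((\<lambda>y. (max 0 (y\<^sup>2 - \<epsilon>\<^sup>2))\<^sup>2) has_real_derivative 2 * ?A * (2 * y)) (at y)"
  by (rule DERIV_chain2[OF has_derivative_pos_part_sq]) (auto intro!: derivative_eq_intros)
 moreover have "((\<lambda>y. (y\<^sup>2 + \<epsilon>\<^sup>2)\<^sup>2) has_real_derivative 2 * ?B * (2 * y)) (at y)"
  by (auto intro!: derivative_eq_intros)
 ultimately have "((\<lambda>y. y * ((max 0 (y\<^sup>2 - \<epsilon>\<^sup>2))\<^sup>2 / (y\<^sup>2 + \<epsilon>\<^sup>2)\<^sup>2)) has_real_derivative
   y * ((2 * ?A * (2 * y) * ?B\<^sup>2 - ?A\<^sup>2 * (2 * ?B * (2 * y))) / (?B\<^sup>2 * ?B\<^sup>2)) + 1 * (?A\<^sup>2 / ?B\<^sup>2)) (at y)"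
  using B by (intro DERIV_mult' DERIV_divide DERIV_ident) auto
 moreover have "y * ((2 * a * (2 * y) * b\<^sup>2 - a\<^sup>2 * (2 * b * (2 * y))) / (b\<^sup>2 * b\<^sup>2)) + 1 * (a\<^sup>2 / b\<^sup>2)
   = (a / b)\<^sup>2 + 4 * (y\<^sup>2 / b) * (a / b * (1 - a / b))" if "b > 0" for a b :: real
  using that by (simp add: field_simps power2_eq_square)
 note this[OF B, of ?A]
 moreover have "(\<lambda>y. y * ((max 0 (y\<^sup>2 - \<epsilon>\<^sup>2))\<^sup>2 / (y\<^sup>2 + \<epsilon>\<^sup>2)\<^sup>2)) = soft \<epsilon>"
  by (simp add: fun_eq_iff soft_def qratio_def power_divide)
 ultimately show ?thesis by (simp only: soft'_def qratio_def)
qed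

lemma soft_chain:
 fixes f :: "real^'n \<Rightarrow> real" and c :: complex
 assumes e: "\<epsilon> > 0" and f: "C1_on S f"
 shows "C1_on S (\<lambda>x. soft \<epsilon> (f x) *\<^sub>R c)" (is ?th1)
  and "x \<in> S \<Longrightarrow> partial_deriv i (\<lambda>x. soft \<epsilon> (f x) *\<^sub>R c) x = soft' \<epsilon> (f x) *\<^sub>R partial_deriv i (\<lambda>x. f x *\<^sub>R c) x"
proof -
 have nz: "y\<^sup>2 + \<epsilon>\<^sup>2 \<noteq> 0" for y using e by (metis add_nonneg_pos less_irrefl zero_le_power2 zero_less_power)
 have "C1_on S (\<lambda>x. soft \<epsilon> (f x))"
  by (rule C1_on_compose_real[OF f, where g' = "soft' \<epsilon>"])
   (use soft_derivative[OF e] nz in "auto simp: has_real_derivative_iff_has_vector_derivative soft'_def qratio_def intro!: continuous_intros")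
 then show ?th1 by (intro C1_on_scaleR C1_on_const)
 assume x: "x \<in> S"
 note d = C1_on_deriv[OF f x]
 have "((\<lambda>x. soft \<epsilon> (f x) *\<^sub>R c) has_derivative (\<lambda>v. (soft' \<epsilon> (f x) * (\<Sum>i\<in>UNIV. v $ i *\<^sub>R partial_deriv i f x)) *\<^sub>R c)) (at x)"
  by (intro has_derivative_scaleR_left has_derivative_compose[OF d soft_derivative[OF e, unfolded has_field_derivative_def]])
 from partial_deriv_eq[OF this, of i] partial_deriv_eq[OF has_derivative_scaleR_left[OF d, of c], of i]
 show "partial_deriv i (\<lambda>x. soft \<epsilon> (f x) *\<^sub>R c) x = soft' \<epsilon> (f x) *\<^sub>R partial_deriv i (\<lambda>x. f x *\<^sub>R c) x" by simp
qed

lemma soft_tendsto: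
 assumes e: "\<And>k. \<epsilon> k > 0" "\<epsilon> \<longlonglongrightarrow> 0"
 shows "(\<lambda>k. soft (\<epsilon> k) y) \<longlonglongrightarrow> y" (is ?th1) and "y \<noteq> 0 \<Longrightarrow> (\<lambda>k. soft' (\<epsilon> k) y) \<longlonglongrightarrow> 1"
proof -
 have q: "(\<lambda>k. qratio (\<epsilon> k) y) \<longlonglongrightarrow> 1" and r: "(\<lambda>k. y\<^sup>2 / (y\<^sup>2 + (\<epsilon> k)\<^sup>2)) \<longlonglongrightarrow> 1" if "y \<noteq> 0"
 proof -
  have "(\<lambda>k. max 0 (y\<^sup>2 - (\<epsilon> k)\<^sup>2) / (y\<^sup>2 + (\<epsilon> k)\<^sup>2)) \<longlonglongrightarrow> max 0 (y\<^sup>2 - 0\<^sup>2) / (y\<^sup>2 + 0\<^sup>2)"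
   "(\<lambda>k. y\<^sup>2 / (y\<^sup>2 + (\<epsilon> k)\<^sup>2)) \<longlonglongrightarrow> y\<^sup>2 / (y\<^sup>2 + 0\<^sup>2)"
   using that by (intro tendsto_intros e(2); simp)+
  then show "(\<lambda>k. qratio (\<epsilon> k) y) \<longlonglongrightarrow> 1" "(\<lambda>k. y\<^sup>2 / (y\<^sup>2 + (\<epsilon> k)\<^sup>2)) \<longlonglongrightarrow> 1"
   using that by (simp_all add: qratio_def)
 qed
 show ?th1
 proof (cases "y = 0")
  case False
  have "(\<lambda>k. y * (qratio (\<epsilon> k) y)\<^sup>2) \<longlonglongrightarrow> y * 1\<^sup>2" by (intro tendsto_intros q False)
  then show ?thesis by (simp add: soft_def)
 qed (simp add: soft_def)
 assume "y \<noteq> 0"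
 then have "(\<lambda>k. soft' (\<epsilon> k) y) \<longlonglongrightarrow> 1\<^sup>2 + 4 * 1 * (1 * (1 - 1))"
  unfolding soft'_def by (intro tendsto_intros q r)
 then show "(\<lambda>k. soft' (\<epsilon> k) y) \<longlonglongrightarrow> 1" by simp
qed


definition cvec :: "real^'n \<Rightarrow> complex \<Rightarrow> complex^'n" where
 "cvec x z = (\<chi> i. x $ i *\<^sub>R z)"

lemma matrix_act_cvec: "matrix_act A (cvec x z) = cvec (A *v x) z"
 by (simp add: vec_eq_iff matrix_act_nth cvec_def matrix_vector_mult_def scaleR_sum_left)

lemma g_inner_cvec: "g_inner A (cvec x z) (cvec x z) = (x \<bullet> (A *v x)) * (cmod z)\<^sup>2"
proof -
 have "cvec x z \<bullet> cvec y z = (x \<bullet> y) * (cmod z)\<^sup>2" for y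
  by (simp add: cvec_def inner_vec_def power2_norm_eq_inner sum_distrib_left mult_ac)
 then show ?thesis by (simp add: g_inner_eq matrix_act_cvec)
qed

locale radial_domain = riemannian_domain G \<Omega>
 for G :: "real^'n \<Rightarrow> real^'n^'n" and \<Omega> +
 assumes G_radial: "\<And>x. x \<noteq> 0 \<Longrightarrow> G x *v (x /\<^sub>R norm x) = x /\<^sub>R norm x"
  and zero_notin: "0 \<notin> closure \<Omega>"
begin

lemma G_x: "G x *v x = x"
proof (cases "x = 0")
 case False
 have "norm x *\<^sub>R (G x *v (x /\<^sub>R norm x)) = norm x *\<^sub>R (x /\<^sub>R norm x)" using G_radial[OF False] by simp
 then show ?thesis using False by (simp add: matrix_vector_mult_scaleR)
qed simp

lemma Gi_x: "matrix_inv (G x) *v x = x"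
 using arg_cong[OF G_x[of x], of "(*v) (matrix_inv (G x))"] by (simp add: matrix_vector_mul_assoc G_inv)

text \<open>
 A \<open>C\<^sup>1\<close> cut-off at infinity.  It is radial, and \<open>G x = x\<close>, so that the norm of its gradient in
 the metric is the Euclidean one and tends to 0 uniformly.
\<close>

definition cut :: "real \<Rightarrow> real^'n \<Rightarrow> real" where
 "cut R x = (max 0 (1 - (x \<bullet> x) / R\<^sup>2))\<^sup>2"

definition cut_rate :: "real \<Rightarrow> real^'n \<Rightarrow> real" where
 "cut_rate R x = - 4 * max 0 (1 - (x \<bullet> x) / R\<^sup>2) / R\<^sup>2"

lemma C1_on_inner_self: "C1_on S (\<lambda>x::real^'n. x \<bullet> x)"
 unfolding inner_vec_def by (intro C1_on_sum C1_on_inner C1_on_nth)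

lemma C1_on_cut: "C1_on S (cut R)"
 unfolding cut_def divide_inverse by (intro C1_on_pos_part_sq C1_on_diff C1_on_const C1_on_mult C1_on_inner_self)

lemma partial_deriv_cut: "partial_deriv i (cut R) x = cut_rate R x * x $ i"
proof -
 have "((\<lambda>x. 1 - (x \<bullet> x) * inverse (R\<^sup>2)) has_derivative (\<lambda>v. - (2 * (x \<bullet> v)) * inverse (R\<^sup>2))) (at x)"
  by (auto intro!: derivative_eq_intros simp: inner_commute)
 then have "((\<lambda>x. 1 - (x \<bullet> x) / R\<^sup>2) has_derivative (\<lambda>v. - (2 * (x \<bullet> v)) / R\<^sup>2)) (at x)"
  by (simp only: divide_inverse)
 from has_derivative_compose[OF this has_derivative_pos_part_sq[unfolded has_field_derivative_def]]
 have "(cut R has_derivative (\<lambda>v. 2 * max 0 (1 - (x \<bullet> x) / R\<^sup>2) * (- (2 * (x \<bullet> v)) / R\<^sup>2))) (at x)"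
  unfolding cut_def .
 from partial_deriv_eq[OF this, of i] show ?thesis
  by (simp add: cut_rate_def inner_axis)
qed

lemma cut_range: "0 \<le> cut R x" "cut R x \<le> 1"
proof -
 have "0 \<le> max 0 (1 - (x \<bullet> x) / R\<^sup>2)" "max 0 (1 - (x \<bullet> x) / R\<^sup>2) \<le> 1" by auto
 then show "0 \<le> cut R x" "cut R x \<le> 1" unfolding cut_def by (auto simp: power_le_one)
qed

lemma cut_outside: "R > 0 \<Longrightarrow> norm x \<ge> R \<Longrightarrow> cut R x = 0 \<and> cut_rate R x = 0"
proof -
 assume R: "R > 0" "norm x \<ge> R"
 then have "R\<^sup>2 \<le> (norm x)\<^sup>2" by (simp add: power_mono)
 then have "1 - (x \<bullet> x) / R\<^sup>2 \<le> 0" using R by (simp add: power2_norm_eq_inner)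
 then show ?thesis by (simp add: cut_def cut_rate_def max_absorb1)
qed

lemma cut_rate_bound:
 assumes "R > 0" shows "(cut_rate R x)\<^sup>2 * (x \<bullet> x) \<le> 16 / R\<^sup>2"
proof (cases "norm x \<ge> R")
 case True then show ?thesis using cut_outside[OF assms True] by simp
next
 case False
 let ?m = "max 0 (1 - (x \<bullet> x) / R\<^sup>2)"
 have m: "?m\<^sup>2 \<le> 1" by (rule power_le_one) auto
 have "x \<bullet> x \<le> R\<^sup>2"
  using False assms by (simp add: power2_norm_eq_inner[symmetric] power_mono)
 then have "?m\<^sup>2 * (x \<bullet> x) \<le> 1 * R\<^sup>2" using m by (intro mult_mono) auto
 then have "16 * (?m\<^sup>2 * (x \<bullet> x)) / (R\<^sup>2 * R\<^sup>2) \<le> 16 * R\<^sup>2 / (R\<^sup>2 * R\<^sup>2)"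
  by (intro divide_right_mono mult_left_mono) auto
 then show ?thesis using assms
  by (simp add: cut_rate_def power_divide power_mult_distrib power2_eq_square)
qed


text \<open>
 The closure of the test functions in \<open>H\<^sup>1\<close>, paired with the limits of the gradients.  Approximation
 by compactly supported functions replaces boundary traces throughout.
\<close>

definition H10 :: "(real^'n \<Rightarrow> complex) \<Rightarrow> (real^'n \<Rightarrow> complex^'n) \<Rightarrow> bool" where
 "H10 u V \<longleftrightarrow> (\<exists>\<phi>. (\<forall>k::nat. C1c \<Omega> (\<phi> k)) \<and> sc.conv \<phi> u sequentially \<and> vf.conv (\<lambda>k. g_grad G (\<phi> k)) V sequentially)"

lemma H10E:
 assumes "H10 u V"
 obtains \<phi> where "\<And>k. C1c \<Omega> (\<phi> k)" "sc.conv \<phi> u sequentially" "vf.conv (\<lambda>k. g_grad G (\<phi> k)) V sequentially"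
  "sc.sqi u" "vf.sqi V"
 using assms unfolding H10_def sc.conv_def vf.conv_def by blast

lemma H10_diff:
 assumes "H10 u U" "H10 v V"
 shows "H10 (\<lambda>x. u x - v x) (\<lambda>x. U x - V x)"
proof -
 obtain \<phi> where \<phi>: "\<And>k. C1c \<Omega> (\<phi> k)" "sc.conv \<phi> u sequentially" "vf.conv (\<lambda>k. g_grad G (\<phi> k)) U sequentially"
  using H10E[OF assms(1)] by metis
 obtain \<psi> where \<psi>: "\<And>k. C1c \<Omega> (\<psi> k)" "sc.conv \<psi> v sequentially" "vf.conv (\<lambda>k. g_grad G (\<psi> k)) V sequentially"
  using H10E[OF assms(2)] by metis
 have t: "C1c \<Omega> (\<lambda>x. \<phi> k x - \<psi> k x)" for k
  using C1c_add[OF \<phi>(1)[of k] C1c_linear[OF bounded_linear_minus[OF bounded_linear_ident] \<psi>(1)[of k]]] by simp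
 have g: "g_grad G (\<lambda>x. \<phi> k x - \<psi> k x) = (\<lambda>x. g_grad G (\<phi> k) x - g_grad G (\<psi> k) x)" for k
  by (rule ext) (intro g_grad_linear C1c_differentiable[OF \<phi>(1)] C1c_differentiable[OF \<psi>(1)])
 show ?thesis
  unfolding H10_def
  by (rule exI[of _ "\<lambda>k x. \<phi> k x - \<psi> k x"], unfold g,
    intro conjI allI t sc.conv_diff[OF \<phi>(2) \<psi>(2)] vf.conv_diff[OF \<phi>(3) \<psi>(3)])
qed

lemma H10_closed:
 assumes H: "\<And>k::nat. H10 (u k) (U k)" and u: "sc.conv u u0 sequentially" and U: "vf.conv U U0 sequentially"
 shows "H10 u0 U0"
proof -
 define t where "t k = inverse (real (Suc k))" for k
 have t: "t k > 0" "t \<longlonglongrightarrow> 0" for k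
  unfolding t_def[abs_def] by (simp, rule LIMSEQ_inverse_real_of_nat)
 have "\<exists>\<psi>. C1c \<Omega> \<psi> \<and> sc.nrm (\<lambda>x. \<psi> x - u k x) < t k \<and> vf.nrm (\<lambda>x. g_grad G \<psi> x - U k x) < t k" for k
 proof -
  obtain \<psi> where \<psi>: "\<And>j. C1c \<Omega> (\<psi> j)" "sc.conv \<psi> (u k) sequentially" "vf.conv (\<lambda>j. g_grad G (\<psi> j)) (U k) sequentially"
   using H10E[OF H] by metis
  have "\<forall>\<^sub>F j in sequentially. sc.nrm (\<lambda>x. \<psi> j x - u k x) < t k \<and> vf.nrm (\<lambda>x. g_grad G (\<psi> j) x - U k x) < t k"
   using \<psi>(2,3) t(1) unfolding sc.conv_def vf.conv_def by (intro eventually_conj order_tendstoD(2)) auto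
  then show ?thesis using \<psi>(1) eventually_happens sequentially_bot by blast
 qed
 then obtain \<psi> where \<psi>': "\<forall>k. C1c \<Omega> (\<psi> k) \<and> sc.nrm (\<lambda>x. \<psi> k x - u k x) < t k \<and> vf.nrm (\<lambda>x. g_grad G (\<psi> k) x - U k x) < t k"
  using choice[of "\<lambda>k \<psi>. C1c \<Omega> \<psi> \<and> sc.nrm (\<lambda>x. \<psi> x - u k x) < t k \<and> vf.nrm (\<lambda>x. g_grad G \<psi> x - U k x) < t k"] by blast
 have \<psi>: "C1c \<Omega> (\<psi> k)" "sc.nrm (\<lambda>x. \<psi> k x - u k x) < t k" "vf.nrm (\<lambda>x. g_grad G (\<psi> k) x - U k x) < t k" for k
  using spec[OF \<psi>', of k] by simp_all
 have s0: "sc.sqi u0" "vf.sqi U0" using u U by (auto simp: sc.conv_def vf.conv_def)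
 have sk: "sc.sqi (u k)" "vf.sqi (U k)" "sc.sqi (\<psi> k)" "vf.sqi (g_grad G (\<psi> k))" for k
  using H10E[OF H[of k]] test_sqi[OF \<psi>(1)[of k]] by blast+
 have "sc.conv \<psi> u0 sequentially"
 proof (rule sc.conv_dominated)
  show "sc.nrm (\<lambda>x. \<psi> k x - u0 x) \<le> t k + sc.nrm (\<lambda>x. u k x - u0 x)" for k
   using sc.nrm_triangle_via[OF sk(3,1) s0(1), of k k] \<psi>(2)[of k] by simp
  show "(\<lambda>k. t k + sc.nrm (\<lambda>x. u k x - u0 x)) \<longlonglongrightarrow> 0"
   using tendsto_add[OF t(2), of "\<lambda>k. sc.nrm (\<lambda>x. u k x - u0 x)" 0] u by (simp add: sc.conv_def)
 qed (use sk s0 in auto)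
 moreover have "vf.conv (\<lambda>k. g_grad G (\<psi> k)) U0 sequentially"
 proof (rule vf.conv_dominated)
  show "vf.nrm (\<lambda>x. g_grad G (\<psi> k) x - U0 x) \<le> t k + vf.nrm (\<lambda>x. U k x - U0 x)" for k
   using vf.nrm_triangle_via[OF sk(4,2) s0(2), of k k] \<psi>(3)[of k] by simp
  show "(\<lambda>k. t k + vf.nrm (\<lambda>x. U k x - U0 x)) \<longlonglongrightarrow> 0"
   using tendsto_add[OF t(2), of "\<lambda>k. vf.nrm (\<lambda>x. U k x - U0 x)" 0] U by (simp add: vf.conv_def)
 qed (use sk s0 in auto)
 ultimately show ?thesis unfolding H10_def using \<psi>(1) by blast
qed

lemma H10_cong_AE:
 assumes H: "H10 u V" and u: "AE x in \<mu>. u x = u' x" "u' \<in> borel_measurable \<mu>"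
  and V: "AE x in \<mu>. V x = V' x" "V' \<in> borel_measurable \<mu>"
 shows "H10 u' V'"
 using H sc.conv_limit_AE[OF _ u] vf.conv_limit_AE[OF _ V] unfolding H10_def by blast

text \<open>A function supported in a closed subset of \<open>\<Omega>\<close> fails to be a test function only at infinity.\<close>

lemma H10_off_closed:
 assumes f: "C1_on \<Omega> f" and C: "closed C" "C \<subseteq> \<Omega>" "\<And>x. x \<notin> C \<Longrightarrow> f x = 0" and fs: "sc.sqi f" and Vs: "vf.sqi (g_grad G f)"
 shows "H10 f (g_grad G f)"
proof -
 define R where "R k = real (Suc k)" for k
 have R: "R k > 0" for k by (simp add: R_def)
 have Rlim: "(\<lambda>k. c / (R k)\<^sup>2) \<longlonglongrightarrow> 0" for c
  using tendsto_mult[OF tendsto_const[of c] tendsto_power[OF LIMSEQ_inverse_real_of_nat, of 2]]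
  by (simp add: R_def divide_inverse power_inverse)
 let ?V = "g_grad G f" and ?\<psi> = "\<lambda>k x. cut (R k) x *\<^sub>R f x" and ?E = "\<lambda>k x. cut_rate (R k) x *\<^sub>R cvec x (f x)"
 have test: "C1c \<Omega> (?\<psi> k)" for k
  by (rule C1cI[OF open_\<Omega> C1_on_scaleR[OF C1_on_cut f] compact_Int_closed[OF compact_cball[of 0 "R k"] C(1)]])
   (use C cut_outside[OF R[of k]] in "auto simp: not_le intro: less_imp_le")
 have grad: "cut (R k) x *\<^sub>R ?V x + ?E k x = g_grad G (?\<psi> k) x" if x: "x \<in> \<Omega>" for k x
 proof -
  have "partial_deriv i (?\<psi> k) x = cut (R k) x *\<^sub>R partial_deriv i f x + (cut_rate (R k) x * x $ i) *\<^sub>R f x" for i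
   using partial_deriv_scaleR[OF C1_on_differentiable[OF C1_on_cut UNIV_I] C1_on_differentiable[OF f x]] by (simp add: partial_deriv_cut)
  then have "grad_vec (?\<psi> k) x = cut (R k) x *\<^sub>R grad_vec f x + ?E k x"
   by (simp add: vec_eq_iff cvec_def)
  then show ?thesis by (simp add: g_grad_eq matrix_act_add matrix_act_scaleR matrix_act_cvec Gi_x)
 qed
 have cutlim: "(\<lambda>k. cut (R k) x) \<longlonglongrightarrow> 1" for x
 proof -
  have "(\<lambda>k. (max 0 (1 - (x \<bullet> x) / (R k)\<^sup>2))\<^sup>2) \<longlonglongrightarrow> (max 0 (1 - 0))\<^sup>2"
   by (intro tendsto_intros Rlim)
  then show ?thesis by (simp add: cut_def)
 qed
 have cm: "cut (R k) \<in> borel_measurable \<mu>" for k by (rule measurable_\<mu>_cont[OF C1_on_continuous[OF C1_on_cut]])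
 have cb: "\<bar>cut (R k) x\<bar> \<le> 1" for k x using cut_range[of "R k" x] by simp
 have Em: "?E k \<in> borel_measurable \<mu>" for k
  by (rule measurable_\<mu>_cont, unfold cvec_def cut_rate_def divide_inverse) (intro continuous_intros C1_on_continuous[OF f])
 have Eq: "g_inner (G x) (?E k x) (?E k x) \<le> 16 / (R k)\<^sup>2 * (f x \<bullet> f x)" for k x
 proof -
  have "g_inner (G x) (?E k x) (?E k x) = ((cut_rate (R k) x)\<^sup>2 * (x \<bullet> x)) * (cmod (f x))\<^sup>2"
   using g_inner_cvec[of "G x" x "f x"] by (simp add: g_inner_eq matrix_act_scaleR G_x power2_eq_square)
  also have "\<dots> \<le> 16 / (R k)\<^sup>2 * (cmod (f x))\<^sup>2" by (rule mult_right_mono[OF cut_rate_bound[OF R]]) simp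
  finally show ?thesis by (simp add: power2_norm_eq_inner)
 qed
 have fi: "integrable \<mu> (\<lambda>x. 16 / (R k)\<^sup>2 * (f x \<bullet> f x))" for k using fs by (simp add: sc.sqi_def)
 have Es: "vf.sqi (?E k)" for k
  unfolding vf.sqi_def
  by (intro conjI Em Bochner_Integration.integrable_bound[OF fi vf.q_meas[OF Em Em]] AE_I2)
   (use Eq[of _ k] g_inner_nonneg R[of k] in simp)
 have "vf.conv ?E (\<lambda>x. 0) sequentially"
 proof (subst vf.conv_iff_ip)
  show "(\<lambda>k. vf.ip (\<lambda>x. ?E k x - 0) (\<lambda>x. ?E k x - 0)) \<longlonglongrightarrow> 0"
  proof (rule tendsto_sandwich[OF _ _ tendsto_const Rlim[of "16 * sc.ip f f"]])
   have "vf.ip (?E k) (?E k) \<le> 16 * sc.ip f f / (R k)\<^sup>2" for k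
    using integral_mono[OF conjunct2[OF Es[unfolded vf.sqi_def]] fi Eq] by (simp add: vf.ip_def sc.ip_def)
   then show "\<forall>\<^sub>F k in sequentially. vf.ip (\<lambda>x. ?E k x - 0) (\<lambda>x. ?E k x - 0) \<le> 16 * sc.ip f f / (R k)\<^sup>2" by simp
  qed (simp add: vf.ip_nonneg)
 qed (simp_all add: Es vf.sqi_zero)
 from vf.conv_add[OF vf.conv_scalar_dominated[OF Vs cm cb cutlim] this]
 have "vf.conv (\<lambda>k. g_grad G (?\<psi> k)) ?V sequentially"
  by (rule vf.conv_cong) (simp_all add: grad)
 moreover have "sc.conv ?\<psi> f sequentially"
  by (rule sc.conv_cong[OF sc.conv_scalar_dominated[OF fs cm cb cutlim]]) simp_all
 ultimately show ?thesis using test unfolding H10_def by (intro exI[of _ ?\<psi>]) simp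
qed

text \<open>
 Softening at the zero set removes the values near the boundary.  The gradients converge to
 the given one multiplied by the indicator of the nonzero set; the limit being a weak
 gradient of the same function, the factor is immaterial almost everywhere.
\<close>

lemma H10_real_direction:
 fixes f :: "real^'n \<Rightarrow> real" and c :: complex
 defines "u \<equiv> \<lambda>x. f x *\<^sub>R c"
 assumes f: "C1_on \<Omega> f" and cl: "continuous_on (closure \<Omega>) f" and bd: "\<And>x. x \<in> frontier \<Omega> \<Longrightarrow> f x = 0"
  and us: "sc.sqi u" and Vs: "vf.sqi (g_grad G u)"
 shows "H10 u (g_grad G u)"
proof -
 let ?V = "g_grad G u"
 define e where "e k = inverse (real (Suc k))" for k
 have e: "e k > 0" and elim: "e \<longlonglongrightarrow> 0" for k
  unfolding e_def[abs_def] by (simp, rule LIMSEQ_inverse_real_of_nat)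
 define S where "S k x = (if x \<in> \<Omega> then soft (e k) (f x) *\<^sub>R c else 0)" for k x
 define \<beta> where "\<beta> x = (if f x = 0 then 0 else 1 :: real)" for x
 have fm: "f \<in> borel_measurable \<mu>" by (rule measurable_\<mu>_cont[OF C1_on_continuous[OF f]])
 have SC1: "C1_on \<Omega> (S k)" for k
  by (rule C1_on_cong_open[OF soft_chain(1)[OF e f] open_\<Omega>]) (simp add: S_def)
 have gS: "soft' (e k) (f x) *\<^sub>R ?V x = g_grad G (S k) x" if x: "x \<in> \<Omega>" for k x
 proof -
  have "partial_deriv i (S k) x = soft' (e k) (f x) *\<^sub>R partial_deriv i u x" for i
   unfolding u_def soft_chain(2)[OF e f x, symmetric] by (rule partial_deriv_cong_open[OF open_\<Omega> x]) (simp add: S_def)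
  then have "grad_vec (S k) x = soft' (e k) (f x) *\<^sub>R grad_vec u x" by (simp add: vec_eq_iff)
  then show ?thesis by (simp add: g_grad_eq matrix_act_scaleR)
 qed
 have qm: "(\<lambda>x. (qratio (e k) (f x))\<^sup>2) \<in> borel_measurable \<mu>" "(\<lambda>x. soft' (e k) (f x)) \<in> borel_measurable \<mu>" for k
  unfolding soft'_def qratio_def using fm by measurable
 have qb: "\<bar>(qratio (e k) y)\<^sup>2\<bar> \<le> 1" "\<bar>soft' (e k) y\<bar> \<le> 5" for k y
  using qratio_range[OF e[of k], of y] soft'_range[OF e[of k], of y] by (auto simp: power_le_one)
 have S0: "soft (e k) 0 = 0" "soft' (e k) 0 = 0" "qratio (e k) 0 = 0" for k by (simp_all add: soft_def soft'_def qratio_def)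
 have ql: "(\<lambda>k. (qratio (e k) (f x))\<^sup>2) \<longlonglongrightarrow> \<beta> x" "(\<lambda>k. soft' (e k) (f x)) \<longlonglongrightarrow> \<beta> x" for x
  using soft_tendsto(2)[OF e elim, of "f x"] tendsto_divide[OF soft_tendsto(1)[OF e elim, of "f x"] tendsto_const[of "f x"]]
  by (auto simp: \<beta>_def S0) (simp add: soft_def)
 have Sc: "sc.conv S u sequentially"
  by (rule sc.conv_cong[OF sc.conv_scalar_dominated[OF us qm(1) qb(1) ql(1)]]) (auto simp: S_def u_def soft_def \<beta>_def mult_ac)
 have gc: "vf.conv (\<lambda>k. g_grad G (S k)) (\<lambda>x. \<beta> x *\<^sub>R ?V x) sequentially"
  by (rule vf.conv_cong[OF vf.conv_scalar_dominated[OF Vs qm(2) qb(2) ql(2)]]) (auto simp: gS)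
 have "AE x in \<mu>. \<beta> x *\<^sub>R ?V x = ?V x"
 proof (rule wk_grad_unique[OF wk_grad_limit[OF SC1 Sc gc]])
  have "C1_on \<Omega> u" unfolding u_def by (intro C1_on_scaleR f C1_on_const)
  then show "wk_grad u ?V" using us Vs smooth_weak_gradient by (simp add: wk_grad_def)
 qed
 from vf.conv_limit_AE[OF gc this vf.sqi_meas[OF Vs]] have gV: "vf.conv (\<lambda>k. g_grad G (S k)) ?V sequentially" .
 have "H10 (S k) (g_grad G (S k))" for k
 proof (rule H10_off_closed[OF SC1])
  let ?C = "{x \<in> closure \<Omega>. e k \<le> \<bar>f x\<bar>}"
  have "continuous_on (closure \<Omega>) (\<lambda>x. \<bar>f x\<bar>)" by (intro continuous_intros cl)
  from continuous_closed_preimage[OF this closed_closure closed_atLeast[of "e k"]]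
  show "closed ?C" by (simp add: Int_def vimage_def)
  show "?C \<subseteq> \<Omega>" using bd e[of k] open_\<Omega> by (force simp: frontier_def interior_open)
  show "S k x = 0" if "x \<notin> ?C" for x
   using that subsetD[OF closure_subset, of x \<Omega>] soft_small[OF e[of k], of "f x"] by (auto simp: S_def not_le)
  have "sc.sqi (\<lambda>x. (qratio (e k) (f x))\<^sup>2 *\<^sub>R u x)" by (rule sc.bounded_scale(1)[OF qm(1) qb(1) us])
  then show "sc.sqi (S k)" by (subst sc.sqi_cong[where g = "S k", symmetric]) (auto simp: S_def u_def soft_def mult_ac)
  have "vf.sqi (\<lambda>x. soft' (e k) (f x) *\<^sub>R ?V x)" by (rule vf.bounded_scale(1)[OF qm(2) qb(2) Vs])
  then show "vf.sqi (g_grad G (S k))" by (subst vf.sqi_cong[where g = "g_grad G (S k)", symmetric]) (auto simp: gS)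
 qed
 then show ?thesis by (rule H10_closed[OF _ Sc gV])
qed

text \<open>The real and imaginary parts are softened separately, since softening acts on real functions.\<close>

lemma H10_boundary_vanishing:
 assumes sm: "\<phi> \<in> H1_smooth G \<Omega>" and bd: "\<And>x. x \<in> frontier \<Omega> \<Longrightarrow> \<phi> x = 0"
 shows "H10 \<phi> (g_grad G \<phi>)"
proof -
 note \<phi> = H1_smoothD[OF sm]
 obtain U where "closure \<Omega> \<subseteq> U" "smooth_on U \<phi>"
  using sm by (auto simp: H1_smooth_def smooth_closure_def)
 then have cl: "continuous_on (closure \<Omega>) \<phi>" using continuous_on_subset smooth_on_def Ck_on.simps(1) by metis
 have comp: "H10 (\<lambda>x. (\<phi> x \<bullet> e) *\<^sub>R c) (\<lambda>x. \<chi> i. (g_grad G \<phi> x $ i \<bullet> e) *\<^sub>R c)" if [simp]: "cmod e = 1" "cmod c = 1" for e c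
 proof -
  let ?T = "\<lambda>z. (z \<bullet> e) *\<^sub>R c"
  have T: "bounded_linear ?T" by (intro bounded_linear_scaleR_const bounded_linear_inner_left)
  have g: "g_grad G (\<lambda>x. ?T (\<phi> x)) x = (\<chi> i. ?T (g_grad G \<phi> x $ i))" if "x \<in> \<Omega>" for x
   using partial_deriv_linear[OF T C1_on_differentiable[OF \<phi>(1) that]]
   by (simp add: vec_eq_iff g_grad_def inner_sum_left scaleR_sum_left)
  have le: "g_inner (G x) (\<chi> i. ?T (X $ i)) (\<chi> i. ?T (X $ i)) \<le> g_inner (G x) X X" for x and X :: "complex^'n"
  proof -
   have ee: "z \<bullet> w = (z \<bullet> e) * (w \<bullet> e) + (z \<bullet> (\<i> * e)) * (w \<bullet> (\<i> * e))" for z w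
   proof -
    have n: "(Re e)\<^sup>2 + (Im e)\<^sup>2 = 1" using cmod_power2[of e] by simp
    have "(z \<bullet> e) * (w \<bullet> e) + (z \<bullet> (\<i> * e)) * (w \<bullet> (\<i> * e)) = (z \<bullet> w) * ((Re e)\<^sup>2 + (Im e)\<^sup>2)"
     by (simp add: inner_complex_def algebra_simps power2_eq_square)
    then show ?thesis by (simp add: n)
   qed
   let ?X1 = "\<chi> i. ?T (X $ i)" and ?X2 = "\<chi> i. (X $ i \<bullet> (\<i> * e)) *\<^sub>R c"
   have cc: "(s *\<^sub>R c) \<bullet> (t *\<^sub>R c) = s * t" for s t using power2_norm_eq_inner[of c] by simp
   have "g_inner (G x) X X = g_inner (G x) ?X1 ?X1 + g_inner (G x) ?X2 ?X2"
    by (simp add: g_inner_def cc ee[of "X $ _" "X $ _"] distrib_left sum.distrib del: inner_scaleR_left inner_scaleR_right)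
   then show ?thesis using g_inner_nonneg[of x ?X2] by simp
  qed
  have m: "(\<lambda>x. \<chi> i. ?T (g_grad G \<phi> x $ i)) \<in> borel_measurable \<mu>"
   unfolding borel_measurable_vec_iff[of "\<lambda>x. \<chi> i. _ x i"] vec_lambda_beta
   using borel_measurable_vec_iff[THEN iffD1, OF vf.sqi_meas[OF \<phi>(3)]] by (intro allI borel_measurable_scaleR borel_measurable_inner) auto
  have Vs: "vf.sqi (\<lambda>x. \<chi> i. ?T (g_grad G \<phi> x $ i))"
   unfolding vf.sqi_def
   by (intro conjI m Bochner_Integration.integrable_bound[OF conjunct2[OF \<phi>(3)[unfolded vf.sqi_def]] vf.q_meas[OF m m]] AE_I2)
    (use le g_inner_nonneg in simp)
  have us: "sc.sqi (\<lambda>x. ?T (\<phi> x))"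
   unfolding sc.sqi_def
  proof (intro conjI)
   show b: "(\<lambda>x. ?T (\<phi> x)) \<in> borel_measurable \<mu>" using sc.sqi_meas[OF \<phi>(2)] by measurable
   show "integrable \<mu> (\<lambda>x. ?T (\<phi> x) \<bullet> ?T (\<phi> x))"
   proof (rule Bochner_Integration.integrable_bound[OF conjunct2[OF \<phi>(2)[unfolded sc.sqi_def]] sc.q_meas[OF b b]], rule AE_I2)
    fix x
    have "\<bar>\<phi> x \<bullet> e\<bar> \<le> cmod (\<phi> x)" using Cauchy_Schwarz_ineq2[of "\<phi> x" e] by simp
    then have "(cmod (?T (\<phi> x)))\<^sup>2 \<le> (cmod (\<phi> x))\<^sup>2" using power_mono[OF _ abs_ge_zero, of "\<phi> x \<bullet> e" "cmod (\<phi> x)" 2] by simp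
    then show "norm (?T (\<phi> x) \<bullet> ?T (\<phi> x)) \<le> norm (\<phi> x \<bullet> \<phi> x)"
     unfolding power2_norm_eq_inner by (simp only: real_norm_def abs_of_nonneg[OF inner_ge_zero])
   qed
  qed
  have "H10 (\<lambda>x. ?T (\<phi> x)) (g_grad G (\<lambda>x. ?T (\<phi> x)))"
  proof (rule H10_real_direction[OF _ _ _ us])
   show "C1_on \<Omega> (\<lambda>x. \<phi> x \<bullet> e)" by (rule C1_on_linear[OF bounded_linear_inner_left \<phi>(1)])
   show "continuous_on (closure \<Omega>) (\<lambda>x. \<phi> x \<bullet> e)" by (intro continuous_intros cl)
   show "vf.sqi (g_grad G (\<lambda>x. ?T (\<phi> x)))" using Vs by (subst vf.sqi_cong[where g = "\<lambda>x. \<chi> i. ?T (g_grad G \<phi> x $ i)"]) (auto simp: g)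
  qed (simp add: bd)
  then show ?thesis
   by (rule H10_cong_AE) (use sc.sqi_meas[OF us] m in "auto simp: g intro!: AE_I2")
 qed
 have "H10 (\<lambda>x. (\<phi> x \<bullet> 1) *\<^sub>R 1 - (\<phi> x \<bullet> \<i>) *\<^sub>R (- \<i>)) (\<lambda>x. (\<chi> i. (g_grad G \<phi> x $ i \<bullet> 1) *\<^sub>R 1) - (\<chi> i. (g_grad G \<phi> x $ i \<bullet> \<i>) *\<^sub>R (- \<i>)))"
  by (intro H10_diff comp) simp_all
 moreover have d: "(z \<bullet> 1) *\<^sub>R 1 - (z \<bullet> \<i>) *\<^sub>R (- \<i>) = z" for z by (simp add: complex_eq_iff inner_complex_def)
 moreover have "(\<chi> i. (X $ i \<bullet> 1) *\<^sub>R 1) - (\<chi> i. (X $ i \<bullet> \<i>) *\<^sub>R (- \<i>)) = X" for X :: "complex^'n"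
  by (simp only: vec_eq_iff vector_minus_component vec_lambda_beta d) simp
 ultimately show ?thesis by (simp only:)
qed

lemma zero_trace_H10:
 assumes z: "zero_trace G \<Omega> u" and V: "wk_grad u V"
 shows "H10 u V"
proof -
 let ?D = "{\<phi> \<in> H1_smooth G \<Omega>. \<forall>x\<in>frontier \<Omega>. \<phi> x = 0}"
 obtain V' where V': "H1_limit G \<Omega> ?D u V'" using z unfolding zero_trace_def by blast
 have ae: "AE x in \<mu>. V' x = V x"
  by (rule wk_grad_unique[OF H1_limit_wk_grad[OF V'] V]) auto
 obtain \<phi> where \<phi>: "\<And>k. \<phi> k \<in> ?D" "sc.conv \<phi> u sequentially" "vf.conv (\<lambda>k. g_grad G (\<phi> k)) V' sequentially"
  using H1_limitD[OF V'] by blast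
 have "H10 u V'" by (rule H10_closed[OF H10_boundary_vanishing \<phi>(2,3)]) (use \<phi>(1) in auto)
 then show ?thesis by (rule H10_cong_AE) (use ae V in "auto simp: wk_grad_def sc.sqi_def vf.sqi_def")
qed

lemma green_H10:
 assumes L: "wk_lap V L" and u: "H10 u U"
 shows "sc.ip L u = - vf.ip V U"
proof -
 obtain \<phi> where \<phi>: "\<And>k. C1c \<Omega> (\<phi> k)" "sc.conv \<phi> u sequentially" "vf.conv (\<lambda>k. g_grad G (\<phi> k)) U sequentially"
  using H10E[OF u] by metis
 have s: "sc.sqi L" "vf.sqi V" using L by (auto simp: wk_lap_def)
 show ?thesis
 proof (rule LIMSEQ_unique)
  show "(\<lambda>k. sc.ip L (\<phi> k)) \<longlonglongrightarrow> sc.ip L u"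
   by (rule sc.conv_tendsto_ip[OF sc.conv_const[OF s(1)] \<phi>(2)])
  have "sc.ip L (\<phi> k) = - vf.ip V (g_grad G (\<phi> k))" for k using L \<phi>(1) by (simp add: wk_lap_def)
  then show "(\<lambda>k. sc.ip L (\<phi> k)) \<longlonglongrightarrow> - vf.ip V U"
   using tendsto_minus[OF vf.conv_tendsto_ip[OF vf.conv_const[OF s(2)] \<phi>(3)]] by simp
 qed
qed

end


section \<open>The radial flow\<close>

definition inward :: "real \<Rightarrow> real^'n \<Rightarrow> real^'n" where
 "inward s x = x - (s / norm x) *\<^sub>R x"

definition outward :: "real \<Rightarrow> real^'n \<Rightarrow> real^'n" where
 "outward s y = y + (s / norm y) *\<^sub>R y"

lemma inward_scale: "norm x > 0 \<Longrightarrow> inward s x = ((norm x - s) / norm x) *\<^sub>R x"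
 by (simp add: inward_def diff_divide_distrib scaleR_diff_left)

lemma outward_scale: "norm y > 0 \<Longrightarrow> outward s y = ((norm y + s) / norm y) *\<^sub>R y"
 by (simp add: outward_def add_divide_distrib scaleR_add_left)

lemma norm_inward: "0 < norm x \<Longrightarrow> s \<le> norm x \<Longrightarrow> norm (inward s x) = norm x - s"
 by (simp add: inward_scale)

lemma norm_outward: "y \<noteq> 0 \<Longrightarrow> 0 \<le> s \<Longrightarrow> norm (outward s y) = norm y + s"
 by (simp add: outward_scale)

lemma outward_inward:
 assumes "0 \<le> s" "s < norm x" shows "outward s (inward s x) = x"
proof -
 have p: "norm x > 0" using assms by linarith
 have n: "norm (inward s x) = norm x - s" using assms p by (simp add: norm_inward)
 have "outward s (inward s x) = ((norm x - s + s) / (norm x - s)) *\<^sub>R inward s x"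
  by (subst outward_scale) (use n assms in auto)
 also have "\<dots> = x" using assms p by (simp add: inward_scale)
 finally show ?thesis .
qed

lemma inward_outward:
 assumes "y \<noteq> 0" "0 \<le> s" shows "inward s (outward s y) = y"
proof -
 have p: "norm y > 0" using assms by simp
 have n: "norm (outward s y) = norm y + s" using assms by (simp add: norm_outward)
 have "inward s (outward s y) = ((norm y + s - s) / (norm y + s)) *\<^sub>R outward s y"
  by (subst inward_scale) (use n assms p in "auto intro: add_pos_nonneg")
 also have "\<dots> = y" using assms p by (simp add: outward_scale add_nonneg_eq_0_iff)
 finally show ?thesis .
qed

lemma outward_direction:
 assumes "y \<noteq> 0" "0 \<le> s" shows "outward s y $ i / norm (outward s y) = y $ i / norm y"
proof -
 have "norm y + s > 0" using assms by (simp add: add_pos_nonneg)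
 then show ?thesis using assms by (simp add: norm_outward) (simp add: outward_scale)
qed

lemma inward_inward:
 assumes "0 \<le> s" "0 \<le> t" "s + t < norm x"
 shows "inward t (inward s x) = inward (s + t) x"
proof -
 have p: "norm x > 0" "norm x - s > 0" using assms by linarith+
 have "inward t (inward s x) = ((norm x - s - t) / (norm x - s)) *\<^sub>R inward s x"
  using inward_scale[of "inward s x" t] norm_inward[of x s] p by (simp del: zero_less_norm_iff)
 also have "\<dots> = ((norm x - (s + t)) / norm x) *\<^sub>R x"
 proof -
  have "(b / a) * (a / c) = b / c" if "a \<noteq> 0" for a b c :: real using that by simp
  from this[of "norm x - s" "norm x - s - t" "norm x"] p show ?thesis
   by (simp add: inward_scale diff_diff_eq)
 qed
 finally show ?thesis using p by (simp add: inward_scale)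
qed

definition rad :: "(real^'n \<Rightarrow> 'b::real_normed_vector) \<Rightarrow> real^'n \<Rightarrow> 'b" where
 "rad f x = (\<Sum>i\<in>UNIV. (x $ i / norm x) *\<^sub>R partial_deriv i f x)"

text \<open>The negative generator of the weighted translations \<open>sh \<kappa>\<close> defined next.\<close>

definition radP :: "real \<Rightarrow> (real^'n \<Rightarrow> 'b::real_normed_vector) \<Rightarrow> real^'n \<Rightarrow> 'b" where
 "radP \<kappa> f x = rad f x + (\<kappa> / norm x) *\<^sub>R f x"

text \<open>
 With \<open>\<kappa> = m/2\<close> these translations are isometries of \<open>L\<^sup>2\<close>, where \<open>r\<^sup>m\<close> is the density of the
 volume in polar coordinates; with \<open>\<kappa> = m\<close> they preserve integrals.
\<close>

definition sh :: "real \<Rightarrow> real \<Rightarrow> (real^'n \<Rightarrow> 'b::real_normed_vector) \<Rightarrow> real^'n \<Rightarrow> 'b" where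
 "sh \<kappa> s f x = (if s < norm x then (((norm x - s) / norm x) powr \<kappa>) *\<^sub>R f (inward s x) else 0)"

lemma sum_sq_norm: "(\<Sum>i\<in>UNIV. x $ i * x $ i) = (norm (x::real^'n))\<^sup>2"
 by (simp add: power2_norm_eq_inner inner_vec_def)

lemma sum_direction_sq:
 fixes x :: "real^'n"
 assumes "x \<noteq> 0" shows "(\<Sum>i\<in>UNIV. (x $ i / norm x) * (x $ i / norm x)) = 1"
proof -
 have "(\<Sum>i\<in>UNIV. (x $ i / norm x) * (x $ i / norm x)) = (\<Sum>i\<in>UNIV. x $ i * x $ i) / (norm x)\<^sup>2"
  by (simp add: sum_divide_distrib power2_eq_square)
 then show ?thesis using assms by (simp add: sum_sq_norm)
qed

lemma C1_on_inward:
 "C1_on {x. s < norm x} (\<lambda>x::real^'n. inward s x $ j)" if "0 \<le> s"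
proof -
 have sub: "{x::real^'n. s < norm x} \<subseteq> - {0}" using that by auto
 show ?thesis
  unfolding inward_def
  by (simp, intro C1_on_diff C1_on_nth C1_on_mult C1_on_divide C1_on_const C1_on_subset[OF C1_on_norm sub])
   (use sub in auto)
qed

lemma partial_deriv_inward:
 fixes x :: "real^'n"
 assumes "x \<noteq> 0"
 shows "partial_deriv i (\<lambda>x. inward s x $ j) x
  = (1 - s / norm x) * (if i = j then 1 else 0) + s / norm x * ((x $ i / norm x) * (x $ j / norm x))"
proof -
 have "((\<lambda>x. x $ j - s * (inverse (norm x) * x $ j)) has_derivative
   (\<lambda>v. v $ j - s * (inverse (norm x) * v $ j + - (inverse (norm x) * (v \<bullet> x / norm x) * inverse (norm x)) * x $ j))) (at x)"
  using assms
  by (intro has_derivative_diff has_derivative_mult_right has_derivative_mult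
    bounded_linear_imp_has_derivative[OF bounded_linear_vec_nth] Deriv.has_derivative_inverse has_derivative_norm_vec) auto
 moreover have "(\<lambda>x. inward s x $ j) = (\<lambda>x. x $ j - s * (inverse (norm x) * x $ j))"
  by (simp add: inward_def divide_inverse fun_eq_iff)
 ultimately have "partial_deriv i (\<lambda>x. inward s x $ j) x
   = axis i 1 $ j - s * (inverse (norm x) * axis i 1 $ j + - (inverse (norm x) * (axis i 1 \<bullet> x / norm x) * inverse (norm x)) * x $ j)"
  by (simp add: partial_deriv_eq)
 then show ?thesis
  using assms unfolding inner_axis' by (auto simp: axis_def field_simps)
qed

lemma powr_quotient_C1:
 "C1_on {x. s < norm x} (\<lambda>x::real^'n. ((norm x - s) / norm x) powr \<kappa>)" if "0 \<le> s"
proof -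
 have sub: "{x::real^'n. s < norm x} \<subseteq> - {0}" using that by auto
 show ?thesis
  by (intro C1_on_powr C1_on_divide C1_on_diff C1_on_const C1_on_subset[OF C1_on_norm sub])
   (use that in "auto intro!: divide_pos_pos")
qed

lemma partial_deriv_powr_quotient:
 fixes x :: "real^'n"
 assumes "0 \<le> s" "s < norm x"
 shows "partial_deriv i (\<lambda>x. ((norm x - s) / norm x) powr \<kappa>) x
  = ((norm x - s) / norm x) powr \<kappa> * (\<kappa> * s / ((norm x - s) * norm x)) * (x $ i / norm x)"
proof -
 let ?q = "\<lambda>r. ((r - s) / r) powr \<kappa>"
 have n: "norm x > 0" "norm x - s > 0" using assms by auto
 have "(?q has_real_derivative \<kappa> * ((norm x - s) / norm x) powr (\<kappa> - 1) * (s / (norm x * norm x))) (at (norm x))"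
  using n by (auto intro!: derivative_eq_intros simp: field_simps)
 moreover have "\<kappa> * ((norm x - s) / norm x) powr (\<kappa> - 1) * (s / (norm x * norm x))
   = ((norm x - s) / norm x) powr \<kappa> * (\<kappa> * s / ((norm x - s) * norm x))"
  using n by (simp add: powr_diff field_simps)
 ultimately have "(?q has_real_derivative ((norm x - s) / norm x) powr \<kappa> * (\<kappa> * s / ((norm x - s) * norm x))) (at (norm x))"
  by (simp only:)
 note q = this[unfolded has_field_derivative_def]
 from has_derivative_compose[OF has_derivative_norm_vec q] n
 have "((\<lambda>x. ?q (norm x)) has_derivative (\<lambda>v. ((norm x - s) / norm x) powr \<kappa> * (\<kappa> * s / ((norm x - s) * norm x)) * (v \<bullet> x / norm x))) (at x)"
  by auto
 from partial_deriv_eq[OF this, of i] show ?thesis by (simp add: inner_axis')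
qed

lemma C1_on_sh:
 assumes "0 \<le> s" "C1_on UNIV f"
 shows "C1_on {x. s < norm x} (sh \<kappa> s f)"
proof -
 have "C1_on {x. s < norm x} (\<lambda>x. (((norm x - s) / norm x) powr \<kappa>) *\<^sub>R f (inward s x))"
  by (intro C1_on_scaleR powr_quotient_C1 assms(1) C1_on_compose_map(1)[OF assms(2) C1_on_inward[OF assms(1)]]) auto
 then show ?thesis
  by (rule C1_on_cong_open) (auto simp: sh_def intro!: open_Collect_less continuous_intros)
qed

lemma partial_deriv_sh:
 assumes s: "0 \<le> s" and f: "C1_on UNIV f" and y: "y \<noteq> 0"
 shows "partial_deriv i (sh \<kappa> s f) (outward s y)
  = (norm y / (norm y + s)) powr \<kappa> *\<^sub>R
    ((norm y / (norm y + s)) *\<^sub>R (partial_deriv i f y - (y $ i / norm y) *\<^sub>R rad f y)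
    + (y $ i / norm y) *\<^sub>R (rad f y + (\<kappa> * s / (norm y * (norm y + s))) *\<^sub>R f y))"
proof -
 define x where "x = outward s y"
 have ny: "norm y > 0" using y by simp
 have nx: "norm x = norm y + s" using norm_outward[OF y s] by (simp add: x_def)
 have xs: "s < norm x" using nx ny by simp
 have x0: "x \<noteq> 0" using nx ny s by (metis add_pos_nonneg less_irrefl norm_zero)
 have ix: "inward s x = y" unfolding x_def by (rule inward_outward[OF y s])
 have dir: "x $ i / norm x = y $ i / norm y" for i unfolding x_def by (rule outward_direction[OF y s])
 let ?S = "{x::real^'a. s < norm x}"
 have oS: "open ?S" by (intro open_Collect_less continuous_intros)
 have xS: "x \<in> ?S" using xs by simp
 have c1: "C1_on ?S (\<lambda>x. f (inward s x))" by (rule C1_on_compose_map(1)[OF f C1_on_inward[OF s]]) simp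
 have "partial_deriv i (sh \<kappa> s f) x = partial_deriv i (\<lambda>x. (((norm x - s) / norm x) powr \<kappa>) *\<^sub>R f (inward s x)) x"
  by (rule partial_deriv_cong_open[OF oS xS]) (simp add: sh_def)
 also have "\<dots> = ((norm x - s) / norm x) powr \<kappa> *\<^sub>R partial_deriv i (\<lambda>x. f (inward s x)) x
   + partial_deriv i (\<lambda>x. ((norm x - s) / norm x) powr \<kappa>) x *\<^sub>R f (inward s x)"
  by (rule partial_deriv_scaleR) (use C1_on_differentiable[OF powr_quotient_C1[OF s] xS] C1_on_differentiable[OF c1 xS] in auto)
 also have "partial_deriv i (\<lambda>x. f (inward s x)) x = (\<Sum>j\<in>UNIV. partial_deriv i (\<lambda>x. inward s x $ j) x *\<^sub>R partial_deriv j f y)"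
  using C1_on_compose_map(2)[OF f C1_on_inward[OF s] _ xS, of i] ix by simp
 also have "\<dots> = (\<Sum>j\<in>UNIV. ((1 - s / norm x) * (if i = j then 1 else 0)) *\<^sub>R partial_deriv j f y
    + (s / norm x * (y $ i / norm y)) *\<^sub>R ((y $ j / norm y) *\<^sub>R partial_deriv j f y))"
  by (rule sum.cong) (auto simp: partial_deriv_inward[OF x0] dir scaleR_add_left)
 also have "\<dots> = (\<Sum>j\<in>UNIV. ((1 - s / norm x) * (if i = j then 1 else 0)) *\<^sub>R partial_deriv j f y)
   + (s / norm x * (y $ i / norm y)) *\<^sub>R rad f y"
  by (simp only: sum.distrib rad_def scaleR_sum_right)
 also have "(\<Sum>j\<in>UNIV. ((1 - s / norm x) * (if i = j then 1 else 0)) *\<^sub>R partial_deriv j f y) = (1 - s / norm x) *\<^sub>R partial_deriv i f y"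
  by (simp add: if_distrib[of "\<lambda>c. _ * c"] if_distrib[of "\<lambda>c. c *\<^sub>R _"] cong: if_cong)
 also have "partial_deriv i (\<lambda>x. ((norm x - s) / norm x) powr \<kappa>) x
   = ((norm x - s) / norm x) powr \<kappa> * (\<kappa> * s / ((norm x - s) * norm x)) * (y $ i / norm y)"
  using partial_deriv_powr_quotient[OF s xs, of i \<kappa>] dir by simp
 finally have main: "partial_deriv i (sh \<kappa> s f) x
   = (norm y / (norm y + s)) powr \<kappa> *\<^sub>R ((1 - s / (norm y + s)) *\<^sub>R partial_deriv i f y + (s / (norm y + s) * (y $ i / norm y)) *\<^sub>R rad f y)
    + ((norm y / (norm y + s)) powr \<kappa> * (\<kappa> * s / (norm y * (norm y + s))) * (y $ i / norm y)) *\<^sub>R f y"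
  by (simp add: nx ix)
 have ne: "norm y + s \<noteq> 0" using ny s by linarith
 have a: "1 - s / (norm y + s) = norm y / (norm y + s)"
  using diff_divide_distrib[of "norm y + s" s "norm y + s"] ne by simp
 have b: "s / (norm y + s) = 1 - norm y / (norm y + s)" using a by linarith
 show ?thesis
  unfolding x_def[symmetric] main a
  unfolding b by (simp add: algebra_simps)
qed

lemma rad_sh:
 assumes s: "0 \<le> s" and f: "C1_on UNIV f" and y: "y \<noteq> 0"
 shows "rad (sh \<kappa> s f) (outward s y)
  = (norm y / (norm y + s)) powr \<kappa> *\<^sub>R (rad f y + (\<kappa> * s / (norm y * (norm y + s))) *\<^sub>R f y)"
proof -
 let ?h = "(norm y / (norm y + s)) powr \<kappa>" and ?l = "norm y / (norm y + s)"
 let ?t = "\<lambda>i. y $ i / norm y" and ?Z = "rad f y + (\<kappa> * s / (norm y * (norm y + s))) *\<^sub>R f y"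
 have "rad (sh \<kappa> s f) (outward s y)
   = (\<Sum>i\<in>UNIV. ?t i *\<^sub>R ?h *\<^sub>R (?l *\<^sub>R (partial_deriv i f y - ?t i *\<^sub>R rad f y) + ?t i *\<^sub>R ?Z))"
  unfolding rad_def[of "sh \<kappa> s f"] partial_deriv_sh[OF s f y] outward_direction[OF y s] ..
 also have "\<dots> = (\<Sum>i\<in>UNIV. (?h * ?l) *\<^sub>R (?t i *\<^sub>R partial_deriv i f y) - (?t i * ?t i) *\<^sub>R ((?h * ?l) *\<^sub>R rad f y) + (?t i * ?t i) *\<^sub>R (?h *\<^sub>R ?Z))"
  by (rule sum.cong) (simp_all add: scaleR_add_right scaleR_diff_right mult_ac)
 also have "\<dots> = (?h * ?l) *\<^sub>R rad f y - (\<Sum>i\<in>UNIV. ?t i * ?t i) *\<^sub>R ((?h * ?l) *\<^sub>R rad f y) + (\<Sum>i\<in>UNIV. ?t i * ?t i) *\<^sub>R (?h *\<^sub>R ?Z)"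
  by (simp only: sum.distrib sum_subtractf scaleR_sum_left scaleR_sum_right[symmetric] rad_def[of f, symmetric])
 also have "\<dots> = ?h *\<^sub>R ?Z" by (simp add: sum_direction_sq[OF y, simplified])
 finally show ?thesis .
qed

lemma radP_sh:
 assumes s: "0 \<le> s" and f: "C1_on UNIV f" and x: "s < norm x"
 shows "radP \<kappa> (sh \<kappa> s f) x = sh \<kappa> s (radP \<kappa> f) x"
proof -
 define y where "y = inward s x"
 have px: "norm x > 0" using s x by linarith
 have ny: "norm y = norm x - s" unfolding y_def using norm_inward[OF px] x by simp
 have y0: "y \<noteq> 0" using ny x by auto
 have xy: "x = outward s y" unfolding y_def using outward_inward[OF s x] by simp
 have e: "\<kappa> * s / (norm y * (norm y + s)) + \<kappa> / (norm y + s) = \<kappa> / norm y"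
 proof -
  have "norm y > 0" "norm y + s > 0" using ny x s px by linarith+
  then show ?thesis by (simp add: divide_simps) (simp add: algebra_simps)
 qed
 have "radP \<kappa> (sh \<kappa> s f) x = (norm y / (norm y + s)) powr \<kappa> *\<^sub>R (rad f y + (\<kappa> * s / (norm y * (norm y + s))) *\<^sub>R f y)
   + (\<kappa> / (norm y + s)) *\<^sub>R (norm y / (norm y + s)) powr \<kappa> *\<^sub>R f y"
  unfolding radP_def[of \<kappa> "sh \<kappa> s f"] using rad_sh[OF s f y0, of \<kappa>] x ny by (simp add: xy[symmetric] sh_def y_def[symmetric])
 also have "\<dots> = (norm y / (norm y + s)) powr \<kappa> *\<^sub>R (rad f y + (\<kappa> * s / (norm y * (norm y + s)) + \<kappa> / (norm y + s)) *\<^sub>R f y)"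
  by (simp add: scaleR_add_right scaleR_add_left mult.commute)
 also have "\<dots> = sh \<kappa> s (radP \<kappa> f) x"
  unfolding e using x ny by (simp add: sh_def y_def[symmetric] radP_def)
 finally show ?thesis .
qed

lemma sh_derivative:
 assumes f: "C1_on UNIV f" and x: "x \<noteq> 0" and s: "s < norm x"
 shows "((\<lambda>s. sh \<kappa> s f x) has_vector_derivative - sh \<kappa> s (radP \<kappa> f) x) (at s)"
proof -
 have px: "norm x > 0" using x by simp
 define y where "y = inward s x"
 have ny: "norm y = norm x - s" unfolding y_def using norm_inward[OF px] s by simp
 have dy: "y $ j / norm y = x $ j / norm x" for j
  using s px by (simp add: ny) (simp add: y_def inward_scale[OF px] field_simps)
 have dq: "((\<lambda>s. ((norm x - s) / norm x) powr \<kappa>) has_real_derivative - (((norm x - s) / norm x) powr \<kappa> * (\<kappa> / norm y))) (at s)"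
 proof -
  have "((\<lambda>s. ((norm x - s) / norm x) powr \<kappa>) has_real_derivative \<kappa> * ((norm x - s) / norm x) powr (\<kappa> - 1) * (- 1 / norm x)) (at s)"
   using s px by (auto intro!: derivative_eq_intros simp: field_simps)
  moreover have "\<kappa> * ((norm x - s) / norm x) powr (\<kappa> - 1) * (- 1 / norm x) = - (((norm x - s) / norm x) powr \<kappa> * (\<kappa> / norm y))"
   using s px by (simp add: powr_diff ny field_simps)
  ultimately show ?thesis by (simp only:)
 qed
 have di: "((\<lambda>s. inward s x) has_derivative (\<lambda>h. - (h / norm x) *\<^sub>R x)) (at s)"
  unfolding inward_def by (auto intro!: derivative_eq_intros simp: divide_inverse)
 have df: "((\<lambda>s. f (inward s x)) has_vector_derivative - rad f y) (at s)"
 proof -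
  have "((\<lambda>s. f (inward s x)) has_derivative (\<lambda>h. \<Sum>j\<in>UNIV. (- (h / norm x) *\<^sub>R x) $ j *\<^sub>R partial_deriv j f y)) (at s)"
   unfolding y_def by (rule has_derivative_compose[OF di C1_on_deriv[OF f]]) simp
  moreover have "(\<Sum>j\<in>UNIV. (- (h / norm x) *\<^sub>R x) $ j *\<^sub>R partial_deriv j f y) = h *\<^sub>R - rad f y" for h
   by (simp add: rad_def dy scaleR_sum_right sum_negf)
  ultimately show ?thesis by (simp add: has_vector_derivative_def)
 qed
 have "((\<lambda>s. ((norm x - s) / norm x) powr \<kappa> *\<^sub>R f (inward s x)) has_vector_derivative
   ((norm x - s) / norm x) powr \<kappa> *\<^sub>R (- rad f y) + (- (((norm x - s) / norm x) powr \<kappa> * (\<kappa> / norm y))) *\<^sub>R f (inward s x)) (at s)"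
  by (rule has_vector_derivative_scaleR[OF dq df])
 moreover have "((norm x - s) / norm x) powr \<kappa> *\<^sub>R (- rad f y) + (- (((norm x - s) / norm x) powr \<kappa> * (\<kappa> / norm y))) *\<^sub>R f (inward s x)
   = - sh \<kappa> s (radP \<kappa> f) x"
  using s by (simp add: sh_def y_def[symmetric] radP_def scaleR_add_right)
 ultimately have "((\<lambda>s. ((norm x - s) / norm x) powr \<kappa> *\<^sub>R f (inward s x)) has_vector_derivative - sh \<kappa> s (radP \<kappa> f) x) (at s)"
  by simp
 then show ?thesis
  by (rule has_vector_derivative_transform_within_open[of _ _ _ "{..<norm x}"]) (use s in "auto simp: sh_def")
qed

text \<open>The weights telescope along a ray.\<close>

lemma sh_compose:
 assumes "0 \<le> s" "0 \<le> t"
 shows "sh \<kappa> s (sh \<kappa> t f) x = sh \<kappa> (s + t) f x"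
proof (cases "s + t < norm x")
 case True
 have p: "norm x > 0" "norm x - s > 0" using True assms by linarith+
 have n: "norm (inward s x) = norm x - s" using p by (simp add: norm_inward)
 have "((norm x - s) / norm x) powr \<kappa> * ((norm x - s - t) / (norm x - s)) powr \<kappa> = ((norm x - (s + t)) / norm x) powr \<kappa>"
 proof -
  have "(a / c) * (b / a) = b / c" if "a \<noteq> 0" for a b c :: real using that by simp
  from this[of "norm x - s" "norm x" "norm x - s - t"] p show ?thesis
   by (simp add: powr_mult[symmetric] diff_diff_eq)
 qed
 then show ?thesis using True p n assms inward_inward[OF assms True] by (simp add: sh_def)
next
 case False
 show ?thesis
 proof (cases "s < norm x")
  case True
  then have "norm (inward s x) = norm x - s" using assms(1) by (intro norm_inward) auto
  then show ?thesis using False True by (simp add: sh_def)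
 next
  case f2: False
  then show ?thesis using False by (simp add: sh_def)
 qed
qed


section \<open>Radial translations of functions on the exterior domain\<close>

locale radial_exterior = radial_domain G \<Omega>
 for G :: "real^'n \<Rightarrow> real^'n^'n" and \<Omega> +
 fixes c0 d :: real
 assumes c0_pos: "c0 > 0"
  and det_eq: "\<And>x. x \<in> \<Omega> \<Longrightarrow> det (G x) = c0 * norm x powr d"
  and outward_\<Omega>: "\<And>x s. x \<in> \<Omega> \<Longrightarrow> 0 \<le> s \<Longrightarrow> outward s x \<in> \<Omega>"
  and d_ge: "d \<ge> 2 * (3 - real CARD('n))"
begin

definition m :: real where "m = real CARD('n) - 1 + d / 2"

lemma m_ge: "m \<ge> 2" using d_ge by (simp add: m_def)

lemma \<Omega>_away: obtains \<delta> where "\<delta> > 0" "\<And>x. x \<in> \<Omega> \<Longrightarrow> \<delta> \<le> norm x"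
proof -
 have "open (- closure \<Omega>)" "0 \<in> - closure \<Omega>" using zero_notin by auto
 then obtain \<delta> where d: "\<delta> > 0" "ball 0 \<delta> \<subseteq> - closure \<Omega>" using open_contains_ball by blast
 have "\<delta> \<le> norm x" if "x \<in> \<Omega>" for x
 proof (rule ccontr)
  assume "\<not> \<delta> \<le> norm x"
  then have "x \<in> ball 0 \<delta>" by simp
  then show False using d that closure_subset by blast
 qed
 then show ?thesis using that d by blast
qed

lemma nonzero: "x \<in> \<Omega> \<Longrightarrow> x \<noteq> 0"
 using zero_notin closure_subset by blast

lemma norm_pos: "x \<in> \<Omega> \<Longrightarrow> norm x > 0" using nonzero by simp

lemma w_eq: "x \<in> \<Omega> \<Longrightarrow> w x = sqrt c0 * norm x powr (d / 2)"
 using nonzero[of x] by (simp add: w_def det_eq real_sqrt_mult powr_half_sqrt[symmetric] powr_powr)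

lemma C1_on_norm_\<Omega>: "C1_on \<Omega> norm"
 by (rule C1_on_subset[OF C1_on_norm]) (use nonzero in auto)

lemma continuous_on_rad: "C1_on \<Omega> f \<Longrightarrow> continuous_on \<Omega> (rad f)"
 unfolding rad_def using nonzero by (intro continuous_intros C1_on_partial) auto

lemma continuous_on_radP: "C1_on \<Omega> f \<Longrightarrow> continuous_on \<Omega> (radP \<kappa> f)"
 unfolding radP_def using nonzero by (intro continuous_intros continuous_on_rad C1_on_continuous) auto

lemma radP_zero: "f x = 0 \<Longrightarrow> (\<And>i. partial_deriv i f x = 0) \<Longrightarrow> radP \<kappa> f x = 0"
 by (simp add: radP_def rad_def)

text \<open>The divergence of \<open>w x/|x|\<close> is \<open>m w/|x|\<close>.\<close>

lemma radial_by_parts: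
 fixes f :: "real^'n \<Rightarrow> real"
 assumes f: "C1c \<Omega> f"
 shows "(\<integral>x. radP m f x \<partial>\<mu>) = 0"
proof -
 define g where "g i x = sqrt c0 * (norm x powr (d / 2 - 1) * x $ i)" for i and x :: "real^'n"
 have g: "C1_on \<Omega> (g i)" for i
  unfolding g_def by (intro C1_on_mult C1_on_const C1_on_powr C1_on_norm_\<Omega> C1_on_nth norm_pos)
 have pg: "partial_deriv i (g i) x = sqrt c0 * ((d / 2 - 1) * norm x powr (d / 2 - 2) * (x $ i / norm x) * x $ i + norm x powr (d / 2 - 1))"
  if x: "x \<in> \<Omega>" for i x
 proof -
  have n: "norm x > 0" using norm_pos[OF x] .
  have "((\<lambda>r. r powr (d / 2 - 1)) has_real_derivative (d / 2 - 1) * norm x powr (d / 2 - 1 - 1)) (at (norm x))"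
   by (rule has_real_derivative_powr[OF n])
  note has_derivative_compose[OF has_derivative_norm_vec[OF nonzero[OF x]] this[unfolded has_field_derivative_def]]
  from has_derivative_mult_right[OF has_derivative_mult[OF this bounded_linear_imp_has_derivative[OF bounded_linear_vec_nth[of i]]], of "sqrt c0"]
  have "(g i has_derivative (\<lambda>h. sqrt c0 * (norm x powr (d / 2 - 1) * h $ i + (d / 2 - 1) * norm x powr (d / 2 - 1 - 1) * (h \<bullet> x / norm x) * x $ i))) (at x)"
   unfolding g_def .
  from partial_deriv_eq[OF this, of i] show ?thesis by (simp add: inner_axis' algebra_simps)
 qed
 have div: "(\<Sum>i\<in>UNIV. partial_deriv i (g i) x) = w x * (m / norm x)" if x: "x \<in> \<Omega>" for x
 proof -
  have n: "norm x > 0" using norm_pos[OF x] .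
  have "(\<Sum>i\<in>UNIV. partial_deriv i (g i) x)
    = (\<Sum>i\<in>UNIV. (sqrt c0 * ((d / 2 - 1) * norm x powr (d / 2 - 2) / norm x)) * (x $ i * x $ i) + sqrt c0 * norm x powr (d / 2 - 1))"
   by (rule sum.cong) (simp_all add: pg[OF x] distrib_left)
  also have "\<dots> = sqrt c0 * ((d / 2 - 1) * norm x powr (d / 2 - 2) / norm x) * (\<Sum>i\<in>UNIV. x $ i * x $ i) + real CARD('n) * (sqrt c0 * norm x powr (d / 2 - 1))"
   by (simp only: sum.distrib sum_distrib_left[symmetric] sum_constant mult.left_commute[of "sqrt c0" "real CARD('n)"])
  also have "\<dots> = sqrt c0 * norm x powr (d / 2 - 1) * m"
   using n powr_mult_base[of "norm x" "d / 2 - 2"]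
   unfolding sum_sq_norm by (simp add: m_def power2_eq_square algebra_simps diff_divide_distrib)
  also have "\<dots> = w x * (m / norm x)" using n by (simp add: w_eq[OF x] powr_diff)
  finally show ?thesis .
 qed
 have "w x * radP m f x = (\<Sum>i\<in>UNIV. partial_deriv i (\<lambda>x. g i x *\<^sub>R f x) x)" if x: "x \<in> \<Omega>" for x
 proof -
  have n: "norm x > 0" using norm_pos[OF x] .
  have "partial_deriv i (\<lambda>x. g i x *\<^sub>R f x) x = g i x *\<^sub>R partial_deriv i f x + partial_deriv i (g i) x *\<^sub>R f x" for i
   by (rule partial_deriv_scaleR) (use C1_on_differentiable[OF g x] C1c_differentiable[OF f] in auto)
  then have "(\<Sum>i\<in>UNIV. partial_deriv i (\<lambda>x. g i x *\<^sub>R f x) x) = (\<Sum>i\<in>UNIV. g i x * partial_deriv i f x) + w x * (m / norm x) * f x"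
   using div[OF x] by (simp add: sum.distrib sum_distrib_right[symmetric])
  also have "(\<Sum>i\<in>UNIV. g i x * partial_deriv i f x) = w x * rad f x"
   using n by (simp add: g_def rad_def w_eq[OF x] powr_diff sum_distrib_left mult_ac)
  finally show ?thesis by (simp add: radP_def distrib_left)
 qed
 from test_divergence(2)[OF C1c_scaleR[OF open_\<Omega> g f] this] show ?thesis .
qed


text \<open>
 The support is transported along outward rays, which stay in \<open>\<Omega>\<close> by the boundary
 condition on the domain.
\<close>

lemma sh_C1c:
 fixes f :: "real^'n \<Rightarrow> 'b::real_normed_vector"
 assumes s: "0 \<le> s" and f: "C1c \<Omega> f"
 shows "C1c \<Omega> (sh \<kappa> s f)"
proof -
 obtain K where K: "compact K" "K \<subseteq> \<Omega>" "\<And>x. x \<notin> K \<Longrightarrow> f x = 0"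
  using C1cE[OF f] by metis
 let ?O = "{x::real^'n. s < norm x}"
 let ?K = "outward s ` K"
 have "continuous_on K (outward s)"
  unfolding outward_def using K(2) nonzero by (intro continuous_intros) auto
 then have cK: "compact ?K" by (rule compact_continuous_image[OF _ K(1)])
 have KO: "?K \<subseteq> ?O" using K(2) nonzero s norm_outward by fastforce
 have K\<Omega>: "?K \<subseteq> \<Omega>" using K(2) outward_\<Omega> s by blast
 have z: "sh \<kappa> s f x = 0" if x: "x \<notin> ?K" for x
 proof (cases "s < norm x")
  case True
  have "inward s x \<notin> K" using outward_inward[OF s True] x by (metis image_eqI)
  then show ?thesis using K(3) by (simp add: sh_def)
 qed (simp add: sh_def)
 have "C1c ?O (sh \<kappa> s f)"
  by (rule C1cI[OF _ C1_on_sh[OF s C1c_C1[OF f]] cK KO z]) (intro open_Collect_less continuous_intros)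
 then have "C1_on UNIV (sh \<kappa> s f)" by (simp add: C1c_def)
 then show ?thesis unfolding C1c_def using cK K\<Omega> z by blast
qed

lemma sh_near_zero:
 assumes d: "\<And>x. x \<in> \<Omega> \<Longrightarrow> \<delta> \<le> norm x" and f: "\<And>x. x \<notin> \<Omega> \<Longrightarrow> f x = 0" and x: "norm x - \<delta> < s"
 shows "sh \<kappa> s f x = 0"
proof (cases "s < norm x \<and> x \<noteq> 0")
 case True
 then have "norm (inward s x) < \<delta>" using x by (subst norm_inward) auto
 then have "inward s x \<notin> \<Omega>" using d by force
 then show ?thesis using f by (simp add: sh_def)
next
 case False
 then have "s \<ge> norm x \<or> x = 0" by auto
 then show ?thesis
 proof
  assume "x = 0"
  then have "inward s x \<notin> \<Omega>" using nonzero by (auto simp: inward_def)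
  then show ?thesis using f by (simp add: sh_def)
 qed (simp add: sh_def)
qed

lemma test_off_\<Omega>: "C1c \<Omega> f \<Longrightarrow> x \<notin> \<Omega> \<Longrightarrow> f x = 0"
 using C1cE[of \<Omega> f] by (metis subsetD)

lemma sh_derivative_all:
 assumes f: "C1c \<Omega> f" and x: "x \<in> \<Omega>"
 shows "((\<lambda>s. sh \<kappa> s f x) has_vector_derivative - sh \<kappa> s (radP \<kappa> f) x) (at s within T)"
proof (cases "s < norm x")
 case True
 then show ?thesis
  using sh_derivative[OF C1c_C1[OF f] nonzero[OF x]] has_vector_derivative_at_within by blast
next
 case False
 obtain \<delta> where \<delta>: "\<delta> > 0" "\<And>x. x \<in> \<Omega> \<Longrightarrow> \<delta> \<le> norm x" using \<Omega>_away by blast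
 have "((\<lambda>s. 0) has_vector_derivative 0) (at s)" by simp
 then have "((\<lambda>s. sh \<kappa> s f x) has_vector_derivative 0) (at s)"
  by (rule has_vector_derivative_transform_within_open[of _ _ _ "{norm x - \<delta><..}"])
   (use \<delta> False sh_near_zero[OF \<delta>(2) test_off_\<Omega>[OF f]] in auto)
 then show ?thesis using False by (simp add: sh_def has_vector_derivative_at_within)
qed

lemma sh_bound:
 assumes "\<kappa> \<ge> 0" "0 \<le> s" "\<And>x. norm (f x) \<le> B"
 shows "norm (sh \<kappa> s f x) \<le> B"
proof (cases "s < norm x")
 case True
 then have "((norm x - s) / norm x) powr \<kappa> \<le> 1"
  using assms(1,2) by (intro powr_le1) (auto simp: divide_le_eq)
 then have "((norm x - s) / norm x) powr \<kappa> * norm (f (inward s x)) \<le> 1 * B"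
  using assms(3) by (intro mult_mono) auto
 then show ?thesis using True by (simp add: sh_def)
next
 case False
 then show ?thesis using order_trans[OF norm_ge_zero assms(3)[of 0]] by (simp add: sh_def)
qed

lemma sh_far_zero:
 assumes "0 \<le> s" "\<And>x. norm x > R \<Longrightarrow> f x = 0" "norm x > R + s"
 shows "sh \<kappa> s f x = 0"
proof (cases "s < norm x")
 case True
 then have "norm (inward s x) > R" using assms by (subst norm_inward) auto
 then show ?thesis using assms by (simp add: sh_def)
qed (simp add: sh_def)

text \<open>
 The mean value theorem along the flow.  The bound is by an integrable function that does not
 depend on \<open>s\<close>, as dominated convergence of the difference quotients requires.
\<close>

lemma sh_lipschitz:
 fixes f :: "real^'n \<Rightarrow> 'b::euclidean_space"
 assumes f: "C1c \<Omega> f" and \<kappa>: "\<kappa> \<ge> 0"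
 obtains B R where "B \<ge> 0"
  "\<And>x s t. x \<in> \<Omega> \<Longrightarrow> s \<in> {0..S} \<Longrightarrow> t \<in> {0..S} \<Longrightarrow> norm (sh \<kappa> s f x - sh \<kappa> t f x) \<le> B * \<bar>s - t\<bar> * indicator (cball 0 R) x"
proof -
 obtain K where K: "compact K" "K \<subseteq> \<Omega>" "\<And>x. x \<notin> K \<Longrightarrow> f x = 0" "\<And>i x. x \<notin> K \<Longrightarrow> partial_deriv i f x = 0"
  using C1cE[OF f] by metis
 have z: "radP \<kappa> f x = 0" if "x \<notin> K" for x using K(3,4)[OF that] radP_zero by blast
 have "continuous_on UNIV (radP \<kappa> f)"
  by (rule continuous_compact_support_UNIV[OF continuous_on_radP[OF C1c_C1[OF f]] K(1,2) z])
 then obtain B where B: "B \<ge> 0" "\<And>x. norm (radP \<kappa> f x) \<le> B"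
  by (rule compact_support_bounds[of "radP \<kappa> f" K]) (use z K(1) in auto)
 obtain R where R: "\<And>x. x \<in> K \<Longrightarrow> norm x \<le> R"
  using compact_imp_bounded[OF K(1)] by (auto simp: bounded_iff)
 have Rz: "f x = 0" if "norm x > R" for x using R[of x] K(3)[of x] that by force
 show ?thesis
 proof (rule that[OF B(1), of "R + S"])
  fix x s t assume x: "x \<in> \<Omega>" and st: "s \<in> {0..S}" "t \<in> {0..S}"
  show "norm (sh \<kappa> s f x - sh \<kappa> t f x) \<le> B * \<bar>s - t\<bar> * indicator (cball 0 (R + S)) x"
  proof (cases "norm x \<le> R + S")
   case True
   have "norm (sh \<kappa> s f x - sh \<kappa> t f x) \<le> B * norm (s - t)"
    by (rule vector_derivative_norm_bound[where S = "{0..S}", OF sh_derivative_all[OF f x] _ convex_real_interval(5) st])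
     (use sh_bound[OF \<kappa> _ B(2)] in auto)
   then show ?thesis using True by simp
  next
   case False
   have "sh \<kappa> s f x = 0" "sh \<kappa> t f x = 0"
    by (rule sh_far_zero[where R = R]; use st Rz False in auto)+
   then show ?thesis using False by simp
  qed
 qed
qed

lemma integrable_indicator_cball: "integrable \<mu> (\<lambda>x. indicator (cball 0 R) x :: real)"
proof -
 have i: "integrable lborel (\<lambda>x. indicator (cball 0 R) x *\<^sub>R w x)"
  by (rule borel_integrable_compact) (auto intro: continuous_on_subset[OF w_cont])
 have "integrable lborel (\<lambda>x. indicator \<Omega> x *\<^sub>R (indicator (cball 0 R) x *\<^sub>R w x))"
  using integrable_mult_indicator[OF _ i, of \<Omega>] by simp
 then show ?thesis
  by (subst integral_\<mu>(2)) (simp_all add: mult.commute mult.left_commute borel_measurable_indicator)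
qed

lemma sh_zero: "x \<noteq> 0 \<Longrightarrow> sh \<kappa> 0 f x = f x"
 by (simp add: sh_def inward_def)

text \<open>
 The derivative of the integral along the flow is the integral of a radial divergence, so the
 integral does not change.
\<close>

lemma integral_sh:
 fixes f :: "real^'n \<Rightarrow> real"
 assumes f: "C1c \<Omega> f" and T: "T \<ge> 0"
 shows "(\<integral>x. sh m T f x \<partial>\<mu>) = (\<integral>x. f x \<partial>\<mu>)"
proof -
 define I where "I s = (\<integral>x. sh m s f x \<partial>\<mu>)" for s
 have m0: "m \<ge> 0" using m_ge by simp
 obtain B R where B: "B \<ge> 0" and lip: "\<And>x s t. x \<in> \<Omega> \<Longrightarrow> s \<in> {0..T} \<Longrightarrow> t \<in> {0..T} \<Longrightarrow>
   norm (sh m s f x - sh m t f x) \<le> B * \<bar>s - t\<bar> * indicator (cball 0 R) x"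
  using sh_lipschitz[OF f m0] by blast
 have int: "integrable \<mu> (sh m s f)" if s0: "s \<ge> 0" for s by (rule test_integrable[OF sh_C1c[OF s0 f]])
 define J :: real where "J = (\<integral>x. indicator (cball 0 R) x \<partial>\<mu>)"
 have Ilip: "\<bar>I s - I t\<bar> \<le> B * \<bar>s - t\<bar> * J" if st: "s \<in> {0..T}" "t \<in> {0..T}" for s t
 proof -
  have "I s - I t = (\<integral>x. sh m s f x - sh m t f x \<partial>\<mu>)"
   unfolding I_def using int st by simp
  also have "\<bar>\<dots>\<bar> \<le> (\<integral>x. B * \<bar>s - t\<bar> * indicator (cball 0 R) x \<partial>\<mu>)"
   by (rule integral_abs_bound[THEN order_trans], rule integral_mono)
    (use int st integrable_indicator_cball lip in auto)
  finally show ?thesis by (simp add: J_def)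
 qed
 have Jn: "J \<ge> 0" unfolding J_def by (rule integral_nonneg_AE) auto
 have cont: "continuous_on {0..T} I"
 proof -
  have "(B * J)-lipschitz_on {0..T} I"
   by (rule lipschitz_onI) (use Ilip B Jn in "auto simp: dist_real_def mult_ac")
  then show ?thesis by (rule lipschitz_on_continuous_on)
 qed
 have der: "DERIV I s :> 0" if s: "0 < s" "s < T" for s
  unfolding DERIV_def tendsto_at_iff_sequentially
 proof (intro allI impI)
  fix X :: "nat \<Rightarrow> real" assume X: "\<forall>i. X i \<in> UNIV - {0}" "X \<longlonglongrightarrow> 0"
  have "\<forall>\<^sub>F i in sequentially. X i > - s \<and> X i < T - s"
   by (rule eventually_conj) (use order_tendstoD[OF X(2)] s in auto)
  then obtain N where N: "\<And>i. i \<ge> N \<Longrightarrow> X i > - s \<and> X i < T - s" by (auto simp: eventually_sequentially)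
  define Y where "Y i = X (i + N)" for i
  have Y: "Y i \<noteq> 0" "s + Y i \<in> {0..T}" for i using X(1) N[of "i + N"] by (auto simp: Y_def)
  have Ylim: "Y \<longlonglongrightarrow> 0" unfolding Y_def by (rule LIMSEQ_ignore_initial_segment[OF X(2)])
  have sT: "s \<in> {0..T}" using s by auto
  have Yat: "filterlim Y (at 0) sequentially" using Ylim Y(1) by (simp add: filterlim_at)
  define Q where "Q i x = (sh m (s + Y i) f x - sh m s f x) /\<^sub>R Y i" for i x
  have shP: "sh m s (radP m f) x = radP m (sh m s f) x" if x: "x \<in> \<Omega>" for x
  proof (cases "s < norm x")
   case True
   then show ?thesis using radP_sh[OF _ C1c_C1[OF f] True] s by simp
  next
   case False
   obtain \<delta> where \<delta>: "\<delta> > 0" "\<And>x. x \<in> \<Omega> \<Longrightarrow> \<delta> \<le> norm x" using \<Omega>_away by blast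
   have z: "sh m s f y = 0" if "y \<in> ball 0 (s + \<delta>)" for y
    using sh_near_zero[OF \<delta>(2) test_off_\<Omega>[OF f]] that by auto
   have xb: "x \<in> ball 0 (s + \<delta>)" using False \<delta> by simp
   have "partial_deriv i (sh m s f) x = partial_deriv i (\<lambda>_. 0) x" for i
    by (rule partial_deriv_cong_open[OF open_ball xb z])
   moreover have "partial_deriv i (\<lambda>_. 0::real) x = 0" for i by (rule partial_deriv_eq) simp
   ultimately have "radP m (sh m s f) x = 0" by (intro radP_zero z xb) auto
   then show ?thesis using False by (simp add: sh_def)
  qed
  have "(\<lambda>i. \<integral>x. Q i x \<partial>\<mu>) \<longlonglongrightarrow> (\<integral>x. - sh m s (radP m f) x \<partial>\<mu>)"
  proof (rule integral_dominated_convergence[where w = "\<lambda>x. B * indicator (cball 0 R) x"])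
   show "integrable \<mu> (\<lambda>x. B * indicator (cball 0 R) x)" using integrable_indicator_cball by simp
   show "AE x in \<mu>. (\<lambda>i. Q i x) \<longlonglongrightarrow> - sh m s (radP m f) x"
   proof (rule AE_I2)
    fix x assume "x \<in> space \<mu>" then have x: "x \<in> \<Omega>" by simp
    show "(\<lambda>i. Q i x) \<longlonglongrightarrow> - sh m s (radP m f) x"
     unfolding Q_def by (rule filterlim_compose[OF has_vector_derivative_quotient[OF sh_derivative_all[OF f x]] Yat])
   qed
   show "AE x in \<mu>. norm (Q i x) \<le> B * indicator (cball 0 R) x" for i
   proof (rule AE_I2)
    fix x assume "x \<in> space \<mu>" then have x: "x \<in> \<Omega>" by simp
    have "norm (sh m (s + Y i) f x - sh m s f x) \<le> B * \<bar>Y i\<bar> * indicator (cball 0 R) x"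
     using lip[OF x Y(2) sT] by simp
    then have "norm (sh m (s + Y i) f x - sh m s f x) / \<bar>Y i\<bar> \<le> B * indicator (cball 0 R) x"
     using Y(1)[of i] by (simp add: divide_le_eq mult_ac)
    then show "norm (Q i x) \<le> B * indicator (cball 0 R) x" by (simp add: Q_def divide_inverse mult.commute abs_mult)
   qed
   show "(\<lambda>x. - sh m s (radP m f) x) \<in> borel_measurable \<mu>"
   proof -
    have "continuous_on \<Omega> (\<lambda>x. - radP m (sh m s f) x)"
     using s by (intro continuous_intros continuous_on_radP C1c_C1[OF sh_C1c[OF _ f]]) auto
    then have "continuous_on \<Omega> (\<lambda>x. - sh m s (radP m f) x)" by (rule continuous_on_eq) (simp add: shP)
    then show ?thesis by (rule measurable_\<mu>_cont)
   qed
   show "Q i \<in> borel_measurable \<mu>" for i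
    unfolding Q_def using int[of s] int[of "s + Y i"] Y(2)[of i] s by (intro borel_measurable_scaleR borel_measurable_diff) auto
  qed
  moreover have "(\<integral>x. - sh m s (radP m f) x \<partial>\<mu>) = 0"
  proof -
   have "(\<integral>x. sh m s (radP m f) x \<partial>\<mu>) = (\<integral>x. radP m (sh m s f) x \<partial>\<mu>)"
    by (rule Bochner_Integration.integral_cong) (auto simp: shP)
   also have "\<dots> = 0" using s by (intro radial_by_parts sh_C1c f) auto
   finally show ?thesis by simp
  qed
  moreover have "(\<integral>x. Q i x \<partial>\<mu>) = (I (s + Y i) - I s) / Y i" for i
   unfolding Q_def I_def using int[of s] int[of "s + Y i"] Y(2)[of i] s
   by (simp add: divide_inverse mult.commute)
  ultimately have "(\<lambda>i. (I (s + X (i + N)) - I s) / X (i + N)) \<longlonglongrightarrow> 0" by (simp add: Y_def)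
  then show "((\<lambda>h. (I (s + h) - I s) / h) \<circ> X) \<longlonglongrightarrow> 0"
   unfolding o_def by (rule LIMSEQ_offset[of "\<lambda>i. (I (s + X i) - I s) / X i" N 0])
 qed
 have "I T = I 0"
 proof (cases "T = 0")
  case False
  then show ?thesis using DERIV_isconst_end[of 0 T I] T cont der by simp
 qed simp
 also have "I 0 = (\<integral>x. f x \<partial>\<mu>)"
  unfolding I_def by (rule Bochner_Integration.integral_cong) (auto simp: sh_zero nonzero)
 finally show ?thesis by (simp add: I_def)
qed

end


context radial_exterior begin

lemma borel_inward [measurable]: "inward s \<in> borel_measurable borel"
 unfolding inward_def by (intro borel_measurable_diff borel_measurable_scaleR borel_measurable_divide) auto

lemma borel_sh [measurable]:
 fixes f :: "real^'n \<Rightarrow> 'b::euclidean_space"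
 assumes [measurable]: "f \<in> borel_measurable borel"
 shows "sh \<kappa> s f \<in> borel_measurable borel"
proof -
 have [measurable]: "(\<lambda>x. f (inward s x)) \<in> borel_measurable borel"
  by (rule measurable_compose[OF borel_inward assms])
 show ?thesis unfolding sh_def by measurable
qed

text \<open>The Jacobian of the inward flow relative to the volume, set to 0 where the flow leaves \<open>\<Omega>\<close>.\<close>

definition jac :: "real \<Rightarrow> real^'n \<Rightarrow> ennreal" where
 "jac s x = (if s < norm x \<and> inward s x \<in> \<Omega> then ennreal (((norm x - s) / norm x) powr m) else 0)"

lemma borel_jac [measurable]: "jac s \<in> borel_measurable borel"
proof -
 have [measurable]: "inward s -` \<Omega> \<in> sets borel"
  using measurable_sets[OF borel_inward \<Omega>_sets] by simp
 have "(\<lambda>x. if s < norm x \<and> x \<in> inward s -` \<Omega> then ennreal (((norm x - s) / norm x) powr m) else 0) \<in> borel_measurable borel"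
  by measurable
 then show ?thesis by (simp add: jac_def[abs_def])
qed

text \<open>
 Change of variables along the flow, for all Borel functions: the two sides are measures that
 agree on test functions.
\<close>

lemma nn_integral_inward:
 assumes H: "H \<in> borel_measurable borel" and s: "0 \<le> s"
 shows "(\<integral>\<^sup>+x. jac s x * H (inward s x) \<partial>\<mu>) = (\<integral>\<^sup>+x. H x \<partial>\<mu>)"
proof -
 let ?dA = "\<lambda>x. indicator \<Omega> x * (ennreal (w x) * jac s x)"
 define A where "A = distr (density lborel ?dA) borel (inward s)"
 define B where "B = density lborel (\<lambda>x. indicator \<Omega> x * ennreal (w x))"
 have A: "(\<integral>\<^sup>+x. H x \<partial>A) = (\<integral>\<^sup>+x. jac s x * H (inward s x) \<partial>\<mu>)" if [measurable]: "H \<in> borel_measurable borel" for H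
 proof -
  have [measurable]: "(\<lambda>x. H (inward s x)) \<in> borel_measurable borel"
   by (rule measurable_compose[OF borel_inward that])
  have "(\<integral>\<^sup>+x. H x \<partial>A) = (\<integral>\<^sup>+x. H (inward s x) \<partial>density lborel ?dA)"
   unfolding A_def by (rule nn_integral_distr) auto
  also have "\<dots> = (\<integral>\<^sup>+x. ?dA x * H (inward s x) \<partial>lborel)"
   by (rule nn_integral_density) auto
  also have "\<dots> = (\<integral>\<^sup>+x. indicator \<Omega> x * (ennreal (w x) * (jac s x * H (inward s x))) \<partial>lborel)"
   by (simp add: mult.assoc)
  also have "\<dots> = (\<integral>\<^sup>+x. jac s x * H (inward s x) \<partial>\<mu>)"
   by (rule nn_integral_\<mu>[symmetric]) auto
  finally show ?thesis .
 qed
 have B: "(\<integral>\<^sup>+x. H x \<partial>B) = (\<integral>\<^sup>+x. H x \<partial>\<mu>)" if [measurable]: "H \<in> borel_measurable borel" for H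
 proof -
  have "(\<integral>\<^sup>+x. H x \<partial>B) = (\<integral>\<^sup>+x. indicator \<Omega> x * ennreal (w x) * H x \<partial>lborel)"
   unfolding B_def by (rule nn_integral_density) auto
  also have "\<dots> = (\<integral>\<^sup>+x. H x \<partial>\<mu>)"
   by (subst nn_integral_\<mu>[OF that]) (simp add: mult.assoc)
  finally show ?thesis .
 qed
 have "B = A"
 proof (rule measure_eq_on_Borel_by_test_functions[OF open_\<Omega>])
  show "sets B = sets borel" "sets A = sets borel" by (simp_all add: A_def B_def)
  show "emeasure B (- \<Omega>) = 0"
  proof -
   have "emeasure B (- \<Omega>) = (\<integral>\<^sup>+x. indicator (- \<Omega>) x \<partial>B)" by (simp add: B_def)
   also have "\<dots> = (\<integral>\<^sup>+x. indicator (- \<Omega>) x \<partial>\<mu>)" by (rule B) auto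
   also have "\<dots> = 0" by (subst nn_integral_cong[of _ _ "\<lambda>_. 0"]) auto
   finally show ?thesis .
  qed
  show "emeasure A (- \<Omega>) = 0"
  proof -
   have "emeasure A (- \<Omega>) = (\<integral>\<^sup>+x. indicator (- \<Omega>) x \<partial>A)" by (simp add: A_def)
   also have "\<dots> = (\<integral>\<^sup>+x. jac s x * indicator (- \<Omega>) (inward s x) \<partial>\<mu>)" by (rule A) auto
   also have "\<dots> = 0" by (subst nn_integral_cong[of _ _ "\<lambda>_. 0"]) (auto simp: jac_def)
   finally show ?thesis .
  qed
  show "emeasure B (cbox a b) < \<infinity>" if ab: "cbox a b \<subseteq> \<Omega>" for a b
  proof -
   have "integrable lborel (\<lambda>x. indicator (cbox a b) x *\<^sub>R w x)"
    by (rule borel_integrable_compact) (auto intro: continuous_on_subset[OF w_cont])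
   then have "(\<integral>\<^sup>+x. ennreal (indicator (cbox a b) x *\<^sub>R w x) \<partial>lborel) < \<infinity>"
    using integrableD(2) by (auto simp: less_top)
   moreover have "emeasure B (cbox a b) = (\<integral>\<^sup>+x. ennreal (indicator (cbox a b) x *\<^sub>R w x) \<partial>lborel)"
    unfolding B_def by (subst emeasure_density) (use ab in "auto intro!: nn_integral_cong simp: indicator_def")
   ultimately show ?thesis by simp
  qed
 next
  fix \<psi> :: "real^'n \<Rightarrow> real"
  assume \<psi>: "C1c \<Omega> \<psi>" "\<And>x. 0 \<le> \<psi> x" "\<And>x. \<psi> x \<le> 1"
  have b[measurable]: "\<psi> \<in> borel_measurable borel" by (rule borel_measurable_continuous_onI[OF C1c_continuous[OF \<psi>(1)]])
  have "(\<integral>\<^sup>+x. ennreal (\<psi> x) \<partial>A) = (\<integral>\<^sup>+x. jac s x * ennreal (\<psi> (inward s x)) \<partial>\<mu>)" by (rule A) auto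
  also have "\<dots> = (\<integral>\<^sup>+x. ennreal (sh m s \<psi> x) \<partial>\<mu>)"
   by (rule nn_integral_cong) (use test_off_\<Omega>[OF \<psi>(1)] in "auto simp: jac_def sh_def ennreal_mult \<psi>(2)")
  also have "\<dots> = ennreal (\<integral>x. sh m s \<psi> x \<partial>\<mu>)"
   by (rule nn_integral_eq_integral[OF test_integrable[OF sh_C1c[OF s \<psi>(1)]]]) (auto simp: sh_def \<psi>(2))
  also have "\<dots> = ennreal (\<integral>x. \<psi> x \<partial>\<mu>)" by (simp only: integral_sh[OF \<psi>(1) s])
  also have "\<dots> = (\<integral>\<^sup>+x. ennreal (\<psi> x) \<partial>\<mu>)"
   by (rule nn_integral_eq_integral[OF test_integrable[OF \<psi>(1)], symmetric]) (auto simp: \<psi>(2))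
  also have "\<dots> = (\<integral>\<^sup>+x. ennreal (\<psi> x) \<partial>B)" by (rule B[symmetric]) auto
  finally show "(\<integral>\<^sup>+x. ennreal (\<psi> x) \<partial>B) = (\<integral>\<^sup>+x. ennreal (\<psi> x) \<partial>A)" by simp
 qed
 then show ?thesis using A[OF H] B[OF H] by simp
qed

text \<open>The weight is the square root of the Jacobian.\<close>

lemma sh_isometry:
 fixes u :: "real^'n \<Rightarrow> complex"
 assumes u: "u \<in> borel_measurable borel" "\<And>x. x \<notin> \<Omega> \<Longrightarrow> u x = 0" "sc.sqi u" and s: "0 \<le> s"
 shows "sc.sqi (sh (m/2) s u)" "sc.nrm (sh (m/2) s u) = sc.nrm u" (is ?th1)
proof -
 have e: "ennreal (sh (m/2) s u x \<bullet> sh (m/2) s u x) = jac s x * ennreal (u (inward s x) \<bullet> u (inward s x))" for x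
 proof (cases "s < norm x \<and> inward s x \<in> \<Omega>")
  case True
  have "((norm x - s) / norm x) powr (m/2) * ((norm x - s) / norm x) powr (m/2) = ((norm x - s) / norm x) powr m"
   by (simp add: powr_add[symmetric])
  then have "sh (m/2) s u x \<bullet> sh (m/2) s u x = ((norm x - s) / norm x) powr m * (u (inward s x) \<bullet> u (inward s x))"
   using True by (simp add: sh_def mult.assoc[symmetric])
  then show ?thesis using True by (simp add: jac_def ennreal_mult)
 next
  case False
  then show ?thesis using u(2) by (auto simp: jac_def sh_def)
 qed
 have "(\<integral>\<^sup>+x. ennreal (sh (m/2) s u x \<bullet> sh (m/2) s u x) \<partial>\<mu>) = (\<integral>\<^sup>+x. ennreal (u x \<bullet> u x) \<partial>\<mu>)"
  unfolding e by (rule nn_integral_inward[OF _ s]) (use u(1) in simp)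
 also have "\<dots> = ennreal (sc.ip u u)" by (rule sc.nn_integral_eq_ip[OF u(3)])
 finally have I: "(\<integral>\<^sup>+x. ennreal (sh (m/2) s u x \<bullet> sh (m/2) s u x) \<partial>\<mu>) = ennreal (sc.ip u u)" .
 have meas: "sh (m/2) s u \<in> borel_measurable \<mu>" by (rule measurable_\<mu>_borel[OF borel_sh[OF u(1)]])
 show sq: "sc.sqi (sh (m/2) s u)" using sc.sqi_iff_finite[OF meas] I by simp
 have "ennreal (sc.ip (sh (m/2) s u) (sh (m/2) s u)) = ennreal (sc.ip u u)"
  using sc.nn_integral_eq_ip[OF sq] I by simp
 then show ?th1
  by (simp add: sc.nrm_def sc.ip_nonneg)
qed

lemma sh_diff: "sh \<kappa> s (\<lambda>x. f x - g x) x = sh \<kappa> s f x - sh \<kappa> s g x"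
 by (simp add: sh_def scaleR_diff_right)

lemma test_borel: "C1c \<Omega> f \<Longrightarrow> f \<in> borel_measurable borel"
 by (rule borel_measurable_continuous_onI[OF C1c_continuous])

lemma radP_sqi:
 fixes \<phi> :: "real^'n \<Rightarrow> complex"
 assumes \<phi>: "C1c \<Omega> \<phi>"
 shows "sc.sqi (radP \<kappa> \<phi>)"
proof -
 obtain K where K: "compact K" "K \<subseteq> \<Omega>" "\<And>x. x \<notin> K \<Longrightarrow> \<phi> x = 0" "\<And>i x. x \<notin> K \<Longrightarrow> partial_deriv i \<phi> x = 0"
  using C1cE[OF \<phi>] by metis
 show ?thesis
  by (rule sc_sqi_compact_support[OF continuous_on_radP[OF C1c_C1[OF \<phi>]] K(1,2)]) (use K(3,4) radP_zero in blast)
qed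

subsection \<open>The generator of the radial translations\<close>

text \<open>Pointwise convergence is the derivative along the flow, and the Lipschitz bound dominates.\<close>

lemma quotient_conv_test:
 fixes \<phi> :: "real^'n \<Rightarrow> complex"
 assumes \<phi>: "C1c \<Omega> \<phi>" and t: "\<And>j. 0 < t j" "\<And>j. t j \<le> 1" "t \<longlonglongrightarrow> 0"
 shows "sc.conv (\<lambda>j x. (\<phi> x - sh (m/2) (t j) \<phi> x) /\<^sub>R t j) (radP (m/2) \<phi>) sequentially"
proof -
 have m0: "m / 2 \<ge> 0" using m_ge by simp
 obtain B R where B: "B \<ge> 0" and lip: "\<And>x s t. x \<in> \<Omega> \<Longrightarrow> s \<in> {0..1} \<Longrightarrow> t \<in> {0..1} \<Longrightarrow>
   norm (sh (m/2) s \<phi> x - sh (m/2) t \<phi> x) \<le> B * \<bar>s - t\<bar> * indicator (cball 0 R) x"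
  using sh_lipschitz[OF \<phi> m0] by blast
 have tat: "filterlim t (at 0) sequentially" using t(1,3) by (simp add: filterlim_at less_imp_neq[THEN not_sym])
 let ?Q = "\<lambda>j x. (\<phi> x - sh (m/2) (t j) \<phi> x) /\<^sub>R t j"
 have sq: "sc.sqi (?Q j)" for j
  by (intro sc.sqi_scale sc.sqi_diff test_sqi(1) sh_C1c \<phi>) (use t(1) less_imp_le in blast)
 have lim: "(\<lambda>j. ?Q j x) \<longlonglongrightarrow> radP (m/2) \<phi> x" if x: "x \<in> \<Omega>" for x
 proof -
  have "((\<lambda>h. (sh (m/2) (0 + h) \<phi> x - sh (m/2) 0 \<phi> x) /\<^sub>R h) \<longlongrightarrow> - sh (m/2) 0 (radP (m/2) \<phi>) x) (at 0)"
   by (rule has_vector_derivative_quotient[OF sh_derivative_all[OF \<phi> x]])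
  from filterlim_compose[OF this tat]
  have "(\<lambda>j. (sh (m/2) (t j) \<phi> x - \<phi> x) /\<^sub>R t j) \<longlonglongrightarrow> - radP (m/2) \<phi> x"
   by (simp add: sh_zero[OF nonzero[OF x]])
  from tendsto_minus[OF this] show ?thesis by (simp add: scaleR_diff_right)
 qed
 have bd: "norm (?Q j x) \<le> B * indicator (cball 0 R) x" if x: "x \<in> \<Omega>" for j x
 proof -
  have "norm (sh (m/2) 0 \<phi> x - sh (m/2) (t j) \<phi> x) \<le> B * \<bar>0 - t j\<bar> * indicator (cball 0 R) x"
   by (rule lip[OF x]) (use t less_imp_le in auto)
  then have "norm (\<phi> x - sh (m/2) (t j) \<phi> x) / t j \<le> B * indicator (cball 0 R) x"
   using t(1)[of j] by (simp add: sh_zero[OF nonzero[OF x]] divide_le_eq mult_ac)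
  moreover have "norm (?Q j x) = norm (\<phi> x - sh (m/2) (t j) \<phi> x) / t j"
   using t(1)[of j] unfolding norm_scaleR by (simp only: abs_inverse abs_of_pos divide_inverse mult.commute)
  ultimately show ?thesis by (simp only:)
 qed
 have bP: "norm (radP (m/2) \<phi> x) \<le> B * indicator (cball 0 R) x" if x: "x \<in> \<Omega>" for x
  by (rule LIMSEQ_le_const2[OF tendsto_norm[OF lim[OF x]]]) (intro exI allI impI bd[OF x])
 have "(\<lambda>j. \<integral>x. (?Q j x - radP (m/2) \<phi> x) \<bullet> (?Q j x - radP (m/2) \<phi> x) \<partial>\<mu>) \<longlonglongrightarrow> (\<integral>x. 0 \<partial>\<mu>)"
 proof (rule integral_dominated_convergence[where w = "\<lambda>x. (2 * B)\<^sup>2 * indicator (cball 0 R) x"])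
  show "integrable \<mu> (\<lambda>x. (2 * B)\<^sup>2 * indicator (cball 0 R) x)" using integrable_indicator_cball by simp
  show "(\<lambda>x. (?Q j x - radP (m/2) \<phi> x) \<bullet> (?Q j x - radP (m/2) \<phi> x)) \<in> borel_measurable \<mu>" for j
   by (intro sc.q_meas borel_measurable_diff sc.sqi_meas sq radP_sqi \<phi>)
  show "AE x in \<mu>. (\<lambda>j. (?Q j x - radP (m/2) \<phi> x) \<bullet> (?Q j x - radP (m/2) \<phi> x)) \<longlonglongrightarrow> 0"
  proof (rule AE_I2)
   fix x assume "x \<in> space \<mu>" then have x: "x \<in> \<Omega>" by simp
   have "(\<lambda>j. (?Q j x - radP (m/2) \<phi> x) \<bullet> (?Q j x - radP (m/2) \<phi> x)) \<longlonglongrightarrow> (radP (m/2) \<phi> x - radP (m/2) \<phi> x) \<bullet> (radP (m/2) \<phi> x - radP (m/2) \<phi> x)"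
    by (intro tendsto_inner tendsto_diff lim[OF x] tendsto_const)
   then show "(\<lambda>j. (?Q j x - radP (m/2) \<phi> x) \<bullet> (?Q j x - radP (m/2) \<phi> x)) \<longlonglongrightarrow> 0" by simp
  qed
  show "AE x in \<mu>. norm ((?Q j x - radP (m/2) \<phi> x) \<bullet> (?Q j x - radP (m/2) \<phi> x)) \<le> (2 * B)\<^sup>2 * indicator (cball 0 R) x" for j
  proof (rule AE_I2)
   fix x assume "x \<in> space \<mu>" then have x: "x \<in> \<Omega>" by simp
   have "norm (?Q j x - radP (m/2) \<phi> x) \<le> 2 * B * indicator (cball 0 R) x"
    using norm_triangle_ineq4[of "?Q j x" "radP (m/2) \<phi> x"] bd[OF x, of j] bP[OF x] by simp
   then have "(norm (?Q j x - radP (m/2) \<phi> x))\<^sup>2 \<le> (2 * B * indicator (cball 0 R) x)\<^sup>2" by (rule power_mono) simp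
   also have "\<dots> = (2 * B)\<^sup>2 * indicator (cball 0 R) x" by (simp add: indicator_def)
   finally show "norm ((?Q j x - radP (m/2) \<phi> x) \<bullet> (?Q j x - radP (m/2) \<phi> x)) \<le> (2 * B)\<^sup>2 * indicator (cball 0 R) x"
    by (simp add: power2_norm_eq_inner)
  qed
 qed simp
 then show ?thesis
  using sq by (subst sc.conv_iff_ip) (auto simp: sc.ip_def radP_sqi[OF \<phi>])
qed

text \<open>
 Splitting a translation into \<open>N\<close> equal steps bounds the difference by \<open>N\<close> times the
 difference over one step, which tends to \<open>s\<close> times the norm of the generator.
\<close>

lemma quotient_bound_test:
 fixes \<phi> :: "real^'n \<Rightarrow> complex"
 assumes \<phi>: "C1c \<Omega> \<phi>" and s: "0 < s"
 shows "sc.nrm (\<lambda>x. \<phi> x - sh (m/2) s \<phi> x) \<le> s * sc.nrm (radP (m/2) \<phi>)"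
proof -
 have step: "sc.nrm (\<lambda>x. \<phi> x - sh (m/2) (real N * t) \<phi> x) \<le> real N * sc.nrm (\<lambda>x. \<phi> x - sh (m/2) t \<phi> x)" if t: "t \<ge> 0" for N t
 proof (induction N)
  case 0
  have "sc.nrm (\<lambda>x. \<phi> x - sh (m/2) 0 \<phi> x) = sc.nrm (\<lambda>x. 0)"
   by (rule sc.nrm_cong_AE[OF _ sc.sqi_meas[OF sc.sqi_diff[OF test_sqi(1)[OF \<phi>] test_sqi(1)[OF sh_C1c[OF order_refl \<phi>]]]]])
    (auto intro!: AE_I2 simp: sh_zero nonzero)
  then show ?case by (simp add: sc.nrm_def sc.ip_def)
 next
  case (Suc N)
  let ?D = "\<lambda>x. \<phi> x - sh (m/2) (real N * t) \<phi> x"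
  have Nt: "real N * t \<ge> 0" using t by simp
  have sD: "sc.sqi ?D" by (intro sc.sqi_diff test_sqi(1) sh_C1c \<phi> Nt)
  have sd: "sc.sqi (\<lambda>x. \<phi> x - sh (m/2) t \<phi> x)" by (intro sc.sqi_diff test_sqi(1) sh_C1c \<phi> t)
  have e: "\<phi> x - sh (m/2) (real (Suc N) * t) \<phi> x = (\<phi> x - sh (m/2) t \<phi> x) + sh (m/2) t ?D x" for x
   using sh_compose[OF t Nt, of "m/2" \<phi> x] by (simp add: sh_diff distrib_right)
  have iso: "sc.sqi (sh (m/2) t ?D)" "sc.nrm (sh (m/2) t ?D) = sc.nrm ?D"
   by (rule sh_isometry[OF _ _ sD t];
     use test_borel[OF \<phi>] test_borel[OF sh_C1c[OF Nt \<phi>]] test_off_\<Omega>[OF \<phi>] test_off_\<Omega>[OF sh_C1c[OF Nt \<phi>]] in auto)+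
  have "sc.nrm (\<lambda>x. \<phi> x - sh (m/2) (real (Suc N) * t) \<phi> x) \<le> sc.nrm (\<lambda>x. \<phi> x - sh (m/2) t \<phi> x) + sc.nrm ?D"
   unfolding e using sc.nrm_triangle[OF sd iso(1)] iso(2) by simp
  then show ?case using Suc by (simp add: distrib_right)
 qed
 \<comment> \<open>The number of steps starts large enough for the step size to be at most 1.\<close>
 obtain N0 :: nat where N0: "s \<le> real N0" using real_arch_simple by blast
 define N where "N j = N0 + Suc j" for j
 define t where "t j = s / real (N j)" for j
 have t: "0 < t j" "t j \<le> 1" for j using s N0 by (auto simp: t_def N_def)
 have tl: "t \<longlonglongrightarrow> 0"
 proof -
  have "(\<lambda>j. s / real (j + (Suc N0))) \<longlonglongrightarrow> 0"
   by (rule LIMSEQ_ignore_initial_segment) (rule lim_const_over_n)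
  moreover have "(\<lambda>j. s / real (j + Suc N0)) = t" by (simp add: t_def N_def fun_eq_iff ac_simps)
  ultimately show ?thesis by simp
 qed
 have "(\<lambda>j. sc.nrm (\<lambda>x. (\<phi> x - sh (m/2) (t j) \<phi> x) /\<^sub>R t j)) \<longlonglongrightarrow> sc.nrm (radP (m/2) \<phi>)"
  by (rule sc.conv_tendsto_nrm[OF quotient_conv_test[OF \<phi> t tl]])
 then have lim: "(\<lambda>j. s * sc.nrm (\<lambda>x. (\<phi> x - sh (m/2) (t j) \<phi> x) /\<^sub>R t j)) \<longlonglongrightarrow> s * sc.nrm (radP (m/2) \<phi>)"
  by (intro tendsto_intros)
 show ?thesis
 proof (rule LIMSEQ_le_const[OF lim], intro exI allI impI)
  fix j :: nat
  have Ns: "real (N j) * t j = s" by (simp add: t_def N_def)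
  have "sc.nrm (\<lambda>x. \<phi> x - sh (m/2) s \<phi> x) \<le> real (N j) * sc.nrm (\<lambda>x. \<phi> x - sh (m/2) (t j) \<phi> x)"
   using step[of "t j" "N j"] t(1)[of j] Ns by simp
  also have "\<dots> = s * sc.nrm (\<lambda>x. (\<phi> x - sh (m/2) (t j) \<phi> x) /\<^sub>R t j)"
  proof -
   have "s * inverse (t j) = real (N j)" using Ns t(1)[of j] by (simp add: field_simps)
   then show ?thesis using sc.nrm_scale[of "inverse (t j)" "\<lambda>x. \<phi> x - sh (m/2) (t j) \<phi> x"] t(1)[of j]
    by (simp add: mult.assoc[symmetric])
  qed
  finally show "sc.nrm (\<lambda>x. \<phi> x - sh (m/2) s \<phi> x) \<le> s * sc.nrm (\<lambda>x. (\<phi> x - sh (m/2) (t j) \<phi> x) /\<^sub>R t j)" .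
 qed
qed

end


section \<open>Radial and tangential parts of gradients\<close>

text \<open>The radial derivative \<open>du(\<theta>)\<close> in terms of the gradient: the factor \<open>G\<close> disappears as \<open>G \<theta> = \<theta>\<close>.\<close>

definition radf :: "(real^'n \<Rightarrow> complex^'n) \<Rightarrow> real^'n \<Rightarrow> complex" where
 "radf V x = (\<Sum>i\<in>UNIV. (x $ i / norm x) *\<^sub>R V x $ i)"

definition tanf :: "(real^'n \<Rightarrow> complex^'n) \<Rightarrow> real^'n \<Rightarrow> complex^'n" where
 "tanf V x = V x - cvec (x /\<^sub>R norm x) (radf V x)"

lemma cvec_inner: "cvec x z \<bullet> W = z \<bullet> (\<Sum>i\<in>UNIV. x $ i *\<^sub>R W $ i)"
 by (simp add: cvec_def inner_vec_def inner_sum_right)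

lemma radf_diff: "radf (\<lambda>x. V x - W x) x = radf V x - radf W x"
 by (simp add: radf_def scaleR_diff_right sum_subtractf)



context radial_domain begin

lemma G_dir: "G x *v (x /\<^sub>R norm x) = x /\<^sub>R norm x"
 by (simp add: matrix_vector_mult_scaleR G_x)

lemma Gi_dir: "matrix_inv (G x) *v (x /\<^sub>R norm x) = x /\<^sub>R norm x"
 by (simp add: matrix_vector_mult_scaleR Gi_x)

lemma radf_sum: "radf V x = (\<Sum>i\<in>UNIV. (x /\<^sub>R norm x) $ i *\<^sub>R V x $ i)"
 by (simp add: radf_def divide_inverse mult.commute)

lemma radf_cvec_dir: "x \<noteq> 0 \<Longrightarrow> (\<Sum>i\<in>UNIV. (x /\<^sub>R norm x) $ i *\<^sub>R cvec (x /\<^sub>R norm x) z $ i) = z"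
 using sum_direction_sq[of x]
 by (simp add: cvec_def scaleR_sum_left[symmetric] divide_inverse mult_ac)

lemma g_inner_cvec_dir: "g_inner (G x) (cvec (x /\<^sub>R norm x) z) W = z \<bullet> (\<Sum>i\<in>UNIV. (x /\<^sub>R norm x) $ i *\<^sub>R W $ i)"
 by (simp only: g_inner_act matrix_act_cvec G_dir cvec_inner)

lemma radf_tanf: "x \<noteq> 0 \<Longrightarrow> radf (tanf V) x = 0"
proof -
 assume x: "x \<noteq> 0"
 have "radf (tanf V) x = radf V x - (\<Sum>i\<in>UNIV. (x /\<^sub>R norm x) $ i *\<^sub>R cvec (x /\<^sub>R norm x) (radf V x) $ i)"
  by (simp add: radf_sum[of "tanf V"] radf_sum[of V] tanf_def scaleR_diff_right sum_subtractf del: vector_scaleR_component)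
 then show ?thesis by (simp only: radf_cvec_dir[OF x] diff_self)
qed

text \<open>
 Radial and tangential directions are orthogonal in the metric as well, because \<open>\<theta>\<close> is an
 eigenvector of the symmetric matrix \<open>G\<close>.
\<close>

lemma g_inner_decomp:
 assumes x: "x \<noteq> 0"
 shows "g_inner (G x) (V x) (W x) = radf V x \<bullet> radf W x + g_inner (G x) (tanf V x) (tanf W x)"
proof -
 have V: "V x = cvec (x /\<^sub>R norm x) (radf V x) + tanf V x" by (simp add: tanf_def)
 have c: "g_inner (G x) (cvec (x /\<^sub>R norm x) z) (tanf W x) = 0" for z and W :: "real^'n \<Rightarrow> complex^'n"
  unfolding g_inner_cvec_dir radf_sum[of "tanf W", symmetric] radf_tanf[OF x] by simp
 have "g_inner (G x) (V x) (W x) = g_inner (G x) (cvec (x /\<^sub>R norm x) (radf V x)) (W x) + g_inner (G x) (tanf V x) (W x)"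
  by (subst V) (rule vf.q_add)
 also have "g_inner (G x) (cvec (x /\<^sub>R norm x) (radf V x)) (W x) = radf V x \<bullet> radf W x"
  unfolding g_inner_cvec_dir radf_sum[of W, symmetric] ..
 also have "g_inner (G x) (tanf V x) (W x) = g_inner (G x) (tanf V x) (tanf W x)"
 proof -
  have "W x = cvec (x /\<^sub>R norm x) (radf W x) + tanf W x" by (simp add: tanf_def)
  then have "g_inner (G x) (W x) (tanf V x) = g_inner (G x) (cvec (x /\<^sub>R norm x) (radf W x)) (tanf V x) + g_inner (G x) (tanf W x) (tanf V x)"
   using vf.q_add by metis
  then have "g_inner (G x) (W x) (tanf V x) = g_inner (G x) (tanf W x) (tanf V x)"
   by (simp only: c add_0)
  then show ?thesis
   using g_inner_sym[of x "W x" "tanf V x"] g_inner_sym[of x "tanf W x" "tanf V x"] by linarith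
 qed
 finally show ?thesis .
qed

lemma radf_grad: "radf (g_grad G \<phi>) x = rad \<phi> x"
proof -
 have "radf (g_grad G \<phi>) x \<bullet> z = rad \<phi> x \<bullet> z" for z
 proof -
  have "radf (g_grad G \<phi>) x \<bullet> z = cvec (x /\<^sub>R norm x) z \<bullet> g_grad G \<phi> x"
   unfolding cvec_inner radf_sum by (rule inner_commute)
  also have "\<dots> = matrix_act (matrix_inv (G x)) (cvec (x /\<^sub>R norm x) z) \<bullet> grad_vec \<phi> x"
   using g_inner_transpose[of "matrix_inv (G x)" "cvec (x /\<^sub>R norm x) z" "grad_vec \<phi> x"]
   by (simp only: g_grad_eq g_inner_eq Gi_sym)
  also have "\<dots> = cvec (x /\<^sub>R norm x) z \<bullet> grad_vec \<phi> x"
   by (simp only: matrix_act_cvec Gi_dir)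
  also have "\<dots> = z \<bullet> (\<Sum>i\<in>UNIV. (x /\<^sub>R norm x) $ i *\<^sub>R partial_deriv i \<phi> x)"
   by (simp only: cvec_inner grad_vec_nth)
  also have "\<dots> = rad \<phi> x \<bullet> z"
   by (subst inner_commute) (simp add: rad_def divide_inverse mult.commute)
  finally show ?thesis .
 qed
 then show ?thesis by (metis inner_eq_zero_iff inner_diff_left right_minus_eq)
qed

end

context radial_exterior begin

lemma direction_C1: "continuous_on \<Omega> (\<lambda>x. x $ i / norm x)"
 using nonzero by (intro continuous_intros) auto

lemma measurable_direction: "(\<lambda>x. x $ i / norm x) \<in> borel_measurable \<mu>"
 by (rule measurable_\<mu>_cont[OF direction_C1])

lemma measurable_radf: "V \<in> borel_measurable \<mu> \<Longrightarrow> radf V \<in> borel_measurable \<mu>"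
 unfolding radf_def
 by (intro borel_measurable_sum borel_measurable_scaleR measurable_direction) (simp add: borel_measurable_vec_iff)

lemma measurable_tanf: "V \<in> borel_measurable \<mu> \<Longrightarrow> tanf V \<in> borel_measurable \<mu>"
proof -
 assume V: "V \<in> borel_measurable \<mu>"
 have "(\<lambda>x. V x $ i - (x $ i / norm x) *\<^sub>R radf V x) \<in> borel_measurable \<mu>" for i
  by (intro borel_measurable_diff borel_measurable_scaleR measurable_direction measurable_radf V)
   (use V in "simp add: borel_measurable_vec_iff")
 then show ?thesis
  by (subst borel_measurable_vec_iff) (simp add: tanf_def cvec_def divide_inverse mult.commute)
qed

lemma radf_le: "x \<in> \<Omega> \<Longrightarrow> radf V x \<bullet> radf V x \<le> g_inner (G x) (V x) (V x)"
 using g_inner_decomp[OF nonzero, of x V V] g_inner_nonneg[of x "tanf V x"] by simp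

lemma radf_sqi:
 assumes "vf.sqi V" shows "sc.sqi (radf V)"
proof -
 have "integrable \<mu> (\<lambda>x. radf V x \<bullet> radf V x)"
 proof (rule Bochner_Integration.integrable_bound)
  show "integrable \<mu> (\<lambda>x. g_inner (G x) (V x) (V x))" using assms by (simp add: vf.sqi_def)
  show "(\<lambda>x. radf V x \<bullet> radf V x) \<in> borel_measurable \<mu>"
   using measurable_radf vf.sqi_meas[OF assms] by simp
  show "AE x in \<mu>. norm (radf V x \<bullet> radf V x) \<le> norm (g_inner (G x) (V x) (V x))"
   by (rule AE_I2) (use radf_le g_inner_nonneg in "auto simp: order_trans[OF _ abs_ge_self]")
 qed
 then show ?thesis using measurable_radf[OF vf.sqi_meas[OF assms]] by (simp add: sc.sqi_def)
qed

lemma radf_nrm: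
 assumes "vf.sqi V" shows "sc.nrm (radf V) \<le> vf.nrm V"
proof -
 have "sc.ip (radf V) (radf V) \<le> vf.ip V V"
  unfolding sc.ip_def vf.ip_def
  by (rule integral_mono_AE) (use assms radf_sqi[OF assms] radf_le in "auto simp: vf.sqi_def sc.sqi_def intro!: AE_I2")
 then show ?thesis by (simp add: sc.nrm_def vf.nrm_def)
qed

lemma radf_conv:
 assumes "vf.conv V V0 F" shows "sc.conv (\<lambda>k. radf (V k)) (radf V0) F"
 unfolding sc.conv_def
proof (intro conjI)
 have s: "vf.sqi V0" "\<forall>\<^sub>F k in F. vf.sqi (V k)" using assms by (auto simp: vf.conv_def)
 show "sc.sqi (radf V0)" by (rule radf_sqi[OF s(1)])
 show "\<forall>\<^sub>F k in F. sc.sqi (radf (V k))" using s(2) by eventually_elim (rule radf_sqi)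
 have l: "((\<lambda>k. vf.nrm (\<lambda>x. V k x - V0 x)) \<longlongrightarrow> 0) F" using assms by (simp add: vf.conv_def)
 have e: "\<forall>\<^sub>F k in F. norm (sc.nrm (\<lambda>x. radf (V k) x - radf V0 x)) \<le> vf.nrm (\<lambda>x. V k x - V0 x)"
  using s(2)
 proof eventually_elim
  case (elim k)
  have "(\<lambda>x. radf (V k) x - radf V0 x) = radf (\<lambda>x. V k x - V0 x)" by (simp add: radf_diff fun_eq_iff)
  then show ?case using radf_nrm[OF vf.sqi_diff[OF elim s(1)]] sc.nrm_nonneg by simp
 qed
 show "((\<lambda>k. sc.nrm (\<lambda>x. radf (V k) x - radf V0 x)) \<longlongrightarrow> 0) F"
  by (rule Lim_null_comparison[OF e l])
qed

lemmas mult_bounded = sc.bounded_scale[unfolded space_\<mu>]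
 and mult_bounded_conv = sc.bounded_scale_conv[unfolded space_\<mu>]

lemma inverse_norm_power:
 obtains C where "\<And>x. x \<in> \<Omega> \<Longrightarrow> \<bar>c / norm x ^ k\<bar> \<le> C" "(\<lambda>x. c / norm x ^ k) \<in> borel_measurable \<mu>"
proof -
 obtain \<delta> where \<delta>: "\<delta> > 0" "\<And>x. x \<in> \<Omega> \<Longrightarrow> \<delta> \<le> norm x" using \<Omega>_away by blast
 have "\<bar>c / norm x ^ k\<bar> \<le> \<bar>c\<bar> / \<delta> ^ k" if "x \<in> \<Omega>" for x
 proof -
  have "\<delta> ^ k \<le> norm x ^ k" using \<delta> that by (intro power_mono) auto
  then show ?thesis using \<delta>(1) by (simp add: abs_divide frac_le)
 qed
 moreover have "(\<lambda>x. c / norm x ^ k) \<in> borel_measurable \<mu>"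
  by (rule measurable_\<mu>_cont) (use nonzero in "auto intro!: continuous_intros")
 ultimately show ?thesis using that by blast
qed

lemma over_norm_conv:
 "sc.conv u u0 F \<Longrightarrow> sc.conv (\<lambda>k x. (c / norm x ^ j) *\<^sub>R u k x) (\<lambda>x. (c / norm x ^ j) *\<^sub>R u0 x) F"
 by (rule inverse_norm_power[of c j], rule mult_bounded_conv)

lemma over_norm_sqi: "sc.sqi u \<Longrightarrow> sc.sqi (\<lambda>x. (c / norm x ^ j) *\<^sub>R u x)"
 by (rule inverse_norm_power[of c j], rule mult_bounded(1))

text \<open>
 \<open>P\<close> on pairs of a function and its gradient.  The exponent 1 makes the second term an instance of
 the estimates for multiplication by \<open>|x|\<^bsup>-j\<^esup>\<close>.
\<close>

definition genP :: "(real^'n \<Rightarrow> complex) \<Rightarrow> (real^'n \<Rightarrow> complex^'n) \<Rightarrow> real^'n \<Rightarrow> complex" where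
 "genP u V x = radf V x + ((m / 2) / norm x ^ 1) *\<^sub>R u x"

lemma genP_test: "genP \<phi> (g_grad G \<phi>) = radP (m / 2) \<phi>"
 by (simp add: genP_def radP_def radf_grad fun_eq_iff)

lemma genP_conv: "sc.conv u u0 F \<Longrightarrow> vf.conv V V0 F \<Longrightarrow> sc.conv (\<lambda>k. genP (u k) (V k)) (genP u0 V0) F"
 unfolding genP_def[abs_def] by (intro sc.conv_add radf_conv over_norm_conv)

lemma genP_sqi: "sc.sqi u \<Longrightarrow> vf.sqi V \<Longrightarrow> sc.sqi (genP u V)"
 unfolding genP_def[abs_def] by (intro sc.sqi_add radf_sqi over_norm_sqi)

lemma genP_diff: "genP (\<lambda>x. u x - u' x) (\<lambda>x. V x - V' x) x = genP u V x - genP u' V' x"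
 by (simp add: genP_def radf_diff scaleR_diff_right)

lemma C1c_inner_self: "C1c \<Omega> f \<Longrightarrow> C1c \<Omega> g \<Longrightarrow> C1c \<Omega> (\<lambda>x. (f x :: complex) \<bullet> g x)"
 by (rule C1c_inner[OF open_\<Omega> C1c_C1])

lemma rad_inner:
 fixes f g :: "real^'n \<Rightarrow> complex"
 assumes "f differentiable (at x)" "g differentiable (at x)"
 shows "rad (\<lambda>x. f x \<bullet> g x) x = rad f x \<bullet> g x + f x \<bullet> rad g x"
 unfolding rad_def partial_deriv_inner[OF assms]
 by (simp add: inner_sum_left inner_sum_right sum.distrib distrib_left add.commute)

text \<open>
 For test functions the sum of the two pairings is the integral of \<open>u\<bullet>u'\<close> differentiated by \<open>radP m\<close>,
 a divergence; the general case follows by density.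
\<close>

lemma genP_antisym:
 assumes u: "H10 u U" and v: "H10 v V"
 shows "sc.ip (genP u U) v = - sc.ip u (genP v V)"
proof -
 have test: "sc.ip (radP (m/2) \<phi>) \<psi> + sc.ip \<phi> (radP (m/2) \<psi>) = 0" if t: "C1c \<Omega> \<phi>" "C1c \<Omega> \<psi>" for \<phi> \<psi>
 proof -
  have "radP (m/2) \<phi> x \<bullet> \<psi> x + \<phi> x \<bullet> radP (m/2) \<psi> x = radP m (\<lambda>x. \<phi> x \<bullet> \<psi> x) x" for x
   using rad_inner[OF C1c_differentiable[OF t(1)] C1c_differentiable[OF t(2)]]
   by (simp add: radP_def inner_add_left inner_add_right)
  moreover have "(\<integral>x. radP m (\<lambda>x. \<phi> x \<bullet> \<psi> x) x \<partial>\<mu>) = 0"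
   by (rule radial_by_parts[OF C1c_inner_self[OF t]])
  ultimately show ?thesis
   unfolding sc.ip_def
   by (subst Bochner_Integration.integral_add[symmetric])
    (use sc.integrable_q[OF radP_sqi[OF t(1)] test_sqi(1)[OF t(2)]] sc.integrable_q[OF test_sqi(1)[OF t(1)] radP_sqi[OF t(2)]] in simp_all)
 qed
 obtain \<phi> where \<phi>: "\<And>k. C1c \<Omega> (\<phi> k)" "sc.conv \<phi> u sequentially" "vf.conv (\<lambda>k. g_grad G (\<phi> k)) U sequentially"
  using H10E[OF u] by metis
 obtain \<psi> where \<psi>: "\<And>k. C1c \<Omega> (\<psi> k)" "sc.conv \<psi> v sequentially" "vf.conv (\<lambda>k. g_grad G (\<psi> k)) V sequentially"
  using H10E[OF v] by metis
 have "(\<lambda>k. sc.ip (genP (\<phi> k) (g_grad G (\<phi> k))) (\<psi> k) + sc.ip (\<phi> k) (genP (\<psi> k) (g_grad G (\<psi> k)))) \<longlonglongrightarrow> sc.ip (genP u U) v + sc.ip u (genP v V)"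
  by (intro tendsto_add sc.conv_tendsto_ip genP_conv \<phi> \<psi>)
 then have "(\<lambda>k. 0) \<longlonglongrightarrow> sc.ip (genP u U) v + sc.ip u (genP v V)"
  by (simp add: genP_test test[OF \<phi>(1) \<psi>(1)])
 then show ?thesis by (simp add: LIMSEQ_const_iff)
qed

text \<open>The divergence identity for \<open>|\<phi>|\<^sup>2/r\<^sup>2\<close>: differentiating the weight turns \<open>m\<close> into \<open>m - 2\<close>.\<close>

lemma hardy_identity:
 assumes u: "H10 u U"
 shows "2 * sc.ip (\<lambda>x. (1 / norm x ^ 2) *\<^sub>R radf U x) u + (m - 2) * sc.ip (\<lambda>x. (1 / norm x ^ 3) *\<^sub>R u x) u = 0"
proof -
 have test: "2 * sc.ip (\<lambda>x. (1 / norm x ^ 2) *\<^sub>R radf (g_grad G \<phi>) x) \<phi> + (m - 2) * sc.ip (\<lambda>x. (1 / norm x ^ 3) *\<^sub>R \<phi> x) \<phi> = 0"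
  if t: "C1c \<Omega> \<phi>" for \<phi>
 proof -
  let ?f = "\<lambda>x. (1 / (norm x * norm x)) *\<^sub>R (\<phi> x \<bullet> \<phi> x)"
  have c: "C1_on \<Omega> (\<lambda>x. 1 / (norm x * norm x))"
   by (intro C1_on_divide C1_on_const C1_on_mult C1_on_norm_\<Omega>) (use nonzero in auto)
  have f: "C1c \<Omega> ?f" by (rule C1c_scaleR[OF open_\<Omega> c C1c_inner_self[OF t t]])
  have pw: "radP m ?f x = 2 * (((1 / norm x ^ 2) *\<^sub>R rad \<phi> x) \<bullet> \<phi> x) + (m - 2) * (((1 / norm x ^ 3) *\<^sub>R \<phi> x) \<bullet> \<phi> x)" if x: "x \<in> \<Omega>" for x
  proof -
   have n: "norm x > 0" using norm_pos[OF x] .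
   have dd: "((\<lambda>r::real. 1 / (r * r)) has_real_derivative - 2 / (norm x ^ 3)) (at (norm x))"
    using n by (auto intro!: derivative_eq_intros simp: field_simps power3_eq_cube)
   from has_derivative_compose[OF has_derivative_norm_vec[OF nonzero[OF x]] dd[unfolded has_field_derivative_def]]
   have pn: "partial_deriv i (\<lambda>x. 1 / (norm x * norm x)) x = - 2 / (norm x ^ 3) * (x $ i / norm x)" for i
    by (subst partial_deriv_eq) (assumption, simp add: inner_axis')
   have pf: "partial_deriv i ?f x = (1 / (norm x * norm x)) *\<^sub>R partial_deriv i (\<lambda>x. \<phi> x \<bullet> \<phi> x) x + (- 2 / (norm x ^ 3) * (x $ i / norm x)) *\<^sub>R (\<phi> x \<bullet> \<phi> x)" for i
    using partial_deriv_scaleR[OF C1_on_differentiable[OF c x] C1c_differentiable[OF C1c_inner_self[OF t t]], of i] pn by simp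
   have "rad ?f x = (\<Sum>i\<in>UNIV. (1 / (norm x * norm x)) * ((x $ i / norm x) *\<^sub>R partial_deriv i (\<lambda>x. \<phi> x \<bullet> \<phi> x) x)
     + (- 2 / norm x ^ 3 * (\<phi> x \<bullet> \<phi> x)) * ((x $ i / norm x) * (x $ i / norm x)))"
    unfolding rad_def[of ?f] pf by (rule sum.cong[OF refl]) (simp add: algebra_simps)
   also have "\<dots> = (1 / (norm x * norm x)) * rad (\<lambda>x. \<phi> x \<bullet> \<phi> x) x + (- 2 / norm x ^ 3 * (\<phi> x \<bullet> \<phi> x)) * (\<Sum>i\<in>UNIV. (x $ i / norm x) * (x $ i / norm x))"
    by (simp only: sum.distrib sum_distrib_left[symmetric] rad_def[of "\<lambda>x. \<phi> x \<bullet> \<phi> x", symmetric])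
   also have "\<dots> = (1 / (norm x * norm x)) * (2 * (rad \<phi> x \<bullet> \<phi> x)) - 2 / norm x ^ 3 * (\<phi> x \<bullet> \<phi> x)"
    unfolding sum_direction_sq[OF nonzero[OF x]] using rad_inner[OF C1c_differentiable[OF t] C1c_differentiable[OF t]]
    by (simp add: inner_commute)
   finally have rf: "rad ?f x = (1 / (norm x * norm x)) * (2 * (rad \<phi> x \<bullet> \<phi> x)) - 2 / norm x ^ 3 * (\<phi> x \<bullet> \<phi> x)" .
   show ?thesis unfolding radP_def rf using n
    by (simp add: field_simps power2_eq_square power3_eq_cube)
  qed
  have i: "integrable \<mu> (\<lambda>x. ((1 / norm x ^ 2) *\<^sub>R rad \<phi> x) \<bullet> \<phi> x)" "integrable \<mu> (\<lambda>x. ((1 / norm x ^ 3) *\<^sub>R \<phi> x) \<bullet> \<phi> x)"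
   using sc.integrable_q[OF over_norm_sqi[OF radf_sqi[OF test_sqi(3)[OF t]]] test_sqi(1)[OF t]]
    sc.integrable_q[OF over_norm_sqi[OF test_sqi(1)[OF t]] test_sqi(1)[OF t]] by (simp_all only: radf_grad)
  have "0 = (\<integral>x. radP m ?f x \<partial>\<mu>)" using radial_by_parts[OF f] by simp
  also have "\<dots> = (\<integral>x. 2 * (((1 / norm x ^ 2) *\<^sub>R rad \<phi> x) \<bullet> \<phi> x) + (m - 2) * (((1 / norm x ^ 3) *\<^sub>R \<phi> x) \<bullet> \<phi> x) \<partial>\<mu>)"
   by (rule Bochner_Integration.integral_cong[OF refl]) (simp only: pw space_\<mu>)
  also have "\<dots> = 2 * (\<integral>x. ((1 / norm x ^ 2) *\<^sub>R rad \<phi> x) \<bullet> \<phi> x \<partial>\<mu>) + (m - 2) * (\<integral>x. ((1 / norm x ^ 3) *\<^sub>R \<phi> x) \<bullet> \<phi> x \<partial>\<mu>)"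
   by (subst Bochner_Integration.integral_add) (intro integrable_mult_right i, intro integrable_mult_right i, simp only: integral_mult_right_zero)
  finally show ?thesis by (simp only: sc.ip_def radf_grad)
 qed
 obtain \<phi> where \<phi>: "\<And>k. C1c \<Omega> (\<phi> k)" "sc.conv \<phi> u sequentially" "vf.conv (\<lambda>k. g_grad G (\<phi> k)) U sequentially"
  using H10E[OF u] by metis
 have "(\<lambda>k. 2 * sc.ip (\<lambda>x. (1 / norm x ^ 2) *\<^sub>R radf (g_grad G (\<phi> k)) x) (\<phi> k) + (m - 2) * sc.ip (\<lambda>x. (1 / norm x ^ 3) *\<^sub>R \<phi> k x) (\<phi> k))
   \<longlonglongrightarrow> 2 * sc.ip (\<lambda>x. (1 / norm x ^ 2) *\<^sub>R radf U x) u + (m - 2) * sc.ip (\<lambda>x. (1 / norm x ^ 3) *\<^sub>R u x) u"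
  by (intro tendsto_add tendsto_mult tendsto_const sc.conv_tendsto_ip over_norm_conv radf_conv \<phi>)
 then have "(\<lambda>k. 0) \<longlonglongrightarrow> 2 * sc.ip (\<lambda>x. (1 / norm x ^ 2) *\<^sub>R radf U x) u + (m - 2) * sc.ip (\<lambda>x. (1 / norm x ^ 3) *\<^sub>R u x) u"
  by (simp only: test[OF \<phi>(1)])
 then show ?thesis by (simp add: LIMSEQ_const_iff)
qed

lemma H10_test: "C1c \<Omega> \<phi> \<Longrightarrow> H10 \<phi> (g_grad G \<phi>)"
 unfolding H10_def
 by (intro exI[of _ "\<lambda>_. \<phi>"] conjI allI) (auto intro!: sc.conv_const vf.conv_const test_sqi)

lemma quotient_bound:
 assumes u: "u \<in> borel_measurable borel" "\<And>x. x \<notin> \<Omega> \<Longrightarrow> u x = 0" and H: "H10 u U" and s: "0 < s"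
 shows "sc.nrm (\<lambda>x. u x - sh (m/2) s u x) \<le> s * sc.nrm (genP u U)"
proof -
 obtain \<phi> where \<phi>: "\<And>k. C1c \<Omega> (\<phi> k)" "sc.conv \<phi> u sequentially" "vf.conv (\<lambda>k. g_grad G (\<phi> k)) U sequentially"
  "sc.sqi u" using H10E[OF H] by metis
 have su: "sc.sqi (sh (m/2) s u)" by (rule sh_isometry(1)[OF u \<phi>(4) less_imp_le[OF s]])
 have "sc.conv (\<lambda>k. sh (m/2) s (\<phi> k)) (sh (m/2) s u) sequentially"
 proof (rule sc.conv_dominated)
  show "\<forall>\<^sub>F k in sequentially. sc.sqi (sh (m/2) s (\<phi> k))"
   by (intro always_eventually allI test_sqi(1) sh_C1c \<phi>(1) less_imp_le[OF s])
  show "sc.nrm (\<lambda>x. sh (m/2) s (\<phi> k) x - sh (m/2) s u x) \<le> sc.nrm (\<lambda>x. \<phi> k x - u x)" for k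
  proof -
   have "sc.nrm (sh (m/2) s (\<lambda>x. \<phi> k x - u x)) = sc.nrm (\<lambda>x. \<phi> k x - u x)"
    by (rule sh_isometry(2)) (use test_borel[OF \<phi>(1)] test_off_\<Omega>[OF \<phi>(1)] u s sc.sqi_diff[OF test_sqi(1)[OF \<phi>(1)] \<phi>(4)] in auto)
   then show ?thesis by (simp add: sh_diff[abs_def])
  qed
  show "(\<lambda>k. sc.nrm (\<lambda>x. \<phi> k x - u x)) \<longlonglongrightarrow> 0" using \<phi>(2) by (simp add: sc.conv_def)
 qed (rule su)
 then have l: "(\<lambda>k. sc.nrm (\<lambda>x. \<phi> k x - sh (m/2) s (\<phi> k) x)) \<longlonglongrightarrow> sc.nrm (\<lambda>x. u x - sh (m/2) s u x)"
  by (intro sc.conv_tendsto_nrm sc.conv_diff \<phi>)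
 have r: "(\<lambda>k. s * sc.nrm (genP (\<phi> k) (g_grad G (\<phi> k)))) \<longlonglongrightarrow> s * sc.nrm (genP u U)"
  by (intro tendsto_intros sc.conv_tendsto_nrm genP_conv \<phi>)
 show ?thesis
  by (rule LIMSEQ_le[OF l r]) (use quotient_bound_test[OF \<phi>(1) s] in "auto simp: genP_test")
qed

text \<open>
 The difference quotients are bounded by the \<open>H\<^sup>1\<close> norm uniformly in the step and converge on a dense
 set, hence they converge everywhere.
\<close>

lemma quotient_conv:
 assumes u: "u \<in> borel_measurable borel" "\<And>x. x \<notin> \<Omega> \<Longrightarrow> u x = 0" and H: "H10 u U"
  and t: "\<And>j. 0 < t j" "\<And>j. t j \<le> 1" "t \<longlonglongrightarrow> 0"
 shows "sc.conv (\<lambda>j x. (u x - sh (m/2) (t j) u x) /\<^sub>R t j) (genP u U) sequentially"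
proof -
 let ?Q = "\<lambda>u j x. (u x - sh (m/2) (t j) u x) /\<^sub>R t j"
 obtain \<phi> where \<phi>: "\<And>k. C1c \<Omega> (\<phi> k)" "sc.conv \<phi> u sequentially" "vf.conv (\<lambda>k. g_grad G (\<phi> k)) U sequentially"
  "sc.sqi u" "vf.sqi U" using H10E[OF H] by metis
 have t0: "0 \<le> t j" for j using t(1)[of j] by simp
 have sQ: "sc.sqi (?Q u j)" for j by (intro sc.sqi_scale sc.sqi_diff \<phi>(4) sh_isometry(1)[OF u \<phi>(4) t0])
 have sQ\<phi>: "sc.sqi (?Q (\<phi> k) j)" for k j by (intro sc.sqi_scale sc.sqi_diff test_sqi(1) \<phi>(1) sh_C1c t0)
 have sP: "sc.sqi (genP u U)" "sc.sqi (radP (m/2) (\<phi> k))" for k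
  by (intro genP_sqi \<phi>, intro radP_sqi \<phi>)
 have D: "sc.nrm (\<lambda>x. ?Q u j x - genP u U x) \<le> 2 * sc.nrm (\<lambda>x. radP (m/2) (\<phi> k) x - genP u U x) + sc.nrm (\<lambda>x. ?Q (\<phi> k) j x - radP (m/2) (\<phi> k) x)" for j k
 proof -
  have b: "sc.nrm (\<lambda>x. ?Q u j x - ?Q (\<phi> k) j x) \<le> sc.nrm (\<lambda>x. radP (m/2) (\<phi> k) x - genP u U x)"
  proof -
   let ?e = "\<lambda>x. u x - \<phi> k x"
   have "sc.nrm (\<lambda>x. ?e x - sh (m/2) (t j) ?e x) \<le> t j * sc.nrm (genP ?e (\<lambda>x. U x - g_grad G (\<phi> k) x))"
    by (rule quotient_bound[OF _ _ H10_diff[OF H H10_test[OF \<phi>(1)]] t(1)])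
     (use u test_borel[OF \<phi>(1)] test_off_\<Omega>[OF \<phi>(1)] in auto)
   also have "sc.nrm (genP ?e (\<lambda>x. U x - g_grad G (\<phi> k) x)) = sc.nrm (\<lambda>x. genP u U x - radP (m/2) (\<phi> k) x)"
    by (simp add: genP_diff[abs_def] genP_test)
   finally have "inverse (t j) * sc.nrm (\<lambda>x. ?e x - sh (m/2) (t j) ?e x) \<le> sc.nrm (\<lambda>x. genP u U x - radP (m/2) (\<phi> k) x)"
    using t(1)[of j] by (simp add: field_simps)
   moreover have "(\<lambda>x. ?Q u j x - ?Q (\<phi> k) j x) = (\<lambda>x. (?e x - sh (m/2) (t j) ?e x) /\<^sub>R t j)"
    by (simp add: fun_eq_iff sh_diff scaleR_diff_right)
   ultimately show ?thesis
    using t(1)[of j] sc.nrm_scale[of "inverse (t j)" "\<lambda>x. ?e x - sh (m/2) (t j) ?e x"]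
     sc.nrm_diff_sym[of "genP u U" "radP (m/2) (\<phi> k)"] by simp
  qed
  have "sc.nrm (\<lambda>x. ?Q u j x - genP u U x) \<le> sc.nrm (\<lambda>x. ?Q u j x - ?Q (\<phi> k) j x) + sc.nrm (\<lambda>x. ?Q (\<phi> k) j x - genP u U x)"
   by (rule sc.nrm_triangle_via[OF sQ sQ\<phi> sP(1)])
  also have "sc.nrm (\<lambda>x. ?Q (\<phi> k) j x - genP u U x) \<le> sc.nrm (\<lambda>x. ?Q (\<phi> k) j x - radP (m/2) (\<phi> k) x) + sc.nrm (\<lambda>x. radP (m/2) (\<phi> k) x - genP u U x)"
   by (rule sc.nrm_triangle_via[OF sQ\<phi> sP(2,1)])
  finally show ?thesis using b by simp
 qed
 have "(\<lambda>j. sc.nrm (\<lambda>x. ?Q u j x - genP u U x)) \<longlonglongrightarrow> 0"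
 proof (rule LIMSEQ_I)
  fix e :: real assume e: "e > 0"
  have "(\<lambda>k. sc.nrm (\<lambda>x. genP (\<phi> k) (g_grad G (\<phi> k)) x - genP u U x)) \<longlonglongrightarrow> 0"
   using genP_conv[OF \<phi>(2,3)] by (simp add: sc.conv_def)
  then have "\<forall>\<^sub>F k in sequentially. sc.nrm (\<lambda>x. radP (m/2) (\<phi> k) x - genP u U x) < e / 4"
   unfolding genP_test using e by (intro order_tendstoD(2)) auto
  then obtain k where k: "sc.nrm (\<lambda>x. radP (m/2) (\<phi> k) x - genP u U x) < e / 4"
   using eventually_happens sequentially_bot by blast
  have "(\<lambda>j. sc.nrm (\<lambda>x. ?Q (\<phi> k) j x - radP (m/2) (\<phi> k) x)) \<longlonglongrightarrow> 0"
   using quotient_conv_test[OF \<phi>(1) t] by (simp add: sc.conv_def)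
  then have "\<forall>\<^sub>F j in sequentially. sc.nrm (\<lambda>x. ?Q (\<phi> k) j x - radP (m/2) (\<phi> k) x) < e / 2"
   using e by (intro order_tendstoD(2)) auto
  then obtain N where N: "\<And>j. j \<ge> N \<Longrightarrow> sc.nrm (\<lambda>x. ?Q (\<phi> k) j x - radP (m/2) (\<phi> k) x) < e / 2"
   by (auto simp: eventually_sequentially)
  have "norm (sc.nrm (\<lambda>x. ?Q u j x - genP u U x) - 0) < e" if "j \<ge> N" for j
   using D[of j k] k N[OF that] sc.nrm_nonneg[of "\<lambda>x. ?Q u j x - genP u U x"] by simp
  then show "\<exists>N. \<forall>j\<ge>N. norm (sc.nrm (\<lambda>x. ?Q u j x - genP u U x) - 0) < e" by blast
 qed
 then show ?thesis using sQ sP(1) by (simp add: sc.conv_def)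
qed

end


section \<open>Monotonicity of the tangential energy along the flow\<close>

definition tanp :: "real^'n \<Rightarrow> complex^'n \<Rightarrow> complex^'n" where
 "tanp x v = v - cvec (x /\<^sub>R norm x) (\<Sum>i\<in>UNIV. (x $ i / norm x) *\<^sub>R v $ i)"

lemma tanf_eq: "tanf V x = tanp x (V x)"
 by (simp add: tanf_def tanp_def radf_def)

lemma tanp_add: "tanp x (u + v) = tanp x u + tanp x v"
 by (simp add: tanp_def vec_eq_iff cvec_def scaleR_add_right sum.distrib)

lemma tanp_scale: "tanp x (c *\<^sub>R v) = c *\<^sub>R tanp x v"
 by (simp add: tanp_def vec_eq_iff cvec_def scaleR_diff_right scaleR_sum_right mult_ac)

lemma g_inner_add_left: "g_inner A (u + v) y = g_inner A u y + g_inner A v y"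
 by (simp add: g_inner_eq inner_add_left)

lemma g_inner_scale_left: "g_inner A (c *\<^sub>R u) y = c * g_inner A u y"
 by (simp add: g_inner_eq)

lemma g_inner_add_right: "g_inner A y (u + v) = g_inner A y u + g_inner A y v"
 by (simp add: g_inner_eq matrix_act_add inner_add_right)

lemma g_inner_scale_right: "g_inner A u (c *\<^sub>R y) = c * g_inner A u y"
 by (simp add: g_inner_eq matrix_act_scaleR)

lemma g_inner_diff_left: "g_inner A (u - v) y = g_inner A u y - g_inner A v y"
 by (simp add: g_inner_eq inner_diff_left)

lemma g_inner_diff_right: "g_inner A y (u - v) = g_inner A y u - g_inner A y v"
 by (simp add: g_inner_eq matrix_act_diff inner_diff_right)

lemma g_inner_matrix_add: "g_inner (A + B) u v = g_inner A u v + g_inner B u v"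
 by (simp add: g_inner_def distrib_right sum.distrib)

lemma g_inner_matrix_scale: "g_inner (c *\<^sub>R A) u v = c * g_inner A u v"
 by (simp add: g_inner_def sum_distrib_left mult.assoc)

locale radial_nontrapping = radial_exterior G \<Omega> c0 d
 for G :: "real^'n \<Rightarrow> real^'n^'n" and \<Omega> c0 d +
 fixes \<alpha> :: "real^'n \<Rightarrow> real"
 assumes \<alpha>_cont: "continuous_on UNIV \<alpha>"
  and \<alpha>_nonneg: "\<And>x. \<alpha> x \<ge> 0"
  and G_tangential: "\<And>x X. x \<in> \<Omega> \<Longrightarrow> X \<in> sphere_tangent x \<Longrightarrow>
   (((1 - \<alpha> x) *\<^sub>R G x + (norm x / 2) *\<^sub>R radial_deriv_matrix G x) *v X) \<bullet> X \<ge> 0"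
begin

text \<open>
 The contribution of the tangential part of the gradient to the Dirichlet energy of a function
 translated by \<open>s\<close>, expressed at the starting point of the ray.  Covectors tangent to the sphere are
 scaled by \<open>|x|/(|x|+s)\<close> and measured by the inverse metric at the end point.
\<close>

definition Tform :: "real \<Rightarrow> real^'n \<Rightarrow> complex^'n \<Rightarrow> complex^'n \<Rightarrow> real" where
 "Tform s x v y = (norm x / (norm x + s))\<^sup>2 *
   g_inner (matrix_inv (G (outward s x))) (matrix_act (G x) (tanp x v)) (matrix_act (G x) (tanp x y))"

lemma Gi_inner_sym: "g_inner (matrix_inv (G x)) X Y = g_inner (matrix_inv (G x)) Y X"
 by (simp add: g_inner_transpose[of "matrix_inv (G x)" X] Gi_sym g_inner_eq[of _ Y] inner_commute)

lemma outward_continuous: "continuous_on \<Omega> (outward s)"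
 unfolding outward_def using nonzero by (intro continuous_intros) auto

lemma Tform_form_field: "form_field \<mu> (Tform s)"
proof
 show "Tform s x (u + v) y = Tform s x u y + Tform s x v y" for x u v y
  by (simp add: Tform_def tanp_add matrix_act_add g_inner_add_left distrib_left)
 show "Tform s x (c *\<^sub>R u) v = c * Tform s x u v" for x c u v
  by (simp add: Tform_def tanp_scale matrix_act_scaleR g_inner_scale_left)
 show "Tform s x u v = Tform s x v u" for x u v
  by (simp add: Tform_def Gi_inner_sym[of _ "matrix_act (G x) (tanp x u)"])
 show "0 \<le> Tform s x u u" for x u
  by (simp add: Tform_def Gi_inner_nonneg)
 show "(\<lambda>x. Tform s x (f x) (g x)) \<in> borel_measurable \<mu>" if "f \<in> borel_measurable \<mu>" "g \<in> borel_measurable \<mu>" for f g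
 proof -
  have t: "(\<lambda>x. matrix_act (G x) (tanp x (h x)) $ i) \<in> borel_measurable \<mu>" if "h \<in> borel_measurable \<mu>" for h i
   using measurable_act_G(1)[OF measurable_tanf[OF that]] unfolding tanf_eq borel_measurable_vec_iff by blast
  have g: "(\<lambda>x. matrix_inv (G (outward s x)) $ i $ j) \<in> borel_measurable \<mu>" for i j
   by (rule measurable_\<mu>_cont) (rule continuous_on_compose2[OF C1_on_continuous[OF Gi_C1[where S = UNIV]] outward_continuous], simp)
  have n: "(\<lambda>x. norm x / (norm x + s)) \<in> borel_measurable \<mu>"
   by (rule measurable_\<mu>_borel) simp
  show ?thesis
   unfolding Tform_def g_inner_def
   by (intro borel_measurable_times borel_measurable_power n borel_measurable_sum g borel_measurable_inner t that)
 qed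
qed

lemma G_tanp: "x \<noteq> 0 \<Longrightarrow> matrix_act (G x) (tanp x v) = matrix_act (G x) v - cvec (x /\<^sub>R norm x) (\<Sum>i\<in>UNIV. (x $ i / norm x) *\<^sub>R v $ i)"
 by (simp only: tanp_def matrix_act_diff matrix_act_cvec G_dir)

lemma tanp_tangent:
 assumes "x \<noteq> 0" shows "(\<Sum>i\<in>UNIV. (x $ i / norm x) *\<^sub>R tanp x v $ i) = 0"
 using radf_tanf[OF assms, of "\<lambda>_. v"] by (simp add: radf_def tanf_eq)

lemma Tform_0: "x \<in> \<Omega> \<Longrightarrow> Tform 0 x v y = g_inner (G x) (tanp x v) (tanp x y)"
 using nonzero[of x] by (simp add: Tform_def outward_def g_inner_eq[of "matrix_inv _"]) (simp add: g_inner_act)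

lemma outward_dir_eq:
 assumes "x \<noteq> 0" "0 \<le> s" shows "outward s x /\<^sub>R norm (outward s x) = x /\<^sub>R norm x"
 using outward_direction[OF assms] by (simp add: vec_eq_iff divide_inverse mult.commute)

lemma radial_deriv_along_flow:
 assumes x: "x \<in> \<Omega>" and s: "0 \<le> s"
 shows "((\<lambda>s. G (outward s x) $ i $ j) has_real_derivative radial_deriv_matrix G (outward s x) $ i $ j) (at s within T)"
proof -
 let ?g = "\<lambda>y. G y $ i $ j"
 have d: "?g differentiable (at (outward s x))" by (rule C1_on_differentiable[OF G_C1]) simp
 then have D: "(?g has_derivative frechet_derivative ?g (at (outward s x))) (at (outward s x))"
  by (simp add: frechet_derivative_works)
 have o: "((\<lambda>s. outward s x) has_derivative (\<lambda>h. h *\<^sub>R (x /\<^sub>R norm x))) (at s within T)"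
  unfolding outward_def by (auto intro!: derivative_eq_intros simp: divide_inverse)
 have "((\<lambda>s. ?g (outward s x)) has_derivative (\<lambda>h. frechet_derivative ?g (at (outward s x)) (h *\<^sub>R (x /\<^sub>R norm x)))) (at s within T)"
  by (rule has_derivative_compose[OF o D])
 moreover have "frechet_derivative ?g (at (outward s x)) (h *\<^sub>R (x /\<^sub>R norm x)) = radial_deriv_matrix G (outward s x) $ i $ j * h" for h
  using linear_scale[OF has_derivative_linear[OF D], of h "x /\<^sub>R norm x"]
  by (simp add: radial_deriv_matrix_def radial_deriv_def outward_dir_eq[OF nonzero[OF x] s])
 ultimately show ?thesis by (simp add: has_field_derivative_def)
qed

text \<open>
 Up to the factor \<open>|x|\<^bsup>-2\<^esup>\<close>, the metric of the sphere of radius \<open>r = |x| + s\<close> pulled back by the radial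
 flow.  Its derivative in \<open>s\<close> is \<open>2 r (G + (r/2) \<partial>G/\<partial>r)\<close>, so the hypothesis on the tangent spaces says
 that it grows at least by \<open>2 r \<alpha> G\<close>.
\<close>

definition bmat :: "real^'n \<Rightarrow> real \<Rightarrow> real^'n^'n" where
 "bmat x s = (norm x + s)\<^sup>2 *\<^sub>R G (outward s x)"

definition bmat' :: "real^'n \<Rightarrow> real \<Rightarrow> real^'n^'n" where
 "bmat' x s = (2 * (norm x + s)) *\<^sub>R G (outward s x) + (norm x + s)\<^sup>2 *\<^sub>R radial_deriv_matrix G (outward s x)"

lemma bmat_derivative:
 assumes x: "x \<in> \<Omega>" and s: "0 \<le> s"
 shows "((\<lambda>s. bmat x s $ i $ j) has_real_derivative bmat' x s $ i $ j) (at s within T)"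
proof -
 have "((\<lambda>s. (norm x + s)\<^sup>2) has_real_derivative 2 * (norm x + s)) (at s within T)"
  by (auto intro!: derivative_eq_intros)
 from DERIV_mult[OF this radial_deriv_along_flow[OF assms]] show ?thesis
  by (simp add: bmat_def bmat'_def mult_ac)
qed

lemma bmat'_lower:
 assumes x: "x \<in> \<Omega>" and s: "0 \<le> s" and X: "(\<Sum>i\<in>UNIV. (x $ i / norm x) *\<^sub>R X $ i) = (0::complex)"
 shows "g_inner (bmat' x s) X X \<ge> 2 * (norm x + s) * \<alpha> (outward s x) * g_inner (G (outward s x)) X X"
proof -
 let ?z = "outward s x"
 have z: "?z \<in> \<Omega>" by (rule outward_\<Omega>[OF x s])
 have nz: "norm ?z = norm x + s" by (rule norm_outward[OF nonzero[OF x] s])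
 have pz: "norm ?z > 0" using norm_pos[OF z] .
 have re: "g_inner (bmat' x s) Y Y \<ge> 2 * (norm x + s) * \<alpha> ?z * g_inner (G ?z) Y Y"
  if Y: "Y \<bullet> (x /\<^sub>R norm x) = 0" for Y :: "real^'n"
 proof -
  have "Y \<in> sphere_tangent ?z" using Y by (simp add: sphere_tangent_def outward_dir_eq[OF nonzero[OF x] s])
  from G_tangential[OF z this]
  have "0 \<le> g_inner ((1 - \<alpha> ?z) *\<^sub>R G ?z + (norm ?z / 2) *\<^sub>R radial_deriv_matrix G ?z) Y Y"
   by (simp add: g_inner_eq matrix_act_real inner_commute)
  then have "0 \<le> (1 - \<alpha> ?z) * g_inner (G ?z) Y Y + norm ?z / 2 * g_inner (radial_deriv_matrix G ?z) Y Y"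
   by (simp add: g_inner_matrix_add g_inner_matrix_scale)
  then have "0 \<le> 2 * norm ?z * ((1 - \<alpha> ?z) * g_inner (G ?z) Y Y + norm ?z / 2 * g_inner (radial_deriv_matrix G ?z) Y Y)"
   using pz by (intro mult_nonneg_nonneg) auto
  also have "\<dots> = (2 * norm ?z * g_inner (G ?z) Y Y + (norm ?z)\<^sup>2 * g_inner (radial_deriv_matrix G ?z) Y Y) - 2 * norm ?z * \<alpha> ?z * g_inner (G ?z) Y Y"
   by (simp add: algebra_simps power2_eq_square)
  also have "2 * norm ?z * g_inner (G ?z) Y Y + (norm ?z)\<^sup>2 * g_inner (radial_deriv_matrix G ?z) Y Y = g_inner (bmat' x s) Y Y"
   by (simp add: bmat'_def g_inner_matrix_add g_inner_matrix_scale nz)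
  finally show ?thesis by (simp add: nz)
 qed
 have "Re (\<Sum>i\<in>UNIV. (x $ i / norm x) *\<^sub>R X $ i) = 0" "Im (\<Sum>i\<in>UNIV. (x $ i / norm x) *\<^sub>R X $ i) = 0" using X by auto
 then have t: "Re_vec X \<bullet> (x /\<^sub>R norm x) = 0" "Im_vec X \<bullet> (x /\<^sub>R norm x) = 0"
  by (simp_all add: inner_vec_def divide_inverse mult_ac)
 show ?thesis
  using re[OF t(1)] re[OF t(2)] by (simp add: g_inner_Re_Im[of _ X] distrib_left)
qed

lemma bmat_mono:
 assumes x: "x \<in> \<Omega>" and s: "0 \<le> s" and X: "(\<Sum>i\<in>UNIV. (x $ i / norm x) *\<^sub>R X $ i) = (0::complex)"
 shows "g_inner (bmat x 0) X X \<le> g_inner (bmat x s) X X"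
proof -
 let ?f = "\<lambda>s. g_inner (bmat x s) X X"
 have der: "(?f has_real_derivative g_inner (bmat' x t) X X) (at t within {0..s})" if "0 \<le> t" for t
  unfolding g_inner_def
  by (auto intro!: derivative_eq_intros bmat_derivative[OF x that])
 have "?f 0 \<le> ?f s"
 proof (rule DERIV_nonneg_imp_increasing_open[OF s])
  show "\<exists>y. DERIV ?f t :> y \<and> 0 \<le> y" if "0 < t" "t < s" for t
  proof (intro exI conjI)
   show "DERIV ?f t :> g_inner (bmat' x t) X X"
    unfolding g_inner_def by (auto intro!: derivative_eq_intros bmat_derivative[OF x] simp: that less_imp_le)
   show "0 \<le> g_inner (bmat' x t) X X"
    using that \<alpha>_nonneg g_inner_nonneg[of "outward t x" X]
    by (intro order_trans[OF _ bmat'_lower[OF x _ X]] mult_nonneg_nonneg) auto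
  qed
  show "continuous_on {0..s} ?f"
   by (rule DERIV_continuous_on[OF der]) simp
 qed
 then show ?thesis .
qed

text \<open>The maximizer in the dual description of \<open>Tform s\<close> used below.\<close>

definition Xf :: "real^'n \<Rightarrow> complex^'n \<Rightarrow> real \<Rightarrow> complex^'n" where
 "Xf x v s = matrix_act (matrix_inv (G (outward s x))) (matrix_act (G x) (tanp x v))"

text \<open>
 The lower bound on the growth of the metric is only available on tangent vectors, and inverse
 metrics preserve these because they are symmetric and fix the radial direction.
\<close>

lemma Xf_tangent:
 assumes x: "x \<in> \<Omega>" and s: "0 \<le> s"
 shows "(\<Sum>i\<in>UNIV. (x $ i / norm x) *\<^sub>R Xf x v s $ i) = 0"
proof -
 let ?z = "outward s x" and ?\<theta> = "x /\<^sub>R norm x"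
 have "c \<bullet> (\<Sum>i\<in>UNIV. ?\<theta> $ i *\<^sub>R Xf x v s $ i) = 0" for c
 proof -
  have "c \<bullet> (\<Sum>i\<in>UNIV. ?\<theta> $ i *\<^sub>R Xf x v s $ i) = cvec ?\<theta> c \<bullet> Xf x v s" by (simp only: cvec_inner)
  also have "\<dots> = matrix_act (matrix_inv (G ?z)) (cvec ?\<theta> c) \<bullet> matrix_act (G x) (tanp x v)"
   using g_inner_transpose[of "matrix_inv (G ?z)" "cvec ?\<theta> c"] by (simp only: Xf_def g_inner_eq Gi_sym)
  also have "matrix_act (matrix_inv (G ?z)) (cvec ?\<theta> c) = cvec ?\<theta> c"
   unfolding matrix_act_cvec outward_dir_eq[OF nonzero[OF x] s, symmetric] Gi_dir ..
  also have "cvec ?\<theta> c \<bullet> matrix_act (G x) (tanp x v) = matrix_act (G x) (cvec ?\<theta> c) \<bullet> tanp x v"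
   using g_inner_act[of x "cvec ?\<theta> c" "tanp x v"] by (simp only: g_inner_eq)
  also have "\<dots> = c \<bullet> (\<Sum>i\<in>UNIV. ?\<theta> $ i *\<^sub>R tanp x v $ i)"
   by (simp only: matrix_act_cvec G_dir cvec_inner)
  also have "\<dots> = 0" using tanp_tangent[OF nonzero[OF x], of v] by (simp add: divide_inverse mult.commute)
  finally show ?thesis .
 qed
 from this[of "\<Sum>i\<in>UNIV. ?\<theta> $ i *\<^sub>R Xf x v s $ i"] show ?thesis
  by (simp add: divide_inverse mult.commute)
qed

text \<open>
 The dual quadratic form is a supremum of \<open>2 \<xi>\<bullet>X - B(X,X)\<close> over all \<open>X\<close>.  Inserting the
 maximizer of the later form into the supremum of the earlier one compares the two.
\<close>

lemma Tform_drop: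
 assumes x: "x \<in> \<Omega>" and s: "0 \<le> s"
 shows "Tform 0 x v v - Tform s x v v \<ge>
  ((norm x)\<^sup>2 / (norm x + s)^4) * (g_inner (bmat x s) (Xf x v s) (Xf x v s) - g_inner (bmat x 0) (Xf x v s) (Xf x v s))"
proof -
 let ?z = "outward s x" and ?Y = "tanp x v" and ?X = "Xf x v s"
 define c where "c = (norm x / (norm x + s))\<^sup>2"
 have n: "norm x > 0" "norm x + s > 0" using norm_pos[OF x] s by linarith+
 have k: "matrix_act (G x) ?Y \<bullet> ?X = g_inner (G ?z) ?X ?X"
  by (simp add: Xf_def g_inner_act)
 have Ts: "Tform s x v v = c * g_inner (G ?z) ?X ?X"
  unfolding Tform_def c_def[symmetric] g_inner_eq[of "matrix_inv _"] Xf_def[symmetric] k ..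
 have "0 \<le> g_inner (G x) (?Y - c *\<^sub>R ?X) (?Y - c *\<^sub>R ?X)" by (rule g_inner_nonneg)
 also have "\<dots> = g_inner (G x) ?Y ?Y - 2 * c * g_inner (G x) ?Y ?X + c\<^sup>2 * g_inner (G x) ?X ?X"
  by (simp add: g_inner_diff_left g_inner_diff_right g_inner_scale_left g_inner_scale_right g_inner_sym[of x ?X ?Y] power2_eq_square algebra_simps)
 also have "g_inner (G x) ?Y ?X = g_inner (G ?z) ?X ?X" using k by (simp add: g_inner_act)
 finally have "Tform 0 x v v - Tform s x v v \<ge> c * g_inner (G ?z) ?X ?X - c\<^sup>2 * g_inner (G x) ?X ?X"
  by (simp add: Tform_0[OF x] Ts)
 moreover have "c * g_inner (G ?z) ?X ?X - c\<^sup>2 * g_inner (G x) ?X ?X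
   = ((norm x)\<^sup>2 / (norm x + s)^4) * (g_inner (bmat x s) ?X ?X - g_inner (bmat x 0) ?X ?X)"
 proof -
  have "outward 0 x = x" by (simp add: outward_def)
  moreover have "c = ((norm x)\<^sup>2 / (norm x + s)^4) * (norm x + s)\<^sup>2" "c\<^sup>2 = ((norm x)\<^sup>2 / (norm x + s)^4) * (norm x)\<^sup>2"
   using n by (auto simp: c_def power_divide power2_eq_square power4_eq_xxxx)
  ultimately show ?thesis
   unfolding bmat_def g_inner_matrix_scale by (simp add: right_diff_distrib mult.assoc)
 qed
 ultimately show ?thesis by simp
qed

lemma Tform_mono:
 assumes x: "x \<in> \<Omega>" and s: "0 \<le> s"
 shows "Tform s x v v \<le> Tform 0 x v v"
proof -
 have "0 \<le> (norm x)\<^sup>2 / (norm x + s)^4 * (g_inner (bmat x s) (Xf x v s) (Xf x v s) - g_inner (bmat x 0) (Xf x v s) (Xf x v s))"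
  using bmat_mono[OF x s Xf_tangent[OF x s, of v]] s by (intro mult_nonneg_nonneg divide_nonneg_nonneg) auto
 with Tform_drop[OF x s, of v] show ?thesis by linarith
qed

text \<open>
 In the limit the lower bound of the previous comparison becomes the derivative of the metric
 evaluated on the tangential gradient.
\<close>

lemma Tform_liminf:
 assumes x: "x \<in> \<Omega>" and t: "\<And>j. 0 < t j" "t \<longlonglongrightarrow> 0"
 shows "ennreal (2 * \<alpha> x / norm x * Tform 0 x v v) \<le> liminf (\<lambda>j. ennreal ((Tform 0 x v v - Tform (t j) x v v) / t j))"
proof -
 have n: "norm x > 0" by (rule norm_pos[OF x])
 have tat: "filterlim t (at 0) sequentially" using t by (simp add: filterlim_at less_imp_neq[THEN not_sym])
 have t0: "0 \<le> t j" for j using t(1)[of j] by simp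
 let ?X = "\<lambda>j. Xf x v (t j)" and ?Y = "tanp x v"
 have Xlim: "(\<lambda>j. ?X j $ i) \<longlonglongrightarrow> ?Y $ i" for i
 proof -
  have oc: "(\<lambda>j. outward (t j) x) \<longlonglongrightarrow> outward 0 x"
   unfolding outward_def using n by (intro tendsto_intros t(2)) auto
  have "(\<lambda>j. matrix_inv (G (outward (t j) x)) $ i $ k) \<longlonglongrightarrow> matrix_inv (G (outward 0 x)) $ i $ k" for k
   by (rule continuous_on_tendsto_compose[OF C1_on_continuous[OF Gi_C1[where S = UNIV]] oc]) auto
  then have "(\<lambda>j. Xf x v (t j) $ i) \<longlonglongrightarrow> Xf x v 0 $ i"
   unfolding Xf_def matrix_act_nth[of "matrix_inv _"] by (rule tendsto_sum[OF tendsto_scaleR[OF _ tendsto_const]])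
  moreover have "Xf x v 0 = ?Y" by (simp add: Xf_def outward_def)
  ultimately show ?thesis by simp
 qed
 have blim: "(\<lambda>j. (bmat x (t j) $ i $ k - bmat x 0 $ i $ k) / t j) \<longlonglongrightarrow> bmat' x 0 $ i $ k" for i k
 proof -
  have "((\<lambda>h. (bmat x (0 + h) $ i $ k - bmat x 0 $ i $ k) / h) \<longlongrightarrow> bmat' x 0 $ i $ k) (at 0)"
   using bmat_derivative[OF x order_refl, of i k UNIV] by (simp add: DERIV_def)
  from filterlim_compose[OF this tat] show ?thesis by simp
 qed
 define Lj where "Lj j = ((norm x)\<^sup>2 / (norm x + t j)^4) * (\<Sum>i\<in>UNIV. \<Sum>k\<in>UNIV. (bmat x (t j) $ i $ k - bmat x 0 $ i $ k) / t j * (?X j $ i \<bullet> ?X j $ k))" for j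
 define L where "L = ((norm x)\<^sup>2 / (norm x + 0)^4) * (\<Sum>i\<in>UNIV. \<Sum>k\<in>UNIV. bmat' x 0 $ i $ k * (?Y $ i \<bullet> ?Y $ k))"
 have Llim: "Lj \<longlonglongrightarrow> L"
  unfolding Lj_def L_def using n
  by (intro tendsto_mult tendsto_sum tendsto_inner tendsto_divide tendsto_power tendsto_add tendsto_const blim Xlim t(2)) auto
 have Lle: "Lj j \<le> (Tform 0 x v v - Tform (t j) x v v) / t j" for j
 proof -
  have "Lj j * t j = ((norm x)\<^sup>2 / (norm x + t j)^4) * (g_inner (bmat x (t j)) (?X j) (?X j) - g_inner (bmat x 0) (?X j) (?X j))"
   using t(1)[of j] unfolding Lj_def g_inner_def
   by (simp add: sum_distrib_right sum_distrib_left sum_subtractf[symmetric] left_diff_distrib[symmetric] mult_ac)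
  then show ?thesis using Tform_drop[OF x t0[of j], of v] t(1)[of j] by (simp add: pos_le_divide_eq)
 qed
 have Lge: "2 * \<alpha> x / norm x * Tform 0 x v v \<le> L"
 proof -
  have "2 * norm x * \<alpha> x * g_inner (G x) ?Y ?Y \<le> g_inner (bmat' x 0) ?Y ?Y"
   using bmat'_lower[OF x order_refl tanp_tangent[OF nonzero[OF x], of v]] by (simp add: outward_def)
  then have "((norm x)\<^sup>2 / (norm x)^4) * (2 * norm x * \<alpha> x * g_inner (G x) ?Y ?Y) \<le> L"
   unfolding L_def g_inner_def[symmetric] add_0_right by (intro mult_left_mono) auto
  moreover have "((norm x)\<^sup>2 / (norm x)^4) * (2 * norm x * \<alpha> x * g_inner (G x) ?Y ?Y) = 2 * \<alpha> x / norm x * g_inner (G x) ?Y ?Y"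
   using n by (simp add: power2_eq_square power4_eq_xxxx)
  ultimately show ?thesis by (simp add: Tform_0[OF x])
 qed
 have "ennreal (2 * \<alpha> x / norm x * Tform 0 x v v) \<le> ennreal L" by (rule ennreal_leI[OF Lge])
 also have "\<dots> = liminf (\<lambda>j. ennreal (Lj j))"
  by (rule lim_imp_Liminf[symmetric]) (auto intro: tendsto_ennrealI Llim)
 also have "\<dots> \<le> liminf (\<lambda>j. ennreal ((Tform 0 x v v - Tform (t j) x v v) / t j))"
  by (intro Liminf_mono always_eventually allI ennreal_leI Lle)
 finally show ?thesis .
qed

end


section \<open>The energy of a translated function\<close>

context radial_nontrapping begin

text \<open>
 The coefficient of the undifferentiated function in the radial derivative of a translate.  It is of
 order \<open>s\<close>, and \<open>kf s / s\<close> tends to \<open>(m/2)/r\<^sup>2\<close>.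
\<close>

definition kf :: "real \<Rightarrow> real^'n \<Rightarrow> real" where
 "kf s y = (m / 2) * s / (norm y * (norm y + s))"

definition grad_density :: "real \<Rightarrow> (real^'n \<Rightarrow> complex) \<Rightarrow> real^'n \<Rightarrow> real" where
 "grad_density s \<phi> y = (cmod (rad \<phi> y + kf s y *\<^sub>R \<phi> y))\<^sup>2 + Tform s y (g_grad G \<phi> y) (g_grad G \<phi> y)"

lemma g_inner_grad_self: "g_inner (G x) (g_grad G f x) (g_grad G f x) = g_inner (matrix_inv (G x)) (grad_vec f x) (grad_vec f x)"
 by (simp only: g_inner_grad) (simp only: g_inner_eq g_grad_eq)

lemma act_tanp_grad: "y \<noteq> 0 \<Longrightarrow> matrix_act (G y) (tanp y (g_grad G \<phi> y)) = grad_vec \<phi> y - cvec (y /\<^sub>R norm y) (rad \<phi> y)"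
 by (simp add: G_tanp radf_grad[unfolded radf_def]) (simp add: g_grad_eq)

lemma norm_cvec_dir: "x \<noteq> 0 \<Longrightarrow> cvec (x /\<^sub>R norm x) z \<bullet> cvec (x /\<^sub>R norm x) z = (cmod z)\<^sup>2"
 using radf_cvec_dir[of x z] by (simp only: cvec_inner) (simp add: power2_norm_eq_inner)

text \<open>
 At the end point of the ray the gradient of the translate splits orthogonally: the radial component
 is transported unchanged apart from the derivative of the weight, the tangential one is rescaled.
\<close>

lemma grad_sh_outward:
 assumes s: "0 \<le> s" and f: "C1_on UNIV \<phi>" and y: "y \<in> \<Omega>"
 shows "g_inner (G (outward s y)) (g_grad G (sh (m/2) s \<phi>) (outward s y)) (g_grad G (sh (m/2) s \<phi>) (outward s y))
  = (norm y / (norm y + s)) powr m * grad_density s \<phi> y"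
proof -
 have y0: "y \<noteq> 0" by (rule nonzero[OF y])
 let ?x = "outward s y" and ?\<theta> = "y /\<^sub>R norm y"
 let ?W = "matrix_act (G y) (tanp y (g_grad G \<phi> y))"
 define \<zeta> where "\<zeta> = norm y / (norm y + s)"
 define z where "z = rad \<phi> y + kf s y *\<^sub>R \<phi> y"
 let ?c = "cvec ?\<theta> z" and ?A = "matrix_inv (G ?x)"
 have gv: "grad_vec (sh (m/2) s \<phi>) ?x = (\<zeta> powr (m/2)) *\<^sub>R (\<zeta> *\<^sub>R ?W + ?c)"
  unfolding act_tanp_grad[OF y0]
 proof (rule vec_eq_iff[THEN iffD2], rule allI)
  fix i
  have \<theta>i: "(y /\<^sub>R norm y) $ i = y $ i / norm y" by (simp add: divide_inverse)
  show "grad_vec (sh (m/2) s \<phi>) ?x $ i = ((\<zeta> powr (m/2)) *\<^sub>R (\<zeta> *\<^sub>R (grad_vec \<phi> y - cvec ?\<theta> (rad \<phi> y)) + ?c)) $ i"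
   unfolding grad_vec_nth partial_deriv_sh[OF s f y0] cvec_def vector_scaleR_component vector_add_component vector_minus_component vec_lambda_beta \<theta>i[unfolded vector_scaleR_component]
   unfolding \<zeta>_def z_def kf_def ..
 qed
 have cA: "matrix_act ?A ?c = ?c"
  unfolding matrix_act_cvec outward_dir_eq[OF y0 s, symmetric] Gi_dir ..
 have cW: "?c \<bullet> ?W = 0"
 proof -
  have "?c \<bullet> ?W = matrix_act (G y) ?c \<bullet> tanp y (g_grad G \<phi> y)"
   using g_inner_act[of y ?c] by (simp only: g_inner_eq)
  also have "\<dots> = z \<bullet> (\<Sum>i\<in>UNIV. ?\<theta> $ i *\<^sub>R tanp y (g_grad G \<phi> y) $ i)"
   by (simp only: matrix_act_cvec G_dir cvec_inner)
  also have "\<dots> = 0" using tanp_tangent[OF y0, of "g_grad G \<phi> y"] by (simp add: divide_inverse mult.commute)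
  finally show ?thesis .
 qed
 have 1: "g_inner ?A ?c v = ?c \<bullet> v" for v
  using g_inner_transpose[of ?A ?c v] by (simp only: Gi_sym cA)
 have "g_inner ?A (\<zeta> *\<^sub>R ?W + ?c) (\<zeta> *\<^sub>R ?W + ?c) = \<zeta>\<^sup>2 * g_inner ?A ?W ?W + (cmod z)\<^sup>2"
  by (simp only: g_inner_add_left g_inner_add_right g_inner_scale_left g_inner_scale_right Gi_inner_sym[of _ ?W ?c] 1 cW norm_cvec_dir[OF y0])
   (simp add: power2_eq_square)
 also have "\<dots> = grad_density s \<phi> y"
  by (simp add: grad_density_def Tform_def \<zeta>_def z_def)
 finally have 2: "g_inner ?A (\<zeta> *\<^sub>R ?W + ?c) (\<zeta> *\<^sub>R ?W + ?c) = grad_density s \<phi> y" .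
 have "\<zeta> powr (m/2) * \<zeta> powr (m/2) = \<zeta> powr m" by (simp add: powr_add[symmetric])
 then show ?thesis
  unfolding g_inner_grad_self gv g_inner_scale_left g_inner_scale_right 2 by (simp add: \<zeta>_def[symmetric] mult.assoc[symmetric])
qed

lemma grad_sh_pointwise:
 assumes s: "0 \<le> s" and f: "C1c \<Omega> \<phi>" and x: "x \<in> \<Omega>"
 shows "ennreal (g_inner (G x) (g_grad G (sh (m/2) s \<phi>) x) (g_grad G (sh (m/2) s \<phi>) x))
  = jac s x * ennreal (grad_density s \<phi> (inward s x))"
proof (cases "s < norm x \<and> inward s x \<in> \<Omega>")
 case True
 let ?y = "inward s x"
 have x0: "0 < norm x" using norm_pos[OF x] .
 have o: "outward s ?y = x" using True s by (intro outward_inward) auto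
 have ny: "norm ?y = norm x - s" using True x0 by (intro norm_inward) auto
 have "0 \<le> grad_density s \<phi> ?y"
  by (simp add: grad_density_def Tform_def Gi_inner_nonneg)
 then show ?thesis
  using grad_sh_outward[OF s C1c_C1[OF f], of ?y] True unfolding o
  by (simp add: jac_def ny ennreal_mult)
next
 case False
 obtain K where K: "compact K" "K \<subseteq> \<Omega>" "\<And>x. x \<notin> K \<Longrightarrow> \<phi> x = 0" using C1cE[OF f] by metis
 have cK: "closed (outward s ` K)"
  by (intro compact_imp_closed compact_continuous_image continuous_on_subset[OF outward_continuous K(2)] K(1))
 have z: "sh (m/2) s \<phi> y = 0" if "y \<in> - outward s ` K" for y
 proof (cases "s < norm y")
  case True
  then have "outward s (inward s y) = y" by (rule outward_inward[OF s])
  then have "inward s y \<notin> K" using that by (metis ComplD imageI)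
  then show ?thesis by (simp add: sh_def K(3))
 qed (simp add: sh_def)
 have "x \<notin> outward s ` K"
 proof
  assume "x \<in> outward s ` K"
  then obtain y where y: "y \<in> K" "x = outward s y" by auto
  then have yO: "y \<in> \<Omega>" using K(2) by auto
  have "norm x = norm y + s" "inward s x = y"
   unfolding y(2) by (rule norm_outward[OF nonzero[OF yO] s], rule inward_outward[OF nonzero[OF yO] s])
  then show False using False yO norm_pos[OF yO] by auto
 qed
 then have "partial_deriv i (sh (m/2) s \<phi>) x = partial_deriv i (\<lambda>_. 0) x" for i
  using z cK by (intro partial_deriv_cong_open[of "- outward s ` K"]) auto
 then have "grad_vec (sh (m/2) s \<phi>) x = 0"
  by (simp add: vec_eq_iff partial_deriv_def)
 then show ?thesis
  using False by (auto simp: jac_def g_inner_grad)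
qed

lemma kf_bound:
 obtains C where "\<And>x s. x \<in> \<Omega> \<Longrightarrow> 0 \<le> s \<Longrightarrow> \<bar>kf s x\<bar> \<le> C" "\<And>x s. x \<in> \<Omega> \<Longrightarrow> 0 \<le> s \<Longrightarrow> \<bar>kf s x\<bar> \<le> C * s"
  "\<And>x s. x \<in> \<Omega> \<Longrightarrow> 0 < s \<Longrightarrow> \<bar>kf s x / s - (m/2) / norm x ^ 2\<bar> \<le> C * s"
proof -
 obtain \<delta> where \<delta>: "\<delta> > 0" "\<And>x. x \<in> \<Omega> \<Longrightarrow> \<delta> \<le> norm x" using \<Omega>_away by blast
 have m0: "m / 2 \<ge> 0" using m_ge by simp
 define C where "C = (m/2) / \<delta> + (m/2) / \<delta>^2 + (m/2) / \<delta>^3"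
 have Ci: "(m/2) / \<delta> \<le> C" "(m/2) / \<delta>^2 \<le> C" "(m/2) / \<delta>^3 \<le> C" using m0 \<delta> by (auto simp: C_def)
 have k: "kf s x \<ge> 0" "kf s x \<le> (m/2) / \<delta>" "kf s x \<le> (m/2) / \<delta>^2 * s"
  if x: "x \<in> \<Omega>" and s: "0 \<le> s" for x s
 proof -
  have n: "norm x \<ge> \<delta>" "norm x > 0" "norm x + s > 0" using \<delta>(2)[OF x] \<delta>(1) s by linarith+
  show "kf s x \<ge> 0" using m0 n s by (simp add: kf_def)
  have "s / (norm x * (norm x + s)) = (1 / norm x) * (s / (norm x + s))" by simp
  also have "\<dots> \<le> (1 / \<delta>) * 1"
  proof (rule mult_mono)
   show "1 / norm x \<le> 1 / \<delta>" using n(1) \<delta>(1) by (rule divide_left_mono[OF _ zero_le_one mult_pos_pos[OF n(2)]])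
   show "s / (norm x + s) \<le> 1" using n by simp
  qed (use \<delta>(1) n s in auto)
  finally show "kf s x \<le> (m/2) / \<delta>" using mult_left_mono[OF _ m0, of "s / (norm x * (norm x + s))" "1 / \<delta>"] unfolding kf_def by simp
  have "s / (norm x * (norm x + s)) \<le> s / (\<delta> * \<delta>)"
   by (rule divide_left_mono[OF mult_mono s mult_pos_pos[OF mult_pos_pos mult_pos_pos]]) (use n s \<delta>(1) in linarith)+
  from mult_left_mono[OF this m0] show "kf s x \<le> (m/2) / \<delta>^2 * s" unfolding kf_def by (simp add: power2_eq_square)
 qed
 have k3: "\<bar>kf s x / s - (m/2) / norm x ^ 2\<bar> \<le> (m/2) / \<delta>^3 * s" if x: "x \<in> \<Omega>" and s: "0 < s" for x s
 proof -
  have n: "norm x \<ge> \<delta>" "norm x > 0" "norm x + s > 0" using \<delta>(2)[OF x] \<delta>(1) s by linarith+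
  have "kf s x / s = (m/2) / (norm x * (norm x + s))" using s by (simp add: kf_def)
  moreover have "(m/2) / norm x ^ 2 - (m/2) / (norm x * (norm x + s)) = (m/2) * (s / (norm x * norm x * (norm x + s)))"
   using n by (simp add: divide_simps power2_eq_square) (simp add: algebra_simps)
  moreover have "s / (norm x * norm x * (norm x + s)) \<le> s / (\<delta> * \<delta> * \<delta>)"
   by (rule divide_left_mono[OF mult_mono[OF mult_mono] less_imp_le[OF s] mult_pos_pos[OF mult_pos_pos[OF mult_pos_pos] mult_pos_pos[OF mult_pos_pos]]])
    (use n s \<delta>(1) in "linarith | simp")+
  moreover have "0 \<le> s / (norm x * norm x * (norm x + s))" using n s by simp
  ultimately show ?thesis using mult_left_mono[of "s / (norm x * norm x * (norm x + s))" "s / (\<delta> * \<delta> * \<delta>)" "m/2"] m0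
    mult_nonneg_nonneg[of "m/2" "s / (norm x * norm x * (norm x + s))"]
   by (simp add: power3_eq_cube)
 qed
 show thesis
 proof (rule that[of C])
  show "\<bar>kf s x\<bar> \<le> C" if "x \<in> \<Omega>" "0 \<le> s" for x s using k[OF that] Ci by linarith
  show "\<bar>kf s x\<bar> \<le> C * s" if "x \<in> \<Omega>" "0 \<le> s" for x s
   using k[OF that] mult_right_mono[OF Ci(2) that(2)] by linarith
  show "\<bar>kf s x / s - (m/2) / norm x ^ 2\<bar> \<le> C * s" if "x \<in> \<Omega>" "0 < s" for x s
   using k3[OF that] mult_right_mono[OF Ci(3), of s] that(2) by linarith
 qed
qed

lemma kf_meas: "kf s \<in> borel_measurable \<mu>"
 unfolding kf_def by (rule measurable_\<mu>_borel) simp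

lemma grad_density_cont:
 assumes s: "0 \<le> s" and f: "C1c \<Omega> \<phi>"
 shows "continuous_on \<Omega> (grad_density s \<phi>)"
proof -
 note gr = continuous_on_g_grad[OF C1c_C1[OF f]]
 have r: "continuous_on \<Omega> (rad \<phi>)" by (rule continuous_on_rad[OF C1c_C1[OF f]])
 have t: "continuous_on \<Omega> (\<lambda>x. tanp x (g_grad G \<phi> x))"
  unfolding tanp_def cvec_def radf_grad[unfolded radf_def]
  using nonzero by (intro continuous_intros gr r) auto
 have t: "continuous_on \<Omega> (\<lambda>x. matrix_act (G x) (tanp x (g_grad G \<phi> x)))"
  by (rule continuous_on_act_G[OF t])
 have gi: "continuous_on \<Omega> (\<lambda>x. matrix_inv (G (outward s x)) $ i $ j)" for i j
  by (rule continuous_on_compose2[OF C1_on_continuous[OF Gi_C1[where S = UNIV]] outward_continuous], simp)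
 have ns: "norm x + s \<noteq> 0" if "x \<in> \<Omega>" for x using norm_pos[OF that] s by linarith
 show ?thesis
  unfolding grad_density_def Tform_def g_inner_def kf_def
  using nonzero ns by (intro continuous_intros r C1c_continuous[OF f] t gi) auto
qed

lemma nn_integral_grad_sh:
 assumes s: "0 \<le> s" and f: "C1c \<Omega> \<phi>"
 shows "(\<integral>\<^sup>+x. ennreal (g_inner (G x) (g_grad G (sh (m/2) s \<phi>) x) (g_grad G (sh (m/2) s \<phi>) x)) \<partial>\<mu>)
  = (\<integral>\<^sup>+x. ennreal (grad_density s \<phi> x) \<partial>\<mu>)"
proof -
 obtain K where K: "compact K" "K \<subseteq> \<Omega>" "\<And>x. x \<notin> K \<Longrightarrow> \<phi> x = 0" "\<And>i x. x \<notin> K \<Longrightarrow> partial_deriv i \<phi> x = 0"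
  using C1cE[OF f] by metis
 have z: "grad_density s \<phi> x = 0" if "x \<notin> K" for x
 proof -
  have "g_grad G \<phi> x = 0" using K(4)[OF that] by (rule g_grad_zero_off_support)
  then show ?thesis using K(3,4)[OF that]
   by (simp add: grad_density_def rad_def Tform_def tanp_def g_inner_def matrix_act_def cvec_def)
 qed
 have b: "grad_density s \<phi> \<in> borel_measurable borel"
  by (rule integral_compact_support(4)[OF grad_density_cont[OF s f] K(1,2) z])
 have "(\<integral>\<^sup>+x. ennreal (g_inner (G x) (g_grad G (sh (m/2) s \<phi>) x) (g_grad G (sh (m/2) s \<phi>) x)) \<partial>\<mu>)
   = (\<integral>\<^sup>+x. jac s x * ennreal (grad_density s \<phi> (inward s x)) \<partial>\<mu>)"
  using grad_sh_pointwise[OF s f] by (intro nn_integral_cong) simp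
 also have "\<dots> = (\<integral>\<^sup>+x. ennreal (grad_density s \<phi> x) \<partial>\<mu>)"
  using b by (intro nn_integral_inward[OF _ s]) simp
 finally show ?thesis .
qed

definition Tint :: "real \<Rightarrow> (real^'n \<Rightarrow> complex^'n) \<Rightarrow> real" where
 "Tint s V = (\<integral>x. Tform s x (V x) (V x) \<partial>\<mu>)"

lemma Tform_le: "x \<in> \<Omega> \<Longrightarrow> 0 \<le> s \<Longrightarrow> Tform s x v v \<le> g_inner (G x) v v"
 using Tform_mono[of x s v] g_inner_decomp[OF nonzero, of x "\<lambda>_. v" "\<lambda>_. v"]
 by (simp add: Tform_0 tanf_eq) (smt (verit) inner_ge_zero)

lemma Tform_sqi:
 assumes V: "vf.sqi V" and s: "0 \<le> s"
 shows "form_field.sqi \<mu> (Tform s) V"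
proof -
 interpret tf: form_field \<mu> "Tform s" by (rule Tform_form_field)
 have Vm: "V \<in> borel_measurable \<mu>" and Vi: "integrable \<mu> (\<lambda>x. g_inner (G x) (V x) (V x))"
  using V by (auto simp: vf.sqi_def)
 have "integrable \<mu> (\<lambda>x. Tform s x (V x) (V x))"
 proof (rule Bochner_Integration.integrable_bound[OF Vi tf.q_meas[OF Vm Vm]], rule AE_I2)
  fix x assume "x \<in> space \<mu>"
  then show "norm (Tform s x (V x) (V x)) \<le> norm (g_inner (G x) (V x) (V x))"
   using Tform_le[of x s "V x"] tf.q_nonneg[of x "V x"] s by simp
 qed
 then show ?thesis using Vm by (simp add: tf.sqi_def)
qed

lemma Tint_conv:
 assumes V: "vf.conv V V0 F" and s: "0 \<le> s"
 shows "((\<lambda>k. Tint s (V k)) \<longlongrightarrow> Tint s V0) F"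
proof -
 interpret tf: form_field \<mu> "Tform s" by (rule Tform_form_field)
 have c: "\<forall>\<^sub>F k in F. vf.sqi (V k)" "vf.sqi V0" "((\<lambda>k. vf.nrm (\<lambda>x. V k x - V0 x)) \<longlongrightarrow> 0) F"
  using V by (auto simp: vf.conv_def)
 have le: "tf.nrm W \<le> vf.nrm W" if W: "vf.sqi W" for W
 proof -
  have "tf.ip W W \<le> vf.ip W W"
   unfolding tf.ip_def vf.ip_def
   using W Tform_sqi[OF W s] Tform_le[OF _ s] by (intro integral_mono) (auto simp: tf.sqi_def vf.sqi_def)
  then show ?thesis by (simp add: tf.nrm_def vf.nrm_def)
 qed
 have "tf.conv V V0 F"
  unfolding tf.conv_def
 proof (intro conjI)
  show "\<forall>\<^sub>F k in F. tf.sqi (V k)" using c(1) by eventually_elim (rule Tform_sqi[OF _ s])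
  show "tf.sqi V0" by (rule Tform_sqi[OF c(2) s])
  show "((\<lambda>k. tf.nrm (\<lambda>x. V k x - V0 x)) \<longlongrightarrow> 0) F"
  proof (rule tendsto_sandwich[OF _ _ tendsto_const c(3)])
   show "\<forall>\<^sub>F k in F. tf.nrm (\<lambda>x. V k x - V0 x) \<le> vf.nrm (\<lambda>x. V k x - V0 x)"
    using c(1) by eventually_elim (rule le[OF vf.sqi_diff[OF _ c(2)]])
  qed (simp add: tf.nrm_nonneg)
 qed
 from tf.conv_tendsto_ip[OF this this] show ?thesis by (simp add: tf.ip_def Tint_def)
qed

lemma kf_sqi: "sc.sqi u \<Longrightarrow> 0 \<le> s \<Longrightarrow> sc.sqi (\<lambda>x. kf s x *\<^sub>R u x)"
proof -
 assume u: "sc.sqi u" and s: "0 \<le> s"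
 obtain C where "\<And>x. x \<in> \<Omega> \<Longrightarrow> \<bar>kf s x\<bar> \<le> C" by (rule kf_bound) (use s in blast)
 from mult_bounded(1)[OF kf_meas this u] show ?thesis .
qed

lemma kf_conv: "sc.conv u u0 F \<Longrightarrow> 0 \<le> s \<Longrightarrow> sc.conv (\<lambda>k x. kf s x *\<^sub>R u k x) (\<lambda>x. kf s x *\<^sub>R u0 x) F"
proof -
 assume u: "sc.conv u u0 F" and s: "0 \<le> s"
 obtain C where "\<And>x. x \<in> \<Omega> \<Longrightarrow> \<bar>kf s x\<bar> \<le> C" by (rule kf_bound) (use s in blast)
 from mult_bounded_conv[OF kf_meas this u] show ?thesis .
qed

lemma grad_sh_ip:
 assumes s: "0 \<le> s" and f: "C1c \<Omega> \<phi>"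
 shows "vf.ip (g_grad G (sh (m/2) s \<phi>)) (g_grad G (sh (m/2) s \<phi>))
  = sc.ip (\<lambda>x. radf (g_grad G \<phi>) x + kf s x *\<^sub>R \<phi> x) (\<lambda>x. radf (g_grad G \<phi>) x + kf s x *\<^sub>R \<phi> x) + Tint s (g_grad G \<phi>)"
proof -
 interpret tf: form_field \<mu> "Tform s" by (rule Tform_form_field)
 let ?z = "\<lambda>x. radf (g_grad G \<phi>) x + kf s x *\<^sub>R \<phi> x" and ?S = "g_grad G (sh (m/2) s \<phi>)"
 have V: "vf.sqi (g_grad G \<phi>)" by (rule test_sqi(3)[OF f])
 have z: "sc.sqi ?z" by (intro sc.sqi_add radf_sqi V kf_sqi test_sqi(1) f s)
 have T: "tf.sqi (g_grad G \<phi>)" by (rule Tform_sqi[OF V s])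
 have S: "vf.sqi ?S" by (rule test_sqi(3)[OF sh_C1c[OF s f]])
 have "ennreal (vf.ip ?S ?S) = (\<integral>\<^sup>+x. ennreal (grad_density s \<phi> x) \<partial>\<mu>)"
  using vf.nn_integral_eq_ip[OF S] nn_integral_grad_sh[OF s f] by simp
 also have "\<dots> = (\<integral>\<^sup>+x. ennreal (?z x \<bullet> ?z x) + ennreal (Tform s x (g_grad G \<phi> x) (g_grad G \<phi> x)) \<partial>\<mu>)"
  by (intro nn_integral_cong) (simp add: grad_density_def radf_grad power2_norm_eq_inner ennreal_plus tf.q_nonneg)
 also have "\<dots> = ennreal (sc.ip ?z ?z) + ennreal (tf.ip (g_grad G \<phi>) (g_grad G \<phi>))"
  using z T by (subst nn_integral_add) (auto simp: sc.sqi_def tf.sqi_def sc.nn_integral_eq_ip[OF z] tf.nn_integral_eq_ip[OF T])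
 also have "\<dots> = ennreal (sc.ip ?z ?z + tf.ip (g_grad G \<phi>) (g_grad G \<phi>))"
  by (simp add: ennreal_plus sc.ip_nonneg tf.ip_nonneg)
 finally show ?thesis
  by (subst (asm) ennreal_inj) (auto simp: Tint_def tf.ip_def[symmetric] intro: vf.ip_nonneg add_nonneg_nonneg sc.ip_nonneg tf.ip_nonneg)
qed

lemma sh_conv:
 assumes \<phi>: "\<And>k. C1c \<Omega> (\<phi> k)" and c: "sc.conv \<phi> u sequentially" and s: "0 \<le> s"
  and u: "u \<in> borel_measurable borel" "\<And>x. x \<notin> \<Omega> \<Longrightarrow> u x = 0"
 shows "sc.conv (\<lambda>k. sh (m/2) s (\<phi> k)) (sh (m/2) s u) sequentially"
proof -
 have us: "sc.sqi u" and t: "(\<lambda>k. sc.nrm (\<lambda>x. \<phi> k x - u x)) \<longlonglongrightarrow> 0" using c by (auto simp: sc.conv_def)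
 show ?thesis
  unfolding sc.conv_def
 proof (intro conjI)
  show "\<forall>\<^sub>F k in sequentially. sc.sqi (sh (m/2) s (\<phi> k))" by (simp add: test_sqi(1)[OF sh_C1c[OF s \<phi>]])
  show "sc.sqi (sh (m/2) s u)" by (rule sh_isometry(1)[OF u us s])
  have "sc.nrm (\<lambda>x. sh (m/2) s (\<phi> k) x - sh (m/2) s u x) = sc.nrm (\<lambda>x. \<phi> k x - u x)" for k
   unfolding sh_diff[symmetric]
   by (rule sh_isometry(2)[OF _ _ _ s]) (use u us test_off_\<Omega>[OF \<phi>] in "auto intro!: borel_measurable_diff test_borel[OF \<phi>] sc.sqi_diff test_sqi(1)[OF \<phi>]")
  then show "(\<lambda>k. sc.nrm (\<lambda>x. sh (m/2) s (\<phi> k) x - sh (m/2) s u x)) \<longlonglongrightarrow> 0" using t by simp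
 qed
qed

lemma vf_ip_decomp:
 assumes V: "vf.sqi V"
 shows "vf.ip V V = sc.ip (radf V) (radf V) + Tint 0 V"
proof -
 interpret tf: form_field \<mu> "Tform 0" by (rule Tform_form_field)
 have r: "sc.sqi (radf V)" by (rule radf_sqi[OF V])
 have T: "tf.sqi V" by (rule Tform_sqi[OF V order_refl])
 have "vf.ip V V = (\<integral>x. radf V x \<bullet> radf V x + Tform 0 x (V x) (V x) \<partial>\<mu>)"
  unfolding vf.ip_def by (intro Bochner_Integration.integral_cong) (auto simp: g_inner_decomp[OF nonzero] Tform_0 tanf_eq)
 also have "\<dots> = sc.ip (radf V) (radf V) + Tint 0 V"
  unfolding sc.ip_def Tint_def using r T by (intro Bochner_Integration.integral_add) (auto simp: sc.sqi_def tf.sqi_def)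
 finally show ?thesis .
qed

text \<open>
 \<open>\<langle>L, u - S\<^sub>s u\<rangle> = -|V|\<^sup>2 + \<langle>V, \<nabla>S\<^sub>s u\<rangle> \<le> (|\<nabla>S\<^sub>s u|\<^sup>2 - |V|\<^sup>2)/2\<close>, and the energy of \<open>S\<^sub>s u\<close> is
 computed by the change of variables.  The radial parts cancel up to terms with \<open>kf\<close>.
\<close>

lemma energy_of_translate:
 assumes H: "H10 u V" and L: "wk_lap V L" and s: "0 \<le> s"
  and u: "u \<in> borel_measurable borel" "\<And>x. x \<notin> \<Omega> \<Longrightarrow> u x = 0"
 shows "sc.ip L (\<lambda>x. u x - sh (m/2) s u x) \<le>
  sc.ip (radf V) (\<lambda>x. kf s x *\<^sub>R u x) + sc.ip (\<lambda>x. kf s x *\<^sub>R u x) (\<lambda>x. kf s x *\<^sub>R u x) / 2 - (Tint 0 V - Tint s V) / 2"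
proof -
 obtain \<phi> where \<phi>: "\<And>k. C1c \<Omega> (\<phi> k)" "sc.conv \<phi> u sequentially" "vf.conv (\<lambda>k. g_grad G (\<phi> k)) V sequentially"
  and us: "sc.sqi u" and Vs: "vf.sqi V" by (rule H10E[OF H]) blast
 have Ls: "sc.sqi L" using L by (simp add: wk_lap_def)
 let ?z = "\<lambda>u V x. radf V x + kf s x *\<^sub>R u x"
 have sus: "sc.sqi (sh (m/2) s u)" by (rule sh_isometry(1)[OF u us s])
 have lim1: "(\<lambda>k. - sc.ip L (sh (m/2) s (\<phi> k))) \<longlonglongrightarrow> - sc.ip L (sh (m/2) s u)"
  by (intro tendsto_minus sc.conv_tendsto_ip[OF sc.conv_const[OF Ls] sh_conv[OF \<phi>(1,2) s u]])
 have zc: "sc.conv (\<lambda>k. ?z (\<phi> k) (g_grad G (\<phi> k))) (?z u V) sequentially"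
  by (intro sc.conv_add radf_conv \<phi>(3) kf_conv \<phi>(2) s)
 have lim2: "(\<lambda>k. (vf.ip V V + (sc.ip (?z (\<phi> k) (g_grad G (\<phi> k))) (?z (\<phi> k) (g_grad G (\<phi> k))) + Tint s (g_grad G (\<phi> k)))) / 2)
   \<longlonglongrightarrow> (vf.ip V V + (sc.ip (?z u V) (?z u V) + Tint s V)) / 2"
  by (intro tendsto_divide tendsto_add tendsto_const sc.conv_tendsto_ip zc Tint_conv \<phi>(3) s) simp
 have "- sc.ip L (sh (m/2) s (\<phi> k)) \<le> (vf.ip V V + (sc.ip (?z (\<phi> k) (g_grad G (\<phi> k))) (?z (\<phi> k) (g_grad G (\<phi> k))) + Tint s (g_grad G (\<phi> k)))) / 2" for k
 proof -
  have "- sc.ip L (sh (m/2) s (\<phi> k)) = vf.ip V (g_grad G (sh (m/2) s (\<phi> k)))"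
   using L sh_C1c[OF s \<phi>(1), of "m/2" k] by (simp add: wk_lap_def)
  also have "\<dots> \<le> (vf.ip V V + vf.ip (g_grad G (sh (m/2) s (\<phi> k))) (g_grad G (sh (m/2) s (\<phi> k)))) / 2"
   using vf.ip_le_half[OF Vs test_sqi(3)[OF sh_C1c[OF s \<phi>(1)]], of "m/2" k] by linarith
  finally show ?thesis by (simp add: grad_sh_ip[OF s \<phi>(1)])
 qed
 then have 1: "- sc.ip L (sh (m/2) s u) \<le> (vf.ip V V + (sc.ip (?z u V) (?z u V) + Tint s V)) / 2"
  by (intro LIMSEQ_le[OF lim1 lim2]) auto
 have "sc.ip (?z u V) (?z u V) = sc.ip (radf V) (radf V) + 2 * sc.ip (radf V) (\<lambda>x. kf s x *\<^sub>R u x) + sc.ip (\<lambda>x. kf s x *\<^sub>R u x) (\<lambda>x. kf s x *\<^sub>R u x)"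
  by (rule sc.ip_add_self[OF radf_sqi[OF Vs] kf_sqi[OF us s]])
 moreover have "sc.ip L (\<lambda>x. u x - sh (m/2) s u x) = - vf.ip V V - sc.ip L (sh (m/2) s u)"
  by (simp add: sc.ip_diff2[OF us sus Ls] green_H10[OF L H])
 ultimately show ?thesis using 1 vf_ip_decomp[OF Vs] by argo
qed

end


section \<open>The Morawetz inequality at fixed time\<close>

definition pw :: "real \<Rightarrow> complex \<Rightarrow> complex" where
 "pw p z = (cmod z powr (p - 1)) *\<^sub>R z"

lemma pw_inner_self:
 assumes p: "1 < p" shows "pw p z \<bullet> z = cmod z powr (p + 1)"
 unfolding pw_def
proof (cases "z = 0")
 case False
 have "z \<bullet> z = cmod z powr 2" using False by (simp add: power2_norm_eq_inner[symmetric])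
 then show "(cmod z powr (p - 1)) *\<^sub>R z \<bullet> z = cmod z powr (p + 1)" using powr_add[of "cmod z" "p - 1" 2] by (simp add: add.commute)
qed simp

text \<open>
 The gradient inequality for \<open>|z|\<^bsup>p+1\<^esup>/(p+1)\<close>, from Young's inequality for the conjugate exponents
 \<open>p + 1\<close> and \<open>(p + 1)/p\<close>.
\<close>

lemma power_potential_convex:
 fixes z w :: complex
 assumes p: "1 < p"
 shows "pw p z \<bullet> (z - w) \<ge> (cmod z powr (p + 1) - cmod w powr (p + 1)) / (p + 1)"
proof -
 have zp: "cmod z powr (p - 1) * cmod z = cmod z powr p"
  using powr_mult_base[of "cmod z" "p - 1"] by (simp add: mult.commute)
 have "pw p z \<bullet> w \<le> cmod z powr (p - 1) * (cmod z * cmod w)"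
  using norm_cauchy_schwarz[of z w] by (simp add: pw_def mult_left_mono)
 also have "\<dots> = cmod z powr p * cmod w" by (simp add: zp[symmetric])
 also have "\<dots> \<le> (cmod z powr p) powr ((p + 1) / p) / ((p + 1) / p) + cmod w powr (p + 1) / (p + 1)"
  using p by (intro Youngs_inequality) (auto simp: field_simps)
 also have "(cmod z powr p) powr ((p + 1) / p) = cmod z powr (p + 1)" using p by (simp add: powr_powr)
 finally have "pw p z \<bullet> w \<le> p / (p + 1) * cmod z powr (p + 1) + cmod w powr (p + 1) / (p + 1)"
  by (simp add: mult.commute)
 moreover have "cmod z powr (p + 1) = p / (p + 1) * cmod z powr (p + 1) + cmod z powr (p + 1) / (p + 1)"
 proof -
  have "p / (p + 1) * cmod z powr (p + 1) + cmod z powr (p + 1) / (p + 1) = ((p + 1) * cmod z powr (p + 1)) / (p + 1)"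
   by (simp only: times_divide_eq_left add_divide_distrib[symmetric] distrib_right mult_1)
  then show ?thesis using p by simp
 qed
 ultimately show ?thesis unfolding inner_diff_right pw_inner_self[OF p] diff_divide_distrib by linarith
qed

lemma norm_ratio:
 fixes x :: "'a::real_normed_vector"
 assumes "0 \<le> s" shows "norm x / (norm x + s) \<le> 1" "0 \<le> norm x / (norm x + s)"
 unfolding divide_le_eq_1 using assms norm_ge_zero[of x] by (linarith, simp)

lemma powr_ratio_limit:
 fixes a :: real
 assumes a: "a > 0" and t: "\<And>j. 0 < t j" "t \<longlonglongrightarrow> 0"
 shows "(\<lambda>j. (1 - (a / (a + t j)) powr e) / t j) \<longlonglongrightarrow> e / a"
proof -
 have tat: "filterlim t (at 0) sequentially" using t by (simp add: filterlim_at less_imp_neq[THEN not_sym])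
 have "((\<lambda>s. (a / (a + s)) powr e) has_real_derivative - (e / a)) (at 0)"
  using a by (auto intro!: derivative_eq_intros simp: field_simps power2_eq_square)
 then have "((\<lambda>h. ((a / (a + (0 + h))) powr e - (a / (a + 0)) powr e) / h) \<longlongrightarrow> - (e / a)) (at 0)"
  by (simp only: DERIV_def)
 from tendsto_minus[OF filterlim_compose[OF this tat]] show ?thesis using a by (simp add: minus_divide_left[symmetric] diff_divide_distrib)
qed

context radial_nontrapping begin

lemma power_of_translate:
 assumes p: "1 < p" and s: "0 \<le> s" and u: "u \<in> borel_measurable borel" "\<And>x. x \<notin> \<Omega> \<Longrightarrow> u x = (0::complex)"
  and I: "integrable \<mu> (\<lambda>x. cmod (u x) powr (p + 1))"
 shows "integrable \<mu> (\<lambda>x. cmod (sh (m/2) s u x) powr (p + 1))" (is ?th1)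
  and "(\<integral>x. cmod (sh (m/2) s u x) powr (p + 1) \<partial>\<mu>) = (\<integral>x. (norm x / (norm x + s)) powr (m * (p - 1) / 2) * cmod (u x) powr (p + 1) \<partial>\<mu>)"
  and "integrable \<mu> (\<lambda>x. (norm x / (norm x + s)) powr (m * (p - 1) / 2) * cmod (u x) powr (p + 1))"
proof -
 let ?e = "m * (p - 1) / 2"
 let ?H = "\<lambda>x. (norm x / (norm x + s)) powr ?e * cmod (u x) powr (p + 1)"
 note [measurable] = u(1)
 have Hb: "?H \<in> borel_measurable borel" by measurable
 have shb: "(\<lambda>x. cmod (sh (m/2) s u x) powr (p + 1)) \<in> borel_measurable borel" by measurable
 have e: "?e \<ge> 0" using p m_ge by simp
 show IH: "integrable \<mu> ?H"
 proof (rule Bochner_Integration.integrable_bound[OF I measurable_\<mu>_borel[OF Hb]], rule AE_I2)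
  fix x :: "real^'n"
  note norm_ratio[OF s, of x]
  then have "(norm x / (norm x + s)) powr ?e \<le> 1" using e powr_mono2[of ?e "norm x / (norm x + s)" 1] by simp
  then show "norm (?H x) \<le> norm (cmod (u x) powr (p + 1))"
   by (simp add: mult_left_le_one_le)
 qed
 have pt: "ennreal (cmod (sh (m/2) s u x) powr (p + 1)) = jac s x * ennreal (?H (inward s x))" for x
 proof (cases "s < norm x \<and> inward s x \<in> \<Omega>")
  case True
  define q where "q = (norm x - s) / norm x"
  have x0: "0 < norm x" using True s by linarith
  have q: "q > 0" using True x0 by (simp add: q_def)
  have ny: "norm (inward s x) = norm x - s" using True x0 by (intro norm_inward) auto
  have qq: "norm (inward s x) / (norm (inward s x) + s) = q" by (simp add: ny q_def)
  have "cmod (sh (m/2) s u x) powr (p + 1) = (q powr (m/2)) powr (p + 1) * cmod (u (inward s x)) powr (p + 1)"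
   using True by (simp add: sh_def q_def[symmetric] powr_mult)
  also have "(q powr (m/2)) powr (p + 1) = q powr m * q powr ?e"
   by (simp add: powr_powr powr_add[symmetric]) (simp add: field_simps)
  finally have "cmod (sh (m/2) s u x) powr (p + 1) = q powr m * ?H (inward s x)"
   by (simp only: qq mult.assoc)
  then show ?thesis using True by (simp add: jac_def q_def[symmetric] ennreal_mult)
 next
  case False
  then show ?thesis by (auto simp: jac_def sh_def u(2))
 qed
 have nn: "(\<integral>\<^sup>+x. ennreal (cmod (sh (m/2) s u x) powr (p + 1)) \<partial>\<mu>) = (\<integral>\<^sup>+x. ennreal (?H x) \<partial>\<mu>)"
  unfolding pt by (rule nn_integral_inward[OF _ s]) (use Hb in simp)
 also have "\<dots> = ennreal (\<integral>x. ?H x \<partial>\<mu>)" by (rule nn_integral_eq_integral[OF IH]) simp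
 finally have nn: "(\<integral>\<^sup>+x. ennreal (cmod (sh (m/2) s u x) powr (p + 1)) \<partial>\<mu>) = ennreal (\<integral>x. ?H x \<partial>\<mu>)" .
 have 0: "0 \<le> (\<integral>x. ?H x \<partial>\<mu>)" by (intro Bochner_Integration.integral_nonneg) simp
 have "has_bochner_integral \<mu> (\<lambda>x. cmod (sh (m/2) s u x) powr (p + 1)) (\<integral>x. ?H x \<partial>\<mu>)"
  by (rule has_bochner_integral_nn_integral[OF measurable_\<mu>_borel[OF shb] _ 0 nn]) simp
 then show ?th1
  "(\<integral>x. cmod (sh (m/2) s u x) powr (p + 1) \<partial>\<mu>) = (\<integral>x. ?H x \<partial>\<mu>)"
  by (auto simp: has_bochner_integral_iff)
qed

lemma potential_of_translate:
 assumes p: "1 < p" and s: "0 \<le> s" and u: "u \<in> borel_measurable borel" "\<And>x. x \<notin> \<Omega> \<Longrightarrow> u x = (0::complex)"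
  and us: "sc.sqi u" and N: "sc.sqi (\<lambda>x. pw p (u x))"
 shows "integrable \<mu> (\<lambda>x. (1 - (norm x / (norm x + s)) powr (m * (p - 1) / 2)) * cmod (u x) powr (p + 1))"
  and "(\<integral>x. (1 - (norm x / (norm x + s)) powr (m * (p - 1) / 2)) * cmod (u x) powr (p + 1) \<partial>\<mu>) / (p + 1)
  \<le> sc.ip (\<lambda>x. pw p (u x)) (\<lambda>x. u x - sh (m/2) s u x)"
proof -
 let ?e = "m * (p - 1) / 2"
 have I: "integrable \<mu> (\<lambda>x. cmod (u x) powr (p + 1))"
  using sc.integrable_q[OF N us] by (simp add: pw_inner_self[OF p])
 have pt: "integrable \<mu> (\<lambda>x. cmod (sh (m/2) s u x) powr (p + 1))"
  "(\<integral>x. cmod (sh (m/2) s u x) powr (p + 1) \<partial>\<mu>) = (\<integral>x. (norm x / (norm x + s)) powr ?e * cmod (u x) powr (p + 1) \<partial>\<mu>)"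
  "integrable \<mu> (\<lambda>x. (norm x / (norm x + s)) powr ?e * cmod (u x) powr (p + 1))"
  by (rule power_of_translate[OF p s u(1)]; (rule I | rule u(2), assumption))+
 show i: "integrable \<mu> (\<lambda>x. (1 - (norm x / (norm x + s)) powr ?e) * cmod (u x) powr (p + 1))"
  using Bochner_Integration.integrable_diff[OF I pt(3)] by (simp add: left_diff_distrib)
 have "(\<integral>x. (1 - (norm x / (norm x + s)) powr ?e) * cmod (u x) powr (p + 1) \<partial>\<mu>) / (p + 1)
   = (\<integral>x. (cmod (u x) powr (p + 1) - cmod (sh (m/2) s u x) powr (p + 1)) / (p + 1) \<partial>\<mu>)"
  using Bochner_Integration.integral_diff[OF I pt(3)] Bochner_Integration.integral_diff[OF I pt(1)]
  by (simp add: left_diff_distrib pt(2))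
 also have "\<dots> \<le> sc.ip (\<lambda>x. pw p (u x)) (\<lambda>x. u x - sh (m/2) s u x)"
  unfolding sc.ip_def
 proof (rule integral_mono)
  show "integrable \<mu> (\<lambda>x. pw p (u x) \<bullet> (u x - sh (m/2) s u x))"
   by (rule sc.integrable_q[OF N sc.sqi_diff[OF us sh_isometry(1)[OF u us s]]])
  show "integrable \<mu> (\<lambda>x. (cmod (u x) powr (p + 1) - cmod (sh (m/2) s u x) powr (p + 1)) / (p + 1))"
   using Bochner_Integration.integrable_diff[OF I pt(1)] by (rule integrable_divide_zero)
  show "(cmod (u x) powr (p + 1) - cmod (sh (m/2) s u x) powr (p + 1)) / (p + 1) \<le> pw p (u x) \<bullet> (u x - sh (m/2) s u x)" for x
   by (rule power_potential_convex[OF p])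
 qed
 finally show "(\<integral>x. (1 - (norm x / (norm x + s)) powr ?e) * cmod (u x) powr (p + 1) \<partial>\<mu>) / (p + 1)
  \<le> sc.ip (\<lambda>x. pw p (u x)) (\<lambda>x. u x - sh (m/2) s u x)" .
qed

lemma fatou_bound:
 fixes g :: "real^'n \<Rightarrow> real" and h :: "nat \<Rightarrow> real^'n \<Rightarrow> real"
 assumes h: "\<And>j. integrable \<mu> (h j)" "\<And>j x. x \<in> \<Omega> \<Longrightarrow> 0 \<le> h j x"
  and g: "\<And>x. x \<in> \<Omega> \<Longrightarrow> ennreal (g x) \<le> liminf (\<lambda>j. ennreal (h j x))"
  and R: "\<And>j. (\<integral>x. h j x \<partial>\<mu>) \<le> R j" "R \<longlonglongrightarrow> r"
 shows "(\<integral>\<^sup>+x. ennreal (g x) \<partial>\<mu>) \<le> ennreal r"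
proof -
 have [measurable]: "h j \<in> borel_measurable \<mu>" for j using h(1) by auto
 have "(\<integral>\<^sup>+x. ennreal (g x) \<partial>\<mu>) \<le> (\<integral>\<^sup>+x. liminf (\<lambda>j. ennreal (h j x)) \<partial>\<mu>)"
  by (intro nn_integral_mono) (simp add: g)
 also have "\<dots> \<le> liminf (\<lambda>j. \<integral>\<^sup>+x. ennreal (h j x) \<partial>\<mu>)"
  by (intro nn_integral_liminf) simp
 also have "\<dots> \<le> liminf (\<lambda>j. ennreal (R j))"
 proof (intro Liminf_mono always_eventually allI)
  fix j
  have "(\<integral>\<^sup>+x. ennreal (h j x) \<partial>\<mu>) = ennreal (\<integral>x. h j x \<partial>\<mu>)"
   by (intro nn_integral_eq_integral h(1) AE_I2) (simp add: h(2))
  then show "(\<integral>\<^sup>+x. ennreal (h j x) \<partial>\<mu>) \<le> ennreal (R j)" using R(1)[of j] by (simp add: ennreal_leI)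
 qed
 also have "\<dots> = ennreal r" by (rule lim_imp_Liminf) (auto intro: tendsto_ennrealI R(2))
 finally show ?thesis .
qed

text \<open>
 The comparison of \<open>u\<close> with its translates, divided by the step: \<open>A\<close> is the loss of tangential energy,
 \<open>B\<close> the loss of potential energy, and \<open>R\<close> collects what converges.  The terms \<open>A\<close> and \<open>B\<close> are
 nonnegative, so Fatou's lemma applies to each of them separately.
\<close>

lemma key_estimate_borel:
 assumes p: "1 < p" and H: "H10 u V" and L: "wk_lap V L" and N: "sc.sqi (\<lambda>x. pw p (u x))"
  and u: "u \<in> borel_measurable borel" "\<And>x. x \<notin> \<Omega> \<Longrightarrow> u x = 0"
 defines "Q \<equiv> sc.ip (\<lambda>x. pw p (u x) - L x) (genP u V)"
 shows "(\<integral>\<^sup>+x. ennreal (2 * \<alpha> x / norm x * Tform 0 x (V x) (V x)) \<partial>\<mu>) \<le> ennreal (2 * Q)" (is ?th1)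
  and "(\<integral>\<^sup>+x. ennreal (m * (p - 1) / 2 / norm x * cmod (u x) powr (p + 1)) \<partial>\<mu>) \<le> ennreal ((p + 1) * Q)"
  and "m * (m - 2) / 4 * sc.ip (\<lambda>x. (1 / norm x ^ 3) *\<^sub>R u x) u \<le> Q" (is ?th2)
proof -
 have us: "sc.sqi u" and Vs: "vf.sqi V" using H10E[OF H] by blast+
 have Ls: "sc.sqi L" using L by (simp add: wk_lap_def)
 let ?N = "\<lambda>x. pw p (u x)" and ?e = "m * (p - 1) / 2"
 have fs: "sc.sqi (\<lambda>x. ?N x - L x)" by (rule sc.sqi_diff[OF N Ls])
 define t where "t j = 1 / real (Suc j)" for j
 have t: "\<And>j. 0 < t j" "\<And>j. t j \<le> 1" "t \<longlonglongrightarrow> 0"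
  unfolding t_def using LIMSEQ_inverse_real_of_nat by (auto simp: inverse_eq_divide divide_le_eq)
 have t0: "0 \<le> t j" for j using t(1)[of j] by simp
 define \<kappa> where "\<kappa> j x = (kf (t j) x / t j) *\<^sub>R u x" for j x
 define D where "D j x = (u x - sh (m/2) (t j) u x) /\<^sub>R t j" for j x
 define A where "A j = (Tint 0 V - Tint (t j) V) / t j" for j
 define B where "B j = (\<integral>x. (1 - (norm x / (norm x + t j)) powr ?e) / t j * cmod (u x) powr (p + 1) \<partial>\<mu>)" for j
 define R where "R j = sc.ip (\<lambda>x. ?N x - L x) (D j) + sc.ip (radf V) (\<kappa> j) + t j / 2 * sc.ip (\<kappa> j) (\<kappa> j)" for j
 have \<kappa>s: "sc.sqi (\<kappa> j)" for j
  using sc.sqi_scale[OF kf_sqi[OF us t0[of j]], of "1 / t j"] by (simp add: \<kappa>_def[abs_def])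
 have \<kappa>e: "(\<lambda>x. kf (t j) x *\<^sub>R u x) = (\<lambda>x. t j *\<^sub>R \<kappa> j x)" for j
  using t(1)[of j] by (simp add: \<kappa>_def fun_eq_iff)
 have Dc: "sc.conv D (genP u V) sequentially"
  unfolding D_def[abs_def] by (rule quotient_conv[OF u H t])
 have De: "(\<lambda>x. u x - sh (m/2) (t j) u x) = (\<lambda>x. t j *\<^sub>R D j x)" for j
  using t(1)[of j] by (simp add: D_def fun_eq_iff)
 have shs: "sc.sqi (sh (m/2) (t j) u)" for j by (rule sh_isometry(1)[OF u us t0])
 have Ds: "sc.sqi (D j)" for j
  using sc.sqi_scale[OF sc.sqi_diff[OF us shs[of j]], of "inverse (t j)"] by (simp add: D_def[abs_def])
 define \<kappa>0 where "\<kappa>0 x = ((m/2) / norm x ^ 2) *\<^sub>R u x" for x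
 have \<kappa>0s: "sc.sqi \<kappa>0" unfolding \<kappa>0_def[abs_def] by (rule over_norm_sqi[OF us])
 have \<kappa>c: "sc.conv \<kappa> \<kappa>0 sequentially"
 proof -
  obtain C where C: "\<And>x s. x \<in> \<Omega> \<Longrightarrow> 0 < s \<Longrightarrow> \<bar>kf s x / s - (m/2) / norm x ^ 2\<bar> \<le> C * s"
   by (rule kf_bound) blast
  have b: "(\<lambda>x. kf (t j) x / t j - (m/2) / norm x ^ 2) \<in> borel_measurable \<mu>" for j
   by (intro borel_measurable_diff borel_measurable_divide kf_meas) (auto intro!: measurable_\<mu>_borel)
  show ?thesis
  proof (rule sc.conv_dominated)
   show "\<forall>\<^sub>F k in sequentially. sc.sqi (\<kappa> k)" by (simp add: \<kappa>s)
   show "sc.nrm (\<lambda>x. \<kappa> j x - \<kappa>0 x) \<le> \<bar>C * t j\<bar> * sc.nrm u" for j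
    using mult_bounded(2)[OF b C[OF _ t(1)[of j]] us] by (simp add: \<kappa>_def \<kappa>0_def scaleR_diff_left)
   have "(\<lambda>j. \<bar>C * t j\<bar> * sc.nrm u) \<longlonglongrightarrow> \<bar>C * 0\<bar> * sc.nrm u"
    by (intro tendsto_intros t(3))
   then show "(\<lambda>j. \<bar>C * t j\<bar> * sc.nrm u) \<longlonglongrightarrow> 0" by simp
  qed (rule \<kappa>0s)
 qed
 define U where "U = sc.ip (\<lambda>x. (1 / norm x ^ 3) *\<^sub>R u x) u"
 have U0: "0 \<le> U"
  unfolding U_def sc.ip_def by (intro Bochner_Integration.integral_nonneg) simp
 \<comment> \<open>The limit of the radial remainder is evaluated by the divergence identity.\<close>
 have k0: "sc.ip (radf V) \<kappa>0 = - (m * (m - 2) / 4) * U"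
 proof -
  have "sc.ip (radf V) \<kappa>0 = (m/2) * sc.ip (\<lambda>x. (1 / norm x ^ 2) *\<^sub>R radf V x) u"
   unfolding sc.ip_def by (subst Bochner_Integration.integral_mult_right_zero[symmetric], intro Bochner_Integration.integral_cong) (auto simp: \<kappa>0_def)
  moreover have "sc.ip (\<lambda>x. (1 / norm x ^ 2) *\<^sub>R radf V x) u = - (m - 2) * U / 2"
   using hardy_identity[OF H] by (simp add: U_def algebra_simps)
  ultimately have "sc.ip (radf V) \<kappa>0 = (m/2) * (- (m - 2) * U / 2)" by simp
  then show ?thesis by argo
 qed
 have Rlim: "R \<longlonglongrightarrow> Q - m * (m - 2) / 4 * U"
 proof -
  have "R \<longlonglongrightarrow> sc.ip (\<lambda>x. ?N x - L x) (genP u V) + sc.ip (radf V) \<kappa>0 + 0 / 2 * sc.ip \<kappa>0 \<kappa>0"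
   unfolding R_def[abs_def]
   by (intro tendsto_add tendsto_mult tendsto_divide tendsto_const t(3) sc.conv_tendsto_ip Dc \<kappa>c sc.conv_const fs radf_sqi Vs) simp
  then show ?thesis by (simp add: k0 Q_def)
 qed
 have i: "integrable \<mu> (\<lambda>x. (1 - (norm x / (norm x + t j)) powr ?e) / t j * cmod (u x) powr (p + 1))" for j
  using integrable_divide_zero[OF potential_of_translate(1)[OF p t0[of j] u us N], of "t j"] by simp
 have AB: "A j / 2 + B j / (p + 1) \<le> R j" for j
 proof -
  have "t j * sc.ip L (D j) \<le> t j * sc.ip (radf V) (\<kappa> j) + t j * (t j * sc.ip (\<kappa> j) (\<kappa> j)) / 2 - t j * (A j / 2)"
   using energy_of_translate[OF H L t0[of j] u] t(1)[of j]
   unfolding De \<kappa>e sc.ip_scale sc.ip_scale2 by (simp add: A_def)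
  then have "t j * (sc.ip L (D j) + A j / 2) \<le> t j * (sc.ip (radf V) (\<kappa> j) + t j / 2 * sc.ip (\<kappa> j) (\<kappa> j))"
   by (simp add: distrib_left right_diff_distrib)
  then have 1: "sc.ip L (D j) + A j / 2 \<le> sc.ip (radf V) (\<kappa> j) + t j / 2 * sc.ip (\<kappa> j) (\<kappa> j)"
   using t(1)[of j] by (simp only: mult_le_cancel_left_pos)
  have "t j * B j = (\<integral>x. (1 - (norm x / (norm x + t j)) powr ?e) * cmod (u x) powr (p + 1) \<partial>\<mu>)"
   unfolding B_def Bochner_Integration.integral_mult_right_zero[symmetric] using t(1)[of j] by simp
  then have "t j * (B j / (p + 1)) \<le> t j * sc.ip ?N (D j)"
   using potential_of_translate(2)[OF p t0[of j] u us N] unfolding De sc.ip_scale2 by simp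
  then have 2: "B j / (p + 1) \<le> sc.ip ?N (D j)" using t(1)[of j] by (simp only: mult_le_cancel_left_pos)
  show ?thesis using 1 2 unfolding R_def sc.ip_diff[OF N Ls Ds] by linarith
 qed
 have Ti: "integrable \<mu> (\<lambda>x. Tform s x (V x) (V x))" if "0 \<le> s" for s
 proof -
  interpret tf: form_field \<mu> "Tform s" by (rule Tform_form_field)
  show ?thesis using Tform_sqi[OF Vs that] by (simp add: tf.sqi_def)
 qed
 have Tii: "integrable \<mu> (\<lambda>x. (Tform 0 x (V x) (V x) - Tform (t j) x (V x) (V x)) / t j)" for j
  by (intro integrable_divide_zero Bochner_Integration.integrable_diff Ti t0) simp_all
 have Aeq: "(\<integral>x. (Tform 0 x (V x) (V x) - Tform (t j) x (V x) (V x)) / t j \<partial>\<mu>) = A j" for j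
  using Bochner_Integration.integral_diff[OF Ti[OF order_refl] Ti[OF t0[of j]]] by (simp add: A_def Tint_def)
 have Apt: "0 \<le> (Tform 0 x (V x) (V x) - Tform (t j) x (V x) (V x)) / t j" if "x \<in> \<Omega>" for j x
  using Tform_mono[OF that t0[of j], of "V x"] t0[of j] by simp
 have Bpt: "0 \<le> (1 - (norm x / (norm x + t j)) powr ?e) / t j * cmod (u x) powr (p + 1)" for j x
 proof -
  note norm_ratio[OF t0, of x j]
  then have "(norm x / (norm x + t j)) powr ?e \<le> 1"
   using p m_ge powr_mono2[of ?e "norm x / (norm x + t j)" 1] by simp
  then show ?thesis using t0[of j] by simp
 qed
 have A0: "0 \<le> A j" for j unfolding Aeq[symmetric] using Apt by (intro Bochner_Integration.integral_nonneg) simp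
 have B0: "0 \<le> B j" for j unfolding B_def by (rule Bochner_Integration.integral_nonneg[OF Bpt])
 have mm: "0 \<le> m * (m - 2) / 4 * U" using m_ge U0 by simp
 have p1: "0 < p + 1" using p by simp
 have A1: "A j \<le> 2 * R j" for j
  using AB[of j] divide_nonneg_pos[OF B0[of j] p1] by linarith
 have B1: "B j \<le> (p + 1) * R j" for j
 proof -
  have "B j / (p + 1) \<le> R j" using AB[of j] A0[of j] by linarith
  then show ?thesis using p1 by (simp add: pos_divide_le_eq mult.commute)
 qed
 show ?th1
 proof -
  have "(\<integral>\<^sup>+x. ennreal (2 * \<alpha> x / norm x * Tform 0 x (V x) (V x)) \<partial>\<mu>) \<le> ennreal (2 * (Q - m * (m - 2) / 4 * U))"
   by (rule fatou_bound[OF Tii Apt Tform_liminf[OF _ t(1,3)] _ tendsto_mult[OF tendsto_const Rlim]]) (auto simp: Aeq A1 simp del: Bochner_Integration.integral_divide_zero)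
  also have "\<dots> \<le> ennreal (2 * Q)" using mm by (intro ennreal_leI mult_left_mono) auto
  finally show ?thesis .
 qed
 show "(\<integral>\<^sup>+x. ennreal (?e / norm x * cmod (u x) powr (p + 1)) \<partial>\<mu>) \<le> ennreal ((p + 1) * Q)"
 proof -
  have lim: "ennreal (?e / norm x * cmod (u x) powr (p + 1)) \<le> liminf (\<lambda>j. ennreal ((1 - (norm x / (norm x + t j)) powr ?e) / t j * cmod (u x) powr (p + 1)))"
   if x: "x \<in> \<Omega>" for x
  proof -
   have "(\<lambda>j. (1 - (norm x / (norm x + t j)) powr ?e) / t j * cmod (u x) powr (p + 1)) \<longlonglongrightarrow> ?e / norm x * cmod (u x) powr (p + 1)"
    by (intro tendsto_mult powr_ratio_limit norm_pos x t tendsto_const)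
   then have "liminf (\<lambda>j. ennreal ((1 - (norm x / (norm x + t j)) powr ?e) / t j * cmod (u x) powr (p + 1))) = ennreal (?e / norm x * cmod (u x) powr (p + 1))"
    by (intro lim_imp_Liminf tendsto_ennrealI) simp_all
   then show ?thesis by simp
  qed
  have "(\<integral>\<^sup>+x. ennreal (?e / norm x * cmod (u x) powr (p + 1)) \<partial>\<mu>) \<le> ennreal ((p + 1) * (Q - m * (m - 2) / 4 * U))"
   by (rule fatou_bound[OF i Bpt lim _ tendsto_mult[OF tendsto_const Rlim]]) (simp_all only: B_def[symmetric] B1)
  also have "\<dots> \<le> ennreal ((p + 1) * Q)" using mm p1 by (intro ennreal_leI mult_left_mono) auto
  finally show ?thesis .
 qed
 have "0 \<le> R j" for j using A1[of j] A0[of j] by linarith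
 then have "0 \<le> Q - m * (m - 2) / 4 * U"
  by (intro LIMSEQ_le_const[OF Rlim] exI allI impI)
 then show ?th2 by (simp add: U_def)
qed

lemma key_estimate:
 assumes p: "1 < p" and H: "H10 u V" and L: "wk_lap V L" and N: "sc.sqi (\<lambda>x. pw p (u x))"
 defines "Q \<equiv> sc.ip (\<lambda>x. pw p (u x) - L x) (genP u V)"
 shows "(\<integral>\<^sup>+x. ennreal (2 * \<alpha> x / norm x * Tform 0 x (V x) (V x)) \<partial>\<mu>) \<le> ennreal (2 * Q)" (is ?th1)
  and "(\<integral>\<^sup>+x. ennreal (m * (p - 1) / 2 / norm x * cmod (u x) powr (p + 1)) \<partial>\<mu>) \<le> ennreal ((p + 1) * Q)" (is ?th2)
  and "m * (m - 2) / 4 * sc.ip (\<lambda>x. (1 / norm x ^ 3) *\<^sub>R u x) u \<le> Q" (is ?th3)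
proof -
 have us: "sc.sqi u" and Vs: "vf.sqi V" using H10E[OF H] by blast+
 have um: "u \<in> borel_measurable \<mu>" using us by (simp add: sc.sqi_def)
 obtain v where v: "v \<in> borel_measurable borel" "\<And>x. x \<notin> \<Omega> \<Longrightarrow> v x = 0" and ae: "AE x in \<mu>. u x = v x"
  using borel_representative[OF um] by metis
 have vm: "v \<in> borel_measurable \<mu>" by (rule measurable_\<mu>_borel[OF v(1)])
 have vs: "sc.sqi v" using sc.sqi_cong_AE[OF ae um vm] us by simp
 have Hv: "H10 v V" by (rule H10_cong_AE[OF H ae vm _ vf.sqi_meas[OF Vs]]) simp
 have Nm: "(\<lambda>x. pw p (u x)) \<in> borel_measurable \<mu>" using N by (simp add: sc.sqi_def)
 have vNm: "(\<lambda>x. pw p (v x)) \<in> borel_measurable \<mu>" unfolding pw_def using vm by measurable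
 have Nae: "AE x in \<mu>. pw p (u x) = pw p (v x)" using ae by eventually_elim simp
 have Nv: "sc.sqi (\<lambda>x. pw p (v x))" using sc.sqi_cong_AE[OF Nae Nm vNm] N by simp
 have Lm: "L \<in> borel_measurable \<mu>" using L by (auto simp: wk_lap_def sc.sqi_def)
 have Q: "sc.ip (\<lambda>x. pw p (v x) - L x) (genP v V) = Q"
  unfolding Q_def
  by (rule sc.ip_cong_AE) (use ae Nae Lm Nm vNm sc.sqi_meas[OF genP_sqi[OF us Vs]] sc.sqi_meas[OF genP_sqi[OF vs Vs]] in "auto simp: genP_def intro!: borel_measurable_diff")
 note k = key_estimate_borel[OF p Hv L Nv v, unfolded Q]
 show ?th1 by (rule k(1))
 have "(\<integral>\<^sup>+x. ennreal (m * (p - 1) / 2 / norm x * cmod (u x) powr (p + 1)) \<partial>\<mu>) = (\<integral>\<^sup>+x. ennreal (m * (p - 1) / 2 / norm x * cmod (v x) powr (p + 1)) \<partial>\<mu>)"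
  by (rule nn_integral_cong_AE) (use ae in eventually_elim, simp)
 then show ?th2 using k(2) by simp
 have "sc.ip (\<lambda>x. (1 / norm x ^ 3) *\<^sub>R u x) u = sc.ip (\<lambda>x. (1 / norm x ^ 3) *\<^sub>R v x) v"
  by (rule sc.ip_cong_AE) (use ae um vm sc.sqi_meas[OF over_norm_sqi[OF us]] sc.sqi_meas[OF over_norm_sqi[OF vs]] in auto)
 then show ?th3 using k(3) by simp
qed

end


section \<open>Radial rays do not leave the domain\<close>

definition dir_deriv :: "real^'n \<Rightarrow> (real^'n \<Rightarrow> real) \<Rightarrow> real^'n \<Rightarrow> real" where
 "dir_deriv v f y = (\<Sum>i\<in>UNIV. v $ i * partial_deriv i f y)"

lemma dir_deriv_line:
 assumes "C1_on S f" "x + s *\<^sub>R v \<in> S"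
 shows "((\<lambda>s. f (x + s *\<^sub>R v)) has_real_derivative dir_deriv v f (x + s *\<^sub>R v)) (at s within T)"
 using C1_on_line[OF assms, of T] by (simp add: has_real_derivative_iff_has_vector_derivative dir_deriv_def)

lemma dir_deriv_cont:
 assumes "C1_on S f" shows "continuous_on S (dir_deriv v f)"
 unfolding dir_deriv_def by (intro continuous_intros C1_on_partial[OF assms])

lemma segment_end_in_closure:
 fixes y :: "'a::real_normed_vector"
 assumes "s0 > (0::real)" and A: "\<And>t. 0 \<le> t \<Longrightarrow> t < s0 \<Longrightarrow> y + t *\<^sub>R v \<in> A"
 shows "y + s0 *\<^sub>R v \<in> closure A"
 unfolding closure_sequential
proof (intro exI conjI allI)
 have "(\<lambda>n. y + (s0 - s0 / real (Suc n)) *\<^sub>R v) \<longlonglongrightarrow> y + (s0 - 0) *\<^sub>R v"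
  using LIMSEQ_Suc[OF lim_const_over_n[of s0]] by (intro tendsto_intros) simp
 then show "(\<lambda>n. y + (s0 - s0 / real (Suc n)) *\<^sub>R v) \<longlonglongrightarrow> y + s0 *\<^sub>R v" by simp
 show "y + (s0 - s0 / real (Suc n)) *\<^sub>R v \<in> A" for n
  by (rule A) (use assms(1) in "auto simp: divide_le_eq")
qed

lemma isCont_eventually_in:
 assumes "isCont f a" "open U" "f a \<in> U" shows "\<forall>\<^sub>F s in nhds a. f s \<in> U"
proof -
 have "(f \<longlongrightarrow> f a) (nhds a)" using assms(1) by (simp add: isCont_def tendsto_at_iff_tendsto_nhds)
 then show ?thesis by (rule topological_tendstoD) (rule assms(2,3))+
qed

text \<open>
 A \<open>C\<^sup>1\<close> function that is nonpositive on the boundary \<open>\<beta> = 0\<close> is locally bounded by a multiple of \<open>-\<beta>\<close> in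
 the region \<open>\<beta> < 0\<close>.  From a point with \<open>\<beta> < 0\<close> one follows a direction of increase of \<open>\<beta>\<close> until the boundary is hit,
 after a time at most \<open>-\<beta>/c\<close>.
\<close>

lemma control_by_defining_function:
 fixes \<beta> h :: "real^'n \<Rightarrow> real"
 assumes U: "open U" "x0 \<in> U" and \<beta>: "C1_on U \<beta>" "\<beta> x0 = 0" and h: "C1_on U h"
  and v: "dir_deriv v \<beta> x0 > 0"
  and sign: "\<And>z. z \<in> U \<Longrightarrow> \<beta> z = 0 \<Longrightarrow> z \<in> closure {y\<in>U. \<beta> y < 0} \<Longrightarrow> h z \<le> 0"
 obtains r C where "r > 0" "ball x0 r \<subseteq> U" "C \<ge> 0" "\<And>y. y \<in> ball x0 r \<Longrightarrow> \<beta> y < 0 \<Longrightarrow> h y \<le> - C * \<beta> y"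
proof -
 define c where "c = dir_deriv v \<beta> x0 / 2"
 have c: "c > 0" "dir_deriv v \<beta> x0 > c" using v by (auto simp: c_def)
 note Dc = dir_deriv_cont[OF \<beta>(1), of v]
 have op: "open {y\<in>U. dir_deriv v \<beta> y > c}"
  using continuous_openin_preimage_gen[OF Dc open_greaterThan[of c]] U(1)
  by (simp add: openin_open_eq vimage_def Int_def conj_commute)
 have "x0 \<in> {y\<in>U. dir_deriv v \<beta> y > c}" using c(2) U(2) by simp
 then obtain R where R: "R > 0" "cball x0 R \<subseteq> {y\<in>U. dir_deriv v \<beta> y > c}"
  by (rule bspec[OF op[unfolded open_contains_cball], elim_format]) (erule exE, erule conjE, rule that)
 have RU: "cball x0 R \<subseteq> U" using R(2) by blast
 have "bounded (dir_deriv v h ` cball x0 R)"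
  by (intro compact_imp_bounded compact_continuous_image continuous_on_subset[OF dir_deriv_cont[OF h] RU] compact_cball)
 then obtain M where M: "M > 0" "\<And>y. y \<in> cball x0 R \<Longrightarrow> \<bar>dir_deriv v h y\<bar> \<le> M"
  unfolding bounded_pos by auto
 define \<epsilon> where "\<epsilon> = c * R / (2 * (norm v + 1))"
 have v1: "norm v + 1 > 0" by (simp add: add_nonneg_pos)
 have e0: "\<epsilon> > 0" using c(1) R(1) v1 by (simp add: \<epsilon>_def)
 have "isCont \<beta> x0" by (rule differentiable_imp_continuous_within[OF C1_on_differentiable[OF \<beta>(1) U(2)]])
 then obtain r0 where r0: "r0 > 0" "\<And>y. dist y x0 < r0 \<Longrightarrow> \<bar>\<beta> y\<bar> < \<epsilon>"
  using e0 unfolding continuous_at_eps_delta by (force simp: \<beta>(2) dist_real_def)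
 define r where "r = min r0 (R / 2)"
 have r: "r > 0" "r \<le> r0" "r \<le> R / 2" using r0 R by (auto simp: r_def)
 show thesis
 proof (rule that[of r "M / c"])
  show "r > 0" "M / c \<ge> 0" using r M c by auto
  show "ball x0 r \<subseteq> U" using r R(1) RU by (auto simp: subset_iff dist_commute)
  fix y assume y: "y \<in> ball x0 r" and neg: "\<beta> y < 0"
  define T where "T = - \<beta> y / c"
  have T0: "T > 0" using neg c by (simp add: T_def divide_neg_pos)
  have "\<bar>\<beta> y\<bar> < \<epsilon>" using r0(2)[of y] y r by (simp add: dist_commute)
  then have "- \<beta> y < \<epsilon>" using neg by simp
  then have "T < \<epsilon> / c" unfolding T_def using c(1) by (rule divide_strict_right_mono)
  also have "\<epsilon> / c = (R / 2) / (norm v + 1)" using c by (simp add: \<epsilon>_def)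
  finally have Tv: "T * (norm v + 1) < R / 2" using v1 by (simp only: pos_less_divide_eq)
  have in_ball: "y + \<tau> *\<^sub>R v \<in> cball x0 R" if "0 \<le> \<tau>" "\<tau> \<le> T" for \<tau>
  proof -
   have "dist x0 (y + \<tau> *\<^sub>R v) \<le> dist x0 y + \<tau> * norm v"
    using dist_triangle[of x0 "y + \<tau> *\<^sub>R v" y] that by (simp add: dist_norm)
   also have "\<tau> * norm v \<le> T * (norm v + 1)" using that T0 by (intro mult_mono) auto
   finally show ?thesis using Tv y r by simp
  qed
  have in_U: "y + \<tau> *\<^sub>R v \<in> U" if "0 \<le> \<tau>" "\<tau> \<le> T" for \<tau> using in_ball[OF that] RU by blast
  let ?\<phi> = "\<lambda>\<tau>. \<beta> (y + \<tau> *\<^sub>R v)"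
  have der: "(?\<phi> has_real_derivative dir_deriv v \<beta> (y + \<tau> *\<^sub>R v)) (at \<tau> within S)" if "0 \<le> \<tau>" "\<tau> \<le> T" for \<tau> S
   by (rule dir_deriv_line[OF \<beta>(1) in_U[OF that]])
  have big: "dir_deriv v \<beta> (y + \<tau> *\<^sub>R v) > c" if "0 \<le> \<tau>" "\<tau> \<le> T" for \<tau>
   using in_ball[OF that] R(2) by blast
  have inc: "?\<phi> b - ?\<phi> a > c * (b - a)" if "0 \<le> a" "a < b" "b \<le> T" for a b
  proof -
   have "\<exists>z. a < z \<and> z < b \<and> ?\<phi> b - ?\<phi> a = (b - a) * dir_deriv v \<beta> (y + z *\<^sub>R v)"
    by (rule MVT2[OF that(2)]) (use der that in auto)
   then obtain z where z: "a < z" "z < b" "?\<phi> b - ?\<phi> a = (b - a) * dir_deriv v \<beta> (y + z *\<^sub>R v)" by blast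
   then show ?thesis using big[of z] that by (simp add: mult.commute)
  qed
  have end_pos: "?\<phi> T \<ge> 0" using inc[of 0 T] T0 c by (simp add: T_def)
  have cont: "continuous_on {0..T} ?\<phi>" by (rule DERIV_continuous_on) (use der in auto)
  obtain \<tau>0 where t0: "0 \<le> \<tau>0" "\<tau>0 \<le> T" "?\<phi> \<tau>0 = 0"
   using IVT'[of ?\<phi> 0 0 T] neg end_pos T0 cont by auto
  have t0p: "\<tau>0 > 0" using t0 neg by (cases "\<tau>0 = 0") auto
  let ?z = "y + \<tau>0 *\<^sub>R v"
  have neg': "?\<phi> \<tau> < 0" if "0 \<le> \<tau>" "\<tau> < \<tau>0" for \<tau>
  proof -
   have "0 < c * (\<tau>0 - \<tau>)" using c that by simp
   then show ?thesis using inc[of \<tau> \<tau>0] that t0 by linarith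
  qed
  have "?z \<in> closure {y\<in>U. \<beta> y < 0}"
   by (rule segment_end_in_closure[OF t0p]) (use neg' in_U t0 in auto)
  then have hz: "h ?z \<le> 0" using sign[OF in_U[OF t0(1,2)] t0(3)] by simp
  have "\<exists>z. 0 < z \<and> z < \<tau>0 \<and> h (y + \<tau>0 *\<^sub>R v) - h (y + 0 *\<^sub>R v) = (\<tau>0 - 0) * dir_deriv v h (y + z *\<^sub>R v)"
   by (rule MVT2[OF t0p]) (use t0 in "auto intro!: dir_deriv_line[OF h] in_U")
  then obtain z where z: "0 < z" "z < \<tau>0" "h ?z - h y = \<tau>0 * dir_deriv v h (y + z *\<^sub>R v)" by auto
  have "\<tau>0 * \<bar>dir_deriv v h (y + z *\<^sub>R v)\<bar> \<le> T * M"
   using z t0 M(2)[OF in_ball[of z]] by (intro mult_mono) auto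
  then have "\<bar>h ?z - h y\<bar> \<le> T * M" using z t0 by (simp add: abs_mult)
  then have "h y \<le> T * M" using hz by linarith
  then show "h y \<le> - (M / c) * \<beta> y" by (simp add: T_def mult.commute)
 qed
qed

context radial_domain begin

text \<open>
 The outer normal in the metric is the normalized \<open>G\<^sup>-\<^sup>1\<nabla>\<beta>\<close>, and \<open>G x = x\<close>: the sign of the derivative of
 the norm along it is that of \<open>\<nabla>\<beta> \<bullet> x\<close>.
\<close>

lemma outward_normal_radial:
 assumes bdry: "\<And>x \<nu>. x \<in> frontier \<Omega> \<Longrightarrow> outer_unit_normal G \<Omega> x \<nu> \<Longrightarrow> frechet_derivative norm (at x) \<nu> \<le> 0"
  and U: "open U" and \<beta>: "C1_on U \<beta>" and \<Omega>U: "\<Omega> \<inter> U = {y\<in>U. \<beta> y < 0}"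
  and y: "y \<in> frontier \<Omega>" "y \<in> U" and nz: "\<exists>i. partial_deriv i \<beta> y \<noteq> 0"
  and zero: "\<And>z. z \<in> frontier \<Omega> \<Longrightarrow> z \<in> U \<Longrightarrow> \<beta> z = 0" and closed: "\<And>z. z \<in> closure \<Omega> \<Longrightarrow> z \<in> U \<Longrightarrow> \<beta> z \<le> 0"
 shows "dir_deriv y \<beta> y \<le> 0"
proof -
 have y0: "y \<noteq> 0" using y(1) zero_notin by (auto simp: frontier_def)
 let ?q = "grad_vec \<beta> y"
 have dd: "dir_deriv v \<beta> y = ?q \<bullet> v" for v
  by (simp add: dir_deriv_def inner_vec_def mult.commute)
 \<comment> \<open>The conormal; it is nonzero, and positivity of \<open>G\<close> allows normalizing it.\<close>
 define \<nu>0 where "\<nu>0 = matrix_inv (G y) *v ?q"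
 have q0: "?q \<noteq> 0" using nz by (auto simp: vec_eq_iff)
 have G\<nu>: "G y *v \<nu>0 = ?q" by (simp add: \<nu>0_def matrix_vector_mul_assoc G_inv)
 have n0: "\<nu>0 \<noteq> 0" using G\<nu> q0 by auto
 define N where "N = sqrt (?q \<bullet> \<nu>0)"
 have qn: "?q \<bullet> \<nu>0 > 0" using G_pos[OF n0, of y] by (simp add: G\<nu>)
 then have N: "N > 0" "N * N = ?q \<bullet> \<nu>0" by (auto simp: N_def)
 define \<nu> where "\<nu> = \<nu>0 /\<^sub>R N"
 have gi: "g_inner (G y) \<nu> X = ?q \<bullet> X / N" for X
 proof -
  have "g_inner (G y) \<nu> X = (G y *v \<nu>) \<bullet> X"
   using g_inner_transpose[of "G y" \<nu> X] by (simp only: G_sym matrix_act_real)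
  also have "G y *v \<nu> = ?q /\<^sub>R N" by (simp add: \<nu>_def matrix_vector_mult_scaleR G\<nu>)
  finally show ?thesis by (simp add: divide_inverse mult.commute)
 qed
 have "outer_unit_normal G \<Omega> y \<nu>"
  unfolding outer_unit_normal_def
 proof (intro conjI allI impI)
  have "?q \<bullet> \<nu> = N * N / N" unfolding N(2) by (simp add: \<nu>_def divide_inverse mult.commute)
  then show "g_normsq (G y) \<nu> = 1" using N(1) by (simp add: g_normsq_def gi)
 next
  fix X assume "tangent_to (frontier \<Omega>) y X"
  then obtain \<gamma> where g: "\<gamma> 0 = y" "(\<gamma> has_vector_derivative X) (at 0)" "\<forall>\<^sub>F s in at 0. \<gamma> s \<in> frontier \<Omega>"
   unfolding tangent_to_def by blast
  have gd: "(\<gamma> has_derivative (\<lambda>t. t *\<^sub>R X)) (at 0)" using g(2) by (simp add: has_vector_derivative_def)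
  have "((\<lambda>s. \<beta> (\<gamma> s)) has_derivative (\<lambda>t. \<Sum>i\<in>UNIV. (t *\<^sub>R X) $ i *\<^sub>R partial_deriv i \<beta> (\<gamma> 0))) (at 0)"
   by (rule has_derivative_compose[OF gd]) (use C1_on_deriv[OF \<beta> y(2)] g(1) in simp)
  then have D: "((\<lambda>s. \<beta> (\<gamma> s)) has_derivative (\<lambda>t. t * (?q \<bullet> X))) (at 0)"
   by (simp add: g(1) inner_vec_def sum_distrib_left mult_ac)
  have cg: "isCont \<gamma> 0" using g(2) has_vector_derivative_continuous by blast
  have "\<forall>\<^sub>F s in nhds 0. \<gamma> s \<in> U"
   by (rule isCont_eventually_in[OF cg U]) (simp add: g(1) y(2))
  moreover have "\<forall>\<^sub>F s in nhds 0. \<gamma> s \<in> frontier \<Omega>"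
   using g(3) unfolding eventually_at_filter by (rule eventually_mono) (metis g(1) y(1) UNIV_I)
  ultimately have z: "\<forall>\<^sub>F s in nhds 0. \<beta> (\<gamma> s) = 0"
   by eventually_elim (rule zero)
  have "((\<lambda>s. 0::real) has_derivative (\<lambda>t. t * (?q \<bullet> X))) (at 0)"
   by (rule has_derivative_transform_eventually[OF D]) (use z g(1) zero[OF y] in "auto simp: eventually_at_filter elim: eventually_mono")
  then have "(\<lambda>t. t * (?q \<bullet> X)) = (\<lambda>t. 0)" by (rule has_derivative_unique) simp
  then have "?q \<bullet> X = 0" by (metis mult_1)
  then show "g_inner (G y) \<nu> X = 0" by (simp add: gi)
 next
  have D: "((\<lambda>s. \<beta> (y + s *\<^sub>R \<nu>)) has_real_derivative N) (at 0)"
  proof -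
   have "?q \<bullet> \<nu> = N * N / N" unfolding N(2) by (simp add: \<nu>_def divide_inverse mult.commute)
   then show ?thesis using dir_deriv_line[OF \<beta>, of y 0 \<nu> UNIV] y(2) N(1) by (simp add: dd)
  qed
  obtain e where e: "e > 0" "\<And>s. 0 < s \<Longrightarrow> s < e \<Longrightarrow> \<beta> (y + s *\<^sub>R \<nu>) > 0"
   using DERIV_pos_inc_right[OF D N(1)] zero[OF y] by auto
  have "isCont (\<lambda>s. y + s *\<^sub>R \<nu>) (0::real)" by (intro continuous_intros)
  then have "\<forall>\<^sub>F s in nhds (0::real). y + s *\<^sub>R \<nu> \<in> U"
   by (rule isCont_eventually_in[OF _ U]) (simp add: y(2))
  then have "\<forall>\<^sub>F s in at_right (0::real). y + s *\<^sub>R \<nu> \<in> U"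
   by (auto simp: eventually_at_filter elim: eventually_mono)
  moreover have "\<forall>\<^sub>F s in at_right (0::real). 0 < s \<and> s < e"
   using e(1) by (auto simp: eventually_at_right_field intro!: exI[of _ e])
  ultimately show "\<forall>\<^sub>F s in at_right 0. y + s *\<^sub>R \<nu> \<notin> closure \<Omega>"
  proof eventually_elim
   case (elim s)
   then show ?case using e(2)[of s] closed[of "y + s *\<^sub>R \<nu>"] by force
  qed
 qed
 from bdry[OF y(1) this] have "\<nu> \<bullet> y / norm y \<le> 0"
  using frechet_derivative_at[OF has_derivative_norm_vec[OF y0]] by metis
 then have "\<nu>0 \<bullet> y \<le> 0" using N(1) y0 by (simp add: \<nu>_def divide_le_0_iff mult_le_0_iff zero_less_mult_iff)
 moreover have "\<nu>0 \<bullet> y = ?q \<bullet> y"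
 proof -
  have "\<nu>0 \<bullet> y = \<nu>0 \<bullet> (G y *v y)" by (simp add: G_x)
  also have "\<dots> = (G y *v \<nu>0) \<bullet> y"
   using g_inner_transpose[of "G y" \<nu>0 y] by (simp only: G_sym g_inner_eq matrix_act_real)
  finally show ?thesis by (simp add: G\<nu>)
 qed
 ultimately show ?thesis by (simp add: dd)
qed

text \<open>
 The condition is not strict, so a ray may be tangent to the boundary where it first meets it, and
 the sign there does not suffice.  Extended to the interior as \<open>\<nabla>\<beta>(y) \<bullet> y \<le> -C \<beta>(y)\<close>, it becomes a
 Gronwall inequality for \<open>-\<beta>\<close> along the ray, which therefore cannot reach 0.
\<close>

lemma rays_stay:
 assumes bdry: "\<And>x \<nu>. x \<in> frontier \<Omega> \<Longrightarrow> outer_unit_normal G \<Omega> x \<nu> \<Longrightarrow> frechet_derivative norm (at x) \<nu> \<le> 0"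
  and smooth: "smooth_boundary \<Omega>" and x: "x \<in> \<Omega>" and s: "0 \<le> s"
 shows "outward s x \<in> \<Omega>"
proof (rule ccontr)
 assume out: "outward s x \<notin> \<Omega>"
 have x0: "x \<noteq> 0" using x zero_notin closure_subset[of \<Omega>] by auto
 define \<theta> where "\<theta> = x /\<^sub>R norm x"
 let ?\<gamma> = "\<lambda>t. x + t *\<^sub>R \<theta>"
 have \<gamma>: "outward t x = ?\<gamma> t" for t by (simp add: outward_def \<theta>_def divide_inverse)
 have n\<gamma>: "norm (?\<gamma> t) = norm x + t" "?\<gamma> t = (norm x + t) *\<^sub>R \<theta>" if "0 \<le> t" for t
  using norm_outward[OF x0 that] x0 unfolding \<gamma> by (simp_all add: \<theta>_def distrib_right scaleR_add_left divide_inverse)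
 define B where "B = {t. 0 \<le> t \<and> ?\<gamma> t \<notin> \<Omega>}"
 have "B = {0..} \<inter> (?\<gamma> -` (- \<Omega>))" by (auto simp: B_def)
 then have Bc: "closed B"
  using open_\<Omega> by (auto intro!: closed_Int closed_vimage continuous_intros)
 have Bne: "B \<noteq> {}" using out s by (auto simp: B_def \<gamma>)
 have Bb: "bdd_below B" by (auto simp: B_def bdd_below_def)
 define s0 where "s0 = Inf B"
 have s0B: "s0 \<in> B" unfolding s0_def by (rule closed_contains_Inf[OF Bne Bb Bc])
 have s0p: "s0 > 0" using s0B x by (cases "s0 = 0") (auto simp: B_def)
 have before: "?\<gamma> t \<in> \<Omega>" if "0 \<le> t" "t < s0" for t
  using that cInf_lower[OF _ Bb, of t] by (auto simp: B_def s0_def)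
 let ?x0 = "?\<gamma> s0"
 have fr: "?x0 \<in> frontier \<Omega>"
 proof -
  have "?x0 \<in> closure \<Omega>" by (rule segment_end_in_closure[OF s0p before])
  then show ?thesis using s0B open_\<Omega> by (simp add: frontier_def interior_open B_def)
 qed
 obtain U and \<beta> :: "real^'n \<Rightarrow> real" where D: "open U \<and> ?x0 \<in> U \<and> smooth_on U \<beta> \<and>
   (\<forall>y\<in>U. \<exists>i. partial_deriv i \<beta> y \<noteq> 0) \<and> \<Omega> \<inter> U = {y\<in>U. \<beta> y < 0}"
  using bspec[OF smooth[unfolded smooth_boundary_def] fr] by (elim exE)
 have U: "open U" "?x0 \<in> U" and sm: "smooth_on U \<beta>" and \<Omega>U: "\<Omega> \<inter> U = {y\<in>U. \<beta> y < 0}" using D by simp_all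
 have nz: "\<exists>i. partial_deriv i \<beta> y \<noteq> 0" if "y \<in> U" for y using D that by simp
 have \<beta>: "C1_on U \<beta>"
  by (rule Ck_on_imp_C1_on[OF spec[OF sm[unfolded smooth_on_def], of "Suc 0"] U(1)])
 have \<beta>i: "C1_on U (partial_deriv i \<beta>)" for i
 proof -
  have "Ck_on (Suc (Suc 0)) U \<beta>" using sm unfolding smooth_on_def by blast
  then have "Ck_on (Suc 0) U (partial_deriv i \<beta>)" by simp
  then show ?thesis by (rule Ck_on_imp_C1_on[OF _ U(1)])
 qed
 have closed: "\<beta> z \<le> 0" if z: "z \<in> closure \<Omega>" "z \<in> U" for z
 proof -
  obtain f where f: "\<And>n. f n \<in> \<Omega>" "f \<longlonglongrightarrow> z" using z(1) unfolding closure_sequential by blast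
  have "isCont \<beta> z" by (rule differentiable_imp_continuous_within[OF C1_on_differentiable[OF \<beta> z(2)]])
  then have "(\<lambda>n. \<beta> (f n)) \<longlonglongrightarrow> \<beta> z" by (rule isCont_tendsto_compose[OF _ f(2)])
  moreover have "\<forall>\<^sub>F n in sequentially. f n \<in> U" using topological_tendstoD[OF f(2) U(1) z(2)] .
  then have "\<forall>\<^sub>F n in sequentially. \<beta> (f n) \<le> 0" by eventually_elim (use f(1) \<Omega>U in force)
  ultimately show ?thesis by (rule tendsto_upperbound) simp
 qed
 have zero: "\<beta> z = 0" if z: "z \<in> frontier \<Omega>" "z \<in> U" for z
 proof -
  have "z \<notin> \<Omega>" "z \<in> closure \<Omega>" using z(1) open_\<Omega> by (auto simp: frontier_def interior_open)
  then have "\<not> \<beta> z < 0" using \<Omega>U z(2) by blast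
  then show ?thesis using closed[OF \<open>z \<in> closure \<Omega>\<close> z(2)] by linarith
 qed
 define h where "h y = dir_deriv y \<beta> y" for y
 have h: "C1_on U h"
  unfolding h_def[abs_def] dir_deriv_def by (intro C1_on_sum C1_on_mult C1_on_nth \<beta>i)
 define v where "v = grad_vec \<beta> ?x0"
 have v: "dir_deriv v \<beta> ?x0 > 0"
 proof -
  have "v \<noteq> 0" using nz[OF U(2)] by (auto simp: v_def vec_eq_iff)
  then have "v \<bullet> v > 0" by simp
  then show ?thesis by (simp add: dir_deriv_def inner_vec_def v_def)
 qed
 have sign: "h z \<le> 0" if z: "z \<in> U" "\<beta> z = 0" "z \<in> closure {y\<in>U. \<beta> y < 0}" for z
 proof -
  have "z \<in> closure \<Omega>" using z(3) \<Omega>U closure_mono[of "\<Omega> \<inter> U" \<Omega>] by auto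
  moreover have "z \<notin> \<Omega>"
  proof
   assume "z \<in> \<Omega>"
   with z(1) have "z \<in> {y\<in>U. \<beta> y < 0}" unfolding \<Omega>U[symmetric] by blast
   with z(2) show False by simp
  qed
  ultimately have fz: "z \<in> frontier \<Omega>" using open_\<Omega> by (simp add: frontier_def interior_open)
  show ?thesis unfolding h_def
   by (rule outward_normal_radial[OF _ U(1) \<beta> \<Omega>U fz z(1) nz[OF z(1)]]) (rule bdry zero closed, assumption, assumption)+
 qed
 obtain r C where r: "r > 0" "ball ?x0 r \<subseteq> U" "C \<ge> 0" and hC: "\<And>y. y \<in> ball ?x0 r \<Longrightarrow> \<beta> y < 0 \<Longrightarrow> h y \<le> - C * \<beta> y"
  by (rule control_by_defining_function[OF U \<beta> zero[OF fr U(2)] h v sign]) (assumption, assumption, assumption, rule that, assumption+)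
 define s1 where "s1 = max 0 (s0 - r / 2)"
 have s1: "0 \<le> s1" "s1 < s0" "s0 - s1 < r" using s0p r by (auto simp: s1_def)
 have n\<theta>: "norm \<theta> = 1" using x0 by (simp add: \<theta>_def)
 have near: "?\<gamma> t \<in> ball ?x0 r" if "s1 \<le> t" "t \<le> s0" for t
 proof -
  have "dist ?x0 (?\<gamma> t) = s0 - t" using that by (simp add: dist_norm scaleR_diff_left[symmetric] n\<theta>)
  then show ?thesis unfolding mem_ball using that s1 by linarith
 qed
 \<comment> \<open>Along the ray \<open>y \<bullet> \<nabla>\<beta>(y)\<close> is \<open>norm y\<close> times the derivative of \<open>\<beta>\<close>, and \<open>norm y \<ge> norm x\<close>.\<close>
 define K where "K = C / norm x"
 let ?b = "\<lambda>t. \<beta> (?\<gamma> t)"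
 let ?e = "\<lambda>t. exp (K * t) * ?b t"
 have der: "(?e has_real_derivative exp (K * t) * (dir_deriv \<theta> \<beta> (?\<gamma> t) + K * ?b t)) (at t within S)" if "s1 \<le> t" "t \<le> s0" for t S
 proof -
  have "(?b has_real_derivative dir_deriv \<theta> \<beta> (?\<gamma> t)) (at t within S)"
   by (rule dir_deriv_line[OF \<beta>]) (use near[OF that] r(2) in blast)
  then show ?thesis by (auto intro!: derivative_eq_intros simp: algebra_simps)
 qed
 have "?e s0 \<le> ?e s1"
 proof (rule DERIV_nonpos_imp_decreasing_open[where f = ?e and a = s1 and b = s0])
  show "s1 \<le> s0" using s1 by simp
  show "continuous_on {s1..s0} ?e" by (rule DERIV_continuous_on, rule der) auto
  fix t assume t: "s1 < t" "t < s0"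
  have t0: "0 \<le> t" using t s1 by simp
  have tU: "?\<gamma> t \<in> U" using near[of t] t r(2) by auto
  have neg: "?b t < 0" using before[OF t0 t(2)] tU \<Omega>U by blast
  have px: "norm x > 0" "norm x + t > 0" using x0 t0 by (auto intro: add_pos_nonneg)
  have hh: "h (?\<gamma> t) = (norm x + t) * dir_deriv \<theta> \<beta> (?\<gamma> t)"
   unfolding h_def by (subst (1) n\<gamma>(2)[OF t0]) (simp add: dir_deriv_def sum_distrib_left mult.assoc)
  have "(norm x + t) * dir_deriv \<theta> \<beta> (?\<gamma> t) \<le> - C * ?b t"
   unfolding hh[symmetric] by (rule hC[OF _ neg]) (use near[of t] t in auto)
  then have "dir_deriv \<theta> \<beta> (?\<gamma> t) \<le> (- C * ?b t) / (norm x + t)"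
   unfolding pos_le_divide_eq[OF px(2)] by (simp only: mult.commute)
  also have "\<dots> \<le> (- C * ?b t) / norm x"
  proof (rule divide_left_mono)
   show "0 \<le> - C * ?b t" using mult_nonneg_nonneg[OF r(3), of "- ?b t"] neg by simp
  qed (use px t0 in auto)
  finally have "dir_deriv \<theta> \<beta> (?\<gamma> t) + K * ?b t \<le> 0" by (simp add: K_def)
  then have "exp (K * t) * (dir_deriv \<theta> \<beta> (?\<gamma> t) + K * ?b t) \<le> 0" by (simp add: mult_le_0_iff)
  then show "\<exists>y. DERIV ?e t :> y \<and> y \<le> 0"
   using der[of t UNIV, OF less_imp_le[OF t(1)] less_imp_le[OF t(2)]] by blast
 qed
 moreover have "?b s0 = 0" by (rule zero[OF fr U(2)])
 moreover have "?b s1 < 0"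
 proof -
  have "?\<gamma> s1 \<in> U" using near[of s1] s1 r(2) by auto
  then show ?thesis using before[OF s1(1,2)] \<Omega>U by blast
 qed
 ultimately show False by (simp add: zero_le_mult_iff)
qed

end


section \<open>Conservation laws and the Morawetz functional\<close>

text \<open>Multiplication by \<open>i\<close> for gradients.\<close>

definition Jv :: "complex^'n \<Rightarrow> complex^'n" where
 "Jv X = (\<chi> k. \<i> * X $ k)"

lemma inner_i: "(\<i> * a) \<bullet> (\<i> * b) = a \<bullet> (b::complex)" "(\<i> * a) \<bullet> b = - (a \<bullet> (\<i> * b))" "(\<i> * a) \<bullet> a = 0" "a \<bullet> (\<i> * a) = 0"
 by (simp_all add: inner_complex_def)

lemma Jv_diff: "Jv X - Jv Y = Jv (X - Y)"
 by (simp add: Jv_def vec_eq_iff right_diff_distrib)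

lemma g_inner_Jv: "g_inner A (Jv X) (Jv Y) = g_inner A X Y" "g_inner A (Jv X) Y = - g_inner A X (Jv Y)"
 by (simp_all add: g_inner_def Jv_def inner_i(1) inner_i(2)[of "X $ _"] sum_negf)

lemma matrix_act_Jv: "matrix_act A (Jv X) = Jv (matrix_act A X)"
 by (simp add: vec_eq_iff matrix_act_nth Jv_def sum_distrib_left)

lemma half_line_nontrivial: "at (0::real) within {0..} \<noteq> bot"
proof
 assume "at (0::real) within {0..} = bot"
 moreover have "at_right 0 \<le> at (0::real) within {0..}" by (rule at_le) auto
 ultimately have "at_right (0::real) = bot" by (simp only: bot_unique)
 then show False using trivial_limit_at_right_real[of "0::real"] by contradiction
qed

context radial_nontrapping begin

lemma sqi_i: "sc.sqi u \<Longrightarrow> sc.sqi (\<lambda>x. \<i> * u x)"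
 by (auto simp: sc.sqi_def inner_i(1))

lemma ip_i: "sc.ip (\<lambda>x. \<i> * u x) (\<lambda>x. \<i> * v x) = sc.ip u v" "sc.ip (\<lambda>x. \<i> * u x) v = - sc.ip u (\<lambda>x. \<i> * v x)"
 by (simp_all add: sc.ip_def inner_i(1) inner_i(2)[of "u _"])

lemma conv_i: "sc.conv u u0 F \<Longrightarrow> sc.conv (\<lambda>k x. \<i> * u k x) (\<lambda>x. \<i> * u0 x) F"
 by (auto simp: sc.conv_def sqi_i sc.nrm_def ip_i(1) right_diff_distrib[symmetric] elim: eventually_mono)

lemma g_grad_i:
 fixes \<phi> :: "real^'n \<Rightarrow> complex"
 assumes "\<phi> differentiable (at x)"
 shows "g_grad G (\<lambda>x. \<i> * \<phi> x) x = Jv (g_grad G \<phi> x)"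
proof -
 have "partial_deriv i (\<lambda>x. \<i> * \<phi> x) x = \<i> * partial_deriv i \<phi> x" for i
  by (rule partial_deriv_linear[OF bounded_linear_mult_right assms])
 then have "grad_vec (\<lambda>x. \<i> * \<phi> x) x = Jv (grad_vec \<phi> x)" by (simp add: vec_eq_iff Jv_def)
 then show ?thesis by (simp add: g_grad_eq matrix_act_Jv)
qed

lemma vf_sqi_J: "vf.sqi V \<Longrightarrow> vf.sqi (\<lambda>x. Jv (V x))"
proof -
 assume V: "vf.sqi V"
 then have "(\<lambda>x. V x $ i) \<in> borel_measurable \<mu>" for i using borel_measurable_vec_iff[of V] by (simp add: vf.sqi_def)
 then have "(\<lambda>x. \<i> * V x $ i) \<in> borel_measurable \<mu>" for i by (intro borel_measurable_times borel_measurable_const)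
 then have "(\<lambda>x. Jv (V x)) \<in> borel_measurable \<mu>" by (simp add: borel_measurable_vec_iff Jv_def)
 then show ?thesis using V by (simp add: vf.sqi_def g_inner_Jv(1))
qed

lemma H10_i:
 assumes "H10 u V"
 shows "H10 (\<lambda>x. \<i> * u x) (\<lambda>x. Jv (V x))"
proof -
 obtain \<phi> where \<phi>: "\<And>k. C1c \<Omega> (\<phi> k)" "sc.conv \<phi> u sequentially" "vf.conv (\<lambda>k. g_grad G (\<phi> k)) V sequentially"
  by (rule H10E[OF assms]) blast
 have g: "g_grad G (\<lambda>x. \<i> * \<phi> k x) = (\<lambda>x. Jv (g_grad G (\<phi> k) x))" for k
  using g_grad_i[OF C1c_differentiable[OF \<phi>(1)[of k]]] by (simp add: fun_eq_iff)
 have "vf.conv (\<lambda>k x. Jv (g_grad G (\<phi> k) x)) (\<lambda>x. Jv (V x)) sequentially"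
  using \<phi>(3) by (auto simp: vf.conv_def vf_sqi_J Jv_diff vf.nrm_def vf.ip_def g_inner_Jv(1) elim: eventually_mono)
 then show ?thesis
  unfolding H10_def
  using C1c_linear[OF bounded_linear_mult_right \<phi>(1)] conv_i[OF \<phi>(2)]
  by (intro exI[of _ "\<lambda>k x. \<i> * \<phi> k x"]) (simp add: g)
qed

lemma vf_ip_i: "vf.ip V (\<lambda>x. Jv (V x)) = 0"
proof -
 have "g_inner (G x) (V x) (Jv (V x)) = 0" for x
  using g_inner_Jv(2)[of "G x" "V x" "V x"] g_inner_sym[of x "Jv (V x)" "V x"] by linarith
 then show ?thesis by (simp add: vf.ip_def)
qed

lemma genP_i: "genP (\<lambda>x. \<i> * u x) (\<lambda>x. Jv (V x)) = (\<lambda>x. \<i> * genP u V x)"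
 by (simp add: genP_def radf_def Jv_def fun_eq_iff distrib_left sum_distrib_left)

end

text \<open>
 A solution with its time derivative \<open>v\<close>, gradient \<open>V\<close> and Laplacian \<open>L\<close> as separate data, so that
 the choices of representatives are no longer visible.
\<close>

locale schroedinger_flow = radial_nontrapping G \<Omega> c0 d \<alpha>
 for G :: "real^'n \<Rightarrow> real^'n^'n" and \<Omega> c0 d \<alpha> +
 fixes p :: real and u v L :: "real \<Rightarrow> real^'n \<Rightarrow> complex" and V :: "real \<Rightarrow> real^'n \<Rightarrow> complex^'n"
 assumes p: "1 < p"
  and H: "\<And>t. t \<ge> 0 \<Longrightarrow> H10 (u t) (V t)"
  and lap: "\<And>t. t \<ge> 0 \<Longrightarrow> wk_lap (V t) (L t)"
  and V_conv: "\<And>t. t \<ge> 0 \<Longrightarrow> vf.conv V (V t) (at t within {0..})"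
  and L_conv: "\<And>t. t \<ge> 0 \<Longrightarrow> sc.conv L (L t) (at t within {0..})"
  and u_conv: "\<And>t. t \<ge> 0 \<Longrightarrow> sc.conv u (u t) (at t within {0..})"
  and v_conv: "\<And>t. t \<ge> 0 \<Longrightarrow> sc.conv v (v t) (at t within {0..})"
  and quot: "\<And>t. t \<ge> 0 \<Longrightarrow> sc.conv (\<lambda>s x. (u s x - u t x) /\<^sub>R (s - t)) (v t) (at t within {0..})"
  and eqn: "\<And>t. t > 0 \<Longrightarrow> AE x in g_vol G \<Omega>. \<i> * v t x = pw p (u t x) - L t x"
begin

lemma us: "t \<ge> 0 \<Longrightarrow> sc.sqi (u t)" and Vs: "t \<ge> 0 \<Longrightarrow> vf.sqi (V t)"
 using H10E[OF H[of t]] by blast+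

lemma vs: "t \<ge> 0 \<Longrightarrow> sc.sqi (v t)" using v_conv by (simp add: sc.conv_def)
lemma Ls: "t \<ge> 0 \<Longrightarrow> sc.sqi (L t)" using lap by (simp add: wk_lap_def)

lemma ev_nonneg: "\<forall>\<^sub>F s in at t within {0::real..}. 0 \<le> s \<and> s \<noteq> t"
 by (simp add: eventually_at_filter)

definition P :: "real \<Rightarrow> real^'n \<Rightarrow> complex" where "P t = genP (u t) (V t)"

lemma P_conv: "t \<ge> 0 \<Longrightarrow> sc.conv P (P t) (at t within {0..})"
 unfolding P_def[abs_def] by (rule genP_conv[OF u_conv V_conv])

lemma Ps: "t \<ge> 0 \<Longrightarrow> sc.sqi (P t)"
 using P_conv by (simp add: sc.conv_def)

lemma diff_s: "s \<ge> 0 \<Longrightarrow> t \<ge> 0 \<Longrightarrow> sc.sqi (\<lambda>x. u s x - u t x)"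
 by (intro sc.sqi_diff us)

text \<open>\<open>mor\<close> is the Morawetz functional \<open>M\<close> and \<open>morq\<close> its derivative.\<close>

definition mor :: "real \<Rightarrow> real" where "mor t = sc.ip (\<lambda>x. \<i> * u t x) (P t)"
definition morq :: "real \<Rightarrow> real" where "morq t = 2 * sc.ip (\<lambda>x. \<i> * v t x) (P t)"

text \<open>
 Antisymmetry of \<open>P\<close> moves it away from the increment of \<open>u\<close>, whose gradient need not be differentiable
 in time.
\<close>

lemma mor_increment:
 assumes s: "s \<ge> 0" and t: "t \<ge> 0"
 shows "mor s - mor t = sc.ip (\<lambda>x. \<i> * (u s x - u t x)) (P s) + sc.ip (\<lambda>x. \<i> * (u s x - u t x)) (P t)"
proof -
 have 1: "sc.ip (\<lambda>x. \<i> * (u s x - u t x)) (P s) = sc.ip (\<lambda>x. \<i> * u s x) (P s) - sc.ip (\<lambda>x. \<i> * u t x) (P s)"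
  unfolding right_diff_distrib by (rule sc.ip_diff[OF sqi_i[OF us[OF s]] sqi_i[OF us[OF t]] Ps[OF s]])
 have "sc.ip (\<lambda>x. \<i> * u t x) (\<lambda>x. P s x - P t x) = sc.ip (\<lambda>x. \<i> * u t x) (P s) - sc.ip (\<lambda>x. \<i> * u t x) (P t)"
  by (rule sc.ip_diff2[OF Ps[OF s] Ps[OF t] sqi_i[OF us[OF t]]])
 moreover have "sc.ip (\<lambda>x. \<i> * u t x) (\<lambda>x. P s x - P t x) = sc.ip (\<lambda>x. \<i> * (u s x - u t x)) (P t)"
 proof -
  have "sc.ip (\<lambda>x. \<i> * u t x) (\<lambda>x. P s x - P t x) = - sc.ip (genP (\<lambda>x. \<i> * u t x) (\<lambda>x. Jv (V t x))) (\<lambda>x. u s x - u t x)"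
  proof -
   have "(\<lambda>x. P s x - P t x) = genP (\<lambda>x. u s x - u t x) (\<lambda>x. V s x - V t x)" by (simp add: fun_eq_iff genP_diff P_def)
   then show ?thesis using genP_antisym[OF H10_i[OF H[OF t]] H10_diff[OF H[OF s] H[OF t]]] by simp
  qed
  also have "\<dots> = sc.ip (P t) (\<lambda>x. \<i> * (u s x - u t x))"
   by (simp add: genP_i ip_i(2) P_def)
  finally show ?thesis by (simp only: sc.ip_sym[of "P t"])
 qed
 ultimately show ?thesis using 1 by (simp add: mor_def)
qed

lemma mor_derivative:
 assumes t: "t \<ge> 0"
 shows "(mor has_real_derivative morq t) (at t within {0..})"
 unfolding has_field_derivative_iff
proof (rule Lim_transform_eventually)
 let ?q = "\<lambda>s x. \<i> * ((u s x - u t x) /\<^sub>R (s - t))"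
 show "((\<lambda>s. sc.ip (?q s) (P s) + sc.ip (?q s) (P t)) \<longlongrightarrow> morq t) (at t within {0..})"
  unfolding morq_def mult_2 by (intro tendsto_add sc.conv_tendsto_ip conv_i quot P_conv t sc.conv_const Ps)
 show "\<forall>\<^sub>F s in at t within {0..}. sc.ip (?q s) (P s) + sc.ip (?q s) (P t) = (mor s - mor t) / (s - t)"
  using ev_nonneg
 proof eventually_elim
  case (elim s)
  have e: "?q s = (\<lambda>x. (1 / (s - t)) *\<^sub>R (\<i> * (u s x - u t x)))" by (simp add: fun_eq_iff divide_inverse)
  show ?case
   unfolding e sc.ip_scale mor_increment[OF conjunct1[OF elim] t] by (simp add: add_divide_distrib)
 qed
qed

lemma morq_cont: "continuous_on {0..} morq"
 unfolding continuous_on_def morq_def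
 by (intro ballI tendsto_mult tendsto_const sc.conv_tendsto_ip conv_i v_conv P_conv) auto

definition mass :: "real \<Rightarrow> real" where "mass t = sc.ip (u t) (u t)"
definition dirichlet :: "real \<Rightarrow> real" where "dirichlet t = vf.ip (V t) (V t)"

text \<open>The term \<open>(m/(2r)) u\<close> of \<open>P u\<close> is pointwise orthogonal to \<open>i u\<close>.\<close>

lemma mor_bound:
 assumes t: "t \<ge> 0"
 shows "\<bar>mor t\<bar> \<le> (mass t + dirichlet t) / 2"
proof -
 have r: "sc.sqi (radf (V t))" by (rule radf_sqi[OF Vs[OF t]])
 have "mor t = sc.ip (\<lambda>x. \<i> * u t x) (radf (V t))"
  unfolding mor_def sc.ip_def P_def genP_def by (simp add: inner_add_right inner_i(3))
 then have "\<bar>mor t\<bar> \<le> (sc.ip (\<lambda>x. \<i> * u t x) (\<lambda>x. \<i> * u t x) + sc.ip (radf (V t)) (radf (V t))) / 2"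
  using sc.ip_le_half[OF sqi_i[OF us[OF t]] r] by simp
 also have "\<dots> \<le> (mass t + dirichlet t) / 2"
  using radf_nrm[OF Vs[OF t]] by (simp add: ip_i(1) mass_def dirichlet_def sc.nrm_def vf.nrm_def)
 finally show ?thesis .
qed

lemma mass_derivative:
 assumes t: "t \<ge> 0"
 shows "(mass has_real_derivative 2 * sc.ip (v t) (u t)) (at t within {0..})"
 unfolding has_field_derivative_iff
proof (rule Lim_transform_eventually)
 let ?q = "\<lambda>s x. (u s x - u t x) /\<^sub>R (s - t)"
 show "((\<lambda>s. sc.ip (?q s) (u s) + sc.ip (?q s) (u t)) \<longlongrightarrow> 2 * sc.ip (v t) (u t)) (at t within {0..})"
  unfolding mult_2 by (intro tendsto_add sc.conv_tendsto_ip quot u_conv t sc.conv_const us)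
 show "\<forall>\<^sub>F s in at t within {0..}. sc.ip (?q s) (u s) + sc.ip (?q s) (u t) = (mass s - mass t) / (s - t)"
  using ev_nonneg
 proof eventually_elim
  case (elim s)
  have s: "s \<ge> 0" using elim by simp
  have e: "?q s = (\<lambda>x. (1 / (s - t)) *\<^sub>R (u s x - u t x))" by (simp add: fun_eq_iff divide_inverse)
  have "sc.ip (\<lambda>x. u s x - u t x) (u s) + sc.ip (\<lambda>x. u s x - u t x) (u t) = mass s - mass t"
   unfolding sc.ip_diff[OF us[OF s] us[OF t] us[OF s]] sc.ip_diff[OF us[OF s] us[OF t] us[OF t]] mass_def
   by (simp add: sc.ip_sym[of "u t" "u s"])
  then show ?case unfolding e sc.ip_scale by (simp add: add_divide_distrib[symmetric])
 qed
qed

text \<open>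
 The difference of squares is a pairing with the increment of the gradients, which Green's formula
 turns into a pairing of Laplacians with the increment of \<open>u\<close>.
\<close>

lemma dirichlet_derivative:
 assumes t: "t \<ge> 0"
 shows "(dirichlet has_real_derivative - (2 * sc.ip (L t) (v t))) (at t within {0..})"
 unfolding has_field_derivative_iff
proof (rule Lim_transform_eventually)
 let ?q = "\<lambda>s x. (u s x - u t x) /\<^sub>R (s - t)"
 show "((\<lambda>s. - (sc.ip (L s) (?q s) + sc.ip (L t) (?q s))) \<longlongrightarrow> - (2 * sc.ip (L t) (v t))) (at t within {0..})"
  unfolding mult_2 by (intro tendsto_minus tendsto_add sc.conv_tendsto_ip quot L_conv t sc.conv_const Ls)
 show "\<forall>\<^sub>F s in at t within {0..}. - (sc.ip (L s) (?q s) + sc.ip (L t) (?q s)) = (dirichlet s - dirichlet t) / (s - t)"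
  using ev_nonneg
 proof eventually_elim
  case (elim s)
  have s: "s \<ge> 0" using elim by simp
  have e: "?q s = (\<lambda>x. (1 / (s - t)) *\<^sub>R (u s x - u t x))" by (simp add: fun_eq_iff divide_inverse)
  have g: "sc.ip (L r) (\<lambda>x. u s x - u t x) = - vf.ip (V r) (\<lambda>x. V s x - V t x)" if "r \<ge> 0" for r
   by (rule green_H10[OF lap[OF that] H10_diff[OF H[OF s] H[OF t]]])
  have k: "dirichlet s - dirichlet t = - (sc.ip (L s) (\<lambda>x. u s x - u t x) + sc.ip (L t) (\<lambda>x. u s x - u t x))"
   unfolding g[OF s] g[OF t] vf.ip_diff2[OF Vs[OF s] Vs[OF t] Vs[OF s]] vf.ip_diff2[OF Vs[OF s] Vs[OF t] Vs[OF t]] dirichlet_def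
   by (simp add: vf.ip_sym[of "V t" "V s"])
  show ?case unfolding e sc.ip_scale2 k by (simp add: diff_divide_distrib)
 qed
qed

text \<open>
 The nonlinear term \<open>Nl\<close> equals \<open>ivL = i v + L\<close> almost everywhere for \<open>t > 0\<close>.  The latter is continuous
 in time up to \<open>t = 0\<close> by assumption and stands in for the nonlinear term in limits.
\<close>

definition Nl :: "real \<Rightarrow> real^'n \<Rightarrow> complex" where "Nl t x = pw p (u t x)"
definition ivL :: "real \<Rightarrow> real^'n \<Rightarrow> complex" where "ivL t x = \<i> * v t x + L t x"

lemma ivL_conv: "t \<ge> 0 \<Longrightarrow> sc.conv ivL (ivL t) (at t within {0..})"
 unfolding ivL_def[abs_def] by (intro sc.conv_add conv_i v_conv L_conv)

lemma ivL_s: "t \<ge> 0 \<Longrightarrow> sc.sqi (ivL t)" using ivL_conv by (simp add: sc.conv_def)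

lemma Nl_meas: "t \<ge> 0 \<Longrightarrow> Nl t \<in> borel_measurable \<mu>"
 unfolding Nl_def[abs_def] pw_def using sc.sqi_meas[OF us[of t]] by measurable

lemma Nl_AE: "t > 0 \<Longrightarrow> AE x in \<mu>. Nl t x = ivL t x"
 using eqn[of t] by (auto simp: Nl_def ivL_def elim: eventually_mono)

lemma Nl_s: "t > 0 \<Longrightarrow> sc.sqi (Nl t)"
 using sc.sqi_cong_AE[OF Nl_AE Nl_meas sc.sqi_meas[OF ivL_s]] ivL_s[of t] by simp

lemma Nl_ip: "t > 0 \<Longrightarrow> sc.sqi g \<Longrightarrow> sc.ip (Nl t) g = sc.ip (ivL t) g"
 by (rule sc.ip_cong_AE[OF Nl_AE _ Nl_meas sc.sqi_meas[OF ivL_s]]) (auto dest: sc.sqi_meas)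

definition pot :: "real \<Rightarrow> real" where "pot t = (\<integral>x. cmod (u t x) powr (p + 1) \<partial>\<mu>) / (p + 1)"

lemma pot_integrable: "t > 0 \<Longrightarrow> integrable \<mu> (\<lambda>x. cmod (u t x) powr (p + 1))"
 using sc.integrable_q[OF Nl_s[of t] us[of t]] by (simp add: Nl_def pw_inner_self[OF p])

lemma pot_nonneg: "0 \<le> pot t"
 unfolding pot_def using p by (intro divide_nonneg_nonneg Bochner_Integration.integral_nonneg) auto

lemma pot_convex:
 assumes s: "s \<ge> 0" and t: "t > 0" and I: "integrable \<mu> (\<lambda>x. cmod (u s x) powr (p + 1))"
 shows "pot t - pot s \<le> sc.ip (ivL t) (\<lambda>x. u t x - u s x)"
proof -
 have t0: "t \<ge> 0" using t by simp
 have "pot t - pot s = (\<integral>x. (cmod (u t x) powr (p + 1) - cmod (u s x) powr (p + 1)) / (p + 1) \<partial>\<mu>)"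
  using Bochner_Integration.integral_diff[OF pot_integrable[OF t] I] by (simp add: pot_def diff_divide_distrib[symmetric])
 also have "\<dots> \<le> sc.ip (Nl t) (\<lambda>x. u t x - u s x)"
  unfolding sc.ip_def
 proof (rule integral_mono)
  show "integrable \<mu> (\<lambda>x. Nl t x \<bullet> (u t x - u s x))"
   by (rule sc.integrable_q[OF Nl_s[OF t] diff_s[OF t0 s]])
  show "integrable \<mu> (\<lambda>x. (cmod (u t x) powr (p + 1) - cmod (u s x) powr (p + 1)) / (p + 1))"
   using Bochner_Integration.integrable_diff[OF pot_integrable[OF t] I] by (rule integrable_divide_zero)
  show "(cmod (u t x) powr (p + 1) - cmod (u s x) powr (p + 1)) / (p + 1) \<le> Nl t x \<bullet> (u t x - u s x)" for x
   unfolding Nl_def by (rule power_potential_convex[OF p])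
 qed
 also have "\<dots> = sc.ip (ivL t) (\<lambda>x. u t x - u s x)" by (rule Nl_ip[OF t diff_s[OF t0 s]])
 finally show ?thesis .
qed

text \<open>
 By convexity the difference quotient lies between the pairings with the gradients at the two times,
 and these have the same limit.
\<close>

lemma pot_derivative:
 assumes t: "t > 0"
 shows "(pot has_real_derivative sc.ip (ivL t) (v t)) (at t within {0..})"
proof -
 let ?F = "at t within {0::real..}"
 let ?q = "\<lambda>s x. (u s x - u t x) /\<^sub>R (s - t)"
 have t0: "t \<ge> 0" using t by simp
 define lo hi where "lo s = sc.ip (ivL t) (?q s)" and "hi s = sc.ip (ivL s) (?q s)" for s
 have lo: "(lo \<longlongrightarrow> sc.ip (ivL t) (v t)) ?F" and hi: "(hi \<longlongrightarrow> sc.ip (ivL t) (v t)) ?F"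
  unfolding lo_def hi_def by (intro sc.conv_tendsto_ip quot ivL_conv t0 sc.conv_const ivL_s)+
 have "((\<lambda>s. \<bar>hi s - lo s\<bar>) \<longlongrightarrow> \<bar>sc.ip (ivL t) (v t) - sc.ip (ivL t) (v t)\<bar>) ?F"
  by (intro tendsto_intros lo hi)
 then have z: "((\<lambda>s. \<bar>hi s - lo s\<bar>) \<longlongrightarrow> 0) ?F" by simp
 have pos: "\<forall>\<^sub>F s in ?F. s > 0"
  using t by (intro eventually_at_topological[THEN iffD2] exI[of _ "{0<..}"]) auto
 have "\<forall>\<^sub>F s in ?F. norm ((pot s - pot t) / (s - t) - lo s) \<le> \<bar>hi s - lo s\<bar>"
  using ev_nonneg pos
 proof eventually_elim
  case (elim s)
  have s: "s \<ge> 0" "s > 0" "s \<noteq> t" using elim by auto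
  have e: "?q s = (\<lambda>x. (1 / (s - t)) *\<^sub>R (u s x - u t x))" by (simp add: fun_eq_iff divide_inverse)
  have lo': "lo s = sc.ip (ivL t) (\<lambda>x. u s x - u t x) / (s - t)" and hi': "hi s = sc.ip (ivL s) (\<lambda>x. u s x - u t x) / (s - t)"
   unfolding lo_def hi_def e sc.ip_scale2 by simp_all
  have a: "pot s - pot t \<le> sc.ip (ivL s) (\<lambda>x. u s x - u t x)"
   by (rule pot_convex[OF t0 s(2) pot_integrable[OF t]])
  have "pot t - pot s \<le> sc.ip (ivL t) (\<lambda>x. u t x - u s x)"
   by (rule pot_convex[OF s(1) t pot_integrable[OF s(2)]])
  also have "\<dots> = - sc.ip (ivL t) (\<lambda>x. u s x - u t x)"
   unfolding sc.ip_diff2[OF us[OF s(1)] us[OF t0] ivL_s[OF t0]] sc.ip_diff2[OF us[OF t0] us[OF s(1)] ivL_s[OF t0]] by simp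
  finally have b: "sc.ip (ivL t) (\<lambda>x. u s x - u t x) \<le> pot s - pot t" by linarith
  have "\<bar>(pot s - pot t) - sc.ip (ivL t) (\<lambda>x. u s x - u t x)\<bar> \<le> \<bar>sc.ip (ivL s) (\<lambda>x. u s x - u t x) - sc.ip (ivL t) (\<lambda>x. u s x - u t x)\<bar>"
   using a b by linarith
  from divide_right_mono[OF this abs_ge_zero[of "s - t"]] show ?case
   by (simp only: lo' hi' real_norm_def diff_divide_distrib[symmetric] abs_divide)
 qed
 then have "((\<lambda>s. (pot s - pot t) / (s - t) - lo s) \<longlongrightarrow> 0) ?F"
  by (rule Lim_null_comparison[OF _ z])
 from tendsto_add[OF this lo] show ?thesis
  unfolding has_field_derivative_iff by simp
qed

text \<open>Gauge invariance: \<open>i u\<close> is orthogonal to \<open>f\<close>.\<close>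

lemma mass_derivative_zero: "t > 0 \<Longrightarrow> sc.ip (v t) (u t) = 0"
proof -
 assume t: "t > 0"
 then have t0: "t \<ge> 0" by simp
 have "sc.ip (v t) (u t) = sc.ip (\<lambda>x. \<i> * v t x) (\<lambda>x. \<i> * u t x)" by (simp add: ip_i)
 also have "\<dots> = sc.ip (ivL t) (\<lambda>x. \<i> * u t x) - sc.ip (L t) (\<lambda>x. \<i> * u t x)"
  unfolding ivL_def by (simp add: sc.ip_add[OF sqi_i[OF vs[OF t0]] Ls[OF t0] sqi_i[OF us[OF t0]]])
 also have "sc.ip (ivL t) (\<lambda>x. \<i> * u t x) = sc.ip (Nl t) (\<lambda>x. \<i> * u t x)"
  by (rule Nl_ip[OF t sqi_i[OF us[OF t0]], symmetric])
 also have "\<dots> = 0" by (simp add: sc.ip_def Nl_def pw_def inner_i)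
 also have "sc.ip (L t) (\<lambda>x. \<i> * u t x) = 0"
  using green_H10[OF lap[OF t0] H10_i[OF H[OF t0]]] by (simp add: vf_ip_i)
 finally show "sc.ip (v t) (u t) = 0" by simp
qed

definition en :: "real \<Rightarrow> real" where "en t = (mass t + dirichlet t) / 2 + pot t"

lemma en_derivative: "t > 0 \<Longrightarrow> (en has_real_derivative 0) (at t)"
proof -
 assume t: "t > 0"
 then have t0: "t \<ge> 0" by simp
 have w: "at t within {0..} = at t"
  using t by (intro at_within_interior) (simp add: interior_real_atLeast)
 have "sc.ip (ivL t) (v t) = sc.ip (\<lambda>x. \<i> * v t x) (v t) + sc.ip (L t) (v t)"
  unfolding ivL_def by (rule sc.ip_add[OF sqi_i[OF vs[OF t0]] Ls[OF t0] vs[OF t0]])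
 also have "sc.ip (\<lambda>x. \<i> * v t x) (v t) = 0" by (simp add: sc.ip_def inner_i)
 finally have e: "sc.ip (ivL t) (v t) = sc.ip (L t) (v t)" by simp
 have "((\<lambda>t. (mass t + dirichlet t) / 2 + pot t) has_real_derivative (2 * sc.ip (v t) (u t) + - (2 * sc.ip (L t) (v t))) / 2 + sc.ip (ivL t) (v t)) (at t)"
  using mass_derivative[OF t0] dirichlet_derivative[OF t0] pot_derivative[OF t]
  unfolding w by (intro DERIV_add DERIV_cdivide)
 then show ?thesis by (simp add: e mass_derivative_zero[OF t] en_def[abs_def])
qed

lemma en_const: "0 < s \<Longrightarrow> s \<le> t \<Longrightarrow> en s = en t"
proof -
 assume s: "0 < s" and le: "s \<le> t"
 show ?thesis
 proof (cases "s = t")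
  case False
  then have "s < t" using le by simp
  moreover have "continuous_on {s..t} en"
   by (rule DERIV_continuous_on[where D = "\<lambda>_. 0"], rule DERIV_subset[OF en_derivative]) (use s in auto)
  moreover have "DERIV en r :> 0" if "s < r" for r by (rule en_derivative) (use s that in simp)
  ultimately have "en t = en s" using DERIV_isconst_end[of s t en] by blast
  then show ?thesis ..
 qed simp
qed

lemma cont_at_0:
 "(mass \<longlongrightarrow> mass 0) (at 0 within {0..})" "(dirichlet \<longlongrightarrow> dirichlet 0) (at 0 within {0..})"
 unfolding mass_def[abs_def] dirichlet_def[abs_def]
 by (intro sc.conv_tendsto_ip vf.conv_tendsto_ip u_conv V_conv order_refl)+

text \<open>
 Convexity bounds the potential energy at small times by the initial one plus a pairing that tends
 to 0.
\<close>

lemma en_le_initial: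
 assumes I: "integrable \<mu> (\<lambda>x. cmod (u 0 x) powr (p + 1))" and T: "T > 0"
 shows "en T \<le> en 0"
proof -
 let ?F = "at (0::real) within {0..}"
 have d: "((\<lambda>t. sc.ip (ivL t) (\<lambda>x. u t x - u 0 x)) \<longlongrightarrow> sc.ip (ivL 0) (\<lambda>x. u 0 x - u 0 x)) ?F"
  by (intro sc.conv_tendsto_ip ivL_conv sc.conv_diff u_conv sc.conv_const us order_refl)
 have "((\<lambda>t. (mass t + dirichlet t) / 2 + (pot 0 + sc.ip (ivL t) (\<lambda>x. u t x - u 0 x))) \<longlongrightarrow> (mass 0 + dirichlet 0) / 2 + (pot 0 + sc.ip (ivL 0) (\<lambda>x. u 0 x - u 0 x))) ?F"
  by (intro tendsto_add tendsto_divide tendsto_const cont_at_0 d) simp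
 then have lim: "((\<lambda>t. (mass t + dirichlet t) / 2 + (pot 0 + sc.ip (ivL t) (\<lambda>x. u t x - u 0 x))) \<longlongrightarrow> en 0) ?F"
  by (simp add: en_def sc.ip_def)
 have "\<forall>\<^sub>F t in ?F. t \<noteq> 0 \<and> t \<in> {0..} \<and> t < T"
  using T by (auto simp: eventually_at intro!: exI[of _ T] simp: dist_real_def)
 then have "\<forall>\<^sub>F t in ?F. en T \<le> (mass t + dirichlet t) / 2 + (pot 0 + sc.ip (ivL t) (\<lambda>x. u t x - u 0 x))"
 proof eventually_elim
  case (elim t)
  then have t: "t > 0" by auto
  have "en T = en t" using en_const[of t T] t elim by simp
  then show ?case using pot_convex[OF order_refl t I] by (simp add: en_def)
 qed
 then show ?thesis by (rule tendsto_lowerbound[OF lim _ half_line_nontrivial])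
qed

end


section \<open>Integration in time\<close>

context schroedinger_flow begin

text \<open>The equation turns \<open>\<langle>f, P u\<rangle>\<close> into half the derivative of the Morawetz functional.\<close>

lemma fixed_time:
 assumes t: "t > 0"
 shows "(\<integral>\<^sup>+x. ennreal (2 * \<alpha> x / norm x * Tform 0 x (V t x) (V t x)) \<partial>\<mu>) \<le> ennreal (morq t)" (is ?th1)
  and "(\<integral>\<^sup>+x. ennreal (m * (p - 1) / 2 / norm x * cmod (u t x) powr (p + 1)) \<partial>\<mu>) \<le> ennreal ((p + 1) * (morq t / 2))" (is ?th2)
  and "m * (m - 2) / 4 * sc.ip (\<lambda>x. (1 / norm x ^ 3) *\<^sub>R u t x) (u t) \<le> morq t / 2" (is ?th3)
proof -
 have t0: "t \<ge> 0" using t by simp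
 have N: "sc.sqi (\<lambda>x. pw p (u t x))" using Nl_s[OF t] by (simp add: Nl_def[abs_def])
 have "sc.ip (\<lambda>x. pw p (u t x) - L t x) (P t) = sc.ip (\<lambda>x. \<i> * v t x) (P t)"
  by (rule sc.ip_cong_AE) (use eqn[OF t] N Ls[OF t0] sqi_i[OF vs[OF t0]] Ps[OF t0] in
    \<open>auto simp: sc.sqi_def elim!: eventually_mono\<close>)
 then have Q: "sc.ip (\<lambda>x. pw p (u t x) - L t x) (genP (u t) (V t)) = morq t / 2"
  by (simp add: morq_def P_def)
 note k = key_estimate[OF p H[OF t0] lap[OF t0] N, unfolded Q]
 show ?th1
  using k(1) by simp
 show ?th2
  by (rule k(2))
 show ?th3 by (rule k(3))
qed

lemma weighted_mass_nonneg: "0 \<le> sc.ip (\<lambda>x. (1 / norm x ^ 3) *\<^sub>R u t x) (u t)"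
 unfolding sc.ip_def by (intro Bochner_Integration.integral_nonneg) simp

lemma morq_nonneg: "t \<ge> 0 \<Longrightarrow> morq t \<ge> 0"
proof -
 have pos: "morq t \<ge> 0" if t: "t > 0" for t
  using fixed_time(3)[OF t] mult_nonneg_nonneg[OF _ weighted_mass_nonneg[of t], of "m * (m - 2) / 4"] m_ge by simp
 assume "t \<ge> 0"
 show ?thesis
 proof (cases "t = 0")
  case True
  have "(morq \<longlongrightarrow> morq 0) (at 0 within {0..})" using morq_cont by (simp add: continuous_on_def)
  moreover have "\<forall>\<^sub>F t in at 0 within {0..}. 0 \<le> morq t"
   using ev_nonneg[of 0] by eventually_elim (simp add: pos)
  ultimately show ?thesis unfolding True using half_line_nontrivial by (intro tendsto_lowerbound)
 next
  case False
  then show ?thesis using pos \<open>t \<ge> 0\<close> by simp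
 qed
qed

lemma time_integral_morq:
 assumes T: "T > 0"
 shows "(\<integral>\<^sup>+t. ennreal (morq t) * indicator {0..T} t \<partial>lborel) = ennreal (mor T - mor 0)"
proof -
 have h: "has_bochner_integral lborel (\<lambda>t. indicator {0..T} t *\<^sub>R morq t) (mor T - mor 0)"
 proof (rule has_bochner_integral_FTC_Icc)
  show "(mor has_vector_derivative morq t) (at t within {0..T})" if "0 \<le> t" "t \<le> T" for t
   using DERIV_subset[OF mor_derivative[OF that(1)], of "{0..T}"]
   by (simp add: has_real_derivative_iff_has_vector_derivative[symmetric])
  show "continuous_on {0..T} morq" by (rule continuous_on_subset[OF morq_cont]) auto
 qed (use T in simp)
 have "(\<integral>\<^sup>+t. ennreal (morq t) * indicator {0..T} t \<partial>lborel) = (\<integral>\<^sup>+t. ennreal (indicator {0..T} t *\<^sub>R morq t) \<partial>lborel)"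
  by (intro nn_integral_cong) (auto simp: indicator_def)
 also have "\<dots> = ennreal (mor T - mor 0)"
  unfolding has_bochner_integral_integral_eq[OF h, symmetric]
  by (intro nn_integral_eq_integral AE_I2) (use h morq_nonneg in "auto simp: has_bochner_integral_iff indicator_def")
 finally show ?thesis .
qed

text \<open>
 An extended real: finiteness of the potential energy is known for positive times only, where the
 equation holds.
\<close>

definition initial_energy :: ennreal where
 "initial_energy = ennreal ((mass 0 + dirichlet 0) / 2) + ennreal (1 / (p + 1)) * (\<integral>\<^sup>+x. ennreal (cmod (u 0 x) powr (p + 1)) \<partial>\<mu>)"

lemma dirichlet_nonneg: "0 \<le> dirichlet t" by (simp add: dirichlet_def vf.ip_nonneg)
lemma mass_nonneg: "0 \<le> mass t" by (simp add: mass_def sc.ip_nonneg)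

lemma mor_difference:
 assumes T: "T > 0" shows "ennreal (mor T - mor 0) \<le> 2 * initial_energy"
proof (cases "(\<integral>\<^sup>+x. ennreal (cmod (u 0 x) powr (p + 1)) \<partial>\<mu>) = \<infinity>")
 case True
 have "ennreal (1 / (p + 1)) * \<infinity> = \<infinity>" using p by (simp add: ennreal_mult_top)
 then have "initial_energy = \<infinity>" by (simp add: initial_energy_def True)
 then show ?thesis by (simp add: ennreal_mult_top)
next
 case False
 let ?f = "\<lambda>x. cmod (u 0 x) powr (p + 1)"
 have m: "?f \<in> borel_measurable \<mu>" using sc.sqi_meas[OF us[OF order_refl]] by measurable
 have I: "integrable \<mu> ?f"
  by (rule integrableI_nonneg[OF m]) (use False in "auto simp: less_top")
 have "(\<integral>\<^sup>+x. ennreal (?f x) \<partial>\<mu>) = ennreal (\<integral>x. ?f x \<partial>\<mu>)"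
  by (rule nn_integral_eq_integral[OF I]) simp
 then have "ennreal (1 / (p + 1)) * (\<integral>\<^sup>+x. ennreal (?f x) \<partial>\<mu>) = ennreal (pot 0)"
  using p by (simp add: pot_def ennreal_mult[symmetric] divide_inverse mult.commute)
 then have e: "initial_energy = ennreal (en 0)"
  using mass_nonneg[of 0] dirichlet_nonneg[of 0] pot_nonneg[of 0] by (simp add: initial_energy_def en_def ennreal_plus)
 have "mor T - mor 0 \<le> (mass T + dirichlet T) / 2 + (mass 0 + dirichlet 0) / 2"
  using mor_bound[of T] mor_bound[of 0] T by linarith
 also have "\<dots> \<le> en T + en 0" using pot_nonneg[of T] pot_nonneg[of 0] unfolding en_def by linarith
 also have "\<dots> \<le> 2 * en 0" using en_le_initial[OF I T] by simp
 finally have "ennreal (mor T - mor 0) \<le> ennreal (2 * en 0)" by (rule ennreal_leI)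
 also have "\<dots> = 2 * initial_energy"
  unfolding e using mass_nonneg[of 0] dirichlet_nonneg[of 0] pot_nonneg[of 0]
  by (subst ennreal_mult) (simp_all add: en_def)
 finally show ?thesis .
qed

lemma spacetime_bound:
 assumes g: "\<And>t. t > 0 \<Longrightarrow> (\<integral>\<^sup>+x. ennreal (f t x) \<partial>\<mu>) \<le> ennreal (c * morq t)" and c: "c \<ge> 0" and T: "T > 0"
 shows "spacetime_integral G \<Omega> T f \<le> ennreal (2 * c) * initial_energy"
proof -
 have "AE t in lborel. t \<noteq> (0::real)" by (rule AE_lborel_singleton)
 then have "AE t in lborel. (\<integral>\<^sup>+x. ennreal (f t x) \<partial>\<mu>) * indicator {0..T} t \<le> ennreal c * (ennreal (morq t) * indicator {0..T} t)"
 proof eventually_elim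
  case (elim t)
  show ?case
  proof (cases "t \<in> {0..T}")
   case True
   then have "t > 0" using elim by auto
   with g[of t] c morq_nonneg[of t] True show ?thesis by (simp add: ennreal_mult)
  qed simp
 qed
 then have "spacetime_integral G \<Omega> T f \<le> (\<integral>\<^sup>+t. ennreal c * (ennreal (morq t) * indicator {0..T} t) \<partial>lborel)"
  unfolding spacetime_integral_def by (rule nn_integral_mono_AE)
 also have "\<dots> = ennreal c * (\<integral>\<^sup>+t. ennreal (morq t) * indicator {0..T} t \<partial>lborel)"
 proof (rule nn_integral_cmult)
  have c: "continuous_on UNIV (\<lambda>t. morq (max 0 t))"
   by (rule continuous_on_compose2[OF morq_cont]) (auto intro!: continuous_intros)
  have "(\<lambda>t. ennreal (morq (max 0 t)) * indicator {0..T} t) \<in> borel_measurable borel"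
   using borel_measurable_continuous_onI[OF c] by measurable
  also have "(\<lambda>t. ennreal (morq (max 0 t)) * indicator {0..T} t) = (\<lambda>t. ennreal (morq t) * indicator {0..T} t)"
   by (auto simp: fun_eq_iff indicator_def)
  finally show "(\<lambda>t. ennreal (morq t) * indicator {0..T} t) \<in> borel_measurable lborel" by simp
 qed
 also have "\<dots> \<le> ennreal c * (2 * initial_energy)"
  unfolding time_integral_morq[OF T] by (rule mult_left_mono[OF mor_difference[OF T]]) simp
 also have "\<dots> = ennreal (2 * c) * initial_energy"
  using c by (simp add: ennreal_mult mult_ac)
 finally show ?thesis .
qed

lemma potential_bound:
 assumes t: "t > 0"
 shows "(\<integral>\<^sup>+x. ennreal (cmod (u t x) powr (p + 1) / norm x) \<partial>\<mu>) \<le> ennreal ((p + 1) / (m * (p - 1)) * morq t)"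
proof -
 define e where "e = m * (p - 1) / 2"
 have e: "e > 0" using m_ge p by (simp add: e_def)
 have um: "u t \<in> borel_measurable \<mu>" using sc.sqi_meas[OF us[of t]] t by simp
 have meas: "(\<lambda>x. cmod (u t x) powr (p + 1) / norm x) \<in> borel_measurable \<mu>"
  using um by (intro borel_measurable_divide measurable_\<mu>_borel[of norm]) auto
 have "(\<integral>\<^sup>+x. ennreal (cmod (u t x) powr (p + 1) / norm x) \<partial>\<mu>)
   = (\<integral>\<^sup>+x. ennreal (1 / e) * ennreal (e / norm x * cmod (u t x) powr (p + 1)) \<partial>\<mu>)"
  using e by (intro nn_integral_cong) (simp add: ennreal_mult[symmetric])
 also have "\<dots> = ennreal (1 / e) * (\<integral>\<^sup>+x. ennreal (e / norm x * cmod (u t x) powr (p + 1)) \<partial>\<mu>)"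
 proof (rule nn_integral_cmult)
  have "(\<lambda>x. e * (cmod (u t x) powr (p + 1) / norm x)) \<in> borel_measurable \<mu>" using meas by measurable
  then show "(\<lambda>x. ennreal (e / norm x * cmod (u t x) powr (p + 1))) \<in> borel_measurable \<mu>" by simp
 qed
 also have "\<dots> \<le> ennreal (1 / e) * ennreal ((p + 1) * (morq t / 2))"
  using fixed_time(2)[OF t] by (intro mult_left_mono) (simp_all add: e_def)
 also have "\<dots> = ennreal (1 / e * ((p + 1) * (morq t / 2)))"
  using e p morq_nonneg[of t] t by (subst ennreal_mult[symmetric]) auto
 also have "1 / e * ((p + 1) * (morq t / 2)) = (p + 1) / (m * (p - 1)) * morq t"
  by (simp add: e_def)
 finally show ?thesis .
qed

lemma weighted_mass_bound:
 assumes t: "t > 0" and m: "m > 2"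
 shows "(\<integral>\<^sup>+x. ennreal ((cmod (u t x))\<^sup>2 / norm x ^ 3) \<partial>\<mu>) \<le> ennreal (2 / (m * (m - 2)) * morq t)"
proof -
 have t0: "t \<ge> 0" using t by simp
 define c where "c = m * (m - 2) / 4"
 have c: "c > 0" using m by (simp add: c_def)
 let ?w = "\<lambda>x. (1 / norm x ^ 3) *\<^sub>R u t x"
 have I: "integrable \<mu> (\<lambda>x. ?w x \<bullet> u t x)"
  by (rule sc.integrable_q[OF over_norm_sqi[OF us[OF t0]] us[OF t0]])
 have "(\<integral>\<^sup>+x. ennreal ((cmod (u t x))\<^sup>2 / norm x ^ 3) \<partial>\<mu>) = (\<integral>\<^sup>+x. ennreal (?w x \<bullet> u t x) \<partial>\<mu>)"
  by (intro nn_integral_cong) (simp add: power2_norm_eq_inner)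
 also have "\<dots> = ennreal (sc.ip ?w (u t))"
  unfolding sc.ip_def by (rule nn_integral_eq_integral[OF I]) simp
 also have "\<dots> \<le> ennreal (2 / (m * (m - 2)) * morq t)"
 proof (rule ennreal_leI)
  have "c * sc.ip ?w (u t) \<le> morq t / 2" using fixed_time(3)[OF t] by (simp only: c_def)
  then have "sc.ip ?w (u t) \<le> morq t / 2 / c" using c by (simp only: pos_le_divide_eq mult.commute)
  also have "\<dots> = 2 / (m * (m - 2)) * morq t" by (simp add: c_def)
  finally show "sc.ip ?w (u t) \<le> 2 / (m * (m - 2)) * morq t" .
 qed
 finally show ?thesis .
qed

lemma angular_bound:
 assumes t: "t > 0"
 shows "(\<integral>\<^sup>+x. ennreal (\<alpha> x / norm x * (g_normsq (G x) (V t x) - (cmod (radf (V t) x))\<^sup>2)) \<partial>\<mu>) \<le> ennreal (1 * morq t)"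
proof -
 have "(\<integral>\<^sup>+x. ennreal (\<alpha> x / norm x * (g_normsq (G x) (V t x) - (cmod (radf (V t) x))\<^sup>2)) \<partial>\<mu>)
   \<le> (\<integral>\<^sup>+x. ennreal (2 * \<alpha> x / norm x * Tform 0 x (V t x) (V t x)) \<partial>\<mu>)"
 proof (rule nn_integral_mono, rule ennreal_leI)
  fix x assume "x \<in> space (g_vol G \<Omega>)"
  then have x: "x \<in> \<Omega>" by simp
  have "g_normsq (G x) (V t x) - (cmod (radf (V t) x))\<^sup>2 = Tform 0 x (V t x) (V t x)"
   using g_inner_decomp[OF nonzero[OF x], of "V t" "V t"]
   by (simp add: g_normsq_def Tform_0[OF x] tanf_eq power2_norm_eq_inner)
  moreover have "0 \<le> \<alpha> x / norm x * Tform 0 x (V t x) (V t x)"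
   unfolding Tform_0[OF x] using \<alpha>_nonneg[of x] by (intro mult_nonneg_nonneg g_inner_nonneg) simp
  ultimately show "\<alpha> x / norm x * (g_normsq (G x) (V t x) - (cmod (radf (V t) x))\<^sup>2) \<le> 2 * \<alpha> x / norm x * Tform 0 x (V t x) (V t x)"
   by simp
 qed
 also have "\<dots> \<le> ennreal (1 * morq t)" using fixed_time(1)[OF t] by simp
 finally show ?thesis .
qed

lemma initial_energy_eq:
 "ennreal (1/2) * (\<integral>\<^sup>+x. ennreal ((cmod (u 0 x))\<^sup>2 + g_normsq (G x) (V 0 x)) \<partial>\<mu>)
   + ennreal (1 / (p + 1)) * (\<integral>\<^sup>+x. ennreal (cmod (u 0 x) powr (p + 1)) \<partial>\<mu>) = initial_energy"
proof -
 have u0: "sc.sqi (u 0)" and V0: "vf.sqi (V 0)" by (simp_all add: us Vs)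
 have "(\<integral>\<^sup>+x. ennreal ((cmod (u 0 x))\<^sup>2 + g_normsq (G x) (V 0 x)) \<partial>\<mu>)
   = (\<integral>\<^sup>+x. ennreal (u 0 x \<bullet> u 0 x) + ennreal (g_inner (G x) (V 0 x) (V 0 x)) \<partial>\<mu>)"
  by (intro nn_integral_cong) (simp add: power2_norm_eq_inner g_normsq_def ennreal_plus g_inner_nonneg)
 also have "\<dots> = ennreal (mass 0) + ennreal (dirichlet 0)"
  unfolding mass_def dirichlet_def sc.nn_integral_eq_ip[OF u0, symmetric] vf.nn_integral_eq_ip[OF V0, symmetric]
  using u0 V0 by (intro nn_integral_add) (auto simp: sc.sqi_def vf.sqi_def)
 also have "\<dots> = ennreal (mass 0 + dirichlet 0)" by (simp add: ennreal_plus mass_nonneg dirichlet_nonneg)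
 finally have "ennreal (1/2) * (\<integral>\<^sup>+x. ennreal ((cmod (u 0 x))\<^sup>2 + g_normsq (G x) (V 0 x)) \<partial>\<mu>)
   = ennreal (1/2) * ennreal (mass 0 + dirichlet 0)" by (rule arg_cong)
 also have "\<dots> = ennreal (1/2 * (mass 0 + dirichlet 0))"
  using mass_nonneg[of 0] dirichlet_nonneg[of 0] by (intro ennreal_mult[symmetric]) auto
 finally show ?thesis by (simp only: initial_energy_def mult_1 times_divide_eq_left)
qed

end

section \<open>Solutions as flows\<close>

context radial_nontrapping begin

lemma L2_space_sqi:
 assumes "f \<in> L2_space G \<Omega>" shows "sc.sqi f"
proof -
 obtain \<phi> where w: "f \<in> borel_measurable \<mu>" and \<phi>: "\<And>k::nat. smooth_closure \<Omega> (\<phi> k)" "\<And>k. L2_sq G \<Omega> (\<phi> k) < \<infinity>"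
  and l: "(\<lambda>k. L2_sq G \<Omega> (\<lambda>x. \<phi> k x - f x)) \<longlonglongrightarrow> 0"
  using assms unfolding L2_space_def by auto
 have "\<phi> k \<in> borel_measurable \<mu>" for k
  by (rule measurable_\<mu>_cont[OF C1_on_continuous[OF smooth_closure_C1(1)[OF \<phi>(1)]]])
 then have s: "sc.sqi (\<phi> k)" for k using \<phi>(2)[of k] by (simp add: sc_sqi_iff)
 have "\<forall>\<^sub>F k in sequentially. L2_sq G \<Omega> (\<lambda>x. \<phi> k x - f x) < 1"
  using l by (rule order_tendstoD) simp
 then obtain k where "L2_sq G \<Omega> (\<lambda>x. \<phi> k x - f x) < 1" by (auto simp: eventually_sequentially)
 then have "L2_sq G \<Omega> (\<lambda>x. \<phi> k x - f x) < \<infinity>" using less_trans[OF _ ennreal_one_less_top] by (simp add: top_unique)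
 then show ?thesis
  by (intro sc.sqi_eventually_finite[OF w s[of k]]) (simp add: L2_sq_def power2_norm_eq_inner)
qed

text \<open>
 Continuity in \<open>H\<^sup>2\<close> refers to the chosen derivatives of differences, which agree almost everywhere
 with the differences of the chosen derivatives.
\<close>

lemma solution_flow:
 assumes sol: "solution G \<Omega> a p u0 u" and a: "\<forall>x\<in>\<Omega>. a x = 0" and p: "1 < p"
 obtains v where "schroedinger_flow G \<Omega> c0 d \<alpha> p u v (\<lambda>t. sob_laplacian G \<Omega> (u t)) (\<lambda>t. sob_grad G \<Omega> (u t))"
proof -
 have uX: "\<And>t. t \<ge> 0 \<Longrightarrow> u t \<in> H1_Gamma_space G \<Omega>" "\<And>t. t \<ge> 0 \<Longrightarrow> u t \<in> H2_space G \<Omega>"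
  and uc: "\<And>t0. t0 \<ge> 0 \<Longrightarrow> ((\<lambda>t. H2_sq G \<Omega> (\<lambda>x. u t x - u t0 x)) \<longlongrightarrow> 0) (at t0 within {0..})"
  using sol unfolding solution_def by auto
 obtain v where vX: "\<And>t. t \<ge> 0 \<Longrightarrow> v t \<in> L2_space G \<Omega>"
  and vc: "\<And>t0. t0 \<ge> 0 \<Longrightarrow> ((\<lambda>t. L2_sq G \<Omega> (\<lambda>x. v t x - v t0 x)) \<longlongrightarrow> 0) (at t0 within {0..})"
  and uv: "\<And>t0. t0 \<ge> 0 \<Longrightarrow> ((\<lambda>t. L2_sq G \<Omega> (\<lambda>x. (u t x - u t0 x) /\<^sub>R (t - t0) - v t0 x)) \<longlongrightarrow> 0) (at t0 within {0..})"
  and eq: "\<And>t. t > 0 \<Longrightarrow> AE x in \<mu>. \<i> * v t x + sob_laplacian G \<Omega> (u t) x + \<i> * complex_of_real (a x) * u t x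
       - complex_of_real (cmod (u t x) powr (p - 1)) * u t x = 0"
  using sol unfolding solution_def by auto
 let ?V = "\<lambda>t. sob_grad G \<Omega> (u t)" and ?L = "\<lambda>t. sob_laplacian G \<Omega> (u t)"
 have H: "H10 (u t) (?V t)" if "t \<ge> 0" for t
  using uX(1)[OF that] zero_trace_H10[OF _ sob_grad_H1] by (simp add: H1_Gamma_space_def)
 have L: "wk_lap (?V t) (?L t)" if "t \<ge> 0" for t by (rule sob_laplacian_H2(2)[OF uX(2)[OF that]])
 have us: "sc.sqi (u t)" and Vs: "vf.sqi (?V t)" if "t \<ge> 0" for t using H10E[OF H[OF that]] by blast+
 have Ls: "sc.sqi (?L t)" if "t \<ge> 0" for t using L[OF that] by (simp add: wk_lap_def)
 have ev: "\<forall>\<^sub>F s in at t within {0::real..}. 0 \<le> s" for t by (simp add: eventually_at_filter)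
 have evs: "\<forall>\<^sub>F s in at t within {0::real..}. sc.sqi (u s)" "\<forall>\<^sub>F s in at t within {0::real..}. vf.sqi (?V s)"
   "\<forall>\<^sub>F s in at t within {0::real..}. sc.sqi (?L s)" for t
  using ev[of t] by (eventually_elim, simp add: us Vs Ls)+
 have squeeze: "(f \<longlongrightarrow> 0) (at t within {0..})"
  if t: "t \<ge> 0" and le: "\<And>s. s \<ge> 0 \<Longrightarrow> f s \<le> H2_sq G \<Omega> (\<lambda>x. u s x - u t x)" for f t
  by (rule tendsto_sandwich[OF _ _ tendsto_const uc[OF t]]) (use ev[of t] le in "auto elim: eventually_mono")
 have gd: "L2_vec_sq G \<Omega> (\<lambda>x. ?V s x - ?V t x) = L2_vec_sq G \<Omega> (sob_grad G \<Omega> (\<lambda>x. u s x - u t x))"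
  and ld: "L2_sq G \<Omega> (\<lambda>x. ?L s x - ?L t x) = L2_sq G \<Omega> (sob_laplacian G \<Omega> (\<lambda>x. u s x - u t x))"
  if "s \<ge> 0" "t \<ge> 0" for s t
  using sob_diff_AE[OF uX(2)[OF that(1)] uX(2)[OF that(2)]] unfolding L2_sq_def L2_vec_sq_def
  by (auto intro!: nn_integral_cong_AE elim: eventually_mono)
 have "schroedinger_flow G \<Omega> c0 d \<alpha> p u v ?L ?V"
 proof
  show "1 < p" by (rule p)
  show "H10 (u t) (?V t)" "wk_lap (?V t) (?L t)" if "t \<ge> 0" for t using H L that by auto
  show "vf.conv ?V (?V t) (at t within {0..})" if t: "t \<ge> 0" for t
   by (rule vf_conv[OF evs(2) Vs[OF t] squeeze[OF t]]) (simp add: gd t H2_sq_def add_increasing add_increasing2)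
  show "sc.conv ?L (?L t) (at t within {0..})" if t: "t \<ge> 0" for t
   by (rule sc_conv[OF evs(3) Ls[OF t] squeeze[OF t]]) (simp add: ld t H2_sq_def add_increasing)
  show "sc.conv u (u t) (at t within {0..})" if t: "t \<ge> 0" for t
   by (rule sc_conv[OF evs(1) us[OF t] squeeze[OF t]]) (simp add: H2_sq_def add.assoc)
  have vs: "sc.sqi (v t)" if "t \<ge> 0" for t by (rule L2_space_sqi[OF vX[OF that]])
  show "sc.conv v (v t) (at t within {0..})" if t: "t \<ge> 0" for t
   by (rule sc_conv[OF _ vs[OF t] vc[OF t]]) (use ev[of t] in eventually_elim, rule vs)
  show "sc.conv (\<lambda>s x. (u s x - u t x) /\<^sub>R (s - t)) (v t) (at t within {0..})" if t: "t \<ge> 0" for t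
   by (rule sc_conv[OF _ vs[OF t] uv[OF t]]) (use evs(1)[of t] in eventually_elim, intro sc.sqi_scale sc.sqi_diff us[OF t])
  show "AE x in \<mu>. \<i> * v t x = pw p (u t x) - ?L t x" if t: "t > 0" for t
   using eq[OF t] AE_space
  proof eventually_elim
   case (elim x)
   then have "\<i> * v t x + ?L t x - pw p (u t x) = 0" by (simp add: a pw_def scaleR_conv_of_real)
   then show ?case by (simp add: algebra_simps)
  qed
 qed
 then show thesis by (rule that)
qed

lemma sob_radial_eq: "sob_radial G \<Omega> f x = radf (sob_grad G \<Omega> f) x"
proof -
 have "(\<Sum>j\<in>UNIV. G x $ i $ j * (x $ j / norm x)) = x $ i / norm x" for i
 proof -
  have "(\<Sum>j\<in>UNIV. G x $ i $ j * (x $ j / norm x)) = (G x *v x) $ i / norm x"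
   by (simp add: matrix_vector_mult_def sum_divide_distrib)
  then show ?thesis by (simp add: G_x)
 qed
 then show ?thesis by (simp add: sob_radial_def radf_def scaleR_left.sum[symmetric])
qed

lemma morawetz_estimate:
 assumes p: "1 < p" and a: "\<forall>x\<in>\<Omega>. a x = 0" and sol: "solution G \<Omega> a p u0 u" and T: "T > 0"
 shows "spacetime_integral G \<Omega> T (\<lambda>t x. cmod (u t x) powr (p + 1) / norm x) \<le> ennreal (2 * ((p + 1) / (m * (p - 1)))) * energy G \<Omega> p u 0" (is ?th1)
  and "m > 2 \<Longrightarrow> spacetime_integral G \<Omega> T (\<lambda>t x. (cmod (u t x))\<^sup>2 / norm x ^ 3 + cmod (u t x) powr (p + 1) / norm x)
   \<le> ennreal (2 * (2 / (m * (m - 2)) + (p + 1) / (m * (p - 1)))) * energy G \<Omega> p u 0"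
  and "spacetime_integral G \<Omega> T (\<lambda>t x. \<alpha> x / norm x *
      (g_normsq (G x) (sob_grad G \<Omega> (u t) x) - (cmod (sob_radial G \<Omega> (u t) x))\<^sup>2)) \<le> ennreal 2 * energy G \<Omega> p u 0" (is ?th2)
proof -
 obtain v where "schroedinger_flow G \<Omega> c0 d \<alpha> p u v (\<lambda>t. sob_laplacian G \<Omega> (u t)) (\<lambda>t. sob_grad G \<Omega> (u t))"
  by (rule solution_flow[OF sol a p])
 then interpret fl: schroedinger_flow G \<Omega> c0 d \<alpha> p u v "\<lambda>t. sob_laplacian G \<Omega> (u t)" "\<lambda>t. sob_grad G \<Omega> (u t)" .
 have E: "energy G \<Omega> p u 0 = fl.initial_energy"
  using fl.initial_energy_eq by (simp add: energy_def)
 have k: "0 \<le> (p + 1) / (m * (p - 1))" using p m_ge by simp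
 show ?th1
  unfolding E by (rule fl.spacetime_bound[OF fl.potential_bound k T])
 show "spacetime_integral G \<Omega> T (\<lambda>t x. (cmod (u t x))\<^sup>2 / norm x ^ 3 + cmod (u t x) powr (p + 1) / norm x)
   \<le> ennreal (2 * (2 / (m * (m - 2)) + (p + 1) / (m * (p - 1)))) * energy G \<Omega> p u 0" if m: "m > 2"
  unfolding E
 proof (rule fl.spacetime_bound[OF _ _ T])
  show "0 \<le> 2 / (m * (m - 2)) + (p + 1) / (m * (p - 1))" using k m by simp
  fix t :: real assume t: "t > 0"
  have um: "u t \<in> borel_measurable \<mu>" using sc.sqi_meas[OF fl.us[of t]] t by simp
  have "(\<integral>\<^sup>+x. ennreal ((cmod (u t x))\<^sup>2 / norm x ^ 3 + cmod (u t x) powr (p + 1) / norm x) \<partial>\<mu>)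
    = (\<integral>\<^sup>+x. ennreal ((cmod (u t x))\<^sup>2 / norm x ^ 3) + ennreal (cmod (u t x) powr (p + 1) / norm x) \<partial>\<mu>)"
   by (intro nn_integral_cong) (simp add: ennreal_plus)
  also have "\<dots> = (\<integral>\<^sup>+x. ennreal ((cmod (u t x))\<^sup>2 / norm x ^ 3) \<partial>\<mu>) + (\<integral>\<^sup>+x. ennreal (cmod (u t x) powr (p + 1) / norm x) \<partial>\<mu>)"
   using um by (intro nn_integral_add measurable_compose[OF _ measurable_ennreal] borel_measurable_divide measurable_\<mu>_borel[of "\<lambda>x. norm x ^ 3"] measurable_\<mu>_borel[of norm]) auto
  also have "\<dots> \<le> ennreal (2 / (m * (m - 2)) * fl.morq t) + ennreal ((p + 1) / (m * (p - 1)) * fl.morq t)"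
   by (rule add_mono[OF fl.weighted_mass_bound[OF t m] fl.potential_bound[OF t]])
  also have "\<dots> = ennreal ((2 / (m * (m - 2)) + (p + 1) / (m * (p - 1))) * fl.morq t)"
   unfolding distrib_right using k m fl.morq_nonneg[of t] t by (intro ennreal_plus[symmetric] mult_nonneg_nonneg) auto
  finally show "(\<integral>\<^sup>+x. ennreal ((cmod (u t x))\<^sup>2 / norm x ^ 3 + cmod (u t x) powr (p + 1) / norm x) \<partial>\<mu>)
   \<le> ennreal ((2 / (m * (m - 2)) + (p + 1) / (m * (p - 1))) * fl.morq t)" .
 qed
 show ?th2
  unfolding E sob_radial_eq using fl.spacetime_bound[OF fl.angular_bound _ T] by simp
qed

end

theorem theorem2p1:
  fixes G :: "real^'n \<Rightarrow> real^'n^'n"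
    and \<Omega> :: "(real^'n) set"
    and a \<alpha> :: "real^'n \<Rightarrow> real"
    and p c0 d :: real
  assumes dim: "CARD('n) \<ge> 3"
    and metric: "complete_riemannian_metric G"
    and domain: "exterior_domain \<Omega>" "0 \<notin> closure \<Omega>"
    and exponent: "1 < p" "p < (real CARD('n) + 2) / (real CARD('n) - 2)"
    and a_reg: "Ck_closure 2 \<Omega> a" "\<forall>x\<in>closure \<Omega>. a x \<ge> 0"
    and a_bdd: "bdd_above ((\<lambda>x. a x + sqrt (g_normsq (G x) (g_grad G a x)) + \<bar>g_laplacian G a x\<bar>) ` closure \<Omega>)"
    and wellposed: "well_posed G \<Omega> a p"
    and a_zero: "\<forall>x\<in>\<Omega>. a x = 0"
    and G_radial: "\<forall>x. x \<noteq> 0 \<longrightarrow> G x *v (x /\<^sub>R norm x) = x /\<^sub>R norm x"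
    and \<alpha>_reg: "continuous_on UNIV \<alpha>" "\<forall>x. \<alpha> x \<ge> 0"
    and G_tangential: "\<forall>x\<in>\<Omega>. \<forall>X\<in>sphere_tangent x.
      (((1 - \<alpha> x) *\<^sub>R G x + (norm x / 2) *\<^sub>R radial_deriv_matrix G x) *v X) \<bullet> X \<ge> 0"
    and c0_pos: "c0 > 0"
    and G_det: "\<forall>x\<in>\<Omega>. det (G x) = c0 * norm x powr d"
    and boundary: "\<forall>x\<in>frontier \<Omega>. \<forall>\<nu>. outer_unit_normal G \<Omega> x \<nu> \<longrightarrow>
      frechet_derivative norm (at x) \<nu> \<le> 0"
  shows "\<exists>C>0. \<forall>u0 u. solution G \<Omega> a p u0 u \<longrightarrow> (\<forall>T>0.
    (d = 2 * (3 - real CARD('n)) \<longrightarrow>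
       spacetime_integral G \<Omega> T (\<lambda>t x. cmod (u t x) powr (p + 1) / norm x)
       + spacetime_integral G \<Omega> T (\<lambda>t x. \<alpha> x / norm x *
           (g_normsq (G x) (sob_grad G \<Omega> (u t) x) - (cmod (sob_radial G \<Omega> (u t) x))\<^sup>2))
       \<le> ennreal C * energy G \<Omega> p u 0) \<and>
    (d > 2 * (3 - real CARD('n)) \<longrightarrow>
       spacetime_integral G \<Omega> T (\<lambda>t x. (cmod (u t x))\<^sup>2 / norm x ^ 3
           + cmod (u t x) powr (p + 1) / norm x)
       + spacetime_integral G \<Omega> T (\<lambda>t x. \<alpha> x / norm x *
           (g_normsq (G x) (sob_grad G \<Omega> (u t) x) - (cmod (sob_radial G \<Omega> (u t) x))\<^sup>2))
       \<le> ennreal C * energy G \<Omega> p u 0))"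
proof (cases "d \<ge> 2 * (3 - real CARD('n))")
 case False
 then show ?thesis by (intro exI[of _ 1]) auto
next
 case d: True
 have op: "open \<Omega>" and sb: "smooth_boundary \<Omega>" using domain(1) by (auto simp: exterior_domain_def)
 have zero: "0 \<notin> \<Omega>" using domain(2) closure_subset[of \<Omega>] by auto
 interpret radial_domain G \<Omega>
 proof
  show "C1_on UNIV (\<lambda>x. G x $ i $ j)" for i j
  proof (rule Ck_on_imp_C1_on[OF _ open_UNIV])
   show "Ck_on (Suc 0) UNIV (\<lambda>x. G x $ i $ j)"
    using metric unfolding complete_riemannian_metric_def smooth_on_def by blast
  qed
  show "transpose (G x) = G x" "X \<noteq> 0 \<Longrightarrow> (G x *v X) \<bullet> X > 0" for x X
   using metric unfolding complete_riemannian_metric_def by blast+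
  show "open \<Omega>" by (rule op)
  show "det (G x) > 0" if "x \<in> \<Omega>" for x
  proof -
   have "x \<noteq> 0" using that zero by auto
   then show ?thesis using G_det that c0_pos by simp
  qed
  show "G x *v (x /\<^sub>R norm x) = x /\<^sub>R norm x" if "x \<noteq> 0" for x using G_radial that by blast
  show "0 \<notin> closure \<Omega>" by (rule domain(2))
 qed
 interpret radial_nontrapping G \<Omega> c0 d \<alpha>
 proof
  show "outward s x \<in> \<Omega>" if "x \<in> \<Omega>" "0 \<le> s" for x s
   by (rule rays_stay[OF _ sb that]) (use boundary in blast)
  show "(((1 - \<alpha> x) *\<^sub>R G x + (norm x / 2) *\<^sub>R radial_deriv_matrix G x) *v X) \<bullet> X \<ge> 0"
   if "x \<in> \<Omega>" "X \<in> sphere_tangent x" for x X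
   using G_tangential that by blast
 qed (use c0_pos G_det d \<alpha>_reg in auto)
 note est = morawetz_estimate[OF exponent(1) a_zero]
 define k1 where "k1 = (p + 1) / (m * (p - 1))"
 \<comment> \<open>When \<open>m = 2\<close> only case (i) can occur, and no bound for \<open>|u|\<^sup>2/r\<^sup>3\<close> is claimed.\<close>
 define k2 where "k2 = (if m > 2 then 2 / (m * (m - 2)) else 0)"
 have k: "k1 > 0" "k2 \<ge> 0" using m_ge exponent(1) by (auto simp: k1_def k2_def)
 define C where "C = 2 * (k2 + k1) + 2"
 have C: "C > 0" using k by (simp add: C_def)
 have add: "A + B \<le> ennreal C * E" if "A \<le> ennreal (2 * k) * E" "B \<le> ennreal 2 * E" "0 \<le> k" "k \<le> k2 + k1" for A B E k
 proof -
  have "A + B \<le> ennreal (2 * k) * E + ennreal 2 * E" by (rule add_mono[OF that(1,2)])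
  also have "\<dots> = ennreal (2 * k + 2) * E" using that(3) by (simp add: ennreal_plus distrib_right)
  also have "\<dots> \<le> ennreal C * E" using that(4) by (intro mult_right_mono ennreal_leI) (simp_all add: C_def)
  finally show ?thesis .
 qed
 show ?thesis
 proof (rule exI[of _ C], intro conjI C allI impI)
  fix u0 u T assume sol: "solution G \<Omega> a p u0 u" and T: "(T::real) > 0"
  show "spacetime_integral G \<Omega> T (\<lambda>t x. cmod (u t x) powr (p + 1) / norm x)
    + spacetime_integral G \<Omega> T (\<lambda>t x. \<alpha> x / norm x *
      (g_normsq (G x) (sob_grad G \<Omega> (u t) x) - (cmod (sob_radial G \<Omega> (u t) x))\<^sup>2))
    \<le> ennreal C * energy G \<Omega> p u 0"
   by (rule add[OF est(1)[OF sol T, folded k1_def] est(3)[OF sol T]]) (use k in auto)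
  assume "d > 2 * (3 - real CARD('n))"
  then have m: "m > 2" by (simp add: m_def)
  then have e: "2 / (m * (m - 2)) = k2" by (simp add: k2_def)
  show "spacetime_integral G \<Omega> T (\<lambda>t x. (cmod (u t x))\<^sup>2 / norm x ^ 3 + cmod (u t x) powr (p + 1) / norm x)
    + spacetime_integral G \<Omega> T (\<lambda>t x. \<alpha> x / norm x *
      (g_normsq (G x) (sob_grad G \<Omega> (u t) x) - (cmod (sob_radial G \<Omega> (u t) x))\<^sup>2))
    \<le> ennreal C * energy G \<Omega> p u 0"
   by (rule add[OF est(2)[OF sol T m, folded k1_def, unfolded e] est(3)[OF sol T]]) (use k in auto)
 qed
qed

end
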